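(* Let $(M,g)$ be a complete Riemannian manifold, let $0<m\leq\infty$, and let $f\in C^\infty(M)$ be such that $\operatorname{Ric}_f^m\geq 0$ on $M$. Suppose that $$\Delta_f f=c_1\exp(c_2 f)\quad\text{on } M$$ for constants $c_1,c_2\geq 0$. Then $f$ is constant.
   Context: Riemannian manifolds are smooth, connected and without boundary. For $f\in C^\infty(M)$ and $0<m\le\infty$, the Bakry-Émery-Ricci tensor is $\operatorname{Ric}_f^m=\operatorname{Ric}+\nabla^2 f-\frac{1}{m}\,df\otimes df$, where $\operatorname{Ric}$ is the Ricci tensor of $g$ and $\nabla^2 f$ is the Hessian of $f$. For $m=\infty$ one sets $\frac1m=0$, so that $\operatorname{Ric}_f^\infty=\operatorname{Ric}+\nabla^2 f$. The inequality $\operatorname{Ric}_f^m\ge 0$ means that this symmetric 2-tensor is positive semidefinite at every point. The $f$-Laplacian is $\Delta_f u=\Delta u-\langle\nabla f,\nabla u\rangle$, where $\Delta$ is the trace of the Hessian. *)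

theory Defs
  imports "HOL-Analysis.Analysis"
begin

primrec Ck_on :: "nat \<Rightarrow> 'e::real_normed_vector set \<Rightarrow> ('e \<Rightarrow> 'b::real_normed_vector) \<Rightarrow> bool"
  where
    "Ck_on 0 S F \<longleftrightarrow> continuous_on S F"
  | "Ck_on (Suc k) S F \<longleftrightarrow>
       (\<forall>x\<in>S. F differentiable (at x)) \<and>
       (\<forall>v. Ck_on k S (\<lambda>x. frechet_derivative F (at x) v))"

text \<open>Only meaningful for open \<open>S\<close>, as the derivatives are not taken within \<open>S\<close>.\<close>

definition smooth_on :: "'e::real_normed_vector set \<Rightarrow> ('e \<Rightarrow> 'b::real_normed_vector) \<Rightarrow> bool"
  where "smooth_on S F \<longleftrightarrow> (\<forall>k. Ck_on k S F)"


section \<open>Smooth manifolds\<close>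

text \<open>
  The manifold \<open>M\<close> is the whole type \<open>'a\<close>, and its dimension is \<open>CARD('n)\<close>.
  A chart is a pair of a domain and a coordinate map; the values of the coordinate map outside
  the domain are irrelevant.
\<close>

type_synonym ('a, 'n) chart = "'a set \<times> ('a \<Rightarrow> real ^ 'n)"

definition in_chart :: "('a, 'n) chart \<Rightarrow> ('a \<Rightarrow> 'b) \<Rightarrow> real ^ 'n \<Rightarrow> 'b"
  where "in_chart c h = h \<circ> inv_into (fst c) (snd c)"

locale smooth_manifold =
  fixes A :: "('a::{t2_space, second_countable_topology}, 'n::finite) chart set"
  assumes open_domain: "c \<in> A \<Longrightarrow> open (fst c)"
    and open_image: "c \<in> A \<Longrightarrow> open (snd c ` fst c)"
    and homeomorphism_chart:
      "c \<in> A \<Longrightarrow> homeomorphism (fst c) (snd c ` fst c) (snd c) (inv_into (fst c) (snd c))"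
    and covers: "(\<Union>c\<in>A. fst c) = UNIV"
    and smooth_transition:
      "c \<in> A \<Longrightarrow> d \<in> A \<Longrightarrow> smooth_on (snd c ` (fst c \<inter> fst d)) (in_chart c (snd d))"

definition smooth_function ::
    "('a, 'n::finite) chart set \<Rightarrow> ('a \<Rightarrow> real) \<Rightarrow> bool"
  where "smooth_function A f \<longleftrightarrow> (\<forall>c\<in>A. smooth_on (snd c ` fst c) (in_chart c f))"


section \<open>Riemannian metrics\<close>

text \<open>
  A Riemannian metric is given by its component matrices: \<open>g c p\<close> is the matrix
  \<open>g(\<partial>\<^sub>i, \<partial>\<^sub>j)\<close> at \<open>p\<close> with respect to the coordinate frame of the chart \<open>c\<close>. The components
  in different charts are related by the transformation law of a covariant 2-tensor, where
  \<open>frechet_derivative (in_chart c (snd d))\<close> is the derivative of the coordinates of \<open>d\<close> with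
  respect to those of \<open>c\<close>.
\<close>

locale riemannian_manifold = smooth_manifold A
  for A :: "('a::{t2_space, second_countable_topology}, 'n::finite) chart set" +
  fixes g :: "('a, 'n) chart \<Rightarrow> 'a \<Rightarrow> real ^ 'n ^ 'n"
  assumes connected: "connected (UNIV :: 'a set)"
    and metric_smooth: "c \<in> A \<Longrightarrow> smooth_on (snd c ` fst c) (in_chart c (g c))"
    and metric_symmetric: "c \<in> A \<Longrightarrow> p \<in> fst c \<Longrightarrow> transpose (g c p) = g c p"
    and metric_positive: "c \<in> A \<Longrightarrow> p \<in> fst c \<Longrightarrow> v \<noteq> 0 \<Longrightarrow> v \<bullet> (g c p *v v) > 0"
    and metric_transforms:
      "c \<in> A \<Longrightarrow> d \<in> A \<Longrightarrow> p \<in> fst c \<Longrightarrow> p \<in> fst d \<Longrightarrow>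
        J = matrix (frechet_derivative (in_chart c (snd d)) (at (snd c p))) \<Longrightarrow>
        g c p = transpose J ** g d p ** J"


section \<open>Coordinate expressions\<close>

text \<open>
  In this section \<open>G\<close> is the coordinate representation of the metric and \<open>F\<close>, \<open>U\<close> are the
  coordinate representations of functions in one fixed chart.
\<close>

definition partial :: "'n::finite \<Rightarrow> (real ^ 'n \<Rightarrow> real) \<Rightarrow> real ^ 'n \<Rightarrow> real"
  where "partial i F x = frechet_derivative F (at x) (axis i 1)"

text \<open>\<open>christoffel G k i j\<close> is \<open>\<Gamma>\<close> with upper index \<open>k\<close> and lower indices \<open>i\<close>, \<open>j\<close>.\<close>

definition christoffel ::
    "(real ^ 'n \<Rightarrow> real ^ 'n ^ 'n) \<Rightarrow> 'n::finite \<Rightarrow> 'n \<Rightarrow> 'n \<Rightarrow> real ^ 'n \<Rightarrow> real"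
  where "christoffel G k i j x =
    (1/2) * (\<Sum>l\<in>UNIV. matrix_inv (G x) $ k $ l *
      (partial i (\<lambda>y. G y $ j $ l) x + partial j (\<lambda>y. G y $ i $ l) x
        - partial l (\<lambda>y. G y $ i $ j) x))"

text \<open>
  \<open>riemann G l i j k\<close> is the \<open>\<partial>\<^sub>l\<close>-component of \<open>R(\<partial>\<^sub>i, \<partial>\<^sub>j)\<partial>\<^sub>k\<close>, with the convention
  \<open>R(X, Y)Z = \<nabla>\<^sub>X\<nabla>\<^sub>YZ - \<nabla>\<^sub>Y\<nabla>\<^sub>XZ - \<nabla>\<^sub>[\<^sub>X\<^sub>,\<^sub>Y\<^sub>]Z\<close>, and \<open>Ric(Y, Z)\<close> is the trace of
  \<open>X \<mapsto> R(X, Y)Z\<close>; so round spheres have positive Ricci curvature.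
\<close>

definition riemann ::
    "(real ^ 'n \<Rightarrow> real ^ 'n ^ 'n) \<Rightarrow> 'n::finite \<Rightarrow> 'n \<Rightarrow> 'n \<Rightarrow> 'n \<Rightarrow> real ^ 'n \<Rightarrow> real"
  where "riemann G l i j k x =
    partial i (christoffel G l j k) x - partial j (christoffel G l i k) x
    + (\<Sum>m\<in>UNIV. christoffel G m j k x * christoffel G l i m x
                - christoffel G m i k x * christoffel G l j m x)"

definition ricci :: "(real ^ 'n \<Rightarrow> real ^ 'n ^ 'n) \<Rightarrow> real ^ 'n \<Rightarrow> real ^ 'n::finite ^ 'n"
  where "ricci G x = (\<chi> j k. \<Sum>i\<in>UNIV. riemann G i i j k x)"

definition hessian ::
    "(real ^ 'n \<Rightarrow> real ^ 'n ^ 'n) \<Rightarrow> (real ^ 'n \<Rightarrow> real) \<Rightarrow> real ^ 'n \<Rightarrow> real ^ 'n::finite ^ 'n"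
  where "hessian G F x =
    (\<chi> i j. partial i (partial j F) x - (\<Sum>k\<in>UNIV. christoffel G k i j x * partial k F x))"

definition laplacian ::
    "(real ^ 'n \<Rightarrow> real ^ 'n ^ 'n) \<Rightarrow> (real ^ 'n \<Rightarrow> real) \<Rightarrow> real ^ 'n::finite \<Rightarrow> real"
  where "laplacian G F x = (\<Sum>i\<in>UNIV. \<Sum>j\<in>UNIV. matrix_inv (G x) $ i $ j * hessian G F x $ i $ j)"

definition gradient ::
    "(real ^ 'n \<Rightarrow> real ^ 'n ^ 'n) \<Rightarrow> (real ^ 'n \<Rightarrow> real) \<Rightarrow> real ^ 'n \<Rightarrow> real ^ 'n::finite"
  where "gradient G F x = matrix_inv (G x) *v (\<chi> i. partial i F x)"

text \<open>\<open>f_laplacian G F U\<close> is \<open>\<Delta>\<^sub>F U\<close>.\<close>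

definition f_laplacian ::
    "(real ^ 'n \<Rightarrow> real ^ 'n ^ 'n) \<Rightarrow> (real ^ 'n \<Rightarrow> real) \<Rightarrow> (real ^ 'n \<Rightarrow> real) \<Rightarrow>
      real ^ 'n::finite \<Rightarrow> real"
  where "f_laplacian G F U x = laplacian G U x - gradient G F x \<bullet> (G x *v gradient G U x)"

text \<open>For \<open>m = \<infinity>\<close>, the extended real \<open>1 / m\<close> is \<open>0\<close>.\<close>

definition bakry_emery_ricci ::
    "ereal \<Rightarrow> (real ^ 'n \<Rightarrow> real ^ 'n ^ 'n) \<Rightarrow> (real ^ 'n \<Rightarrow> real) \<Rightarrow> real ^ 'n \<Rightarrow>
      real ^ 'n::finite ^ 'n"
  where "bakry_emery_ricci m G F x =
    ricci G x + hessian G F x - real_of_ereal (1 / m) *\<^sub>R (\<chi> i j. partial i F x * partial j F x)"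


section \<open>Notions on the manifold\<close>

text \<open>
  Tensorial and scalar equations and inequalities are required to hold in all charts of the atlas.
\<close>

definition bakry_emery_ricci_nonneg ::
    "('a, 'n::finite) chart set \<Rightarrow> (('a, 'n) chart \<Rightarrow> 'a \<Rightarrow> real ^ 'n ^ 'n) \<Rightarrow> ereal \<Rightarrow>
      ('a \<Rightarrow> real) \<Rightarrow> bool"
  where "bakry_emery_ricci_nonneg A g m f \<longleftrightarrow>
    (\<forall>c\<in>A. \<forall>p\<in>fst c. \<forall>v.
      v \<bullet> (bakry_emery_ricci m (in_chart c (g c)) (in_chart c f) (snd c p) *v v) \<ge> 0)"

definition f_laplacian_at ::
    "(('a, 'n::finite) chart \<Rightarrow> 'a \<Rightarrow> real ^ 'n ^ 'n) \<Rightarrow> ('a, 'n) chart \<Rightarrow>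
      ('a \<Rightarrow> real) \<Rightarrow> ('a \<Rightarrow> real) \<Rightarrow> 'a \<Rightarrow> real"
  where "f_laplacian_at g c f u p =
    f_laplacian (in_chart c (g c)) (in_chart c f) (in_chart c u) (snd c p)"

definition geodesic ::
    "('a::topological_space, 'n::finite) chart set \<Rightarrow>
      (('a, 'n) chart \<Rightarrow> 'a \<Rightarrow> real ^ 'n ^ 'n) \<Rightarrow> (real \<Rightarrow> 'a) \<Rightarrow> bool"
  where "geodesic A g \<gamma> \<longleftrightarrow>
    continuous_on UNIV \<gamma> \<and>
    (\<forall>c\<in>A. \<forall>t. \<gamma> t \<in> fst c \<longrightarrow>
      (let \<gamma>' = (\<lambda>s. vector_derivative (snd c \<circ> \<gamma>) (at s)) in
        (snd c \<circ> \<gamma>) differentiable (at t) \<and>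
        (\<gamma>' has_vector_derivative
          (\<chi> k. - (\<Sum>i\<in>UNIV. \<Sum>j\<in>UNIV.
            christoffel (in_chart c (g c)) k i j (snd c (\<gamma> t)) * \<gamma>' t $ i * \<gamma>' t $ j))) (at t)))"

text \<open>
  Completeness is geodesic completeness: every initial position and velocity (the latter expressed
  in a chart) is that of a geodesic defined for all times.
\<close>

definition complete_metric ::
    "('a::topological_space, 'n::finite) chart set \<Rightarrow>
      (('a, 'n) chart \<Rightarrow> 'a \<Rightarrow> real ^ 'n ^ 'n) \<Rightarrow> bool"
  where "complete_metric A g \<longleftrightarrow>
    (\<forall>c\<in>A. \<forall>p\<in>fst c. \<forall>v. \<exists>\<gamma>. geodesic A g \<gamma> \<and> \<gamma> 0 = p \<and>
      ((snd c \<circ> \<gamma>) has_vector_derivative v) (at 0))"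

end

theory Submission
  imports Defs
begin

text \<open>
  Let \<open>w = |\<nabla>f|\<^sup>2\<close>. Bochner's formula and the hypotheses give \<open>\<Delta>w \<ge> (2/n) w\<^sup>2 + \<langle>\<nabla>f, \<nabla>w\<rangle>\<close>. Fix \<open>p\<close>, and let
  \<open>x\<close> maximize \<open>w (R\<^sup>2 - d(p, -)\<^sup>2)\<^sup>2\<close> over the ball of radius \<open>R\<close>. As \<open>d\<^sup>2\<close> need not be smooth at \<open>x\<close>, it is
  replaced by the energy of variations of a minimal geodesic from \<open>p\<close> to \<open>x\<close> along a parallel orthonormal
  frame, multiplied by a cutoff \<open>h\<close>. In the sum of the second variations, the Ricci curvature of the geodesic is
  at least \<open>- (f \<circ> \<gamma>)''\<close>; after an integration by parts the boundary term cancels the drift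
  \<open>\<langle>\<nabla>f, \<nabla>w\<rangle>\<close> at \<open>x\<close>, and the remaining terms only involve \<open>\<nabla>f\<close> near \<open>p\<close>. Hence \<open>w(p) = O(1/R)\<close>.
\<close>

section \<open>Calculus of smooth maps\<close>

text \<open>Under a bound on Ric + Hess f alone, the second variation of distance is controlled only
  up to the derivative of f at the far end x. This term has exactly the size of dw(X) at the
  maximum, so the Bochner inequality must keep its drift with coefficient 1 for the two to cancel.
  An upper barrier is enough at x: a competitor of unit duration has energy at least the squared
  distance, with equality at parameter 0, so the maximum persists, and only second-order
  coefficients of the barrier matter. The cutoff h vanishes at p and equals 1 from distance 1 on at
  the latest, hence the bound on df is needed in the unit ball around p only. The equation enters
  twice: the Laplacian of f is w plus a nonnegative term, which gives the quadratic term in w, and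
  the derivative of that term along the gradient of f is nonnegative. For finite m a nonnegative
  tensor is subtracted, so Ric + Hess f is nonnegative in every case. Completeness yields, by
  Hopf-Rinow, both the minimal geodesic to x and the existence of x, as a maximum over a compact
  ball of the tangent space at p.\<close>

lemma has_derivative_cong_open:
  assumes "open S" "x \<in> S" "\<And>y. y \<in> S \<Longrightarrow> F y = H y"
  shows "(F has_derivative F') (at x) \<longleftrightarrow> (H has_derivative F') (at x)"
  using assms by (metis has_derivative_transform_within_open)

lemma frechet_derivative_cong_open:
  assumes "open S" "x \<in> S" "\<And>y. y \<in> S \<Longrightarrow> F y = H y"
  shows "frechet_derivative F (at x) = frechet_derivative H (at x)"
  unfolding frechet_derivative_def using has_derivative_cong_open[OF assms] by simp

lemma differentiable_cong_open:
  assumes "open S" "x \<in> S" "\<And>y. y \<in> S \<Longrightarrow> F y = H y"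
  shows "F differentiable (at x) \<longleftrightarrow> H differentiable (at x)"
  unfolding differentiable_def using has_derivative_cong_open[OF assms] by simp

lemma Ck_on_cong:
  assumes "open S" "\<And>y. y \<in> S \<Longrightarrow> F y = H y"
  shows "Ck_on k S F \<longleftrightarrow> Ck_on k S H"
  using assms(2)
proof (induction k arbitrary: F H)
  case 0
  then show ?case by (simp cong: continuous_on_cong)
next
  case (Suc k)
  have "Ck_on k S (\<lambda>x. frechet_derivative F (at x) v) \<longleftrightarrow> Ck_on k S (\<lambda>x. frechet_derivative H (at x) v)" for v
    by (rule Suc.IH) (simp add: frechet_derivative_cong_open[OF assms(1) _ Suc.prems])
  moreover have "F differentiable (at x) \<longleftrightarrow> H differentiable (at x)" if "x \<in> S" for x
    by (rule differentiable_cong_open[OF assms(1) that Suc.prems])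
  ultimately show ?case by simp
qed

lemma Ck_on_continuous: "Ck_on k S F \<Longrightarrow> continuous_on S F"
proof (cases k)
  case (Suc l)
  assume "Ck_on k S F"
  then show ?thesis
    using Suc by (simp add: continuous_at_imp_continuous_on differentiable_imp_continuous_within)
qed simp

lemma Ck_on_Suc_imp: "Ck_on (Suc k) S F \<Longrightarrow> Ck_on k S F"
proof (induction k arbitrary: F)
  case 0
  then show ?case using Ck_on_continuous by fastforce
next
  case (Suc k)
  then show ?case by simp
qed

lemma Ck_on_const: "Ck_on k S (\<lambda>x. c)"
  by (induction k arbitrary: c) auto

lemma Ck_on_linear:
  assumes "open S" and L: "bounded_linear L" and F: "Ck_on k S F"
  shows "Ck_on k S (\<lambda>x. L (F x))"
  using F
proof (induction k arbitrary: F)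
  case 0
  then show ?case by (simp add: bounded_linear.continuous_on[OF L])
next
  case (Suc k)
  have D: "((\<lambda>x. L (F x)) has_derivative (\<lambda>v. L (frechet_derivative F (at x) v))) (at x)" if "x \<in> S" for x
    using Suc.prems that by (intro bounded_linear.has_derivative[OF L]) (simp add: frechet_derivative_works[symmetric])
  have "Ck_on k S (\<lambda>x. frechet_derivative (\<lambda>x. L (F x)) (at x) v)" for v
  proof (subst Ck_on_cong[OF assms(1)])
    show "Ck_on k S (\<lambda>x. L (frechet_derivative F (at x) v))"
      using Suc by simp
    show "frechet_derivative (\<lambda>x. L (F x)) (at y) v = L (frechet_derivative F (at y) v)" if "y \<in> S" for y
      using frechet_derivative_at[OF D[OF that]] by metis
  qed
  then show ?case using D by (auto simp: differentiable_def)
qed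

lemma Ck_on_add:
  assumes "open S" and F: "Ck_on k S F" "Ck_on k S H"
  shows "Ck_on k S (\<lambda>x. F x + H x)"
  using F
proof (induction k arbitrary: F H)
  case 0
  then show ?case by (simp add: continuous_on_add)
next
  case (Suc k)
  have D: "((\<lambda>x. F x + H x) has_derivative (\<lambda>v. frechet_derivative F (at x) v + frechet_derivative H (at x) v)) (at x)" if "x \<in> S" for x
    using Suc.prems that by (intro has_derivative_add) (simp_all add: frechet_derivative_works[symmetric])
  have "Ck_on k S (\<lambda>x. frechet_derivative (\<lambda>x. F x + H x) (at x) v)" for v
  proof (subst Ck_on_cong[OF assms(1)])
    show "Ck_on k S (\<lambda>x. frechet_derivative F (at x) v + frechet_derivative H (at x) v)"
      using Suc by simp
    show "frechet_derivative (\<lambda>x. F x + H x) (at y) v = frechet_derivative F (at y) v + frechet_derivative H (at y) v" if "y \<in> S" for y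
      using frechet_derivative_at[OF D[OF that]] by metis
  qed
  then show ?case using D by (auto simp: differentiable_def)
qed

text \<open>Leibniz rule: the derivative is a sum of two terms of the same bilinear shape with one
  factor differentiated, so the induction keeps both functions arbitrary and lowers the order of the
  undifferentiated factor. Products, scaling, and evaluation or composition of bounded linear maps
  are instances.\<close>

lemma Ck_on_bilinear:
  assumes "open S" and L: "bounded_bilinear L" and F: "Ck_on k S F" "Ck_on k S H"
  shows "Ck_on k S (\<lambda>x. L (F x) (H x))"
  using F
proof (induction k arbitrary: F H)
  case 0
  then show ?case by (simp add: bounded_bilinear.continuous_on[OF L])
next
  case (Suc k)
  have D: "((\<lambda>x. L (F x) (H x)) has_derivative (\<lambda>v. L (F x) (frechet_derivative H (at x) v) + L (frechet_derivative F (at x) v) (H x))) (at x)" if "x \<in> S" for x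
    using Suc.prems that by (intro bounded_bilinear.FDERIV[OF L]) (simp_all add: frechet_derivative_works[symmetric])
  have "Ck_on k S (\<lambda>x. frechet_derivative (\<lambda>x. L (F x) (H x)) (at x) v)" for v
  proof (subst Ck_on_cong[OF assms(1)])
    have "Ck_on k S F" "Ck_on k S H"
      using Suc.prems Ck_on_Suc_imp by blast+
    then show "Ck_on k S (\<lambda>x. L (F x) (frechet_derivative H (at x) v) + L (frechet_derivative F (at x) v) (H x))"
      using Suc by (intro Ck_on_add assms Suc.IH) simp_all
    show "frechet_derivative (\<lambda>x. L (F x) (H x)) (at y) v = L (F y) (frechet_derivative H (at y) v) + L (frechet_derivative F (at y) v) (H y)" if "y \<in> S" for y
      using frechet_derivative_at[OF D[OF that]] by metis
  qed
  then show ?case using D by (auto simp: differentiable_def)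
qed

text \<open>The derivative is built from the inverse itself and the derivative of F; so order k of
  the inverse gives order k + 1, with F fixed throughout the induction.\<close>

lemma Ck_on_inverse:
  fixes F :: "'e::real_normed_vector \<Rightarrow> real"
  assumes "open S" and nz: "\<And>x. x \<in> S \<Longrightarrow> F x \<noteq> 0" and F: "Ck_on k S F"
  shows "Ck_on k S (\<lambda>x. inverse (F x))"
  using F
proof (induction k)
  case 0
  then show ?case using nz by (simp add: continuous_on_inverse)
next
  case (Suc k)
  have D: "((\<lambda>x. inverse (F x)) has_derivative (\<lambda>v. - (inverse (F x) * frechet_derivative F (at x) v * inverse (F x)))) (at x)" if "x \<in> S" for x
    using Suc.prems that nz by (intro Deriv.has_derivative_inverse) (simp_all add: frechet_derivative_works[symmetric])
  have I: "Ck_on k S (\<lambda>x. inverse (F x))"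
    using Suc Ck_on_Suc_imp by blast
  have "Ck_on k S (\<lambda>x. frechet_derivative (\<lambda>x. inverse (F x)) (at x) v)" for v
  proof (subst Ck_on_cong[OF assms(1)])
    show "Ck_on k S (\<lambda>x. - (inverse (F x) * frechet_derivative F (at x) v * inverse (F x)))"
      using Suc.prems I
      by (intro Ck_on_linear[OF assms(1) bounded_linear_minus[OF bounded_linear_ident]]
          Ck_on_bilinear[OF assms(1) bounded_bilinear_mult]) simp_all
    show "frechet_derivative (\<lambda>x. inverse (F x)) (at y) v = - (inverse (F y) * frechet_derivative F (at y) v * inverse (F y))" if "y \<in> S" for y
      using frechet_derivative_at[OF D[OF that]] by metis
  qed
  then show ?case using D by (auto simp: differentiable_def)
qed

lemma smooth_on_cong:
  assumes "open S" "\<And>y. y \<in> S \<Longrightarrow> F y = H y"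
  shows "smooth_on S F \<longleftrightarrow> smooth_on S H"
  unfolding smooth_on_def using Ck_on_cong[OF assms(1), of F H] assms(2) by simp

lemma smooth_on_const: "smooth_on S (\<lambda>x. c)"
  unfolding smooth_on_def using Ck_on_const by blast

lemma smooth_on_linear: "open S \<Longrightarrow> bounded_linear L \<Longrightarrow> smooth_on S F \<Longrightarrow> smooth_on S (\<lambda>x. L (F x))"
  unfolding smooth_on_def using Ck_on_linear by blast

lemma smooth_on_add: "open S \<Longrightarrow> smooth_on S F \<Longrightarrow> smooth_on S H \<Longrightarrow> smooth_on S (\<lambda>x. F x + H x)"
  unfolding smooth_on_def using Ck_on_add by blast

lemma smooth_on_bilinear:
  "open S \<Longrightarrow> bounded_bilinear L \<Longrightarrow> smooth_on S F \<Longrightarrow> smooth_on S H \<Longrightarrow> smooth_on S (\<lambda>x. L (F x) (H x))"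
  unfolding smooth_on_def using Ck_on_bilinear by blast

lemmas smooth_on_mult = smooth_on_bilinear[OF _ bounded_bilinear_mult]
lemmas smooth_on_scaleR = smooth_on_bilinear[OF _ bounded_bilinear_scaleR]
lemmas smooth_on_minus = smooth_on_linear[OF _ bounded_linear_minus[OF bounded_linear_ident]]

lemma smooth_on_diff: "open S \<Longrightarrow> smooth_on S F \<Longrightarrow> smooth_on S H \<Longrightarrow> smooth_on S (\<lambda>x. F x - H x)"
  using smooth_on_add[OF _ _ smooth_on_minus] by simp

lemma smooth_on_inverse:
  fixes F :: "'e::real_normed_vector \<Rightarrow> real"
  shows "open S \<Longrightarrow> (\<And>x. x \<in> S \<Longrightarrow> F x \<noteq> 0) \<Longrightarrow> smooth_on S F \<Longrightarrow> smooth_on S (\<lambda>x. inverse (F x))"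
  unfolding smooth_on_def using Ck_on_inverse by blast

lemma smooth_on_sum:
  assumes "open S" "\<And>i. i \<in> I \<Longrightarrow> smooth_on S (F i)"
  shows "smooth_on S (\<lambda>x. \<Sum>i\<in>I. F i x)"
  using assms(2)
  by (induction I rule: infinite_finite_induct) (auto intro: smooth_on_const smooth_on_add[OF assms(1)])

lemma smooth_on_prod:
  fixes F :: "'i \<Rightarrow> 'e::real_normed_vector \<Rightarrow> real"
  assumes "open S" "\<And>i. i \<in> I \<Longrightarrow> smooth_on S (F i)"
  shows "smooth_on S (\<lambda>x. \<Prod>i\<in>I. F i x)"
  using assms(2)
  by (induction I rule: infinite_finite_induct) (auto intro: smooth_on_const smooth_on_mult[OF assms(1)])

lemma smooth_on_det:
  fixes M :: "'e::real_normed_vector \<Rightarrow> real ^ 'n::finite ^ 'n"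
  assumes "open S" "\<And>i j. smooth_on S (\<lambda>x. M x $ i $ j)"
  shows "smooth_on S (\<lambda>x. det (M x))"
  unfolding det_def
  by (intro smooth_on_sum smooth_on_mult smooth_on_const smooth_on_prod assms)

text \<open>Cramer's rule: an entry of the inverse is the determinant of G with one column replaced
  by a basis vector, divided by the determinant of G, hence a rational function of the entries with
  nonvanishing denominator.\<close>

lemma smooth_on_matrix_inv:
  fixes G :: "'e::real_normed_vector \<Rightarrow> real ^ 'n::finite ^ 'n"
  assumes S: "open S" and G: "\<And>i j. smooth_on S (\<lambda>x. G x $ i $ j)" and inv: "\<And>x. x \<in> S \<Longrightarrow> invertible (G x)"
  shows "smooth_on S (\<lambda>x. matrix_inv (G x) $ k $ l)"
proof -
  let ?M = "\<lambda>x. (\<chi> i j. if j = k then axis l 1 $ i else G x $ i $ j) :: real^'n^'n"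
  have eq: "matrix_inv (G x) $ k $ l = det (?M x) * inverse (det (G x))" if "x \<in> S" for x
  proof -
    have d: "det (G x) \<noteq> 0" using inv[OF that] invertible_det_nz by blast
    have "G x ** matrix_inv (G x) = mat 1"
      using inv[OF that] unfolding invertible_def matrix_inv_def by (rule someI2_ex) blast
    then have "G x *v (matrix_inv (G x) *v axis l 1) = axis l 1"
      by (simp add: matrix_vector_mul_assoc)
    then have "matrix_inv (G x) *v axis l 1 = (\<chi> k. det (\<chi> i j. if j = k then axis l 1 $ i else G x $ i $ j) / det (G x))"
      using cramer[OF d] by blast
    moreover have "(matrix_inv (G x) *v axis l 1) $ k = matrix_inv (G x) $ k $ l"
      by (simp add: matrix_vector_mult_basis column_def)
    ultimately show ?thesis by (simp add: divide_inverse)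
  qed
  have "smooth_on S (\<lambda>x. det (?M x) * inverse (det (G x)))"
  proof (intro smooth_on_mult smooth_on_det smooth_on_inverse S G)
    show "smooth_on S (\<lambda>x. ?M x $ i $ j)" for i j
      by (cases "j = k") (simp_all add: smooth_on_const G)
    show "det (G x) \<noteq> 0" if "x \<in> S" for x
      using inv[OF that] invertible_det_nz by blast
  qed
  then show ?thesis by (subst smooth_on_cong[OF S eq])
qed

section \<open>Derivatives as bounded linear maps, and symmetry of second derivatives\<close>

lemma smooth_on_has_derivative:
  "smooth_on S F \<Longrightarrow> x \<in> S \<Longrightarrow> (F has_derivative frechet_derivative F (at x)) (at x)"
  unfolding smooth_on_def frechet_derivative_works[symmetric] by (metis Ck_on.simps(2))

lemma smooth_on_frechet: "smooth_on S F \<Longrightarrow> smooth_on S (\<lambda>x. frechet_derivative F (at x) v)"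
  unfolding smooth_on_def by (metis Ck_on.simps(2))

lemma smooth_on_continuous: "smooth_on S F \<Longrightarrow> continuous_on S F"
  unfolding smooth_on_def using Ck_on_continuous by blast

text \<open>\<open>frechet_derivative\<close> yields plain functions; packaged as a bounded linear
  map, the derivative takes values in a normed space and can be bounded, composed and differentiated
  again. In \<open>bderiv (bderiv F) x u v\<close> the direction u belongs to the later
  differentiation.\<close>

definition bderiv :: "('e::real_normed_vector \<Rightarrow> 'b::real_normed_vector) \<Rightarrow> 'e \<Rightarrow> 'e \<Rightarrow>\<^sub>L 'b"
  where "bderiv F x = Blinfun (frechet_derivative F (at x))"

lemma bderiv_apply:
  "smooth_on S F \<Longrightarrow> x \<in> S \<Longrightarrow> blinfun_apply (bderiv F x) = frechet_derivative F (at x)"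
  unfolding bderiv_def
  by (rule bounded_linear_Blinfun_apply) (metis smooth_on_has_derivative has_derivative_bounded_linear)

lemma bderiv_works:
  "smooth_on S F \<Longrightarrow> x \<in> S \<Longrightarrow> (F has_derivative blinfun_apply (bderiv F x)) (at x)"
  using smooth_on_has_derivative bderiv_apply by metis

lemma bderiv_eqI:
  "smooth_on S F \<Longrightarrow> x \<in> S \<Longrightarrow> (F has_derivative D) (at x) \<Longrightarrow> blinfun_apply (bderiv F x) = D"
  using bderiv_works has_derivative_unique by metis

text \<open>\<open>Ck_on\<close> speaks of directional derivatives only. In finite dimension the
  derivative is a finite sum of directional derivatives times coordinate functionals, so smoothness
  in each direction gives smoothness as a map into bounded linear maps.\<close>

lemma smooth_on_bderiv:
  fixes F :: "'e::euclidean_space \<Rightarrow> 'b::real_normed_vector"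
  assumes "open S" "smooth_on S F"
  shows "smooth_on S (bderiv F)"
proof -
  let ?H = "\<lambda>x. \<Sum>b\<in>Basis. blinfun_scaleR_left (frechet_derivative F (at x) b) o\<^sub>L blinfun_inner_left b"
  have "smooth_on S ?H"
    by (intro smooth_on_sum smooth_on_bilinear[OF _ bounded_bilinear_blinfun_compose] smooth_on_const
        smooth_on_linear[OF _ bounded_linear_blinfun_scaleR_left] smooth_on_frechet assms)
  moreover have "bderiv F x = ?H x" if "x \<in> S" for x
  proof (rule blinfun_eqI)
    fix v
    have lin: "linear (frechet_derivative F (at x))"
      using assms(2) that bderiv_apply by (metis blinfun.bounded_linear_right bounded_linear.linear)
    have "frechet_derivative F (at x) v = frechet_derivative F (at x) (\<Sum>b\<in>Basis. (v \<bullet> b) *\<^sub>R b)"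
      by (simp add: euclidean_representation)
    also have "\<dots> = (\<Sum>b\<in>Basis. (v \<bullet> b) *\<^sub>R frechet_derivative F (at x) b)"
      by (simp add: linear_sum[OF lin] linear_scale[OF lin])
    finally show "bderiv F x v = ?H x v"
      by (simp add: bderiv_apply[OF assms(2) that] blinfun.sum_left blinfun_inner_left.rep_eq)
  qed
  ultimately show ?thesis using smooth_on_cong[OF assms(1), of "bderiv F" ?H] by blast
qed

text \<open>The link to the iterated partial derivatives that occur in
  \<open>hessian\<close>.\<close>

lemma bderiv_bderiv_frechet:
  fixes F :: "'e::euclidean_space \<Rightarrow> 'b::real_normed_vector"
  assumes "open S" "smooth_on S F" "x \<in> S"
  shows "bderiv (bderiv F) x u v = frechet_derivative (\<lambda>y. frechet_derivative F (at y) v) (at x) u"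
proof -
  have "(bderiv F has_derivative bderiv (bderiv F) x) (at x)"
    using bderiv_works[OF smooth_on_bderiv] assms by blast
  then have "((\<lambda>y. bderiv F y v) has_derivative (\<lambda>u. bderiv (bderiv F) x u v)) (at x)"
    by (rule bounded_linear.has_derivative[OF blinfun.bounded_linear_left])
  then have "((\<lambda>y. frechet_derivative F (at y) v) has_derivative (\<lambda>u. bderiv (bderiv F) x u v)) (at x)"
    by (subst has_derivative_cong_open[OF assms(1,3), symmetric])
      (auto simp: bderiv_apply[OF assms(2)])
  from frechet_derivative_at[OF this] show ?thesis by metis
qed

lemma bderiv_bderiv_eq:
  fixes F :: "'e::euclidean_space \<Rightarrow> 'b::real_normed_vector"
  assumes "open S" "smooth_on S F" "x \<in> S"
  shows "bderiv (bderiv F) x u v = bderiv (\<lambda>y. bderiv F y v) x u"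
proof -
  have "(bderiv F has_derivative bderiv (bderiv F) x) (at x)"
    using bderiv_works[OF smooth_on_bderiv] assms by blast
  then have 1: "((\<lambda>y. bderiv F y v) has_derivative (\<lambda>u. bderiv (bderiv F) x u v)) (at x)"
    by (rule bounded_linear.has_derivative[OF blinfun.bounded_linear_left])
  have 2: "smooth_on S (\<lambda>y. bderiv F y v)"
    by (intro smooth_on_linear[OF _ blinfun.bounded_linear_left] smooth_on_bderiv assms)
  show ?thesis
    by (simp add: bderiv_eqI[OF 2 assms(3) 1])
qed

lemma smooth_on_along_line:
  assumes "smooth_on S F" "x + t *\<^sub>R v \<in> S"
  shows "((\<lambda>t. F (x + t *\<^sub>R v)) has_vector_derivative bderiv F (x + t *\<^sub>R v) v) (at t)"
proof -
  have "((\<lambda>t. x + t *\<^sub>R v) has_vector_derivative v) (at t)"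
    by (auto intro!: derivative_eq_intros)
  from vector_derivative_diff_chain_within[OF this has_derivative_at_withinI[OF bderiv_works[OF assms]]]
  show ?thesis by (simp add: o_def)
qed

lemma has_derivative_bderiv_line:
  fixes F :: "'e::euclidean_space \<Rightarrow> real"
  assumes "open S" "smooth_on S F" "x + t *\<^sub>R v \<in> S"
  shows "((\<lambda>t. F (x + t *\<^sub>R v)) has_real_derivative bderiv F (x + t *\<^sub>R v) v) (at t)"
    "((\<lambda>t. bderiv F (x + t *\<^sub>R v) u) has_real_derivative bderiv (bderiv F) (x + t *\<^sub>R v) v u) (at t)"
proof -
  have 1: "smooth_on S (bderiv F)"
    by (rule smooth_on_bderiv[OF assms(1,2)])
  show "((\<lambda>t. F (x + t *\<^sub>R v)) has_real_derivative bderiv F (x + t *\<^sub>R v) v) (at t)"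
    using smooth_on_along_line[OF assms(2,3)] by (simp add: has_real_derivative_iff_has_vector_derivative)
  show "((\<lambda>t. bderiv F (x + t *\<^sub>R v) u) has_real_derivative bderiv (bderiv F) (x + t *\<^sub>R v) v u) (at t)"
    using bounded_linear.has_vector_derivative[OF blinfun.bounded_linear_left smooth_on_along_line[OF 1 assms(3)]]
    by (simp add: has_real_derivative_iff_has_vector_derivative)
qed

text \<open>The second difference of F over a small parallelogram is symmetric in u and v. Two mean
  value theorems express it by a second derivative at an intermediate point, and continuity of the
  second derivative passes to the limit.\<close>

lemma bderiv2_symmetric_real:
  fixes F :: "'e::euclidean_space \<Rightarrow> real"
  assumes S: "open S" and F: "smooth_on S F" and x: "x \<in> S"
  shows "bderiv (bderiv F) x u v = bderiv (bderiv F) x v u"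
proof -
  have key: "\<exists>a b. 0 < a \<and> a < t \<and> 0 < b \<and> b < t \<and>
      F (x + t *\<^sub>R u + t *\<^sub>R v) - F (x + t *\<^sub>R u) - F (x + t *\<^sub>R v) + F x
        = t * (t * bderiv (bderiv F) (x + a *\<^sub>R u + b *\<^sub>R v) v u)"
    if t: "0 < t" and in_S: "\<And>a b. \<lbrakk>0 \<le> a; a \<le> t; 0 \<le> b; b \<le> t\<rbrakk> \<Longrightarrow> x + a *\<^sub>R u + b *\<^sub>R v \<in> S" for u v t
  proof -
    \<comment> \<open>The increment of F in direction t v, as a function of the displacement s in
      direction u; its own increment over [0, t] is the second difference.\<close>
    let ?\<phi> = "\<lambda>s. F (x + t *\<^sub>R v + s *\<^sub>R u) - F (x + s *\<^sub>R u)"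
    have "\<exists>a. 0 < a \<and> a < t \<and> ?\<phi> t - ?\<phi> 0 = (t - 0) * (bderiv F (x + t *\<^sub>R v + a *\<^sub>R u) u - bderiv F (x + a *\<^sub>R u) u)"
    proof (rule MVT2[OF t])
      fix s assume s: "0 \<le> s" "s \<le> t"
      have 1: "x + t *\<^sub>R v + s *\<^sub>R u \<in> S"
        using in_S[of s t] s t by (simp add: add_ac)
      have 2: "x + s *\<^sub>R u \<in> S"
        using in_S[of s 0] s t by simp
      show "DERIV ?\<phi> s :> bderiv F (x + t *\<^sub>R v + s *\<^sub>R u) u - bderiv F (x + s *\<^sub>R u) u"
        by (intro DERIV_diff has_derivative_bderiv_line[OF S F] 1 2)
    qed
    then obtain a where a: "0 < a" "a < t"
      "?\<phi> t - ?\<phi> 0 = t * (bderiv F (x + t *\<^sub>R v + a *\<^sub>R u) u - bderiv F (x + a *\<^sub>R u) u)"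
      by auto
    let ?\<psi> = "\<lambda>s. bderiv F (x + a *\<^sub>R u + s *\<^sub>R v) u"
    have "\<exists>b. 0 < b \<and> b < t \<and> ?\<psi> t - ?\<psi> 0 = (t - 0) * (bderiv (bderiv F) (x + a *\<^sub>R u + b *\<^sub>R v) v u)"
    proof (rule MVT2[OF t])
      fix s assume s: "0 \<le> s" "s \<le> t"
      then have "x + a *\<^sub>R u + s *\<^sub>R v \<in> S"
        using in_S[of a s] a by simp
      then show "DERIV ?\<psi> s :> bderiv (bderiv F) (x + a *\<^sub>R u + s *\<^sub>R v) v u"
        by (rule has_derivative_bderiv_line[OF S F])
    qed
    then obtain b where "0 < b" "b < t" "?\<psi> t - ?\<psi> 0 = t * bderiv (bderiv F) (x + a *\<^sub>R u + b *\<^sub>R v) v u"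
      by auto
    with a show ?thesis
      by (intro exI[of _ a] exI[of _ b]) (simp add: add_ac)
  qed
  have cont: "isCont (bderiv (bderiv F)) x"
    using smooth_on_continuous[OF smooth_on_bderiv[OF S smooth_on_bderiv[OF S F]]] S x
    by (simp add: continuous_on_eq_continuous_at)
  have contv: "isCont (\<lambda>y. bderiv (bderiv F) y v u) x" for v u
    using cont by (intro continuous_intros)
  obtain r where r: "r > 0" "ball x r \<subseteq> S" using S x open_contains_ball by blast
  have "\<bar>bderiv (bderiv F) x u v - bderiv (bderiv F) x v u\<bar> \<le> e" if "e > 0" for e
  proof -
    obtain d1 where d1: "d1 > 0" "\<And>y. dist y x < d1 \<Longrightarrow> dist (bderiv (bderiv F) y u v) (bderiv (bderiv F) x u v) < e/2"
      using contv[of u v] \<open>e > 0\<close> unfolding continuous_at_eps_delta by (metis half_gt_zero dist_commute)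
    obtain d2 where d2: "d2 > 0" "\<And>y. dist y x < d2 \<Longrightarrow> dist (bderiv (bderiv F) y v u) (bderiv (bderiv F) x v u) < e/2"
      using contv[of v u] \<open>e > 0\<close> unfolding continuous_at_eps_delta by (metis half_gt_zero dist_commute)
    \<comment> \<open>m lies within the domain and both continuity radii; the denominator of t
      brings every point of the parallelogram of side t closer to x than m.\<close>
    define m where "m = min r (min d1 d2)"
    define t where "t = m / (2 * (norm u + norm v + 1))"
    have m: "m > 0" using r d1 d2 by (simp add: m_def)
    have t: "t > 0" using m by (simp add: t_def add_nonneg_pos)
    have close: "dist (x + a *\<^sub>R u + b *\<^sub>R v) x < m" if "0 \<le> a" "a \<le> t" "0 \<le> b" "b \<le> t" for a b
    proof -
      have "dist (x + a *\<^sub>R u + b *\<^sub>R v) x \<le> a * norm u + b * norm v"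
        using norm_triangle_ineq[of "a *\<^sub>R u" "b *\<^sub>R v"] that by (simp add: dist_norm add.assoc)
      also have "\<dots> \<le> t * norm u + t * norm v"
        using that by (intro add_mono mult_right_mono) auto
      also have "\<dots> = t * (norm u + norm v)"
        by (simp add: distrib_left)
      also have "\<dots> < t * (2 * (norm u + norm v + 1))"
        using norm_ge_zero[of u] norm_ge_zero[of v]
        by (intro mult_strict_left_mono t) (smt (verit) norm_ge_zero)
      also have "\<dots> = m" by (simp add: t_def add_nonneg_eq_0_iff)
      finally show ?thesis .
    qed
    have inS: "x + a *\<^sub>R u + b *\<^sub>R v \<in> S" if "0 \<le> a" "a \<le> t" "0 \<le> b" "b \<le> t" for a b
      using close[OF that] r by (auto simp: m_def dist_commute subset_eq)
    have inS': "x + a *\<^sub>R v + b *\<^sub>R u \<in> S" if "0 \<le> a" "a \<le> t" "0 \<le> b" "b \<le> t" for a b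
      using inS[of b a] that by (simp add: add_ac)
    obtain a b where ab: "0 < a" "a < t" "0 < b" "b < t"
      "F (x + t *\<^sub>R u + t *\<^sub>R v) - F (x + t *\<^sub>R u) - F (x + t *\<^sub>R v) + F x
        = t * (t * bderiv (bderiv F) (x + a *\<^sub>R u + b *\<^sub>R v) v u)"
      using key[OF t inS] by blast
    obtain a' b' where ab': "0 < a'" "a' < t" "0 < b'" "b' < t"
      "F (x + t *\<^sub>R v + t *\<^sub>R u) - F (x + t *\<^sub>R v) - F (x + t *\<^sub>R u) + F x
        = t * (t * bderiv (bderiv F) (x + a' *\<^sub>R v + b' *\<^sub>R u) u v)"
      using key[OF t inS'] by blast
    have "t * (t * bderiv (bderiv F) (x + a *\<^sub>R u + b *\<^sub>R v) v u) = t * (t * bderiv (bderiv F) (x + a' *\<^sub>R v + b' *\<^sub>R u) u v)"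
      using ab(5) ab'(5)[unfolded add.assoc add.commute[of "t *\<^sub>R v" "t *\<^sub>R u"], folded add.assoc]
      by linarith
    then have eq: "bderiv (bderiv F) (x + a *\<^sub>R u + b *\<^sub>R v) v u = bderiv (bderiv F) (x + a' *\<^sub>R v + b' *\<^sub>R u) u v"
      using t by simp
    have "dist (x + a *\<^sub>R u + b *\<^sub>R v) x < d2" using close[of a b] ab by (simp add: m_def)
    from d2(2)[OF this] have 1: "\<bar>bderiv (bderiv F) (x + a *\<^sub>R u + b *\<^sub>R v) v u - bderiv (bderiv F) x v u\<bar> < e/2"
      by (simp add: dist_real_def)
    have "dist (x + a' *\<^sub>R v + b' *\<^sub>R u) x < d1" using close[of b' a'] ab' by (simp add: m_def add_ac)
    from d1(2)[OF this] have 2: "\<bar>bderiv (bderiv F) (x + a' *\<^sub>R v + b' *\<^sub>R u) u v - bderiv (bderiv F) x u v\<bar> < e/2"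
      by (simp add: dist_real_def)
    show ?thesis using 1 2 eq by linarith
  qed
  then have "\<bar>bderiv (bderiv F) x u v - bderiv (bderiv F) x v u\<bar> \<le> 0"
    by (rule field_le_epsilon) simp
  then show ?thesis by simp
qed

lemma bderiv_linear:
  fixes F :: "'e::euclidean_space \<Rightarrow> 'b::real_normed_vector"
  assumes S: "open S" and F: "smooth_on S F" and x: "x \<in> S" and L: "bounded_linear L"
  shows "bderiv (\<lambda>y. L (F y)) x u = L (bderiv F x u)"
    "bderiv (bderiv (\<lambda>y. L (F y))) x u v = L (bderiv (bderiv F) x u v)"
proof -
  have sm: "smooth_on S (\<lambda>y. L (F y))"
    by (rule smooth_on_linear[OF S L F])
  have 1: "bderiv (\<lambda>y. L (F y)) x u = L (bderiv F x u)" if "x \<in> S" for x u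
    using bderiv_eqI[OF sm that bounded_linear.has_derivative[OF L bderiv_works[OF F that]]]
    by simp
  show "bderiv (\<lambda>y. L (F y)) x u = L (bderiv F x u)" by (rule 1[OF x])
  have smv: "smooth_on S (\<lambda>y. bderiv F y v)"
    by (intro smooth_on_linear[OF S blinfun.bounded_linear_left] smooth_on_bderiv S F)
  have "bderiv (bderiv (\<lambda>y. L (F y))) x u v = bderiv (\<lambda>y. bderiv (\<lambda>y. L (F y)) y v) x u"
    by (rule bderiv_bderiv_eq[OF S sm x])
  also have "\<dots> = bderiv (\<lambda>y. L (bderiv F y v)) x u"
  proof -
    have "frechet_derivative (\<lambda>y. bderiv (\<lambda>y. L (F y)) y v) (at x) = frechet_derivative (\<lambda>y. L (bderiv F y v)) (at x)"
      by (rule frechet_derivative_cong_open[OF S x]) (simp add: 1)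
    then show ?thesis by (simp add: bderiv_def)
  qed
  also have "\<dots> = L (bderiv (\<lambda>y. bderiv F y v) x u)"
    using bderiv_eqI[OF smooth_on_linear[OF S L smv] x
        bounded_linear.has_derivative[OF L bderiv_works[OF smv x]]]
    by simp
  also have "\<dots> = L (bderiv (bderiv F) x u v)"
    by (simp add: bderiv_bderiv_eq[OF S F x])
  finally show "bderiv (bderiv (\<lambda>y. L (F y))) x u v = L (bderiv (bderiv F) x u v)" .
qed

text \<open>Tested against every vector b, this is the real case for
  \<open>F y \<bullet> b\<close>.\<close>

lemma bderiv2_symmetric:
  fixes F :: "'e::euclidean_space \<Rightarrow> 'b::real_inner"
  assumes S: "open S" and F: "smooth_on S F" and x: "x \<in> S"
  shows "bderiv (bderiv F) x u v = bderiv (bderiv F) x v u"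
proof -
  have "bderiv (bderiv F) x u v \<bullet> b = bderiv (bderiv F) x v u \<bullet> b" for b
    using bderiv2_symmetric_real[OF S smooth_on_linear[OF S bounded_linear_inner_left F] x, of b u v]
    by (simp add: bderiv_linear(2)[OF S F x bounded_linear_inner_left])
  then show ?thesis by (metis vector_eq_rdot)
qed

section \<open>Riemannian geometry in a chart\<close>

lemma partial_eq_bderiv: "smooth_on U F \<Longrightarrow> x \<in> U \<Longrightarrow> partial i F x = bderiv F x (axis i 1)"
  unfolding partial_def by (simp add: bderiv_apply)

text \<open>The elementary bilinear map with the single coefficient w at position (i, j); sums of
  these turn index arrays into bounded bilinear maps.\<close>

definition form2 :: "'n::finite \<Rightarrow> 'n \<Rightarrow> 'b::real_normed_vector \<Rightarrow> (real^'n) \<Rightarrow>\<^sub>L (real^'n) \<Rightarrow>\<^sub>L 'b"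
  where "form2 i j w = blinfun_scaleR_left (blinfun_scaleR_left w o\<^sub>L blinfun_inner_left (axis j 1)) o\<^sub>L blinfun_inner_left (axis i 1)"

lemma form2_apply [simp]: "form2 i j w a b = (a $ i * b $ j) *\<^sub>R w"
  by (simp add: form2_def blinfun_inner_left.rep_eq blinfun.scaleR_left inner_axis)

lemma bounded_linear_form2: "bounded_linear (form2 i j)"
  unfolding form2_def
  by (intro bounded_linear_compose[OF bounded_bilinear.bounded_linear_left[OF bounded_bilinear_blinfun_compose]]
      bounded_linear_compose[OF bounded_linear_blinfun_scaleR_left]
      bounded_linear_compose[OF bounded_bilinear.bounded_linear_left[OF bounded_bilinear_blinfun_compose]]
      bounded_linear_ident) 

text \<open>Metric and, below, Christoffel symbols as maps from points to bounded bilinear maps: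
  their derivatives are again multilinear, and tensor identities can be proved without
  indices.\<close>

definition gB :: "(real ^ 'n \<Rightarrow> real ^ 'n ^ 'n) \<Rightarrow> real^'n::finite \<Rightarrow> (real^'n) \<Rightarrow>\<^sub>L (real^'n) \<Rightarrow>\<^sub>L real"
  where "gB G x = (\<Sum>i\<in>UNIV. \<Sum>j\<in>UNIV. form2 i j (G x $ i $ j))"

definition chrB :: "(real ^ 'n \<Rightarrow> real ^ 'n ^ 'n) \<Rightarrow> real^'n::finite \<Rightarrow> (real^'n) \<Rightarrow>\<^sub>L (real^'n) \<Rightarrow>\<^sub>L (real^'n)"
  where "chrB G x = (\<Sum>i\<in>UNIV. \<Sum>j\<in>UNIV. form2 i j (\<chi> k. christoffel G k i j x))"

lemma gB_apply: "gB G x a b = a \<bullet> (G x *v b)"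
  by (simp add: gB_def blinfun.sum_left inner_vec_def matrix_vector_mult_def sum_distrib_left mult_ac)

lemma chrB_nth: "chrB G x a b $ k = (\<Sum>i\<in>UNIV. \<Sum>j\<in>UNIV. christoffel G k i j x * a $ i * b $ j)"
  by (simp add: chrB_def blinfun.sum_left mult_ac)

lemma gB_axis: "gB G x (axis i 1) (axis j 1) = G x $ i $ j"
  by (simp add: gB_apply matrix_vector_mult_basis inner_axis' column_def)

lemma sum_axis_left: "(\<Sum>i\<in>UNIV. f i * axis (k::'n::finite) (1::real) $ i) = f k"
proof -
  have "(\<Sum>i\<in>UNIV. f i * axis k 1 $ i) = (\<Sum>i\<in>UNIV. if i = k then f i else 0)"
    by (rule sum.cong) (auto simp: axis_def)
  then show ?thesis by simp
qed

lemma chrB_axis: "chrB G x (axis i 1) (axis j 1) $ k = christoffel G k i j x"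
  by (simp add: chrB_nth sum_axis_left)

lemma bilinear_eq_axis:
  fixes f h :: "real^'n \<Rightarrow> real^'n \<Rightarrow> 'b::real_vector"
  assumes "bilinear f" "bilinear h" "\<And>i j. f (axis i 1) (axis j 1) = h (axis i 1) (axis j 1)"
  shows "f a b = h a b"
proof -
  have "f = h"
    by (rule bilinear_eq_stdbasis[OF assms(1,2)]) (auto simp: Basis_vec_def assms(3))
  then show ?thesis by simp
qed

lemma smooth_on_vec:
  fixes F :: "'e::real_normed_vector \<Rightarrow> real^'n::finite"
  assumes "open S" "\<And>i. smooth_on S (\<lambda>x. F x $ i)"
  shows "smooth_on S F"
proof -
  have "smooth_on S (\<lambda>x. \<Sum>i\<in>UNIV. (F x $ i) *\<^sub>R (axis i 1 :: real^'n))"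
    by (intro smooth_on_sum smooth_on_scaleR smooth_on_const assms)
  moreover have "(\<Sum>i\<in>UNIV. (F x $ i) *\<^sub>R (axis i 1 :: real^'n)) = F x" for x
    by (simp add: vec_eq_iff sum_axis_left axis_def if_distrib cong: if_cong)
  ultimately show ?thesis by simp
qed

lemma linear_axis_expand:
  fixes L :: "real^'n::finite \<Rightarrow> 'b::real_vector"
  assumes "linear L"
  shows "L v = (\<Sum>l\<in>UNIV. v $ l *\<^sub>R L (axis l 1))"
proof -
  have "L v = L (\<Sum>l\<in>UNIV. v $ l *\<^sub>R axis l 1)"
    by (rule arg_cong[of _ _ L]) (simp add: vec_eq_iff axis_def if_distrib cong: if_cong)
  then show ?thesis by (simp add: linear_sum[OF assms] linear_scale[OF assms])
qed

section \<open>Connection and curvature of a metric on an open set of coordinate space\<close>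

locale chart_metric =
  fixes U :: "(real^'n::finite) set" and G :: "real^'n \<Rightarrow> real^'n^'n"
  assumes open_U: "open U"
    and smooth_G: "smooth_on U G"
    and sym_G: "x \<in> U \<Longrightarrow> transpose (G x) = G x"
    and pos_G: "x \<in> U \<Longrightarrow> v \<noteq> 0 \<Longrightarrow> v \<bullet> (G x *v v) > 0"
begin

abbreviation "g \<equiv> gB G"
abbreviation "\<Gamma> \<equiv> chrB G"
abbreviation "dg \<equiv> bderiv (gB G)"
abbreviation "d\<Gamma> \<equiv> bderiv (chrB G)"
abbreviation "ddg \<equiv> bderiv (bderiv (gB G))"

text \<open>R(X, Y)Z computed for the extensions of X, Y, Z to constant coordinate fields, whose
  brackets vanish.\<close>

definition riem :: "real^'n \<Rightarrow> real^'n \<Rightarrow> real^'n \<Rightarrow> real^'n \<Rightarrow> real^'n"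
  where "riem x X Y Z = d\<Gamma> x X Y Z - d\<Gamma> x Y X Z + \<Gamma> x X (\<Gamma> x Y Z) - \<Gamma> x Y (\<Gamma> x X Z)"

lemma smooth_G_nth: "smooth_on U (\<lambda>x. G x $ i $ j)"
  by (intro smooth_on_linear[OF open_U bounded_linear_vec_nth] smooth_G)

lemma invertible_G: "x \<in> U \<Longrightarrow> invertible (G x)"
proof -
  assume x: "x \<in> U"
  have "v = 0" if "G x *v v = 0" for v
    using pos_G[OF x, of v] that by auto
  then show ?thesis
    by (metis invertible_left_inverse matrix_left_invertible_ker)
qed

lemma matrix_inv_G: "x \<in> U \<Longrightarrow> G x ** matrix_inv (G x) = mat 1" "x \<in> U \<Longrightarrow> matrix_inv (G x) ** G x = mat 1"
  using someI_ex[OF invertible_G[unfolded invertible_def]] by (auto simp: matrix_inv_def)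

lemma smooth_g: "smooth_on U g"
  unfolding gB_def
  by (intro smooth_on_sum open_U smooth_on_linear[OF open_U bounded_linear_form2] smooth_G_nth)

lemma smooth_christoffel: "smooth_on U (christoffel G k i j)"
proof -
  have 1: "smooth_on U (partial l (\<lambda>y. G y $ a $ b))" for l a b
    unfolding partial_def by (intro smooth_on_frechet smooth_G_nth)
  have 2: "smooth_on U (\<lambda>x. matrix_inv (G x) $ a $ b)" for a b
    by (intro smooth_on_matrix_inv open_U smooth_G_nth invertible_G)
  show ?thesis
    unfolding christoffel_def
    by (intro smooth_on_mult smooth_on_const smooth_on_sum smooth_on_add smooth_on_diff open_U 1 2)
qed

lemma smooth_\<Gamma>: "smooth_on U \<Gamma>"
  unfolding chrB_def
  by (intro smooth_on_sum open_U smooth_on_linear[OF open_U bounded_linear_form2] smooth_on_vec)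
    (simp add: smooth_christoffel)

lemma g_sym: "x \<in> U \<Longrightarrow> g x a b = g x b a"
  by (metis gB_apply dot_lmul_matrix inner_commute sym_G vector_transpose_matrix)

lemma g_pos: "x \<in> U \<Longrightarrow> v \<noteq> 0 \<Longrightarrow> g x v v > 0"
  by (simp add: gB_apply pos_G)

lemma g_nonneg: "x \<in> U \<Longrightarrow> g x v v \<ge> 0"
  using g_pos[of x v] by (cases "v = 0") (auto simp: blinfun.zero_left less_imp_le)

lemma g_nondegenerate: "x \<in> U \<Longrightarrow> (\<And>v. g x a v = g x b v) \<Longrightarrow> a = b"
proof (rule ccontr)
  assume x: "x \<in> U" and eq: "\<And>v. g x a v = g x b v" and "a \<noteq> b"
  then have "g x (a - b) (a - b) > 0" using g_pos by simp
  then show False using eq[of "a - b"] by (simp add: blinfun.diff_left blinfun.diff_right)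
qed

lemma bounded_linear_eval2: "bounded_linear (\<lambda>B. blinfun_apply (blinfun_apply B a) b)"
  by (intro bounded_linear_compose[OF blinfun.bounded_linear_left] blinfun.bounded_linear_left)

lemma partial_G: "x \<in> U \<Longrightarrow> partial l (\<lambda>y. G y $ i $ j) x = dg x (axis l 1) (axis i 1) (axis j 1)"
proof -
  assume x: "x \<in> U"
  have "partial l (\<lambda>y. G y $ i $ j) x = bderiv (\<lambda>y. g y (axis i 1) (axis j 1)) x (axis l 1)"
    using partial_eq_bderiv[OF smooth_G_nth x] by (simp add: gB_axis)
  then show ?thesis
    by (simp add: bderiv_linear(1)[OF open_U smooth_g x bounded_linear_eval2])
qed

lemma dg_sym: assumes "x \<in> U" shows "dg x u a b = dg x u b a"
proof -
  have "bderiv (\<lambda>y. g y a b) x = bderiv (\<lambda>y. g y b a) x"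
    unfolding bderiv_def using frechet_derivative_cong_open[OF open_U assms, of "\<lambda>y. g y a b" "\<lambda>y. g y b a"] g_sym by simp
  then show ?thesis
    by (metis bderiv_linear(1)[OF open_U smooth_g assms bounded_linear_eval2])
qed

text \<open>The Koszul formula for constant fields: contraction with G cancels the inverse matrix in
  \<open>christoffel\<close>, and bilinearity reduces a and b to coordinate vectors. Symmetry of
  \<Gamma> and metric compatibility follow from it without indices.\<close>

lemma koszul:
  assumes x: "x \<in> U"
  shows "g x (\<Gamma> x a b) v = (dg x a b v + dg x b a v - dg x v a b) / 2"
proof (rule bilinear_eq_axis[of "\<lambda>a b. g x (\<Gamma> x a b) v" "\<lambda>a b. (dg x a b v + dg x b a v - dg x v a b) / 2"])
  show "bilinear (\<lambda>a b. g x (\<Gamma> x a b) v)" "bilinear (\<lambda>a b. (dg x a b v + dg x b a v - dg x v a b) / 2)"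
    by (auto simp: bilinear_def linear_iff blinfun.bilinear_simps algebra_simps add_divide_distrib diff_divide_distrib)
  fix i j
  define K :: "real^'n" where "K = (\<chi> l. dg x (axis i 1) (axis j 1) (axis l 1) + dg x (axis j 1) (axis i 1) (axis l 1) - dg x (axis l 1) (axis i 1) (axis j 1))"
  have "\<Gamma> x (axis i 1) (axis j 1) = (1/2) *\<^sub>R (matrix_inv (G x) *v K)"
    by (simp add: vec_eq_iff chrB_axis christoffel_def partial_G x K_def matrix_vector_mult_def)
  then have "G x *v \<Gamma> x (axis i 1) (axis j 1) = (1/2) *\<^sub>R K"
    by (simp add: matrix_vector_mult_scaleR matrix_vector_mul_assoc matrix_inv_G x)
  then have "g x (\<Gamma> x (axis i 1) (axis j 1)) v = (1/2) * (v \<bullet> K)"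
    by (simp add: g_sym[OF x, of _ v] gB_apply[of G x v])
  also have "v \<bullet> K = (\<Sum>l\<in>UNIV. v $ l * (dg x (axis i 1) (axis j 1) (axis l 1) + dg x (axis j 1) (axis i 1) (axis l 1) - dg x (axis l 1) (axis i 1) (axis j 1)))"
    by (simp add: inner_vec_def K_def)
  also have "\<dots> = dg x (axis i 1) (axis j 1) v + dg x (axis j 1) (axis i 1) v - dg x v (axis i 1) (axis j 1)"
  proof -
    have 1: "L v = (\<Sum>l\<in>UNIV. v $ l * L (axis l 1))" if "bounded_linear L" for L :: "real^'n \<Rightarrow> real"
      unfolding real_scaleR_def[symmetric] by (rule linear_axis_expand[OF bounded_linear.linear[OF that]])
    have 2: "bounded_linear (\<lambda>v. dg x v (axis i 1) (axis j 1))"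
      by (intro bounded_linear_compose[OF bounded_linear_eval2] blinfun.bounded_linear_right)
    show ?thesis
      unfolding 1[OF blinfun.bounded_linear_right, of "dg x (axis i 1) (axis j 1)"]
        1[OF blinfun.bounded_linear_right, of "dg x (axis j 1) (axis i 1)"] 1[OF 2]
      by (simp add: algebra_simps sum.distrib sum_subtractf)
  qed
  finally show "g x (\<Gamma> x (axis i 1) (axis j 1)) v = (dg x (axis i 1) (axis j 1) v + dg x (axis j 1) (axis i 1) v - dg x v (axis i 1) (axis j 1)) / 2"
    by simp
qed

lemma \<Gamma>_sym: "x \<in> U \<Longrightarrow> \<Gamma> x a b = \<Gamma> x b a"
  by (rule g_nondegenerate) (auto simp: koszul dg_sym[of x _ a b])

text \<open>Metric compatibility: in the sum of the two Koszul formulas all terms but the derivative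
  along v cancel.\<close>

lemma compat: "x \<in> U \<Longrightarrow> dg x v a b = g x (\<Gamma> x v a) b + g x a (\<Gamma> x v b)"
  by (simp add: g_sym[of x a] koszul dg_sym[of x _ a b] dg_sym[of x _ v b] dg_sym[of x _ v a] field_simps)

lemma ddg_sym: "x \<in> U \<Longrightarrow> ddg x u v a b = ddg x v u a b"
proof -
  assume x: "x \<in> U"
  have "smooth_on U (\<lambda>y. g y a b)"
    by (rule smooth_on_linear[OF open_U bounded_linear_eval2 smooth_g])
  from bderiv2_symmetric[OF open_U this x, of u v] show ?thesis
    by (simp add: bderiv_linear(2)[OF open_U smooth_g x bounded_linear_eval2])
qed

lemma has_derivative_blinfun2:
  assumes "(B has_derivative B') (at x)" "(a has_derivative a') (at x)" "(b has_derivative b') (at x)"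
  shows "((\<lambda>y. blinfun_apply (blinfun_apply (B y) (a y)) (b y)) has_derivative (\<lambda>u. B' u (a x) (b x) + B x (a' u) (b x) + B x (a x) (b' u))) (at x)"
  using bounded_bilinear.FDERIV[OF bounded_bilinear_blinfun_apply
      bounded_bilinear.FDERIV[OF bounded_bilinear_blinfun_apply assms(1,2)] assms(3)]
  by (simp add: blinfun.bilinear_simps algebra_simps)

lemma d\<Gamma>_works: "x \<in> U \<Longrightarrow> (\<Gamma> has_derivative d\<Gamma> x) (at x)"
  by (rule bderiv_works[OF smooth_\<Gamma>])

lemma dg_works: "x \<in> U \<Longrightarrow> (g has_derivative dg x) (at x)"
  by (rule bderiv_works[OF smooth_g])

lemma ddg_eq:
  assumes x: "x \<in> U"
  shows "ddg x u v a b = dg x u (\<Gamma> x v a) b + g x (d\<Gamma> x u v a) b + dg x u a (\<Gamma> x v b) + g x a (d\<Gamma> x u v b)"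
proof -
  have 1: "((\<lambda>y. dg y v a b) has_derivative (\<lambda>u. ddg x u v a b)) (at x)"
    using bounded_linear.has_derivative[OF bounded_linear_eval2[of a b]
      bounded_linear.has_derivative[OF blinfun.bounded_linear_left[of v] bderiv_works[OF smooth_on_bderiv[OF open_U smooth_g] x]]]
    by simp
  have \<Gamma>': "((\<lambda>y. \<Gamma> y v c) has_derivative (\<lambda>u. d\<Gamma> x u v c)) (at x)" for c
    by (rule bounded_linear.has_derivative[OF bounded_linear_eval2 d\<Gamma>_works[OF x]])
  have "((\<lambda>y. g y (\<Gamma> y v a) b + g y a (\<Gamma> y v b)) has_derivative
      (\<lambda>u. (dg x u (\<Gamma> x v a) b + g x (d\<Gamma> x u v a) b + g x (\<Gamma> x v a) 0) + (dg x u a (\<Gamma> x v b) + g x 0 (\<Gamma> x v b) + g x a (d\<Gamma> x u v b)))) (at x)"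
    by (intro has_derivative_add has_derivative_blinfun2 dg_works x \<Gamma>' has_derivative_const)
  then have "((\<lambda>y. dg y v a b) has_derivative
      (\<lambda>u. (dg x u (\<Gamma> x v a) b + g x (d\<Gamma> x u v a) b + g x (\<Gamma> x v a) 0) + (dg x u a (\<Gamma> x v b) + g x 0 (\<Gamma> x v b) + g x a (d\<Gamma> x u v b)))) (at x)"
    by (subst has_derivative_cong_open[OF open_U x]) (auto simp: compat)
  from has_derivative_unique[OF 1 this] show ?thesis
    by (simp add: fun_eq_iff blinfun.bilinear_simps)
qed

text \<open>Second derivatives of g commute. Both orders written out by the differentiated
  compatibility \<open>ddg_eq\<close> leave, after cancellation, the skew symmetry of the curvature
  operator.\<close>

lemma riem_antisym:
  assumes x: "x \<in> U"
  shows "g x (riem x X Y Z) W = - g x (riem x X Y W) Z"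
proof -
  have "ddg x X Y Z W = ddg x Y X Z W" by (rule ddg_sym[OF x])
  then show ?thesis
    unfolding ddg_eq[OF x] compat[OF x] riem_def
    by (simp add: blinfun.bilinear_simps g_sym[OF x, of Z] g_sym[OF x, of W]
        g_sym[OF x, of "\<Gamma> x X Z"] g_sym[OF x, of "\<Gamma> x X W"] algebra_simps)
qed

end

section \<open>Traces, orthonormal frames, Ricci curvature and Hessian\<close>

definition trc :: "(real^'n::finite \<Rightarrow> real^'n) \<Rightarrow> real"
  where "trc L = (\<Sum>i\<in>UNIV. L (axis i 1) $ i)"

lemma trc_add: "trc (\<lambda>u. L u + K u) = trc L + trc K"
  by (simp add: trc_def sum.distrib)

text \<open>Cyclicity of the trace; in Bochner's formula it cancels the terms that are not
  tensorial.\<close>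

lemma trc_commute:
  fixes B C :: "real^'n::finite \<Rightarrow> real^'n"
  assumes "linear B" "linear C"
  shows "trc (\<lambda>u. B (C u)) = trc (\<lambda>u. C (B u))"
proof -
  have 1: "trc (\<lambda>u. B (C u)) = (\<Sum>i\<in>UNIV. \<Sum>k\<in>UNIV. C (axis i 1) $ k * B (axis k 1) $ i)"
    if "linear B" "linear C" for B C :: "real^'n \<Rightarrow> real^'n"
    unfolding trc_def by (subst linear_axis_expand[OF that(1)]) simp
  show ?thesis
    unfolding 1[OF assms] 1[OF assms(2,1)]
    by (rule trans[OF sum.swap]) (intro sum.cong refl mult.commute)
qed

context chart_metric begin

lemma partial_christoffel:
  assumes x: "x \<in> U"
  shows "partial i (christoffel G l j k) x = d\<Gamma> x (axis i 1) (axis j 1) (axis k 1) $ l"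
proof -
  have eq: "christoffel G l j k = (\<lambda>y. \<Gamma> y (axis j 1) (axis k 1) $ l)"
    by (simp add: chrB_axis)
  have "partial i (christoffel G l j k) x = bderiv (christoffel G l j k) x (axis i 1)"
    by (rule partial_eq_bderiv[OF smooth_christoffel x])
  also have "\<dots> = d\<Gamma> x (axis i 1) (axis j 1) (axis k 1) $ l"
    unfolding eq
    by (rule bderiv_linear(1)[OF open_U smooth_\<Gamma> x bounded_linear_compose[OF bounded_linear_vec_nth bounded_linear_eval2]])
  finally show ?thesis .
qed

lemma linear_riem:
  "linear (\<lambda>u. riem x u Y Z)" "linear (\<lambda>u. riem x X u Z)" "linear (riem x X Y)"
  by (auto simp: linear_iff riem_def blinfun.bilinear_simps algebra_simps)

lemma riemann_nth:
  assumes x: "x \<in> U"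
  shows "riemann G l i j k x = riem x (axis i 1) (axis j 1) (axis k 1) $ l"
proof -
  have "\<Gamma> x a w $ l = (\<Sum>m\<in>UNIV. w $ m * \<Gamma> x a (axis m 1) $ l)" for a w
    by (subst linear_axis_expand[of "\<Gamma> x a"]) (auto simp: bounded_linear.linear blinfun.bounded_linear_right)
  then show ?thesis
    unfolding riemann_def riem_def
    by (simp add: partial_christoffel x chrB_axis sum_subtractf)
qed

lemma ricci_eq_trc:
  assumes x: "x \<in> U"
  shows "v \<bullet> (ricci G x *v v) = trc (\<lambda>u. riem x u v v)"
proof -
  have "riem x u v v = (\<Sum>j\<in>UNIV. \<Sum>k\<in>UNIV. (v $ j * v $ k) *\<^sub>R riem x u (axis j 1) (axis k 1))" for u
  proof -
    have "riem x u v v = (\<Sum>j\<in>UNIV. v $ j *\<^sub>R riem x u (axis j 1) v)"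
      by (rule linear_axis_expand[OF linear_riem(2)])
    also have "\<dots> = (\<Sum>j\<in>UNIV. v $ j *\<^sub>R (\<Sum>k\<in>UNIV. v $ k *\<^sub>R riem x u (axis j 1) (axis k 1)))"
      by (intro sum.cong refl arg_cong2[of _ _ _ _ scaleR] linear_axis_expand[OF linear_riem(3)])
    finally show ?thesis by (simp add: scaleR_sum_right)
  qed
  then have "trc (\<lambda>u. riem x u v v) = (\<Sum>i\<in>UNIV. \<Sum>j\<in>UNIV. \<Sum>k\<in>UNIV. v $ j * v $ k * riemann G i i j k x)"
    by (simp add: trc_def riemann_nth[OF x])
  also have "\<dots> = (\<Sum>j\<in>UNIV. \<Sum>k\<in>UNIV. \<Sum>i\<in>UNIV. v $ j * v $ k * riemann G i i j k x)"
    by (subst sum.swap) (intro sum.cong refl sum.swap)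
  also have "\<dots> = v \<bullet> (ricci G x *v v)"
    by (simp add: inner_vec_def matrix_vector_mult_def ricci_def sum_distrib_left mult_ac)
  finally show ?thesis by simp
qed

definition on_frame :: "real^'n \<Rightarrow> ('n \<Rightarrow> real^'n) \<Rightarrow> bool"
  where "on_frame x E \<longleftrightarrow> (\<forall>i j. g x (E i) (E j) = (if i = j then 1 else 0))"

text \<open>Let P have the frame vectors as columns. Orthonormality says that the transpose of P
  times G times P is the identity; a left inverse of a square matrix is also a right inverse, so the
  inverse metric is P times its transpose. Both claims are readings of this.\<close>

lemma frame_expand:
  assumes x: "x \<in> U" and E: "on_frame x E"
  shows "v = (\<Sum>k\<in>UNIV. g x v (E k) *\<^sub>R E k)"
    and "matrix_inv (G x) $ a $ b = (\<Sum>k\<in>UNIV. E k $ a * E k $ b)"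
proof -
  define P :: "real^'n^'n" where "P = (\<chi> a k. E k $ a)"
  have "(transpose P ** G x ** P) $ i $ j = E i \<bullet> (G x *v E j)" for i j
    unfolding matrix_mul_assoc[symmetric]
    by (simp add: matrix_matrix_mult_def matrix_vector_mult_def P_def transpose_def inner_vec_def)
  then have "transpose P ** G x ** P = mat 1"
    using E by (simp add: vec_eq_iff mat_def on_frame_def gB_apply)
  then have PG: "P ** (transpose P ** G x) = mat 1"
    using matrix_left_right_inverse by blast
  have "P ** transpose P ** (G x ** matrix_inv (G x)) = matrix_inv (G x)"
    using PG by (simp add: matrix_mul_assoc)
  then have inv: "matrix_inv (G x) = P ** transpose P"
    by (simp add: matrix_inv_G x)
  then show "matrix_inv (G x) $ a $ b = (\<Sum>k\<in>UNIV. E k $ a * E k $ b)"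
    by (simp add: matrix_matrix_mult_def P_def transpose_def)
  have "v = P *v (transpose P *v (G x *v v))"
    using PG by (simp add: matrix_vector_mul_assoc)
  moreover have "(transpose P *v (G x *v v)) $ k = g x v (E k)" for k
    unfolding g_sym[OF x, of v] by (simp add: gB_apply matrix_vector_mult_def P_def transpose_def inner_vec_def)
  then have "transpose P *v (G x *v v) = (\<chi> k. g x v (E k))"
    by (simp add: vec_eq_iff)
  ultimately have "v = P *v (\<chi> k. g x v (E k))" by metis
  also have "\<dots> = (\<Sum>k\<in>UNIV. g x v (E k) *\<^sub>R E k)"
    by (simp add: vec_eq_iff matrix_vector_mult_def P_def mult.commute)
  finally show "v = (\<Sum>k\<in>UNIV. g x v (E k) *\<^sub>R E k)" .
qed

lemma frame_trc:
  assumes x: "x \<in> U" and E: "on_frame x E" and L: "linear L"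
  shows "trc L = (\<Sum>k\<in>UNIV. g x (L (E k)) (E k))"
proof -
  have "trc L = (\<Sum>i\<in>UNIV. \<Sum>k\<in>UNIV. g x (L (axis i 1)) (E k) * E k $ i)"
    unfolding trc_def by (intro sum.cong refl, subst frame_expand(1)[OF x E]) simp
  also have "\<dots> = (\<Sum>k\<in>UNIV. \<Sum>i\<in>UNIV. E k $ i *\<^sub>R g x (L (axis i 1)) (E k))"
    by (subst sum.swap) (simp add: mult.commute)
  also have "\<dots> = (\<Sum>k\<in>UNIV. g x (L (E k)) (E k))"
  proof (intro sum.cong refl)
    fix k
    have "linear (\<lambda>v. g x (L v) (E k))"
      using L by (auto simp: linear_iff blinfun.bilinear_simps)
    from linear_axis_expand[OF this, of "E k"]
    show "(\<Sum>i\<in>UNIV. E k $ i *\<^sub>R g x (L (axis i 1)) (E k)) = g x (L (E k)) (E k)" by simp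
  qed
  finally show ?thesis .
qed

lemma frame_norm2:
  assumes x: "x \<in> U" and E: "on_frame x E"
  shows "g x u v = (\<Sum>k\<in>UNIV. g x u (E k) * g x v (E k))"
proof -
  have "g x u v = g x u (\<Sum>k\<in>UNIV. g x v (E k) *\<^sub>R E k)"
    using frame_expand(1)[OF x E, of v] by simp
  then show ?thesis
    by (simp add: blinfun.bilinear_simps blinfun.sum_right mult.commute)
qed

text \<open>Gram-Schmidt: while an orthonormal set has fewer than \<open>CARD('n)\<close> elements
  its span is proper, and the normalized orthogonal remainder of a vector outside the span extends
  it.\<close>

lemma frame_exists:
  assumes x: "x \<in> U"
  shows "\<exists>E. on_frame x E"
proof -
  have basis: "\<exists>B. finite B \<and> card B = k \<and> (\<forall>a\<in>B. \<forall>b\<in>B. g x a b = (if a = b then 1 else 0))" if "k \<le> CARD('n)" for k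
    using that
  proof (induction k)
    case 0
    show ?case by (intro exI[of _ "{}"]) simp
  next
    case (Suc k)
    then obtain B where B: "finite B" "card B = k" "\<And>a b. a \<in> B \<Longrightarrow> b \<in> B \<Longrightarrow> g x a b = (if a = b then 1 else 0)"
      by auto
    have "dim (span B) \<le> k" using dim_le_card'[OF B(1)] B(2) by simp
    then have "span B \<noteq> UNIV" using Suc.prems by (metis DIM_cart DIM_real dim_UNIV mult.right_neutral not_less_eq_eq)
    then obtain v where v: "v \<notin> span B" by auto
    define v' where "v' = v - (\<Sum>b\<in>B. g x v b *\<^sub>R b)"
    have "v' \<noteq> 0"
    proof
      assume "v' = 0"
      then have "v = (\<Sum>b\<in>B. g x v b *\<^sub>R b)" by (simp add: v'_def)
      moreover have "(\<Sum>b\<in>B. g x v b *\<^sub>R b) \<in> span B"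
        by (intro span_sum span_scale span_base)
      ultimately show False using v by simp
    qed
    then have pos: "g x v' v' > 0" by (rule g_pos[OF x])
    have orth: "g x v' b = 0" if "b \<in> B" for b
    proof -
      have "(\<Sum>c\<in>B. g x v c * g x c b) = (\<Sum>c\<in>B. if c = b then g x v c else 0)"
        by (rule sum.cong) (auto simp: B(3) that)
      then show ?thesis
        by (simp add: v'_def blinfun.bilinear_simps blinfun.sum_left B(1) that)
    qed
    define u where "u = (1 / sqrt (g x v' v')) *\<^sub>R v'"
    have uu: "g x u u = 1"
      using pos by (simp add: u_def blinfun.bilinear_simps)
    have ub: "g x u b = 0" "g x b u = 0" if "b \<in> B" for b
      using orth[OF that] by (simp_all add: u_def blinfun.bilinear_simps g_sym[OF x, of b])
    have "u \<notin> B" using uu ub by fastforce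
    then show ?case
      using B ub uu by (intro exI[of _ "insert u B"]) auto
  qed
  from basis[OF order_refl] obtain B where B: "finite B" "card B = CARD('n)"
    "\<forall>a\<in>B. \<forall>b\<in>B. g x a b = (if a = b then 1 else 0)"
    by auto
  obtain E where E: "bij_betw E (UNIV :: 'n set) B"
    using finite_same_card_bij[of "UNIV :: 'n set" B] B by auto
  have "E i \<in> B" for i using E by (auto simp: bij_betw_def)
  moreover have "E i = E j \<longleftrightarrow> i = j" for i j using E by (auto simp: bij_betw_def inj_eq)
  ultimately have "on_frame x E"
    using B(3) by (simp add: on_frame_def)
  then show ?thesis by blast
qed

text \<open>The covariant Hessian as a bilinear form on coordinate vectors.\<close>

definition hs :: "(real^'n \<Rightarrow> real) \<Rightarrow> real^'n \<Rightarrow> real^'n \<Rightarrow> real^'n \<Rightarrow> real"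
  where "hs F x u v = bderiv (bderiv F) x u v - bderiv F x (\<Gamma> x u v)"

lemma bilinear_hs: "bilinear (hs F x)"
  by (auto simp: bilinear_def linear_iff hs_def blinfun.bilinear_simps algebra_simps)

lemma hs_sym: "smooth_on U F \<Longrightarrow> x \<in> U \<Longrightarrow> hs F x u v = hs F x v u"
  unfolding hs_def using bderiv2_symmetric[OF open_U] \<Gamma>_sym by metis

lemma hessian_nth:
  assumes F: "smooth_on U F" and x: "x \<in> U"
  shows "hessian G F x $ i $ j = hs F x (axis i 1) (axis j 1)"
proof -
  have "bderiv F x (\<Gamma> x (axis i 1) (axis j 1)) = (\<Sum>k\<in>UNIV. christoffel G k i j x * partial k F x)"
    by (subst linear_axis_expand[OF bounded_linear.linear[OF blinfun.bounded_linear_right]])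
      (simp add: chrB_axis partial_eq_bderiv[OF F x])
  moreover have "partial i (partial j F) x = bderiv (bderiv F) x (axis i 1) (axis j 1)"
    unfolding partial_def bderiv_bderiv_frechet[OF open_U F x] ..
  ultimately show ?thesis by (simp add: hessian_def hs_def)
qed

lemma bilinear_axis_expand:
  fixes B :: "real^'n \<Rightarrow> real^'n \<Rightarrow> real"
  assumes "bilinear B"
  shows "B u v = (\<Sum>i\<in>UNIV. \<Sum>j\<in>UNIV. u $ i * v $ j * B (axis i 1) (axis j 1))"
proof -
  have l: "linear (\<lambda>u. B u v)" "linear (B u)" for u v
    using assms by (simp_all add: bilinear_def)
  have "B u v = (\<Sum>i\<in>UNIV. u $ i *\<^sub>R B (axis i 1) v)"
    by (rule linear_axis_expand[OF l(1)])
  also have "\<dots> = (\<Sum>i\<in>UNIV. u $ i *\<^sub>R (\<Sum>j\<in>UNIV. v $ j *\<^sub>R B (axis i 1) (axis j 1)))"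
    by (intro sum.cong refl arg_cong2[of _ _ _ _ scaleR] linear_axis_expand[OF l(2)])
  finally show ?thesis by (simp add: sum_distrib_left mult.assoc)
qed

lemma hessian_eq_hs:
  assumes F: "smooth_on U F" and x: "x \<in> U"
  shows "u \<bullet> (hessian G F x *v v) = hs F x u v"
  by (subst bilinear_axis_expand[OF bilinear_hs])
    (simp add: hessian_nth[OF F x, symmetric] inner_vec_def matrix_vector_mult_def sum_distrib_left mult_ac)

text \<open>The inverse metric in \<open>laplacian\<close> is the sum of the products of frame
  components, which turns the double sum into a trace over the frame.\<close>

lemma laplacian_frame:
  assumes F: "smooth_on U F" and x: "x \<in> U" and E: "on_frame x E"
  shows "laplacian G F x = (\<Sum>k\<in>UNIV. hs F x (E k) (E k))"
proof -
  have "(\<Sum>k\<in>UNIV. hs F x (E k) (E k)) = (\<Sum>k\<in>UNIV. \<Sum>i\<in>UNIV. \<Sum>j\<in>UNIV. E k $ i * E k $ j * hs F x (axis i 1) (axis j 1))"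
    by (intro sum.cong refl bilinear_axis_expand[OF bilinear_hs])
  also have "\<dots> = (\<Sum>i\<in>UNIV. \<Sum>j\<in>UNIV. \<Sum>k\<in>UNIV. E k $ i * E k $ j * hs F x (axis i 1) (axis j 1))"
    by (subst sum.swap) (intro sum.cong refl sum.swap)
  finally show ?thesis
    by (simp add: laplacian_def hessian_nth[OF F x] frame_expand(2)[OF x E] sum_distrib_right)
qed

end

section \<open>Bochner inequality\<close>

locale chart_function = chart_metric +
  fixes F :: "real^'a::finite \<Rightarrow> real"
  assumes smooth_F: "smooth_on U F"
begin

abbreviation "X \<equiv> gradient G F"
abbreviation "dX \<equiv> bderiv (gradient G F)"
abbreviation "ddX \<equiv> bderiv (bderiv (gradient G F))"

definition w :: "real^'a \<Rightarrow> real" where "w x = bderiv F x (X x)"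

text \<open>The covariant derivative of the gradient field along u; \<open>nY\<close> is the same
  for the field \<open>Y\<close>.\<close>

definition nX :: "real^'a \<Rightarrow> real^'a \<Rightarrow> real^'a" where "nX x u = dX x u + \<Gamma> x u (X x)"

text \<open>The covariant derivative of the gradient field along itself, which is half of the
  gradient of w.\<close>

definition Y :: "real^'a \<Rightarrow> real^'a" where "Y x = dX x (X x) + \<Gamma> x (X x) (X x)"

lemma smooth_X: "smooth_on U X"
proof (rule smooth_on_vec[OF open_U])
  fix k
  have "smooth_on U (\<lambda>x. \<Sum>j\<in>UNIV. matrix_inv (G x) $ k $ j * partial j F x)"
    unfolding partial_def
    by (intro smooth_on_sum smooth_on_mult smooth_on_matrix_inv open_U smooth_G_nth invertible_G smooth_on_frechet smooth_F)
  then show "smooth_on U (\<lambda>x. X x $ k)"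
    by (simp add: gradient_def matrix_vector_mult_def)
qed

lemma g_X: assumes x: "x \<in> U" shows "g x (X x) v = bderiv F x v"
proof -
  have "G x *v X x = (\<chi> i. partial i F x)"
    by (simp add: gradient_def matrix_vector_mul_assoc matrix_inv_G x)
  then have "g x v (X x) = (\<Sum>i\<in>UNIV. v $ i *\<^sub>R bderiv F x (axis i 1))"
    by (simp add: gB_apply inner_vec_def partial_eq_bderiv[OF smooth_F x])
  also have "\<dots> = bderiv F x v"
    by (rule linear_axis_expand[symmetric]) (simp add: bounded_linear.linear blinfun.bounded_linear_right)
  finally show ?thesis by (simp add: g_sym[OF x, of "X x"])
qed

lemma w_eq: "x \<in> U \<Longrightarrow> w x = g x (X x) (X x)"
  by (simp add: w_def g_X)

lemma X_works: "x \<in> U \<Longrightarrow> (X has_derivative dX x) (at x)"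
  by (rule bderiv_works[OF smooth_X])

lemma smooth_w: "smooth_on U w"
  unfolding w_def
  by (intro smooth_on_bilinear[OF open_U bounded_bilinear_blinfun_apply] smooth_on_bderiv open_U smooth_F smooth_X)

lemma smooth_Y: "smooth_on U Y"
  unfolding Y_def
  by (intro smooth_on_add smooth_on_bilinear[OF open_U bounded_bilinear_blinfun_apply] smooth_on_bderiv
      open_U smooth_X smooth_\<Gamma>)

text \<open>Differentiate g(X, v) = dF(v) for constant v and insert metric compatibility.\<close>

lemma g_nX: assumes x: "x \<in> U" shows "g x (nX x u) v = hs F x u v"
proof -
  have "((\<lambda>y. g y (X y) v) has_derivative (\<lambda>u. dg x u (X x) v + g x (dX x u) v + g x (X x) 0)) (at x)"
    by (intro has_derivative_blinfun2 dg_works X_works x has_derivative_const)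
  then have "((\<lambda>y. bderiv F y v) has_derivative (\<lambda>u. dg x u (X x) v + g x (dX x u) v + g x (X x) 0)) (at x)"
    by (subst has_derivative_cong_open[OF open_U x]) (auto simp: g_X)
  moreover have "((\<lambda>y. bderiv F y v) has_derivative (\<lambda>u. bderiv (bderiv F) x u v)) (at x)"
    by (rule bounded_linear.has_derivative[OF blinfun.bounded_linear_left bderiv_works[OF smooth_on_bderiv[OF open_U smooth_F] x]])
  ultimately have "(\<lambda>u. dg x u (X x) v + g x (dX x u) v + g x (X x) 0) = (\<lambda>u. bderiv (bderiv F) x u v)"
    by (rule has_derivative_unique)
  then have "dg x u (X x) v + g x (dX x u) v + g x (X x) 0 = bderiv (bderiv F) x u v"
    by meson
  then show ?thesis
    by (simp add: hs_def nX_def compat[OF x] blinfun.bilinear_simps flip: g_X[OF x])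
qed

lemma nX_X: "nX x (X x) = Y x"
  by (simp add: nX_def Y_def)

lemma g_nX_sym: "x \<in> U \<Longrightarrow> g x (nX x u) v = g x (nX x v) u"
  by (simp add: g_nX hs_sym[OF smooth_F])

text \<open>By compatibility dw(u) is twice g(\<nabla>X(u), X), and the symmetry of the Hessian
  exchanges u and X.\<close>

lemma bderiv_w: assumes x: "x \<in> U" shows "bderiv w x u = 2 * g x (Y x) u"
proof -
  have "((\<lambda>y. g y (X y) (X y)) has_derivative (\<lambda>u. dg x u (X x) (X x) + g x (dX x u) (X x) + g x (X x) (dX x u))) (at x)"
    by (intro has_derivative_blinfun2 dg_works X_works x)
  then have "(w has_derivative (\<lambda>u. dg x u (X x) (X x) + g x (dX x u) (X x) + g x (X x) (dX x u))) (at x)"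
    by (subst has_derivative_cong_open[OF open_U x]) (auto simp: w_eq)
  from bderiv_eqI[OF smooth_w x this]
  have "bderiv w x u = 2 * g x (nX x u) (X x)"
    by (simp add: compat[OF x] nX_def g_sym[OF x, of "X x"] blinfun.bilinear_simps)
  then show ?thesis
    by (simp add: g_nX_sym[OF x, of u] nX_X)
qed

definition nY :: "real^'a \<Rightarrow> real^'a \<Rightarrow> real^'a" where "nY x u = bderiv Y x u + \<Gamma> x u (Y x)"

lemma hs_w: assumes x: "x \<in> U" shows "hs w x u v = 2 * g x (nY x u) v"
proof -
  have "((\<lambda>y. g y (Y y) v) has_derivative (\<lambda>u. dg x u (Y x) v + g x (bderiv Y x u) v + g x (Y x) 0)) (at x)"
    by (intro has_derivative_blinfun2 dg_works bderiv_works[OF smooth_Y] x has_derivative_const)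
  then have "((\<lambda>y. 2 * g y (Y y) v) has_derivative (\<lambda>u. 2 * (dg x u (Y x) v + g x (bderiv Y x u) v + g x (Y x) 0))) (at x)"
    by (rule has_derivative_mult_right)
  then have "((\<lambda>y. bderiv w y v) has_derivative (\<lambda>u. 2 * (dg x u (Y x) v + g x (bderiv Y x u) v + g x (Y x) 0))) (at x)"
    by (subst has_derivative_cong_open[OF open_U x]) (auto simp: bderiv_w)
  moreover have "((\<lambda>y. bderiv w y v) has_derivative (\<lambda>u. bderiv (bderiv w) x u v)) (at x)"
    by (rule bounded_linear.has_derivative[OF blinfun.bounded_linear_left bderiv_works[OF smooth_on_bderiv[OF open_U smooth_w] x]])
  ultimately have "(\<lambda>u. 2 * (dg x u (Y x) v + g x (bderiv Y x u) v + g x (Y x) 0)) = (\<lambda>u. bderiv (bderiv w) x u v)"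
    by (rule has_derivative_unique)
  then have "2 * (dg x u (Y x) v + g x (bderiv Y x u) v + g x (Y x) 0) = bderiv (bderiv w) x u v"
    by meson
  then show ?thesis
    by (simp add: hs_def nY_def compat[OF x] blinfun.bilinear_simps bderiv_w[OF x])
qed

lemma dX_works: "x \<in> U \<Longrightarrow> (dX has_derivative ddX x) (at x)"
  by (rule bderiv_works[OF smooth_on_bderiv[OF open_U smooth_X]])

lemma bderiv_Y: assumes x: "x \<in> U"
  shows "bderiv Y x u = ddX x u (X x) + dX x (dX x u)
    + (d\<Gamma> x u (X x) (X x) + \<Gamma> x (dX x u) (X x) + \<Gamma> x (X x) (dX x u))"
proof -
  have "(Y has_derivative (\<lambda>u. (dX x (dX x u) + ddX x u (X x))
      + (d\<Gamma> x u (X x) (X x) + \<Gamma> x (dX x u) (X x) + \<Gamma> x (X x) (dX x u)))) (at x)"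
    unfolding Y_def
    by (intro has_derivative_add bounded_bilinear.FDERIV[OF bounded_bilinear_blinfun_apply] dX_works X_works x
        has_derivative_blinfun2 d\<Gamma>_works)
  from bderiv_eqI[OF smooth_Y x this] show ?thesis by (simp add: add_ac)
qed

lemma linear_nX: "linear (nX x)" and linear_nY: "linear (nY x)"
  by (auto simp: linear_iff nX_def nY_def blinfun.bilinear_simps algebra_simps)

lemma laplacian_eq_trc: assumes x: "x \<in> U" shows "laplacian G F x = trc (nX x)"
proof -
  obtain E where E: "on_frame x E" using frame_exists[OF x] by blast
  show ?thesis
    by (simp add: laplacian_frame[OF smooth_F x E] frame_trc[OF x E linear_nX] g_nX[OF x])
qed

lemma laplacian_w_eq_trc: assumes x: "x \<in> U" shows "laplacian G w x = 2 * trc (nY x)"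
proof -
  obtain E where E: "on_frame x E" using frame_exists[OF x] by blast
  show ?thesis
    by (simp add: laplacian_frame[OF smooth_w x E] frame_trc[OF x E linear_nY] hs_w[OF x] sum_distrib_left)
qed

text \<open>The derivative along X of the coordinate matrix of \<open>nX\<close>, with u held fixed
  in coordinates. It is not a tensor, but its trace is the derivative of the Laplacian of F in
  direction X.\<close>

definition dnX :: "real^'a \<Rightarrow> real^'a \<Rightarrow> real^'a"
  where "dnX x u = ddX x (X x) u + (d\<Gamma> x (X x) u (X x) + \<Gamma> x u (dX x (X x)))"

lemma laplacian_has_derivative:
  assumes x: "x \<in> U"
  shows "(laplacian G F has_derivative
     (\<lambda>v. \<Sum>i\<in>UNIV. (ddX x v (axis i 1) + (d\<Gamma> x v (axis i 1) (X x) + \<Gamma> x (axis i 1) (dX x v))) $ i)) (at x)"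
proof -
  have "((\<lambda>y. nX y a) has_derivative (\<lambda>v. ddX x v a + (d\<Gamma> x v a (X x) + \<Gamma> x 0 (X x) + \<Gamma> x a (dX x v)))) (at x)" for a
    unfolding nX_def
    by (intro has_derivative_add bounded_linear.has_derivative[OF blinfun.bounded_linear_left]
        has_derivative_blinfun2 dX_works X_works d\<Gamma>_works x has_derivative_const)
  then have "((\<lambda>y. \<Sum>i\<in>UNIV. nX y (axis i 1) $ i) has_derivative
      (\<lambda>v. \<Sum>i\<in>UNIV. (ddX x v (axis i 1) + (d\<Gamma> x v (axis i 1) (X x) + \<Gamma> x 0 (X x) + \<Gamma> x (axis i 1) (dX x v))) $ i)) (at x)"
    by (intro has_derivative_sum bounded_linear.has_derivative[OF bounded_linear_vec_nth])
  then show ?thesis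
    by (subst has_derivative_cong_open[OF open_U x]) (auto simp: laplacian_eq_trc trc_def blinfun.bilinear_simps)
qed

text \<open>Bochner's formula: the divergence of \<nabla>X(X) is tr((\<nabla>X)^2) + X(\<Delta>F) +
  Ric(X, X). Pointwise the two sides differ by the two compositions of \<open>dX\<close> with
  \<Gamma>(-, X), whose traces agree; the remaining terms match by symmetry of \<Gamma> and of the
  second derivative of X.\<close>

lemma trc_nY:
  assumes x: "x \<in> U"
  shows "trc (nY x) = trc (\<lambda>u. nX x (nX x u)) + trc (dnX x) + trc (\<lambda>u. riem x u (X x) (X x))"
proof -
  let ?B = "\<lambda>u. \<Gamma> x u (X x)"
  have "nY x u + dX x (?B u) = ((nX x (nX x u) + dnX x u) + riem x u (X x) (X x)) + ?B (dX x u)" for u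
    unfolding nY_def bderiv_Y[OF x] nX_def dnX_def riem_def Y_def
    using bderiv2_symmetric[OF open_U smooth_X x, of u "X x"] \<Gamma>_sym[OF x, of "X x" "dX x u"]
      \<Gamma>_sym[OF x, of "X x" "\<Gamma> x u (X x)"]
    by (simp add: blinfun.bilinear_simps algebra_simps)
  then have "trc (\<lambda>u. nY x u + dX x (?B u)) = trc (\<lambda>u. ((nX x (nX x u) + dnX x u) + riem x u (X x) (X x)) + ?B (dX x u))"
    by simp
  moreover have "trc (\<lambda>u. dX x (?B u)) = trc (\<lambda>u. ?B (dX x u))"
    by (rule trc_commute) (auto simp: linear_iff blinfun.bilinear_simps)
  ultimately show ?thesis
    by (simp add: trc_add)
qed

text \<open>Bochner's formula contributes \<open>dw(X)\<close> through \<open>\<langle>X, \<nabla>\<Delta>F\<rangle>\<close>, and half of it is lost to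
  \<open>Ric(X, X) \<ge> - Hess F(X, X) = - dw(X) / 2\<close>.\<close>

lemma bochner:
  assumes x: "x \<in> U"
    and eq: "\<And>y. y \<in> U \<Longrightarrow> f_laplacian G F F y = c1 * exp (c2 * F y)"
    and c: "c1 \<ge> 0" "c2 \<ge> 0"
    and ric: "\<And>v. v \<bullet> (ricci G x *v v) + hs F x v v \<ge> 0"
  shows "laplacian G w x \<ge> 2 / real CARD('a) * (w x)\<^sup>2 + bderiv w x (X x)"
proof -
  \<comment> \<open>The drift term of the f-Laplacian of F itself is the squared norm of its
    gradient.\<close>
  have lap: "laplacian G F y = w y + c1 * exp (c2 * F y)" if "y \<in> U" for y
    using eq[OF that] w_eq[OF that] by (simp add: f_laplacian_def gB_apply)
  have "((\<lambda>y. w y + c1 * exp (c2 * F y)) has_derivative (\<lambda>v. bderiv w x v + c1 * (exp (c2 * F x) * (c2 * bderiv F x v)))) (at x)"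
    by (auto intro!: derivative_eq_intros bderiv_works[OF smooth_w x] bderiv_works[OF smooth_F x] simp: mult_ac)
  then have 1: "(laplacian G F has_derivative (\<lambda>v. bderiv w x v + c1 * (exp (c2 * F x) * (c2 * bderiv F x v)))) (at x)"
    by (subst has_derivative_cong_open[OF open_U x]) (auto simp: lap)
  have "trc (dnX x) = bderiv w x (X x) + c1 * (exp (c2 * F x) * (c2 * bderiv F x (X x)))"
    using fun_cong[OF has_derivative_unique[OF laplacian_has_derivative[OF x] 1], of "X x"]
    by (simp add: trc_def dnX_def)
  \<comment> \<open>The signs of both constants enter here, together with dF(X) = w \<ge> 0.\<close>
  moreover have "c1 * (exp (c2 * F x) * (c2 * bderiv F x (X x))) \<ge> 0"
    using c g_nonneg[OF x, of "X x"] by (simp add: w_eq[OF x, unfolded w_def])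
  ultimately have dn: "trc (dnX x) \<ge> bderiv w x (X x)" by linarith
  have ricX: "trc (\<lambda>u. riem x u (X x) (X x)) \<ge> - (bderiv w x (X x) / 2)"
    using ric[of "X x"] by (simp add: ricci_eq_trc[OF x] bderiv_w[OF x] g_nX[OF x, symmetric] nX_X)
  obtain E where E: "on_frame x E" using frame_exists[OF x] by blast
  \<comment> \<open>\<nabla>X is symmetric, so the trace of its square is the sum of the squares of
    its entries. Keeping the diagonal only and applying Cauchy-Schwarz bounds this below by the
    squared Laplacian over the dimension.\<close>
  have "trc (\<lambda>u. nX x (nX x u)) = (\<Sum>k\<in>UNIV. g x (nX x (nX x (E k))) (E k))"
    by (rule frame_trc[OF x E]) (rule linear_compose[OF linear_nX linear_nX, unfolded o_def])
  also have "\<dots> = (\<Sum>k\<in>UNIV. g x (nX x (E k)) (nX x (E k)))"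
    by (intro sum.cong refl g_nX_sym[OF x])
  also have "\<dots> \<ge> (\<Sum>k\<in>UNIV. (g x (nX x (E k)) (E k))\<^sup>2)"
  proof (rule sum_mono)
    fix k
    have "(g x (nX x (E k)) (E k))\<^sup>2 \<le> (\<Sum>j\<in>UNIV. (g x (nX x (E k)) (E j))\<^sup>2)"
      by (rule member_le_sum[of k UNIV "\<lambda>j. (g x (nX x (E k)) (E j))\<^sup>2"]) auto
    then show "(g x (nX x (E k)) (E k))\<^sup>2 \<le> g x (nX x (E k)) (nX x (E k))"
      by (subst frame_norm2[OF x E]) (simp add: power2_eq_square)
  qed
  finally have A: "real CARD('a) * (\<Sum>k\<in>UNIV. (g x (nX x (E k)) (E k))\<^sup>2) \<le> real CARD('a) * trc (\<lambda>u. nX x (nX x u))"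
    by (rule mult_left_mono) simp
  have B: "(\<Sum>k\<in>UNIV. g x (nX x (E k)) (E k))\<^sup>2 \<le> real CARD('a) * (\<Sum>k\<in>UNIV. (g x (nX x (E k)) (E k))\<^sup>2)"
    using sum_squared_le_sum_of_squares[of "\<lambda>k. g x (nX x (E k)) (E k)" "UNIV :: 'a set"] by (simp add: mult.commute)
  have C: "(\<Sum>k\<in>UNIV. g x (nX x (E k)) (E k)) = laplacian G F x"
    by (simp add: laplacian_eq_trc[OF x] frame_trc[OF x E linear_nX])
  have "(laplacian G F x)\<^sup>2 \<le> real CARD('a) * trc (\<lambda>u. nX x (nX x u))"
    using order_trans[OF B A] unfolding C .
  then have sq: "(laplacian G F x)\<^sup>2 / real CARD('a) \<le> trc (\<lambda>u. nX x (nX x u))"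
    by (simp add: divide_le_eq mult.commute)
  \<comment> \<open>The Laplacian may be replaced by w under the square because it is at least w and
    w is nonnegative.\<close>
  have "0 \<le> w x" by (simp add: w_eq[OF x] g_nonneg[OF x])
  moreover have "w x \<le> laplacian G F x" using c by (simp add: lap[OF x])
  ultimately have "(w x)\<^sup>2 / real CARD('a) \<le> (laplacian G F x)\<^sup>2 / real CARD('a)"
    by (intro divide_right_mono power_mono) auto
  then show ?thesis
    unfolding laplacian_w_eq_trc[OF x] trc_nY[OF x]
    using sq dn ricX by simp
qed

end

section \<open>Second variation of energy\<close>

lemma norm_diff_le_bound_unit_interval:
  fixes f :: "real \<Rightarrow> 'b::real_normed_vector"
  assumes "\<And>t. 0 \<le> t \<Longrightarrow> t \<le> 1 \<Longrightarrow> (f has_vector_derivative f' t) (at t)"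
    and "\<And>t. 0 \<le> t \<Longrightarrow> t \<le> 1 \<Longrightarrow> norm (f' t) \<le> B" and t: "0 \<le> t" "t \<le> 1"
  shows "norm (f t - f 0) \<le> B"
proof -
  have "norm (f t - f 0) \<le> B * norm (t - 0)"
  proof (rule differentiable_bound[of "{0..1::real}" f "\<lambda>t h. h *\<^sub>R f' t"])
    show "(f has_derivative (\<lambda>h. h *\<^sub>R f' x)) (at x within {0..1})" if "x \<in> {0..1}" for x
      using assms(1)[of x] that by (simp add: has_vector_derivative_def has_derivative_at_withinI)
    show "onorm (\<lambda>h. h *\<^sub>R f' x) \<le> B" if "x \<in> {0..1}" for x
      using assms(2)[of x] that by (simp add: onorm_scaleR_left onorm_id)
  qed (use t in auto)
  also have "\<dots> \<le> B * 1"
    using t assms(2)[of 0] by (intro mult_left_mono) (auto intro: order_trans[OF norm_ge_zero])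
  finally show ?thesis by simp
qed

text \<open>Taylor's formula with a remainder uniform over a compact set of base points. The mean
  value inequality is applied three times along the segment; only the order of the remainder
  matters, so the factor 1/6 is not kept.\<close>

lemma taylor3_bound:
  fixes F :: "'e::euclidean_space \<Rightarrow> 'b::real_normed_vector"
  assumes S: "open S" and F: "smooth_on S F" and K: "compact K" "K \<subseteq> S"
  shows "\<exists>C \<epsilon>. 0 < \<epsilon> \<and> 0 \<le> C \<and> (\<forall>x\<in>K. \<forall>z. norm z \<le> \<epsilon> \<longrightarrow> x + z \<in> S \<and>
    norm (F (x + z) - (F x + bderiv F x z + (1/2) *\<^sub>R bderiv (bderiv F) x z z)) \<le> C * norm z ^ 3)"
proof -
  obtain e where e: "e > 0" "(\<Union>x\<in>K. cball x e) \<subseteq> S"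
    by (metis compact_subset_open_imp_cball_epsilon_subset[OF K(1) S K(2)])
  \<comment> \<open>The compact e-neighbourhood of K, on which the third derivative is
    bounded.\<close>
  let ?K = "(\<lambda>(x, y). x + y) ` (K \<times> cball 0 e)"
  have KS: "?K \<subseteq> S" using e(2) by (force simp: dist_norm)
  have cK: "compact ?K"
    by (intro compact_continuous_image compact_Times K compact_cball)
       (auto simp: case_prod_unfold intro!: continuous_intros)
  have sm1: "smooth_on S (bderiv F)" by (intro smooth_on_bderiv S F)
  have sm2: "smooth_on S (bderiv (bderiv F))" by (intro smooth_on_bderiv S sm1)
  have "smooth_on S (bderiv (bderiv (bderiv F)))" by (intro smooth_on_bderiv S sm2)
  then have "continuous_on ?K (\<lambda>x. bderiv (bderiv (bderiv F)) x)"
    using smooth_on_continuous continuous_on_subset KS by blast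
  then have "bounded ((\<lambda>x. bderiv (bderiv (bderiv F)) x) ` ?K)"
    by (intro compact_imp_bounded compact_continuous_image cK)
  then obtain B where B: "\<And>x. x \<in> ?K \<Longrightarrow> norm (bderiv (bderiv (bderiv F)) x) \<le> B"
    unfolding bounded_iff by blast
  have "x + z \<in> S \<and> norm (F (x + z) - (F x + bderiv F x z + (1/2) *\<^sub>R bderiv (bderiv F) x z z)) \<le> max B 0 * norm z ^ 3"
    if x: "x \<in> K" and z: "norm z \<le> e" for x z
  proof -
    have inK: "x + t *\<^sub>R z \<in> ?K" if "0 \<le> t" "t \<le> 1" for t
    proof -
      have "norm (t *\<^sub>R z) \<le> e"
        using that z mult_mono[of t 1 "norm z" e] e by auto
      then show ?thesis using x by (force simp: image_iff)
    qed
    have inS: "x + t *\<^sub>R z \<in> S" if "0 \<le> t" "t \<le> 1" for t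
      using inK[OF that] KS by blast
    let ?M = "max B 0 * norm z ^ 3"
    have d0: "((\<lambda>t. F (x + t *\<^sub>R z)) has_vector_derivative bderiv F (x + t *\<^sub>R z) z) (at t)"
      and d1: "((\<lambda>t. bderiv F (x + t *\<^sub>R z) z) has_vector_derivative bderiv (bderiv F) (x + t *\<^sub>R z) z z) (at t)"
      and d2: "((\<lambda>t. bderiv (bderiv F) (x + t *\<^sub>R z) z z) has_vector_derivative bderiv (bderiv (bderiv F)) (x + t *\<^sub>R z) z z z) (at t)"
      if "0 \<le> t" "t \<le> 1" for t
    proof -
      show "((\<lambda>t. F (x + t *\<^sub>R z)) has_vector_derivative bderiv F (x + t *\<^sub>R z) z) (at t)"
        by (rule smooth_on_along_line[OF F inS[OF that]])
      show "((\<lambda>t. bderiv F (x + t *\<^sub>R z) z) has_vector_derivative bderiv (bderiv F) (x + t *\<^sub>R z) z z) (at t)"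
        by (intro bounded_linear.has_vector_derivative[OF blinfun.bounded_linear_left] smooth_on_along_line[OF sm1 inS[OF that]])
      show "((\<lambda>t. bderiv (bderiv F) (x + t *\<^sub>R z) z z) has_vector_derivative bderiv (bderiv (bderiv F)) (x + t *\<^sub>R z) z z z) (at t)"
        by (intro bounded_linear.has_vector_derivative[OF blinfun.bounded_linear_left] smooth_on_along_line[OF sm2 inS[OF that]])
    qed
    have b3: "norm (bderiv (bderiv (bderiv F)) (x + t *\<^sub>R z) z z z) \<le> ?M" if "0 \<le> t" "t \<le> 1" for t
    proof -
      let ?D = "bderiv (bderiv (bderiv F)) (x + t *\<^sub>R z)"
      have "norm (?D z z z) \<le> norm (?D z z) * norm z" by (rule norm_blinfun)
      also have "\<dots> \<le> (norm (?D z) * norm z) * norm z" by (intro mult_right_mono norm_blinfun) simp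
      also have "\<dots> \<le> ((norm ?D * norm z) * norm z) * norm z" by (intro mult_right_mono norm_blinfun) simp_all
      also have "\<dots> = norm ?D * norm z ^ 3"
        by (simp add: power3_eq_cube mult.assoc)
      also have "\<dots> \<le> ?M"
        using B[OF inK[OF that]] by (intro mult_right_mono) auto
      finally show ?thesis .
    qed
    \<comment> \<open>The derivative of \<open>?h0\<close> is the increment of \<open>?h1\<close>
      from 0, and that of \<open>?h1\<close> is the increment of \<open>?h2\<close>; so the bound
      \<open>?M\<close> passes from the third derivative up to the Taylor remainder.\<close>
    let ?h2 = "\<lambda>t. bderiv (bderiv F) (x + t *\<^sub>R z) z z"
    let ?h1 = "\<lambda>t. bderiv F (x + t *\<^sub>R z) z - t *\<^sub>R ?h2 0"
    let ?h0 = "\<lambda>t. F (x + t *\<^sub>R z) - t *\<^sub>R bderiv F x z - (t\<^sup>2 / 2) *\<^sub>R ?h2 0"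
    have h2: "norm (?h2 t - ?h2 0) \<le> ?M" if "0 \<le> t" "t \<le> 1" for t
      by (rule norm_diff_le_bound_unit_interval[OF d2 b3 that])
    have h1: "norm (?h1 t - ?h1 0) \<le> ?M" if "0 \<le> t" "t \<le> 1" for t
    proof (rule norm_diff_le_bound_unit_interval[OF _ h2 that])
      fix s :: real assume "0 \<le> s" "s \<le> 1"
      from d1[OF this] show "(?h1 has_vector_derivative ?h2 s - ?h2 0) (at s)"
        by (auto intro!: derivative_eq_intros)
    qed
    have "norm (?h0 1 - ?h0 0) \<le> ?M"
    proof (rule norm_diff_le_bound_unit_interval[OF _ h1])
      fix s :: real assume "0 \<le> s" "s \<le> 1"
      from d0[OF this] show "(?h0 has_vector_derivative ?h1 s - ?h1 0) (at s)"
        by (auto intro!: derivative_eq_intros)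
    qed auto
    moreover have eq: "?h0 1 - ?h0 0 = F (x + z) - (F x + bderiv F x z + (1/2) *\<^sub>R bderiv (bderiv F) x z z)"
      by (simp add: algebra_simps)
    ultimately show ?thesis using inS[of 1] unfolding eq by simp
  qed
  then show ?thesis using e(1) by (intro exI[of _ "max B 0"] exI[of _ e]) auto
qed

text \<open>Expansions with a cubic remainder, uniform in the parameter, survive integration over it and changes
  of coordinates, while no regularity of the curves \<open>\<phi> t\<close> is needed.\<close>

definition jet :: "'t set \<Rightarrow> ('t \<Rightarrow> real \<Rightarrow> 'b::real_normed_vector) \<Rightarrow> ('t \<Rightarrow> 'b) \<Rightarrow> ('t \<Rightarrow> 'b) \<Rightarrow> ('t \<Rightarrow> 'b) \<Rightarrow> bool"
  where "jet S \<phi> a b c \<longleftrightarrow> (\<exists>C e. e > 0 \<and> (\<forall>t\<in>S. norm (a t) \<le> C \<and> norm (b t) \<le> C \<and> norm (c t) \<le> C \<and>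
    (\<forall>s. \<bar>s\<bar> \<le> e \<longrightarrow> norm (\<phi> t s - (a t + s *\<^sub>R b t + (s\<^sup>2 / 2) *\<^sub>R c t)) \<le> C * \<bar>s\<bar> ^ 3)))"

text \<open>Also provides the truncations at lower order. The normalization C \<ge> 1 and e \<le> 1
  lets a lower power of |s| dominate a higher one.\<close>

lemma jetE:
  assumes "jet S \<phi> a b c"
  obtains C e where "0 < e" "e \<le> 1" "1 \<le> C"
    "\<And>t. t \<in> S \<Longrightarrow> norm (a t) \<le> C" "\<And>t. t \<in> S \<Longrightarrow> norm (b t) \<le> C" "\<And>t. t \<in> S \<Longrightarrow> norm (c t) \<le> C"
    "\<And>t s. t \<in> S \<Longrightarrow> \<bar>s\<bar> \<le> e \<Longrightarrow> norm (\<phi> t s - (a t + s *\<^sub>R b t + (s\<^sup>2 / 2) *\<^sub>R c t)) \<le> C * \<bar>s\<bar> ^ 3"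
    "\<And>t s. t \<in> S \<Longrightarrow> \<bar>s\<bar> \<le> e \<Longrightarrow> norm (\<phi> t s - (a t + s *\<^sub>R b t)) \<le> 2 * C * \<bar>s\<bar> ^ 2"
    "\<And>t s. t \<in> S \<Longrightarrow> \<bar>s\<bar> \<le> e \<Longrightarrow> norm (\<phi> t s - a t) \<le> 3 * C * \<bar>s\<bar>"
    "\<And>t s. t \<in> S \<Longrightarrow> \<bar>s\<bar> \<le> e \<Longrightarrow> norm (\<phi> t s) \<le> 4 * C"
proof -
  obtain C0 e0 where C0: "e0 > 0" "\<And>t. t \<in> S \<Longrightarrow> norm (a t) \<le> C0 \<and> norm (b t) \<le> C0 \<and> norm (c t) \<le> C0"
    "\<And>t s. t \<in> S \<Longrightarrow> \<bar>s\<bar> \<le> e0 \<Longrightarrow> norm (\<phi> t s - (a t + s *\<^sub>R b t + (s\<^sup>2 / 2) *\<^sub>R c t)) \<le> C0 * \<bar>s\<bar> ^ 3"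
    using assms unfolding jet_def by metis
  define C e where "C = max C0 1" and "e = min e0 1"
  have 1: "norm (a t) \<le> C" "norm (b t) \<le> C" "norm (c t) \<le> C" if "t \<in> S" for t
    using C0(2)[OF that] by (auto simp: C_def)
  have 2: "norm (\<phi> t s - (a t + s *\<^sub>R b t + (s\<^sup>2 / 2) *\<^sub>R c t)) \<le> C * \<bar>s\<bar> ^ 3" if "t \<in> S" "\<bar>s\<bar> \<le> e" for t s
  proof -
    have "C0 * \<bar>s\<bar> ^ 3 \<le> C * \<bar>s\<bar> ^ 3" by (intro mult_right_mono) (auto simp: C_def)
    then show ?thesis using C0(3)[OF that(1), of s] that by (auto simp: e_def)
  qed
  have 3: "norm (\<phi> t s - (a t + s *\<^sub>R b t)) \<le> 2 * C * \<bar>s\<bar> ^ 2" if t: "t \<in> S" "\<bar>s\<bar> \<le> e" for t s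
  proof -
    have "\<phi> t s - (a t + s *\<^sub>R b t) = (\<phi> t s - (a t + s *\<^sub>R b t + (s\<^sup>2 / 2) *\<^sub>R c t)) + (s\<^sup>2 / 2) *\<^sub>R c t"
      by simp
    then have "norm (\<phi> t s - (a t + s *\<^sub>R b t)) \<le> norm (\<phi> t s - (a t + s *\<^sub>R b t + (s\<^sup>2 / 2) *\<^sub>R c t)) + norm ((s\<^sup>2 / 2) *\<^sub>R c t)"
      by (metis norm_triangle_ineq)
    also have "\<dots> \<le> C * \<bar>s\<bar> ^ 3 + s\<^sup>2 / 2 * C"
      using 2[OF t] 1(3)[OF t(1)] by (intro add_mono) (auto intro!: mult_left_mono)
    also have "C * \<bar>s\<bar> ^ 3 \<le> C * \<bar>s\<bar> ^ 2"
      using t(2) by (intro mult_left_mono power_decreasing) (auto simp: C_def e_def)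
    finally have "norm (\<phi> t s - (a t + s *\<^sub>R b t)) \<le> C * \<bar>s\<bar>\<^sup>2 + s\<^sup>2 / 2 * C" by simp
    moreover have "s\<^sup>2 / 2 * C \<le> C * \<bar>s\<bar>\<^sup>2" by (simp add: C_def)
    ultimately show ?thesis by linarith
  qed
  have 4: "norm (\<phi> t s - a t) \<le> 3 * C * \<bar>s\<bar>" if t: "t \<in> S" "\<bar>s\<bar> \<le> e" for t s
  proof -
    have "\<phi> t s - a t = (\<phi> t s - (a t + s *\<^sub>R b t)) + s *\<^sub>R b t" by simp
    then have "norm (\<phi> t s - a t) \<le> norm (\<phi> t s - (a t + s *\<^sub>R b t)) + norm (s *\<^sub>R b t)"
      by (metis norm_triangle_ineq)
    also have "\<dots> \<le> 2 * C * \<bar>s\<bar> ^ 2 + \<bar>s\<bar> * C"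
      using 3[OF t] 1(2)[OF t(1)] by (intro add_mono) (auto intro!: mult_left_mono)
    also have "2 * C * \<bar>s\<bar> ^ 2 \<le> 2 * C * \<bar>s\<bar> ^ 1"
      using t(2) by (intro mult_left_mono power_decreasing) (auto simp: C_def e_def)
    finally show ?thesis by (simp add: algebra_simps)
  qed
  have 5: "norm (\<phi> t s) \<le> 4 * C" if t: "t \<in> S" "\<bar>s\<bar> \<le> e" for t s
  proof -
    have "norm (\<phi> t s) \<le> norm (\<phi> t s - a t) + norm (a t)" by (metis diff_add_cancel norm_triangle_ineq)
    also have "\<dots> \<le> 3 * C * \<bar>s\<bar> + C" by (intro add_mono 4 1 t)
    also have "3 * C * \<bar>s\<bar> \<le> 3 * C * 1"
      using t(2) by (intro mult_left_mono) (auto simp: C_def e_def)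
    finally show ?thesis by simp
  qed
  show thesis
    by (rule that[of e C]) (use C0(1) 1 2 3 4 5 in \<open>auto simp: C_def e_def\<close>)
qed

lemma jetI:
  assumes "e > 0" "\<And>t. t \<in> S \<Longrightarrow> norm (a t) \<le> C1" "\<And>t. t \<in> S \<Longrightarrow> norm (b t) \<le> C2" "\<And>t. t \<in> S \<Longrightarrow> norm (c t) \<le> C3"
    "\<And>t s. t \<in> S \<Longrightarrow> \<bar>s\<bar> \<le> e \<Longrightarrow> norm (\<phi> t s - (a t + s *\<^sub>R b t + (s\<^sup>2 / 2) *\<^sub>R c t)) \<le> C4 * \<bar>s\<bar> ^ 3"
  shows "jet S \<phi> a b c"
proof -
  define C where "C = max (max C1 C2) (max C3 C4)"
  have "norm (\<phi> t s - (a t + s *\<^sub>R b t + (s\<^sup>2 / 2) *\<^sub>R c t)) \<le> C * \<bar>s\<bar> ^ 3" if "t \<in> S" "\<bar>s\<bar> \<le> e" for t s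
    by (rule order_trans[OF assms(5)[OF that]]) (intro mult_right_mono, auto simp: C_def)
  then show ?thesis
    unfolding jet_def using assms(1-4)
    by (intro exI[of _ C] exI[of _ e]) (fastforce simp: C_def)
qed

lemma jet_cong:
  assumes "jet S \<phi> a b c" "\<And>t s. t \<in> S \<Longrightarrow> \<phi>' t s = \<phi> t s" "\<And>t. t \<in> S \<Longrightarrow> a' t = a t"
    "\<And>t. t \<in> S \<Longrightarrow> b' t = b t" "\<And>t. t \<in> S \<Longrightarrow> c' t = c t"
  shows "jet S \<phi>' a' b' c'"
  using assms unfolding jet_def by (metis (no_types, lifting))

lemma jet_add:
  assumes "jet S \<phi> a b c" "jet S \<phi>' a' b' c'"
  shows "jet S (\<lambda>t s. \<phi> t s + \<phi>' t s) (\<lambda>t. a t + a' t) (\<lambda>t. b t + b' t) (\<lambda>t. c t + c' t)"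
proof -
  obtain C e where 1: "0 < e" "e \<le> 1" "1 \<le> C"
    "\<And>t. t \<in> S \<Longrightarrow> norm (a t) \<le> C" "\<And>t. t \<in> S \<Longrightarrow> norm (b t) \<le> C" "\<And>t. t \<in> S \<Longrightarrow> norm (c t) \<le> C"
    "\<And>t s. t \<in> S \<Longrightarrow> \<bar>s\<bar> \<le> e \<Longrightarrow> norm (\<phi> t s - (a t + s *\<^sub>R b t + (s\<^sup>2 / 2) *\<^sub>R c t)) \<le> C * \<bar>s\<bar> ^ 3"
    by (rule jetE[OF assms(1)]) blast
  obtain C' e' where 2: "0 < e'" "e' \<le> 1" "1 \<le> C'"
    "\<And>t. t \<in> S \<Longrightarrow> norm (a' t) \<le> C'" "\<And>t. t \<in> S \<Longrightarrow> norm (b' t) \<le> C'" "\<And>t. t \<in> S \<Longrightarrow> norm (c' t) \<le> C'"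
    "\<And>t s. t \<in> S \<Longrightarrow> \<bar>s\<bar> \<le> e' \<Longrightarrow> norm (\<phi>' t s - (a' t + s *\<^sub>R b' t + (s\<^sup>2 / 2) *\<^sub>R c' t)) \<le> C' * \<bar>s\<bar> ^ 3"
    by (rule jetE[OF assms(2)]) blast
  show ?thesis
  proof (rule jetI[of "min e e'" S _ "C + C'" _ "C + C'" _ "C + C'" _ "C + C'"])
    fix t s assume t: "t \<in> S" "\<bar>s\<bar> \<le> min e e'"
    have "norm ((\<phi> t s - (a t + s *\<^sub>R b t + (s\<^sup>2 / 2) *\<^sub>R c t)) + (\<phi>' t s - (a' t + s *\<^sub>R b' t + (s\<^sup>2 / 2) *\<^sub>R c' t))) \<le> C * \<bar>s\<bar> ^ 3 + C' * \<bar>s\<bar> ^ 3"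
      by (intro order_trans[OF norm_triangle_ineq] add_mono 1 2) (use t in auto)
    then show "norm (\<phi> t s + \<phi>' t s - (a t + a' t + s *\<^sub>R (b t + b' t) + (s\<^sup>2 / 2) *\<^sub>R (c t + c' t))) \<le> (C + C') * \<bar>s\<bar> ^ 3"
      by (simp add: algebra_simps)
  qed (use 1 2 in \<open>auto intro!: order_trans[OF norm_triangle_ineq] add_mono\<close>)
qed

lemma bounded_bilinear_bound:
  fixes pr :: "'a::real_normed_vector \<Rightarrow> 'b::real_normed_vector \<Rightarrow> 'c::real_normed_vector"
  assumes "bounded_bilinear pr"
  obtains K where "K > 0" "\<And>x y p q. norm x \<le> p \<Longrightarrow> norm y \<le> q \<Longrightarrow> norm (pr x y) \<le> p * q * K"
proof -
  obtain K where K: "K > 0" "\<And>x y. norm (pr x y) \<le> norm x * norm y * K"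
    using bounded_bilinear.pos_bounded[OF assms] by blast
  show thesis
  proof (rule that[OF K(1)])
    fix x :: 'a and y :: 'b and p q assume H: "norm x \<le> p" "norm y \<le> q"
    have "norm x * norm y \<le> p * q"
      using H by (intro mult_mono) (auto intro: order_trans[OF norm_ge_zero])
    then have "norm x * norm y * K \<le> p * q * K" using K(1) by (intro mult_right_mono) auto
    then show "norm (pr x y) \<le> p * q * K" using K(2)[of x y] by linarith
  qed
qed

text \<open>Leibniz rule; the coefficient c is a second derivative, whence the binomial factor
  2.\<close>

lemma jet_bilinear:
  assumes L: "bounded_bilinear pr" and "jet S \<phi> a b c" "jet S \<phi>' a' b' c'"
  shows "jet S (\<lambda>t s. pr (\<phi> t s) (\<phi>' t s)) (\<lambda>t. pr (a t) (a' t)) (\<lambda>t. pr (b t) (a' t) + pr (a t) (b' t))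
    (\<lambda>t. pr (c t) (a' t) + 2 *\<^sub>R pr (b t) (b' t) + pr (a t) (c' t))"
proof -
  obtain C e where 1: "0 < e" "e \<le> 1" "1 \<le> C"
    "\<And>t. t \<in> S \<Longrightarrow> norm (a t) \<le> C" "\<And>t. t \<in> S \<Longrightarrow> norm (b t) \<le> C" "\<And>t. t \<in> S \<Longrightarrow> norm (c t) \<le> C"
    "\<And>t s. t \<in> S \<Longrightarrow> \<bar>s\<bar> \<le> e \<Longrightarrow> norm (\<phi> t s - (a t + s *\<^sub>R b t + (s\<^sup>2 / 2) *\<^sub>R c t)) \<le> C * \<bar>s\<bar> ^ 3"
    by (rule jetE[OF assms(2)]) blast
  obtain C' e' where 2: "0 < e'" "e' \<le> 1" "1 \<le> C'"
    "\<And>t. t \<in> S \<Longrightarrow> norm (a' t) \<le> C'" "\<And>t. t \<in> S \<Longrightarrow> norm (b' t) \<le> C'" "\<And>t. t \<in> S \<Longrightarrow> norm (c' t) \<le> C'"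
    "\<And>t s. t \<in> S \<Longrightarrow> \<bar>s\<bar> \<le> e' \<Longrightarrow> norm (\<phi>' t s - (a' t + s *\<^sub>R b' t + (s\<^sup>2 / 2) *\<^sub>R c' t)) \<le> C' * \<bar>s\<bar> ^ 3"
    "\<And>t s. t \<in> S \<Longrightarrow> \<bar>s\<bar> \<le> e' \<Longrightarrow> norm (\<phi>' t s - (a' t + s *\<^sub>R b' t)) \<le> 2 * C' * \<bar>s\<bar> ^ 2"
    "\<And>t s. t \<in> S \<Longrightarrow> \<bar>s\<bar> \<le> e' \<Longrightarrow> norm (\<phi>' t s - a' t) \<le> 3 * C' * \<bar>s\<bar>"
    "\<And>t s. t \<in> S \<Longrightarrow> \<bar>s\<bar> \<le> e' \<Longrightarrow> norm (\<phi>' t s) \<le> 4 * C'"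
    by (rule jetE[OF assms(3)]) blast
  obtain K where K: "K > 0" "\<And>x y p q. norm x \<le> p \<Longrightarrow> norm y \<le> q \<Longrightarrow> norm (pr x y) \<le> p * q * K"
    by (rule bounded_bilinear_bound[OF L]) blast
  interpret bounded_bilinear pr by (rule L)
  show ?thesis
  proof (rule jetI[of "min e e'" S _ "C * C' * K" _ "2 * (C * C' * K)" _ "4 * (C * C' * K)" _ "100 * (C * C' * K)"])
    fix t assume t: "t \<in> S"
    have n: "norm (pr (a t) (a' t)) \<le> C * C' * K" "norm (pr (b t) (a' t)) \<le> C * C' * K" "norm (pr (a t) (b' t)) \<le> C * C' * K"
      "norm (pr (c t) (a' t)) \<le> C * C' * K" "norm (pr (b t) (b' t)) \<le> C * C' * K" "norm (pr (a t) (c' t)) \<le> C * C' * K"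
      by (intro K(2) 1 2 t)+
    show "norm (pr (a t) (a' t)) \<le> C * C' * K" by (rule n)
    show "norm (pr (b t) (a' t) + pr (a t) (b' t)) \<le> 2 * (C * C' * K)"
      using norm_triangle_ineq[of "pr (b t) (a' t)" "pr (a t) (b' t)"] n by linarith
    show "norm (pr (c t) (a' t) + 2 *\<^sub>R pr (b t) (b' t) + pr (a t) (c' t)) \<le> 4 * (C * C' * K)"
      using norm_triangle_ineq[of "pr (c t) (a' t) + 2 *\<^sub>R pr (b t) (b' t)" "pr (a t) (c' t)"]
        norm_triangle_ineq[of "pr (c t) (a' t)" "2 *\<^sub>R pr (b t) (b' t)"] n by simp
    fix s assume s: "\<bar>s\<bar> \<le> min e e'"
    let ?r = "\<phi> t s - (a t + s *\<^sub>R b t + (s\<^sup>2 / 2) *\<^sub>R c t)"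
    let ?r3 = "\<phi>' t s - (a' t + s *\<^sub>R b' t + (s\<^sup>2 / 2) *\<^sub>R c' t)"
    let ?r2 = "\<phi>' t s - (a' t + s *\<^sub>R b' t)"
    let ?r1 = "\<phi>' t s - a' t"
    \<comment> \<open>Each summand pairs a remainder with the power of s that it lacks: orders 3 +
      0, 0 + 3, 1 + 2 and 2 + 1.\<close>
    have eq: "pr (\<phi> t s) (\<phi>' t s) - (pr (a t) (a' t) + s *\<^sub>R (pr (b t) (a' t) + pr (a t) (b' t)) +
          (s\<^sup>2 / 2) *\<^sub>R (pr (c t) (a' t) + 2 *\<^sub>R pr (b t) (b' t) + pr (a t) (c' t)))
      = pr ?r (\<phi>' t s) + (pr (a t) ?r3 + (s *\<^sub>R pr (b t) ?r2 + (s\<^sup>2 / 2) *\<^sub>R pr (c t) ?r1))"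
      by (simp add: add_left add_right diff_left diff_right scaleR_left scaleR_right algebra_simps power2_eq_square)
    have "norm (pr ?r (\<phi>' t s)) \<le> (C * \<bar>s\<bar> ^ 3) * (4 * C') * K"
      using s by (intro K(2) 1 2 t) auto
    moreover have "norm (pr (a t) ?r3) \<le> C * (C' * \<bar>s\<bar> ^ 3) * K"
      using s by (intro K(2) 1 2 t) auto
    moreover have "norm (s *\<^sub>R pr (b t) ?r2) \<le> \<bar>s\<bar> * (C * (2 * C' * s ^ 2) * K)"
      unfolding norm_scaleR real_norm_def power2_abs[symmetric, of s] using s by (intro mult_left_mono K(2) 1 2 t) auto
    moreover have "norm ((s\<^sup>2 / 2) *\<^sub>R pr (c t) ?r1) \<le> (s\<^sup>2 / 2) * (C * (3 * C' * \<bar>s\<bar>) * K)"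
    proof -
      have "norm (pr (c t) ?r1) \<le> C * (3 * C' * \<bar>s\<bar>) * K" using s by (intro K(2) 1 2 t) auto
      then show ?thesis by (simp add: mult_left_mono)
    qed
    \<comment> \<open>The four contributions are 4, 1, 2 and 3/2; the final constant 100 is merely
      generous.\<close>
    moreover have "(C * \<bar>s\<bar> ^ 3) * (4 * C') * K + (C * (C' * \<bar>s\<bar> ^ 3) * K + (\<bar>s\<bar> * (C * (2 * C' * s ^ 2) * K) + (s\<^sup>2 / 2) * (C * (3 * C' * \<bar>s\<bar>) * K)))
        = (17/2) * (C * C' * K) * \<bar>s\<bar> ^ 3"
    proof -
      have "(C * \<sigma> ^ 3) * (4 * C') * K + (C * (C' * \<sigma> ^ 3) * K + (\<sigma> * (C * (2 * C' * \<sigma> ^ 2) * K) + (\<sigma>\<^sup>2 / 2) * (C * (3 * C' * \<sigma>) * K)))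
        = (17/2) * (C * C' * K) * \<sigma> ^ 3" for \<sigma> :: real
        by (simp add: power2_eq_square power3_eq_cube algebra_simps)
      from this[of "\<bar>s\<bar>"] show ?thesis unfolding power2_abs .
    qed
    moreover have "(17/2) * (C * C' * K) * \<bar>s\<bar> ^ 3 \<le> 100 * (C * C' * K) * \<bar>s\<bar> ^ 3"
      using 1 2 K by (intro mult_right_mono) auto
    ultimately show "norm (pr (\<phi> t s) (\<phi>' t s) - (pr (a t) (a' t) + s *\<^sub>R (pr (b t) (a' t) + pr (a t) (b' t)) +
          (s\<^sup>2 / 2) *\<^sub>R (pr (c t) (a' t) + 2 *\<^sub>R pr (b t) (b' t) + pr (a t) (c' t)))) \<le> 100 * (C * C' * K) * \<bar>s\<bar> ^ 3"
      unfolding eq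
      using norm_triangle_ineq[of "pr ?r (\<phi>' t s)" "pr (a t) ?r3 + (s *\<^sub>R pr (b t) ?r2 + (s\<^sup>2 / 2) *\<^sub>R pr (c t) ?r1)"]
        norm_triangle_ineq[of "pr (a t) ?r3" "s *\<^sub>R pr (b t) ?r2 + (s\<^sup>2 / 2) *\<^sub>R pr (c t) ?r1"]
        norm_triangle_ineq[of "s *\<^sub>R pr (b t) ?r2" "(s\<^sup>2 / 2) *\<^sub>R pr (c t) ?r1"]
      by linarith
  qed (use 1 2 in auto)
qed

text \<open>Chain rule to second order, uniform in t because the base points stay in the compact set
  K.\<close>

lemma jet_compose:
  fixes F :: "'e::euclidean_space \<Rightarrow> 'b::real_normed_vector"
  assumes U: "open U" and F: "smooth_on U F" and K: "compact K" "K \<subseteq> U"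
    and j: "jet S \<phi> a b c" and aK: "\<And>t. t \<in> S \<Longrightarrow> a t \<in> K"
  shows "jet S (\<lambda>t s. F (\<phi> t s)) (\<lambda>t. F (a t)) (\<lambda>t. bderiv F (a t) (b t))
    (\<lambda>t. bderiv (bderiv F) (a t) (b t) (b t) + bderiv F (a t) (c t))"
proof -
  obtain C e where 1: "0 < e" "e \<le> 1" "1 \<le> C"
    "\<And>t. t \<in> S \<Longrightarrow> norm (a t) \<le> C" "\<And>t. t \<in> S \<Longrightarrow> norm (b t) \<le> C" "\<And>t. t \<in> S \<Longrightarrow> norm (c t) \<le> C"
    "\<And>t s. t \<in> S \<Longrightarrow> \<bar>s\<bar> \<le> e \<Longrightarrow> norm (\<phi> t s - (a t + s *\<^sub>R b t + (s\<^sup>2 / 2) *\<^sub>R c t)) \<le> C * \<bar>s\<bar> ^ 3"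
    "\<And>t s. t \<in> S \<Longrightarrow> \<bar>s\<bar> \<le> e \<Longrightarrow> norm (\<phi> t s - (a t + s *\<^sub>R b t)) \<le> 2 * C * \<bar>s\<bar> ^ 2"
    "\<And>t s. t \<in> S \<Longrightarrow> \<bar>s\<bar> \<le> e \<Longrightarrow> norm (\<phi> t s - a t) \<le> 3 * C * \<bar>s\<bar>"
    by (rule jetE[OF j]) blast
  obtain C' e' where 2: "e' > 0" "C' \<ge> 0" "\<And>x z. x \<in> K \<Longrightarrow> norm z \<le> e' \<Longrightarrow>
      norm (F (x + z) - (F x + bderiv F x z + (1/2) *\<^sub>R bderiv (bderiv F) x z z)) \<le> C' * norm z ^ 3"
    using taylor3_bound[OF U F K] by blast
  have bd: "\<exists>B. \<forall>x\<in>K. norm (H x) \<le> B" if "smooth_on U H" for H :: "'e \<Rightarrow> 'c::real_normed_vector"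
  proof -
    have "compact (H ` K)"
      using smooth_on_continuous[OF that] K continuous_on_subset compact_continuous_image by blast
    then show ?thesis using compact_imp_bounded bounded_iff by (metis imageI)
  qed
  obtain B0 where B0: "\<forall>x\<in>K. norm (F x) \<le> B0" using bd[OF F] by blast
  have smd: "smooth_on U (bderiv F)" by (rule smooth_on_bderiv[OF U F])
  obtain B1 where B1: "\<forall>x\<in>K. norm (bderiv F x) \<le> B1" using bd[OF smd] by blast
  obtain B2 where B2: "\<forall>x\<in>K. norm (bderiv (bderiv F) x) \<le> B2" using bd[OF smooth_on_bderiv[OF U smd]] by blast
  have nb: "norm (blinfun_apply A v) \<le> p * q" if "norm A \<le> p" "norm v \<le> q" for A :: "'x::real_normed_vector \<Rightarrow>\<^sub>L 'y::real_normed_vector" and v p q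
    by (rule order_trans[OF norm_blinfun]) (intro mult_mono that order_trans[OF norm_ge_zero that(1)] norm_ge_zero)
  define M where "M = C' * (3 * C) ^ 3 + B1 * C + (B2 * (2 * C)) * (3 * C) + (B2 * C) * (2 * C)"
  show ?thesis
  proof (rule jetI[of "min e (e' / (3 * C))" S _ B0 _ "B1 * C" _ "B2 * C * C + B1 * C" _ M])
    show "min e (e' / (3 * C)) > 0" using 1 2 by simp
    fix t assume t: "t \<in> S"
    have n1: "norm (bderiv F (a t)) \<le> B1" and n2: "norm (bderiv (bderiv F) (a t)) \<le> B2" using B1 B2 aK[OF t] by auto
    show "norm (F (a t)) \<le> B0" using B0 aK[OF t] by blast
    show "norm (bderiv F (a t) (b t)) \<le> B1 * C" by (intro nb n1 1 t)
    show "norm (bderiv (bderiv F) (a t) (b t) (b t) + bderiv F (a t) (c t)) \<le> B2 * C * C + B1 * C"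
      by (intro order_trans[OF norm_triangle_ineq] add_mono nb n1 n2 1 t)
    fix s assume s: "\<bar>s\<bar> \<le> min e (e' / (3 * C))"
    then have se: "\<bar>s\<bar> \<le> e" by simp
    let ?z = "\<phi> t s - a t"
    let ?q = "\<phi> t s - (a t + s *\<^sub>R b t)"
    let ?r = "\<phi> t s - (a t + s *\<^sub>R b t + (s\<^sup>2 / 2) *\<^sub>R c t)"
    have z: "norm ?z \<le> 3 * C * \<bar>s\<bar>" by (rule 1(9)[OF t se])
    also have "\<dots> \<le> e'" using s 1 by (simp add: field_simps)
    finally have "norm (F (a t + ?z) - (F (a t) + bderiv F (a t) ?z + (1/2) *\<^sub>R bderiv (bderiv F) (a t) ?z ?z)) \<le> C' * norm ?z ^ 3"
      by (rule 2(3)[OF aK[OF t]])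
    also have "\<dots> \<le> C' * (3 * C * \<bar>s\<bar>) ^ 3" by (intro mult_left_mono power_mono z 2) simp
    finally have e1: "norm (F (\<phi> t s) - (F (a t) + bderiv F (a t) ?z + (1/2) *\<^sub>R bderiv (bderiv F) (a t) ?z ?z)) \<le> C' * (3 * C) ^ 3 * \<bar>s\<bar> ^ 3"
      by (simp add: power_mult_distrib)
    have e2: "norm (bderiv F (a t) ?r) \<le> B1 * C * \<bar>s\<bar> ^ 3"
      using nb[OF n1 1(7)[OF t se]] by simp
    have e3: "norm (bderiv (bderiv F) (a t) ?q ?z) \<le> (B2 * (2 * C)) * (3 * C) * \<bar>s\<bar> ^ 3"
      using nb[OF nb[OF n2 1(8)[OF t se]] z] by (simp add: power2_eq_square power3_eq_cube mult_ac)
    have e4: "norm (s *\<^sub>R bderiv (bderiv F) (a t) (b t) ?q) \<le> (B2 * C) * (2 * C) * \<bar>s\<bar> ^ 3"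
      using mult_left_mono[OF nb[OF nb[OF n2 1(5)[OF t]] 1(8)[OF t se]], of "\<bar>s\<bar>"] by (simp add: power2_eq_square power3_eq_cube mult_ac)
    \<comment> \<open>Since z = q + s b, one has F''(z, z) - F''(s b, s b) = F''(q, z) + s F''(b,
      q), and q is quadratically small.\<close>
    have eq: "F (\<phi> t s) - (F (a t) + s *\<^sub>R bderiv F (a t) (b t) + (s\<^sup>2 / 2) *\<^sub>R (bderiv (bderiv F) (a t) (b t) (b t) + bderiv F (a t) (c t)))
      = (F (\<phi> t s) - (F (a t) + bderiv F (a t) ?z + (1/2) *\<^sub>R bderiv (bderiv F) (a t) ?z ?z))
        + (bderiv F (a t) ?r + ((1/2) *\<^sub>R bderiv (bderiv F) (a t) ?q ?z + (1/2) *\<^sub>R (s *\<^sub>R bderiv (bderiv F) (a t) (b t) ?q)))"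
      by (simp add: blinfun.bilinear_simps algebra_simps power2_eq_square)
    have "norm ((1/2) *\<^sub>R bderiv (bderiv F) (a t) ?q ?z) \<le> norm (bderiv (bderiv F) (a t) ?q ?z)"
      "norm ((1/2) *\<^sub>R (s *\<^sub>R bderiv (bderiv F) (a t) (b t) ?q)) \<le> norm (s *\<^sub>R bderiv (bderiv F) (a t) (b t) ?q)" by auto
    then have "norm (F (\<phi> t s) - (F (a t) + s *\<^sub>R bderiv F (a t) (b t) + (s\<^sup>2 / 2) *\<^sub>R (bderiv (bderiv F) (a t) (b t) (b t) + bderiv F (a t) (c t))))
      \<le> C' * (3 * C) ^ 3 * \<bar>s\<bar> ^ 3 + (B1 * C * \<bar>s\<bar> ^ 3 + ((B2 * (2 * C)) * (3 * C) * \<bar>s\<bar> ^ 3 + (B2 * C) * (2 * C) * \<bar>s\<bar> ^ 3))"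
      unfolding eq
      by (intro order_trans[OF norm_triangle_ineq] add_mono order_trans[OF _ e3] order_trans[OF _ e4] e1 e2)
    then show "norm (F (\<phi> t s) - (F (a t) + s *\<^sub>R bderiv F (a t) (b t) + (s\<^sup>2 / 2) *\<^sub>R (bderiv (bderiv F) (a t) (b t) (b t) + bderiv F (a t) (c t)))) \<le> M * \<bar>s\<bar> ^ 3"
      by (simp add: M_def algebra_simps)
  qed
qed

lemma has_vector_derivative_blinfun2:
  assumes B: "(B has_derivative B') (at (\<gamma> t))" and \<gamma>: "(\<gamma> has_vector_derivative T) (at t within I)"
    and a: "(a has_vector_derivative a') (at t within I)" and b: "(b has_vector_derivative b') (at t within I)"
  shows "((\<lambda>t. blinfun_apply (blinfun_apply (B (\<gamma> t)) (a t)) (b t)) has_vector_derivative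
    (B' T (a t) (b t) + B (\<gamma> t) a' (b t) + B (\<gamma> t) (a t) b')) (at t within I)"
proof -
  have "((\<lambda>t. B (\<gamma> t)) has_vector_derivative B' T) (at t within I)"
    using vector_derivative_diff_chain_within[OF \<gamma> has_derivative_at_withinI[OF B]] by (simp add: o_def)
  from blinfun.has_vector_derivative[OF blinfun.has_vector_derivative[OF this a] b]
  show ?thesis by (simp add: blinfun.bilinear_simps algebra_simps)
qed

lemma jet_integral:
  fixes \<phi> :: "real \<Rightarrow> real \<Rightarrow> real"
  assumes j: "jet {a..b} \<phi> A B C" and ab: "a \<le> b"
    and cA: "continuous_on {a..b} A" "continuous_on {a..b} B" "continuous_on {a..b} C"
    and e: "e > 0" "\<And>s. \<bar>s\<bar> \<le> e \<Longrightarrow> continuous_on {a..b} (\<lambda>t. \<phi> t s)"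
  shows "jet UNIV (\<lambda>_ s. integral {a..b} (\<lambda>t. \<phi> t s)) (\<lambda>_::unit. integral {a..b} A) (\<lambda>_. integral {a..b} B) (\<lambda>_. integral {a..b} C)"
proof -
  obtain K d where 1: "0 < d" 
    "\<And>t s. t \<in> {a..b} \<Longrightarrow> \<bar>s\<bar> \<le> d \<Longrightarrow> norm (\<phi> t s - (A t + s *\<^sub>R B t + (s\<^sup>2 / 2) *\<^sub>R C t)) \<le> K * \<bar>s\<bar> ^ 3"
    by (rule jetE[OF j]) blast
  show ?thesis
  proof (rule jetI[of "min d e" _ _ "norm (integral {a..b} A)" _ "norm (integral {a..b} B)" _ "norm (integral {a..b} C)" _ "K * (b - a)"])
    fix s assume s: "\<bar>s\<bar> \<le> min d e"
    have i: "\<phi> integrable_on {a..b}" if "continuous_on {a..b} \<phi>" for \<phi> :: "real \<Rightarrow> real"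
      by (rule integrable_continuous_real[OF that])
    have c: "continuous_on {a..b} (\<lambda>t. \<phi> t s)" using e(2) s by simp
    have "integral {a..b} (\<lambda>t. \<phi> t s - (A t + s *\<^sub>R B t + (s\<^sup>2 / 2) *\<^sub>R C t))
      = integral {a..b} (\<lambda>t. \<phi> t s) - (integral {a..b} A + s *\<^sub>R integral {a..b} B + (s\<^sup>2 / 2) *\<^sub>R integral {a..b} C)"
      by (simp add: integral_diff integral_add i c cA continuous_intros)
    moreover have "norm (integral {a..b} (\<lambda>t. \<phi> t s - (A t + s *\<^sub>R B t + (s\<^sup>2 / 2) *\<^sub>R C t))) \<le> K * \<bar>s\<bar> ^ 3 * (b - a)"
      using s by (intro integral_bound ab 1 continuous_intros c cA) auto
    ultimately show "norm (integral {a..b} (\<lambda>t. \<phi> t s) - (integral {a..b} A + s *\<^sub>R integral {a..b} B + (s\<^sup>2 / 2) *\<^sub>R integral {a..b} C)) \<le> K * (b - a) * \<bar>s\<bar> ^ 3"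
      by (simp add: mult_ac)
  qed (use 1 e in auto)
qed

text \<open>Picard's operator is a contraction in the sup norm when M (b - a) < 1; short intervals
  suffice because geodesics are later traversed in short pieces. \<open>cl\<close> clamps time to
  the interval, so that the iteration runs in the complete space of bounded continuous functions on
  the whole line.\<close>

lemma linear_ode_exists:
  fixes A :: "real \<Rightarrow> 'e::banach \<Rightarrow>\<^sub>L 'e"
  assumes ab: "a \<le> b" and A: "continuous_on {a..b} A" and M: "\<And>t. t \<in> {a..b} \<Longrightarrow> norm (A t) \<le> M" "M * (b - a) < 1"
  shows "\<exists>E. E a = e0 \<and> (\<forall>t\<in>{a..b}. (E has_vector_derivative A t (E t)) (at t within {a..b}))"
proof -
  define cl where "cl t = max a (min b t)" for t :: real
  have cl: "cl t \<in> {a..b}" "a \<le> cl t" "cl t \<le> b" for t using ab by (auto simp: cl_def)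
  have cl_id: "cl t = t" if "t \<in> {a..b}" for t using that by (auto simp: cl_def)
  define I where "I f t = e0 + integral {a..t} (\<lambda>s. A s (apply_bcontfun f s))" for f :: "real \<Rightarrow>\<^sub>C 'e" and t
  have cont: "continuous_on {a..b} (\<lambda>s. A s (apply_bcontfun f s))" for f :: "real \<Rightarrow>\<^sub>C 'e"
    by (intro continuous_intros A continuous_on_apply_bcontfun)
  have contI: "continuous_on {a..b} (I f)" for f
    unfolding I_def by (intro continuous_intros indefinite_integral_continuous_1 integrable_continuous_real cont)
  define P where "P f = Bcontfun (\<lambda>t. I f (cl t))" for f
  have Pf: "(\<lambda>t. I f (cl t)) \<in> bcontfun" for f
  proof -
    have "bounded (I f ` {a..b})"
      by (intro compact_imp_bounded compact_continuous_image contI compact_Icc)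
    then obtain B where "\<And>t. t \<in> {a..b} \<Longrightarrow> norm (I f t) \<le> B" unfolding bounded_iff by blast
    moreover have "continuous_on UNIV (\<lambda>t. I f (cl t))"
      by (rule continuous_on_compose2[OF contI]) (auto simp: cl cl_def[abs_def] ab intro!: continuous_intros)
    ultimately show ?thesis by (intro bcontfun_normI[of _ B]) (auto simp: cl)
  qed
  have P: "apply_bcontfun (P f) t = I f (cl t)" for f t
    unfolding P_def using Bcontfun_inverse[OF Pf] by simp
  have M0: "0 \<le> M" using M(1)[of a] ab by (auto intro: order_trans[OF norm_ge_zero])
  have lip: "dist (P f) (P h) \<le> (M * (b - a)) * dist f h" for f h
  proof (rule dist_bound)
    fix t
    have "integral {a..cl t} (\<lambda>s. A s (f s)) - integral {a..cl t} (\<lambda>s. A s (h s)) = integral {a..cl t} (\<lambda>s. A s (f s) - A s (h s))"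
      by (rule integral_diff[symmetric]; rule integrable_continuous_real; rule continuous_on_subset[OF cont]) (use cl in auto)
    moreover have "norm (integral {a..cl t} (\<lambda>s. A s (f s) - A s (h s))) \<le> (M * dist f h) * (cl t - a)"
    proof (rule integral_bound[OF cl(2)])
      show "continuous_on {a..cl t} (\<lambda>s. A s (f s) - A s (h s))"
        using cl by (intro continuous_intros continuous_on_subset[OF cont]) auto
      fix s assume "s \<in> {a..cl t}"
      then have s: "s \<in> {a..b}" using cl(3)[of t] by auto
      have "norm (A s (f s) - A s (h s)) = norm (A s (f s - h s))" by (simp add: blinfun.diff_right)
      also have "\<dots> \<le> norm (A s) * norm (f s - h s)" by (rule norm_blinfun)
      also have "\<dots> \<le> M * dist f h"
        using M(1)[OF s] dist_bounded[of f s h] M0 by (intro mult_mono) (auto simp: dist_norm)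
      finally show "norm (A s (f s) - A s (h s)) \<le> M * dist f h" .
    qed
    moreover have "(M * dist f h) * (cl t - a) \<le> (M * dist f h) * (b - a)"
      using cl M0 by (intro mult_left_mono) auto
    ultimately show "dist (P f t) (P h t) \<le> (M * (b - a)) * dist f h"
      by (simp add: P I_def dist_norm mult_ac)
  qed
  obtain f where f: "P f = f"
    using banach_fix_type[of "M * (b - a)" P] lip M(2) M0 ab by auto
  have f_eq: "f t = I f (cl t)" for t using P[of f t] f by simp
  show ?thesis
  proof (intro exI[of _ "I f"] conjI ballI)
    show "I f a = e0" by (simp add: I_def)
    fix t assume t: "t \<in> {a..b}"
    have "((\<lambda>u. integral {a..u} (\<lambda>s. A s (f s))) has_vector_derivative A t (f t)) (at t within {a..b})"
      by (rule integral_has_vector_derivative[OF cont t])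
    then have "(I f has_vector_derivative A t (f t)) (at t within {a..b})"
      unfolding I_def by (auto intro!: derivative_eq_intros)
    then show "(I f has_vector_derivative A t (I f t)) (at t within {a..b})"
      using f_eq[of t] cl_id[OF t] by simp
  qed
qed

section \<open>The second variation at a point, parallel transport, and variations of a geodesic in
  one chart\<close>

context chart_metric begin

lemma d\<Gamma>_sym: assumes "x \<in> U" shows "d\<Gamma> x u a b = d\<Gamma> x u b a"
proof -
  have "bderiv (\<lambda>y. \<Gamma> y a b) x = bderiv (\<lambda>y. \<Gamma> y b a) x"
    unfolding bderiv_def using frechet_derivative_cong_open[OF open_U assms, of "\<lambda>y. \<Gamma> y a b" "\<lambda>y. \<Gamma> y b a"] \<Gamma>_sym by simp
  then show ?thesis
    by (metis bderiv_linear(1)[OF open_U smooth_\<Gamma> assms bounded_linear_eval2])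
qed

text \<open>The left sides are the coefficients that the jet calculus produces for the energy
  density. V is the variation field, W makes the transversal curves free of acceleration at
  parameter 0, V' and W' are ordinary time derivatives, and D is the covariant derivative of V along
  the geodesic.\<close>

lemma second_variation_coeff:
  assumes x: "x \<in> U" and W: "W = - \<Gamma> x V V" and W': "W' = - (d\<Gamma> x T V V + 2 *\<^sub>R \<Gamma> x V' V)"
    and D: "D = V' + \<Gamma> x T V"
  shows "dg x V T T + g x V' T + g x T V' = 2 * g x D T"
    and "ddg x V V T T + dg x W T T + 2 * dg x V V' T + g x W' T + 2 * (dg x V T V' + g x V' V') + g x T W'
      = 2 * g x D D + 2 * g x (riem x V T V) T"
proof -
  show "dg x V T T + g x V' T + g x T V' = 2 * g x D T"
    unfolding D compat[OF x] by (simp add: blinfun.bilinear_simps g_sym[OF x, of T] \<Gamma>_sym[OF x, of T])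
  show "ddg x V V T T + dg x W T T + 2 * dg x V V' T + g x W' T + 2 * (dg x V T V' + g x V' V') + g x T W'
      = 2 * g x D D + 2 * g x (riem x V T V) T"
    unfolding D W W' ddg_eq[OF x] compat[OF x] riem_def
    by (simp add: blinfun.bilinear_simps g_sym[OF x, of T] \<Gamma>_sym[OF x, of T V] \<Gamma>_sym[OF x, of V' V]
        \<Gamma>_sym[OF x, of T "\<Gamma> x V V"] g_sym[OF x, of V' "\<Gamma> x V T"] d\<Gamma>_sym[OF x, of V V T] algebra_simps)
qed

end

locale geodesic_piece = chart_metric +
  fixes a b :: real and \<gamma> T :: "real \<Rightarrow> real^'a"
  assumes ab: "a \<le> b" and \<gamma>_U: "\<And>t. t \<in> {a..b} \<Longrightarrow> \<gamma> t \<in> U"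
    and \<gamma>': "\<And>t. t \<in> {a..b} \<Longrightarrow> (\<gamma> has_vector_derivative T t) (at t within {a..b})"
    and T': "\<And>t. t \<in> {a..b} \<Longrightarrow> (T has_vector_derivative - \<Gamma> (\<gamma> t) (T t) (T t)) (at t within {a..b})"
begin

definition parallel :: "(real \<Rightarrow> real^'a) \<Rightarrow> bool"
  where "parallel E \<longleftrightarrow> (\<forall>t\<in>{a..b}. (E has_vector_derivative - \<Gamma> (\<gamma> t) (T t) (E t)) (at t within {a..b}))"

lemma cont_\<gamma>: "continuous_on {a..b} \<gamma>" and cont_T: "continuous_on {a..b} T"
  by (rule continuous_on_vector_derivative[OF \<gamma>'] continuous_on_vector_derivative[OF T'], assumption)+

lemma continuous_on_along:
  assumes "smooth_on U B"
  shows "continuous_on {a..b} (\<lambda>t. B (\<gamma> t))"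
  by (rule continuous_on_compose2[OF smooth_on_continuous[OF assms] cont_\<gamma>]) (use \<gamma>_U in auto)

lemma parallel_cont: "parallel E \<Longrightarrow> continuous_on {a..b} E"
  unfolding parallel_def by (rule continuous_on_vector_derivative) blast

lemma g_parallel:
  assumes "parallel E" "parallel E'" and t: "t \<in> {a..b}"
  shows "((\<lambda>t. g (\<gamma> t) (E t) (E' t)) has_vector_derivative 0) (at t within {a..b})"
proof -
  have "((\<lambda>t. g (\<gamma> t) (E t) (E' t)) has_vector_derivative
     (dg (\<gamma> t) (T t) (E t) (E' t) + g (\<gamma> t) (- \<Gamma> (\<gamma> t) (T t) (E t)) (E' t) + g (\<gamma> t) (E t) (- \<Gamma> (\<gamma> t) (T t) (E' t)))) (at t within {a..b})"
    using assms unfolding parallel_def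
    by (intro has_vector_derivative_blinfun2 dg_works \<gamma>_U \<gamma>') auto
  then show ?thesis by (simp add: compat[OF \<gamma>_U[OF t]] blinfun.bilinear_simps)
qed

lemma g_parallel_const:
  assumes "parallel E" "parallel E'" and t: "t \<in> {a..b}"
  shows "g (\<gamma> t) (E t) (E' t) = g (\<gamma> a) (E a) (E' a)"
proof -
  obtain c where "\<And>t. t \<in> {a..b} \<Longrightarrow> g (\<gamma> t) (E t) (E' t) = c"
    using has_vector_derivative_zero_constant[OF convex_closed_interval g_parallel[OF assms(1,2)]] by (metis box_real(2))
  then show ?thesis using t ab by fastforce
qed

lemma parallel_T: "parallel T"
  unfolding parallel_def using T' by blast

lemma parallel_exists:
  assumes "\<And>t. t \<in> {a..b} \<Longrightarrow> norm (\<Gamma> (\<gamma> t) (T t)) \<le> M" "M * (b - a) < 1"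
  shows "\<exists>E. E a = e0 \<and> parallel E"
proof -
  have c: "continuous_on {a..b} (\<lambda>t. - \<Gamma> (\<gamma> t) (T t))"
    by (intro continuous_intros continuous_on_along smooth_\<Gamma> cont_T)
  have "\<exists>E. E a = e0 \<and> (\<forall>t\<in>{a..b}. (E has_vector_derivative (- \<Gamma> (\<gamma> t) (T t)) (E t)) (at t within {a..b}))"
    by (rule linear_ode_exists[OF ab c _ assms(2)]) (use assms(1) in simp)
  then show ?thesis by (simp add: parallel_def blinfun.minus_left)
qed

end

text \<open>The shift r is constant in time and of third order. It changes neither the velocity
  \<alpha>' nor any 2-jet, but lets the variation start exactly on a prescribed curve of which only
  the 2-jet is known. Thus pieces in different charts can be joined without gaps.\<close>

locale geodesic_variation = geodesic_piece +
  fixes E :: "real \<Rightarrow> real^'a" and h h' :: "real \<Rightarrow> real" and r :: "real \<Rightarrow> real^'a" and Cr \<epsilon>r :: real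
  assumes E: "parallel E" and gEE: "g (\<gamma> a) (E a) (E a) = 1"
    and h': "\<And>t. t \<in> {a..b} \<Longrightarrow> (h has_vector_derivative h' t) (at t within {a..b})"
    and cont_h': "continuous_on {a..b} h'"
    and r: "0 < \<epsilon>r" "\<And>s. \<bar>s\<bar> \<le> \<epsilon>r \<Longrightarrow> norm (r s) \<le> Cr * \<bar>s\<bar> ^ 3"
begin

definition V where "V t = h t *\<^sub>R E t"
definition V' where "V' t = h' t *\<^sub>R E t - h t *\<^sub>R \<Gamma> (\<gamma> t) (T t) (E t)"
definition W where "W t = - \<Gamma> (\<gamma> t) (V t) (V t)"
definition W' where "W' t = - (d\<Gamma> (\<gamma> t) (T t) (V t) (V t) + 2 *\<^sub>R \<Gamma> (\<gamma> t) (V' t) (V t))"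
definition \<alpha> where "\<alpha> t s = \<gamma> t + s *\<^sub>R V t + (s\<^sup>2 / 2) *\<^sub>R W t + r s"
definition \<alpha>' where "\<alpha>' t s = T t + s *\<^sub>R V' t + (s\<^sup>2 / 2) *\<^sub>R W' t"

lemma V_deriv: "t \<in> {a..b} \<Longrightarrow> (V has_vector_derivative V' t) (at t within {a..b})"
  unfolding V_def[abs_def] V'_def using E[unfolded parallel_def] h'
  by (auto intro!: derivative_eq_intros simp: has_real_derivative_iff_has_vector_derivative)

lemma W_deriv: "t \<in> {a..b} \<Longrightarrow> (W has_vector_derivative W' t) (at t within {a..b})"
proof -
  assume t: "t \<in> {a..b}"
  have "((\<lambda>t. - \<Gamma> (\<gamma> t) (V t) (V t)) has_vector_derivative
     - (d\<Gamma> (\<gamma> t) (T t) (V t) (V t) + \<Gamma> (\<gamma> t) (V' t) (V t) + \<Gamma> (\<gamma> t) (V t) (V' t))) (at t within {a..b})"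
    by (intro has_vector_derivative_minus has_vector_derivative_blinfun2 d\<Gamma>_works \<gamma>_U \<gamma>' V_deriv t)
  then show ?thesis
    unfolding W_def[abs_def] W'_def by (simp add: \<Gamma>_sym[OF \<gamma>_U[OF t], of "V t"] scaleR_2 algebra_simps)
qed

lemma \<alpha>_deriv: "t \<in> {a..b} \<Longrightarrow> ((\<lambda>t. \<alpha> t s) has_vector_derivative \<alpha>' t s) (at t within {a..b})"
  unfolding \<alpha>_def \<alpha>'_def by (auto intro!: derivative_eq_intros \<gamma>' V_deriv W_deriv)

lemma cont_h: "continuous_on {a..b} h"
  by (rule continuous_on_vector_derivative[OF h'])

lemma cont_VW: "continuous_on {a..b} V" "continuous_on {a..b} V'" "continuous_on {a..b} W" "continuous_on {a..b} W'"
proof -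
  note cE = parallel_cont[OF E]
  show V: "continuous_on {a..b} V" unfolding V_def[abs_def] by (intro continuous_intros cont_h cE)
  show V': "continuous_on {a..b} V'" unfolding V'_def[abs_def]
    by (intro continuous_intros cont_h cont_h' cE cont_T continuous_on_along smooth_\<Gamma>)
  show "continuous_on {a..b} W" unfolding W_def[abs_def]
    by (intro continuous_intros V continuous_on_along smooth_\<Gamma>)
  show "continuous_on {a..b} W'" unfolding W'_def[abs_def]
    by (intro continuous_intros V V' cont_T continuous_on_along smooth_\<Gamma> smooth_on_bderiv open_U)
qed

lemma continuous_bound:
  fixes f :: "real \<Rightarrow> 'b::real_normed_vector"
  assumes "continuous_on {a..b} f"
  shows "\<exists>C. \<forall>t\<in>{a..b}. norm (f t) \<le> C"
proof -
  have "bounded (f ` {a..b})"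
    by (intro compact_imp_bounded compact_continuous_image assms compact_Icc)
  then show ?thesis by (auto simp: bounded_iff)
qed

lemma jet_poly:
  fixes A B C :: "real \<Rightarrow> 'b::real_normed_vector"
  assumes "continuous_on {a..b} A" "continuous_on {a..b} B" "continuous_on {a..b} C"
    and R: "0 < e" "\<And>s. \<bar>s\<bar> \<le> e \<Longrightarrow> norm (R s) \<le> K * \<bar>s\<bar> ^ 3"
  shows "jet {a..b} (\<lambda>t s. A t + s *\<^sub>R B t + (s\<^sup>2 / 2) *\<^sub>R C t + R s) A B C"
proof -
  obtain CA CB CC where "\<forall>t\<in>{a..b}. norm (A t) \<le> CA" "\<forall>t\<in>{a..b}. norm (B t) \<le> CB" "\<forall>t\<in>{a..b}. norm (C t) \<le> CC"
    using continuous_bound assms(1-3) by metis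
  then show ?thesis
    by (intro jetI[of e _ _ CA _ CB _ CC _ K]) (auto simp: R)
qed

lemma jet_\<alpha>: "jet {a..b} \<alpha> \<gamma> V W"
  unfolding \<alpha>_def by (rule jet_poly[OF cont_\<gamma> cont_VW(1,3) r])

lemma jet_\<alpha>': "jet {a..b} \<alpha>' T V' W'"
  using jet_poly[OF cont_T cont_VW(2,4), of 1 "\<lambda>_. 0" 0] unfolding \<alpha>'_def by simp

lemma E_norm: "t \<in> {a..b} \<Longrightarrow> g (\<gamma> t) (E t) (E t) = 1"
  using g_parallel_const[OF E E] gEE by simp

text \<open>E is parallel, so the covariant derivative of V = h E is h' E, and E has norm 1; the
  general coefficients reduce accordingly.\<close>

lemma jet_energy_density:
  "jet {a..b} (\<lambda>t s. g (\<alpha> t s) (\<alpha>' t s) (\<alpha>' t s)) (\<lambda>t. g (\<gamma> t) (T t) (T t)) (\<lambda>t. 2 * (h' t * g (\<gamma> t) (E t) (T t)))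
    (\<lambda>t. 2 * (h' t)\<^sup>2 + 2 * ((h t)\<^sup>2 * g (\<gamma> t) (riem (\<gamma> t) (E t) (T t) (E t)) (T t)))"
proof -
  have cK: "compact (\<gamma> ` {a..b})" by (intro compact_continuous_image cont_\<gamma> compact_Icc)
  have KU: "\<gamma> ` {a..b} \<subseteq> U" using \<gamma>_U by auto
  have "jet {a..b} (\<lambda>t s. g (\<alpha> t s)) (\<lambda>t. g (\<gamma> t)) (\<lambda>t. dg (\<gamma> t) (V t))
      (\<lambda>t. ddg (\<gamma> t) (V t) (V t) + dg (\<gamma> t) (W t))"
    by (rule jet_compose[OF open_U smooth_g cK KU jet_\<alpha>]) auto
  note j = jet_bilinear[OF bounded_bilinear_blinfun_apply
      jet_bilinear[OF bounded_bilinear_blinfun_apply this jet_\<alpha>'] jet_\<alpha>']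
  show ?thesis
  proof (rule jet_cong[OF j])
    fix t assume t: "t \<in> {a..b}"
    note x = \<gamma>_U[OF t]
    have D: "h' t *\<^sub>R E t = V' t + \<Gamma> (\<gamma> t) (T t) (V t)"
      by (simp add: V'_def V_def blinfun.bilinear_simps)
    note c = second_variation_coeff[OF x W_def W'_def D]
    show "2 * (h' t * g (\<gamma> t) (E t) (T t)) = (dg (\<gamma> t) (V t) (T t) + g (\<gamma> t) (V' t)) (T t) + g (\<gamma> t) (T t) (V' t)"
      using c(1) by (simp add: blinfun.bilinear_simps)
    show "2 * (h' t)\<^sup>2 + 2 * ((h t)\<^sup>2 * g (\<gamma> t) (riem (\<gamma> t) (E t) (T t) (E t)) (T t)) =
       ((ddg (\<gamma> t) (V t) (V t) + dg (\<gamma> t) (W t)) (T t) + 2 *\<^sub>R dg (\<gamma> t) (V t) (V' t) + g (\<gamma> t) (W' t)) (T t) +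
         2 *\<^sub>R (dg (\<gamma> t) (V t) (T t) + g (\<gamma> t) (V' t)) (V' t) + g (\<gamma> t) (T t) (W' t)"
    proof -
      have "riem (\<gamma> t) (V t) (T t) (V t) = (h t)\<^sup>2 *\<^sub>R riem (\<gamma> t) (E t) (T t) (E t)"
        using linear_scale[OF linear_riem(1)] linear_scale[OF linear_riem(3)]
        by (simp add: V_def power2_eq_square)
      then show ?thesis
        using c(2) E_norm[OF t] by (simp add: blinfun.bilinear_simps power2_eq_square)
    qed
  qed auto
qed

lemma \<alpha>_in_U: "\<exists>e>0. \<forall>s t. \<bar>s\<bar> \<le> e \<longrightarrow> t \<in> {a..b} \<longrightarrow> \<alpha> t s \<in> U"
proof -
  have cK: "compact (\<gamma> ` {a..b})" by (intro compact_continuous_image cont_\<gamma> compact_Icc)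
  have KU: "\<gamma> ` {a..b} \<subseteq> U" using \<gamma>_U by auto
  obtain d where d: "d > 0" "(\<Union>x\<in>\<gamma> ` {a..b}. cball x d) \<subseteq> U"
    by (metis compact_subset_open_imp_cball_epsilon_subset[OF cK open_U KU])
  obtain C e where j: "0 < e" "e \<le> 1" "1 \<le> C"
    "\<And>t s. t \<in> {a..b} \<Longrightarrow> \<bar>s\<bar> \<le> e \<Longrightarrow> norm (\<alpha> t s - \<gamma> t) \<le> 3 * C * \<bar>s\<bar>"
    by (rule jetE[OF jet_\<alpha>]) blast
  have "\<alpha> t s \<in> U" if "\<bar>s\<bar> \<le> min e (d / (3 * C))" "t \<in> {a..b}" for s t
  proof -
    have "norm (\<alpha> t s - \<gamma> t) \<le> 3 * C * \<bar>s\<bar>" using j(4) that by simp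
    also have "\<dots> \<le> d" using that j by (simp add: field_simps)
    finally have "\<alpha> t s \<in> cball (\<gamma> t) d" by (simp add: dist_norm norm_minus_commute)
    then show ?thesis using d(2) that(2) by blast
  qed
  then show ?thesis using j(1,3) d(1) by (intro exI[of _ "min e (d / (3 * C))"]) auto
qed

lemma hgET_deriv:
  assumes t: "t \<in> {a..b}"
  shows "((\<lambda>t. h t * g (\<gamma> t) (E t) (T t)) has_vector_derivative h' t * g (\<gamma> t) (E t) (T t)) (at t within {a..b})"
  using has_vector_derivative_mult[OF h'[OF t] g_parallel[OF E parallel_T t]] by simp

lemma cont_gET: "continuous_on {a..b} (\<lambda>t. g (\<gamma> t) (E t) (T t))"
  by (intro continuous_intros continuous_on_along smooth_g parallel_cont[OF E] cont_T)

lemma smooth_riem: "smooth_on U (\<lambda>x. d\<Gamma> x)"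
  by (intro smooth_on_bderiv open_U smooth_\<Gamma>)

lemma cont_riem: "continuous_on {a..b} (\<lambda>t. g (\<gamma> t) (riem (\<gamma> t) (E t) (T t) (E t)) (T t))"
  unfolding riem_def
  by (intro continuous_intros continuous_on_along smooth_g smooth_\<Gamma> smooth_riem parallel_cont[OF E] cont_T)

lemma energy_continuous:
  "\<exists>e>0. \<forall>s. \<bar>s\<bar> \<le> e \<longrightarrow> (\<forall>t\<in>{a..b}. \<alpha> t s \<in> U) \<and> continuous_on {a..b} (\<lambda>t. \<alpha>' t s)
     \<and> continuous_on {a..b} (\<lambda>t. g (\<alpha> t s) (\<alpha>' t s) (\<alpha>' t s))"
proof -
  obtain e where e: "e > 0" "\<forall>s t. \<bar>s\<bar> \<le> e \<longrightarrow> t \<in> {a..b} \<longrightarrow> \<alpha> t s \<in> U" using \<alpha>_in_U by blast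
  show ?thesis
  proof (intro exI[of _ e] conjI e allI impI)
    fix s assume s: "\<bar>s\<bar> \<le> e"
    show "\<forall>t\<in>{a..b}. \<alpha> t s \<in> U" using e s by blast
    have c\<alpha>: "continuous_on {a..b} (\<lambda>t. \<alpha> t s)" by (rule continuous_on_vector_derivative[OF \<alpha>_deriv])
    show c\<alpha>': "continuous_on {a..b} (\<lambda>t. \<alpha>' t s)" unfolding \<alpha>'_def by (intro continuous_intros cont_T cont_VW)
    have "continuous_on {a..b} (\<lambda>t. g (\<alpha> t s))"
      by (rule continuous_on_compose2[OF smooth_on_continuous[OF smooth_g] c\<alpha>]) (use e s in auto)
    then show "continuous_on {a..b} (\<lambda>t. g (\<alpha> t s) (\<alpha>' t s) (\<alpha>' t s))"
      by (intro continuous_intros c\<alpha>')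
  qed
qed

text \<open>The speed is constant, and so is g(E, T); hence the integrand of the first variation is
  an exact derivative. In this form the first two coefficients telescope over consecutive
  pieces.\<close>

lemma jet_energy:
  "jet UNIV (\<lambda>_ s. integral {a..b} (\<lambda>t. g (\<alpha> t s) (\<alpha>' t s) (\<alpha>' t s)))
    (\<lambda>_::unit. (b - a) * g (\<gamma> a) (T a) (T a))
    (\<lambda>_. 2 * (h b * g (\<gamma> b) (E b) (T b) - h a * g (\<gamma> a) (E a) (T a)))
    (\<lambda>_. integral {a..b} (\<lambda>t. 2 * (h' t)\<^sup>2 + 2 * ((h t)\<^sup>2 * g (\<gamma> t) (riem (\<gamma> t) (E t) (T t) (E t)) (T t))))"
proof -
  obtain e where e: "e > 0" "\<And>s. \<bar>s\<bar> \<le> e \<Longrightarrow> continuous_on {a..b} (\<lambda>t. g (\<alpha> t s) (\<alpha>' t s) (\<alpha>' t s))"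
    using energy_continuous by blast
  have c1: "continuous_on {a..b} (\<lambda>t. g (\<gamma> t) (T t) (T t))"
    by (intro continuous_intros continuous_on_along smooth_g cont_T)
  have "integral {a..b} (\<lambda>t. g (\<gamma> t) (T t) (T t)) = integral {a..b} (\<lambda>t. g (\<gamma> a) (T a) (T a))"
    by (rule integral_cong) (rule g_parallel_const[OF parallel_T parallel_T])
  then have i1: "integral {a..b} (\<lambda>t. g (\<gamma> t) (T t) (T t)) = (b - a) * g (\<gamma> a) (T a) (T a)"
    using ab by simp
  have "((\<lambda>t. h' t * g (\<gamma> t) (E t) (T t)) has_integral h b * g (\<gamma> b) (E b) (T b) - h a * g (\<gamma> a) (E a) (T a)) {a..b}"
    by (rule fundamental_theorem_of_calculus[OF ab hgET_deriv])
  then have "integral {a..b} (\<lambda>t. h' t * g (\<gamma> t) (E t) (T t)) = h b * g (\<gamma> b) (E b) (T b) - h a * g (\<gamma> a) (E a) (T a)"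
    by (rule integral_unique)
  then have i2: "integral {a..b} (\<lambda>t. 2 * (h' t * g (\<gamma> t) (E t) (T t))) = 2 * (h b * g (\<gamma> b) (E b) (T b) - h a * g (\<gamma> a) (E a) (T a))"
    by simp
  have "jet UNIV (\<lambda>_ s. integral {a..b} (\<lambda>t. g (\<alpha> t s) (\<alpha>' t s) (\<alpha>' t s)))
    (\<lambda>_::unit. integral {a..b} (\<lambda>t. g (\<gamma> t) (T t) (T t)))
    (\<lambda>_. integral {a..b} (\<lambda>t. 2 * (h' t * g (\<gamma> t) (E t) (T t))))
    (\<lambda>_. integral {a..b} (\<lambda>t. 2 * (h' t)\<^sup>2 + 2 * ((h t)\<^sup>2 * g (\<gamma> t) (riem (\<gamma> t) (E t) (T t) (E t)) (T t))))"
    by (rule jet_integral[OF jet_energy_density ab c1 _ _ e]) (intro continuous_intros cont_h' cont_h cont_gET cont_riem)+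
  then show ?thesis unfolding i1 i2 .
qed

lemma jet_end: "jet UNIV (\<lambda>_::unit. \<alpha> b) (\<lambda>_. \<gamma> b) (\<lambda>_. V b) (\<lambda>_. W b)"
proof -
  obtain C e where j: "0 < e" "\<And>t. t \<in> {a..b} \<Longrightarrow> norm (\<gamma> t) \<le> C" "\<And>t. t \<in> {a..b} \<Longrightarrow> norm (V t) \<le> C" "\<And>t. t \<in> {a..b} \<Longrightarrow> norm (W t) \<le> C"
    "\<And>t s. t \<in> {a..b} \<Longrightarrow> \<bar>s\<bar> \<le> e \<Longrightarrow> norm (\<alpha> t s - (\<gamma> t + s *\<^sub>R V t + (s\<^sup>2 / 2) *\<^sub>R W t)) \<le> C * \<bar>s\<bar> ^ 3"
    by (rule jetE[OF jet_\<alpha>]) blast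
  then show ?thesis using ab by (intro jetI[of e _ _ C _ C _ C _ C]) auto
qed

end

section \<open>Paths and distance\<close>

context riemannian_manifold begin

text \<open>Legend: domain, coordinate map, image and inverse of a chart; \<open>G\<close>,
  \<open>q\<close> and \<Gamma> are the metric matrix, the metric form and the Christoffel form in
  its coordinates, and \<open>tr c d\<close> is the coordinate change from c to d.\<close>

abbreviation (input) "dm c \<equiv> fst c"
abbreviation (input) "co c \<equiv> snd c"
abbreviation (input) "im c \<equiv> snd c ` fst c"
abbreviation (input) "ci c \<equiv> inv_into (fst c) (snd c)"
abbreviation (input) "G c \<equiv> in_chart c (g c)"
abbreviation (input) "q c \<equiv> gB (in_chart c (g c))"
abbreviation (input) "\<Gamma> c \<equiv> chrB (in_chart c (g c))"
abbreviation (input) "tr c d \<equiv> in_chart c (snd d)"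

lemma inj_chart: "c \<in> A \<Longrightarrow> inj_on (co c) (dm c)"
  by (rule inj_on_inverseI[of _ "ci c"]) (rule homeomorphism_apply1[OF homeomorphism_chart])

lemma ci_co [simp]: "c \<in> A \<Longrightarrow> p \<in> dm c \<Longrightarrow> ci c (co c p) = p"
  using inj_chart by simp

lemma co_ci [simp]: "x \<in> im c \<Longrightarrow> co c (ci c x) = x"
  by (rule f_inv_into_f)

lemma ci_dom [simp]: "x \<in> im c \<Longrightarrow> ci c x \<in> dm c"
  by (rule inv_into_into)

lemma in_chart_co [simp]: "c \<in> A \<Longrightarrow> p \<in> dm c \<Longrightarrow> in_chart c h (co c p) = h p"
  by (simp add: in_chart_def)

lemma cont_co: "c \<in> A \<Longrightarrow> continuous_on (dm c) (co c)"
  using homeomorphism_chart homeomorphism_cont1 by blast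

lemma cont_ci: "c \<in> A \<Longrightarrow> continuous_on (im c) (ci c)"
  using homeomorphism_chart homeomorphism_cont2 by blast

lemma open_ci_image: "c \<in> A \<Longrightarrow> V \<subseteq> im c \<Longrightarrow> open V \<Longrightarrow> open (ci c ` V)"
proof -
  assume c: "c \<in> A" and V: "V \<subseteq> im c" "open V"
  have "ci c ` V = dm c \<inter> co c -` V"
  proof (intro equalityI subsetI)
    fix p assume "p \<in> dm c \<inter> co c -` V"
    then have "p = ci c (co c p)" "co c p \<in> V" using c by auto
    then show "p \<in> ci c ` V" by blast
  qed (use V c in auto)
  then show ?thesis
    using continuous_on_open_vimage[OF open_domain[OF c]] cont_co[OF c] V(2) by (metis Int_commute)
qed

lemma open_co_image: "c \<in> A \<Longrightarrow> open S \<Longrightarrow> open (co c ` (dm c \<inter> S))"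
proof -
  assume c: "c \<in> A" and S: "open S"
  have "co c ` (dm c \<inter> S) = im c \<inter> ci c -` S" using c by force
  then show ?thesis
    using continuous_on_open_vimage[OF open_image[OF c]] cont_ci[OF c] S by (metis Int_commute)
qed

lemma chart_metric_chart: "c \<in> A \<Longrightarrow> chart_metric (im c) (G c)"
proof
  assume c: "c \<in> A"
  show "open (im c)" by (rule open_image[OF c])
  show "smooth_on (im c) (G c)" by (rule metric_smooth[OF c])
  show "transpose (G c x) = G c x" if "x \<in> im c" for x
    using that metric_symmetric[OF c] c by (auto simp del: transpose_iff)
  show "v \<bullet> (G c x *v v) > 0" if "x \<in> im c" "v \<noteq> 0" for x v
    using that metric_positive[OF c] c by auto
qed

section \<open>Change of chart\<close>

definition jac :: "('a, 'n) chart \<Rightarrow> ('a, 'n) chart \<Rightarrow> 'a \<Rightarrow> (real^'n) \<Rightarrow>\<^sub>L (real^'n)"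
  where "jac c d p = bderiv (tr c d) (co c p)"

lemma open_overlap: "c \<in> A \<Longrightarrow> d \<in> A \<Longrightarrow> open (co c ` (dm c \<inter> dm d))"
  by (rule open_co_image) (auto intro: open_domain)

lemma tr_works: "c \<in> A \<Longrightarrow> d \<in> A \<Longrightarrow> p \<in> dm c \<Longrightarrow> p \<in> dm d \<Longrightarrow> (tr c d has_derivative jac c d p) (at (co c p))"
  unfolding jac_def by (rule bderiv_works[OF smooth_transition]) auto

text \<open>The matrix transformation law, read as invariance of the inner product of tangent
  vectors.\<close>

lemma q_jac:
  assumes cd: "c \<in> A" "d \<in> A" and p: "p \<in> dm c" "p \<in> dm d"
  shows "q c (co c p) a b = q d (co d p) (jac c d p a) (jac c d p b)"
proof -
  define M where "M = matrix (frechet_derivative (tr c d) (at (co c p)))"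
  have lin: "linear (jac c d p)" by (rule bounded_linear.linear[OF blinfun.bounded_linear_right])
  have J: "blinfun_apply (jac c d p) = frechet_derivative (tr c d) (at (co c p))"
    unfolding jac_def by (rule bderiv_apply[OF smooth_transition[OF cd]]) (use p in auto)
  have M: "M *v v = jac c d p v" for v
    unfolding M_def J[symmetric]
    using linear_axis_expand[OF lin, of v] by (simp add: vec_eq_iff matrix_vector_mult_def matrix_def mult.commute)
  have "g c p = transpose M ** g d p ** M"
    by (rule metric_transforms[OF cd p M_def])
  then have "a \<bullet> (g c p *v b) = a \<bullet> (transpose M *v (g d p *v (M *v b)))"
    by (simp only: matrix_vector_mul_assoc matrix_mul_assoc)
  also have "\<dots> = (M *v a) \<bullet> (g d p *v (M *v b))"
    by (metis dot_lmul_matrix vector_transpose_matrix)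
  finally have "a \<bullet> (g c p *v b) = (M *v a) \<bullet> (g d p *v (M *v b))" .
  then show ?thesis using cd p by (simp add: gB_apply M)
qed

lemma jac_inverse:
  assumes cd: "c \<in> A" "d \<in> A" and p: "p \<in> dm c" "p \<in> dm d"
  shows "jac d c p (jac c d p v) = v"
proof -
  have "(tr d c has_derivative jac d c p) (at (tr c d (co c p)))"
    using tr_works[OF cd(2,1) p(2,1)] cd p by simp
  from diff_chain_at[OF tr_works[OF cd p] this]
  have "((\<lambda>x. tr d c (tr c d x)) has_derivative (\<lambda>v. jac d c p (jac c d p v))) (at (co c p))"
    by (simp only: o_def)
  then have "((\<lambda>x. x) has_derivative (\<lambda>v. jac d c p (jac c d p v))) (at (co c p))"
  proof (subst has_derivative_cong_open[OF open_overlap[OF cd]])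
    show "co c p \<in> co c ` (dm c \<inter> dm d)" using p by auto
    show "x = tr d c (tr c d x)" if "x \<in> co c ` (dm c \<inter> dm d)" for x
      using that cd by auto
  qed
  from fun_cong[OF has_derivative_unique[OF this has_derivative_ident], of v] show ?thesis .
qed

text \<open>Differentiate the transformation law of the metric, insert the Koszul formula in both
  charts, and remove the test vector by nondegeneracy. The inhomogeneous term is what makes it
  independent of the chart that a curve with first coefficient V has second coefficient -\<Gamma>(V,
  V).\<close>

lemma christoffel_transform:
  assumes cd: "c \<in> A" "d \<in> A" and p: "p \<in> dm c" "p \<in> dm d"
  shows "jac c d p (\<Gamma> c (co c p) a b) = \<Gamma> d (co d p) (jac c d p a) (jac c d p b) + bderiv (bderiv (tr c d)) (co c p) a b"
proof -
  interpret c: chart_metric "im c" "G c" by (rule chart_metric_chart[OF cd(1)])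
  interpret d: chart_metric "im d" "G d" by (rule chart_metric_chart[OF cd(2)])
  let ?x = "co c p" and ?y = "co d p" and ?O = "co c ` (dm c \<inter> dm d)"
  let ?J = "jac c d p" and ?H = "bderiv (bderiv (tr c d)) (co c p)"
  have x: "?x \<in> im c" "?y \<in> im d" and xO: "?x \<in> ?O" using p by auto
  note oO = open_overlap[OF cd]
  have J2: "(bderiv (tr c d) has_derivative ?H) (at ?x)"
    by (rule bderiv_works[OF smooth_on_bderiv[OF oO smooth_transition[OF cd]] xO])
  have dg: "bderiv (q c) ?x u a b = bderiv (q d) ?y (?J u) (?J a) (?J b) + q d ?y (?H u a) (?J b) + q d ?y (?J a) (?H u b)" for u a b
  proof -
    have 1: "((\<lambda>x. q c x a b) has_derivative (\<lambda>u. bderiv (q c) ?x u a b)) (at ?x)"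
      by (rule bounded_linear.has_derivative[OF c.bounded_linear_eval2 c.dg_works[OF x(1)]])
    have "(q d has_derivative bderiv (q d) ?y) (at (tr c d ?x))"
      using d.dg_works[OF x(2)] cd p by simp
    from diff_chain_at[OF tr_works[OF cd p] this]
    have qd: "((\<lambda>x. q d (tr c d x)) has_derivative (\<lambda>u. bderiv (q d) ?y (?J u))) (at ?x)"
      by (simp add: o_def)
    have Ja: "((\<lambda>x. bderiv (tr c d) x a) has_derivative (\<lambda>u. ?H u a)) (at ?x)" for a
      by (rule bounded_linear.has_derivative[OF blinfun.bounded_linear_left J2])
    have "((\<lambda>x. q d (tr c d x) (bderiv (tr c d) x a) (bderiv (tr c d) x b)) has_derivative
      (\<lambda>u. bderiv (q d) ?y (?J u) (bderiv (tr c d) ?x a) (bderiv (tr c d) ?x b) + q d (tr c d ?x) (?H u a) (bderiv (tr c d) ?x b)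
        + q d (tr c d ?x) (bderiv (tr c d) ?x a) (?H u b))) (at ?x)"
      by (rule c.has_derivative_blinfun2[OF qd Ja Ja])
    then have "((\<lambda>x. q c x a b) has_derivative
      (\<lambda>u. bderiv (q d) ?y (?J u) (bderiv (tr c d) ?x a) (bderiv (tr c d) ?x b) + q d (tr c d ?x) (?H u a) (bderiv (tr c d) ?x b)
        + q d (tr c d ?x) (bderiv (tr c d) ?x a) (?H u b))) (at ?x)"
    proof (subst has_derivative_cong_open[OF oO xO])
      fix y assume "y \<in> ?O"
      then obtain p' where p': "y = co c p'" "p' \<in> dm c" "p' \<in> dm d" by auto
      show "q c y a b = q d (tr c d y) (bderiv (tr c d) y a) (bderiv (tr c d) y b)"
        using q_jac[OF cd p'(2,3)] p' cd by (simp add: jac_def)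
    qed
    from has_derivative_unique[OF 1 this] show ?thesis
      using cd p by (simp add: jac_def fun_eq_iff)
  qed
  have Hsym: "?H u v = ?H v u" for u v
    by (rule bderiv2_symmetric[OF oO smooth_transition[OF cd] xO])
  have "q d ?y (?J (\<Gamma> c ?x a b)) (?J v) = q d ?y (\<Gamma> d ?y (?J a) (?J b) + ?H a b) (?J v)" for v
  proof -
    have "q d ?y (?J (\<Gamma> c ?x a b)) (?J v) = q c ?x (\<Gamma> c ?x a b) v"
      by (rule q_jac[OF cd p, symmetric])
    also have "\<dots> = (bderiv (q c) ?x a b v + bderiv (q c) ?x b a v - bderiv (q c) ?x v a b) / 2"
      by (rule c.koszul[OF x(1)])
    \<comment> \<open>Six terms contain the second derivative of the coordinate change; by its
      symmetry four of them cancel and the other two agree.\<close>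
    also have "\<dots> = (bderiv (q d) ?y (?J a) (?J b) (?J v) + bderiv (q d) ?y (?J b) (?J a) (?J v) - bderiv (q d) ?y (?J v) (?J a) (?J b)) / 2
        + q d ?y (?H a b) (?J v)"
      unfolding dg using Hsym[of b a] Hsym[of v a] Hsym[of v b] d.g_sym[OF x(2), of "?H a v"] d.g_sym[OF x(2), of "?H b v"]
      by (simp add: field_simps)
    also have "\<dots> = q d ?y (\<Gamma> d ?y (?J a) (?J b) + ?H a b) (?J v)"
      by (simp add: d.koszul[OF x(2)] blinfun.bilinear_simps)
    finally show ?thesis .
  qed
  note eq = this
  show ?thesis
  proof (rule d.g_nondegenerate[OF x(2)])
    fix w
    show "q d ?y (?J (\<Gamma> c ?x a b)) w = q d ?y (\<Gamma> d ?y (?J a) (?J b) + ?H a b) w"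
      using eq[of "jac d c p w"] jac_inverse[OF cd(2,1) p(2,1)] by simp
  qed
qed

end

context chart_metric begin

text \<open>The lower constant is the minimum of g(v, v) over K times the unit sphere, extended by
  homogeneity.\<close>

lemma g_bounds:
  assumes K: "compact K" "K \<subseteq> U"
  shows "\<exists>l L. 0 < l \<and> 0 < L \<and> (\<forall>x\<in>K. \<forall>v. l * (norm v)\<^sup>2 \<le> g x v v \<and> g x v v \<le> L * (norm v)\<^sup>2)"
proof -
  have cg: "continuous_on K g" using smooth_on_continuous[OF smooth_g] K(2) continuous_on_subset by blast
  then have "bounded (g ` K)" by (intro compact_imp_bounded compact_continuous_image K)
  then obtain B where B: "\<And>x. x \<in> K \<Longrightarrow> norm (g x) \<le> B" by (auto simp: bounded_iff)
  define L where "L = max B 1"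
  have up: "g x v v \<le> L * (norm v)\<^sup>2" if "x \<in> K" for x v
  proof -
    have "g x v v \<le> norm (g x v v)" by simp
    also have "\<dots> \<le> norm (g x v) * norm v" by (rule norm_blinfun)
    also have "\<dots> \<le> (norm (g x) * norm v) * norm v" by (intro mult_right_mono norm_blinfun) simp
    also have "\<dots> \<le> (L * norm v) * norm v"
      using B[OF that] by (intro mult_right_mono) (auto simp: L_def)
    finally show ?thesis by (simp add: power2_eq_square mult.assoc)
  qed
  have "\<exists>l>0. \<forall>x\<in>K. \<forall>v\<in>sphere 0 1. l \<le> g x v v"
  proof (cases "K = {}")
    case False
    have "continuous_on (K \<times> sphere 0 1) (\<lambda>(x, v). g x v v)"
      unfolding case_prod_unfold
      by (intro continuous_intros continuous_on_compose2[OF cg]) auto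
    moreover have "compact (K \<times> sphere (0::real^'n) 1)" by (intro compact_Times K compact_sphere)
    moreover have "K \<times> sphere (0::real^'n) 1 \<noteq> {}" using False by (auto simp: ex_in_conv sphere_eq_empty)
    ultimately obtain z where z: "z \<in> K \<times> sphere (0::real^'n) 1"
      "\<And>y. y \<in> K \<times> sphere (0::real^'n) 1 \<Longrightarrow> (case z of (x, v) \<Rightarrow> g x v v) \<le> (case y of (x, v) \<Rightarrow> g x v v)"
      using continuous_attains_inf[of "K \<times> sphere 0 1" "\<lambda>(x, v). g x v v"] by blast
    obtain x v where xv: "z = (x, v)" by fastforce
    have "g x v v > 0" using z(1) K by (intro g_pos) (auto simp: xv)
    then show ?thesis using z(2) xv by (intro exI[of _ "g x v v"]) auto
  qed (auto intro: exI[of _ 1])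
  then obtain l where l: "l > 0" "\<And>x v. x \<in> K \<Longrightarrow> norm v = 1 \<Longrightarrow> l \<le> g x v v" by auto
  have "l * (norm v)\<^sup>2 \<le> g x v v" if x: "x \<in> K" for x v
  proof (cases "v = 0")
    case False
    have "l \<le> g x (v /\<^sub>R norm v) (v /\<^sub>R norm v)" using False by (intro l x) simp
    then show ?thesis using False by (simp add: blinfun.bilinear_simps field_simps power2_eq_square)
  qed (simp add: blinfun.bilinear_simps)
  then show ?thesis using l(1) up by (intro exI[of _ l] exI[of _ L]) (auto simp: L_def)
qed

end

section \<open>Paths with duration and energy, and the distance they define\<close>

context riemannian_manifold begin

text \<open>The last two arguments are the duration and the energy.\<close>

inductive path :: "'a set \<Rightarrow> 'a \<Rightarrow> 'a \<Rightarrow> real \<Rightarrow> real \<Rightarrow> bool" for S where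
  piece: "c \<in> A \<Longrightarrow> a \<le> b \<Longrightarrow> (\<forall>t\<in>{a..b}. (\<beta> has_vector_derivative \<beta>' t) (at t within {a..b})) \<Longrightarrow>
    continuous_on {a..b} \<beta>' \<Longrightarrow> (\<forall>t\<in>{a..b}. \<beta> t \<in> snd c ` (fst c \<inter> S)) \<Longrightarrow>
    path S (inv_into (fst c) (snd c) (\<beta> a)) (inv_into (fst c) (snd c) (\<beta> b)) (b - a)
      (integral {a..b} (\<lambda>t. gB (in_chart c (g c)) (\<beta> t) (\<beta>' t) (\<beta>' t)))"
| trans: "path S x y \<tau>1 e1 \<Longrightarrow> path S y z \<tau>2 e2 \<Longrightarrow> path S x z (\<tau>1 + \<tau>2) (e1 + e2)"

lemma piece_continuous:
  assumes c: "c \<in> A" and \<beta>: "\<forall>t\<in>{a..b}. (\<beta> has_vector_derivative \<beta>' t) (at t within {a..b})"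
    and \<beta>': "continuous_on {a..b} \<beta>'" and im: "\<forall>t\<in>{a..b}. \<beta> t \<in> co c ` (dm c \<inter> S)"
  shows "continuous_on {a..b} \<beta>" "continuous_on {a..b} (\<lambda>t. ci c (\<beta> t))"
    "continuous_on {a..b} (\<lambda>t. q c (\<beta> t) (\<beta>' t) (\<beta>' t))"
    "\<And>t. t \<in> {a..b} \<Longrightarrow> 0 \<le> q c (\<beta> t) (\<beta>' t) (\<beta>' t)"
proof -
  interpret c: chart_metric "im c" "G c" by (rule chart_metric_chart[OF c])
  show cb: "continuous_on {a..b} \<beta>" by (rule continuous_on_vector_derivative[of _ _ \<beta>']) (use \<beta> in auto)
  have im': "\<beta> ` {a..b} \<subseteq> im c" using im by auto
  show "continuous_on {a..b} (\<lambda>t. ci c (\<beta> t))"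
    by (rule continuous_on_compose2[OF cont_ci[OF c] cb im'])
  have "continuous_on {a..b} (\<lambda>t. q c (\<beta> t))"
    by (rule continuous_on_compose2[OF smooth_on_continuous[OF c.smooth_g] cb im'])
  then show "continuous_on {a..b} (\<lambda>t. q c (\<beta> t) (\<beta>' t) (\<beta>' t))" by (intro continuous_intros \<beta>')
  show "\<And>t. t \<in> {a..b} \<Longrightarrow> 0 \<le> q c (\<beta> t) (\<beta>' t) (\<beta>' t)"
    using im' by (intro c.g_nonneg) auto
qed

lemma path_nonneg: "path S y z \<tau> e \<Longrightarrow> 0 \<le> \<tau> \<and> 0 \<le> e"
proof (induction rule: path.induct)
  case (piece c a b \<beta> \<beta>')
  note p = piece_continuous[OF piece(1,3,4,5)]
  have "0 \<le> integral {a..b} (\<lambda>t. q c (\<beta> t) (\<beta>' t) (\<beta>' t))"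
    by (rule integral_nonneg[OF integrable_continuous_real[OF p(3)]]) (use p(4) in auto)
  then show ?case using piece(2) by auto
qed auto

lemma path_endpoints: "path S y z \<tau> e \<Longrightarrow> y \<in> S \<and> z \<in> S"
proof (induction rule: path.induct)
  case (piece c a b \<beta> \<beta>')
  then have "\<beta> a \<in> co c ` (dm c \<inter> S)" "\<beta> b \<in> co c ` (dm c \<inter> S)" by auto
  then show ?case using piece(1) by auto
qed auto

lemma ex_chart: "\<exists>c\<in>A. p \<in> dm c"
  using covers by auto

lemma path_refl: "p \<in> S \<Longrightarrow> path S p p 0 0"
proof -
  assume p: "p \<in> S"
  obtain c where c: "c \<in> A" "p \<in> dm c" using ex_chart by blast
  show ?thesis
    using path.piece[of c 0 0 "\<lambda>_. co c p" "\<lambda>_. 0" S] c p by simp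
qed

text \<open>Running through the path in k times the time divides the squared speed by the square of
  k, hence the energy by k.\<close>

lemma path_rescale: "path S y z \<tau> e \<Longrightarrow> 0 < k \<Longrightarrow> path S y z (k * \<tau>) (e / k)"
proof (induction rule: path.induct)
  case (piece c a b \<beta> \<beta>')
  note k = \<open>0 < k\<close>
  have img: "(\<lambda>t. t / k) ` {k * a..k * b} = {a..b}"
    using k image_divide_atLeastAtMost[of k "k * a" "k * b"] by simp
  have "path S (ci c (\<beta> (k * a / k))) (ci c (\<beta> (k * b / k))) (k * b - k * a)
    (integral {k * a..k * b} (\<lambda>t. q c (\<beta> (t / k)) ((1 / k) *\<^sub>R \<beta>' (t / k)) ((1 / k) *\<^sub>R \<beta>' (t / k))))"
  proof (rule path.piece[OF piece(1), where \<beta> = "\<lambda>t. \<beta> (t / k)"])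
    show "k * a \<le> k * b" using piece(2) k by simp
    show "\<forall>t\<in>{k * a..k * b}. ((\<lambda>t. \<beta> (t / k)) has_vector_derivative (1 / k) *\<^sub>R \<beta>' (t / k)) (at t within {k * a..k * b})"
    proof
      fix t assume t: "t \<in> {k * a..k * b}"
      have "((\<lambda>t. t / k) has_vector_derivative 1 / k) (at t within {k * a..k * b})"
        using k by (auto intro!: derivative_eq_intros simp: has_real_derivative_iff_has_vector_derivative[symmetric])
      moreover have "t / k \<in> {a..b}" using t img by blast
      then have "(\<beta> has_vector_derivative \<beta>' (t / k)) (at (t / k) within (\<lambda>t. t / k) ` {k * a..k * b})"
        using piece(3) img by simp
      ultimately show "((\<lambda>t. \<beta> (t / k)) has_vector_derivative (1 / k) *\<^sub>R \<beta>' (t / k)) (at t within {k * a..k * b})"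
        using vector_diff_chain_within by (fastforce simp: o_def)
    qed
    show "continuous_on {k * a..k * b} (\<lambda>t. (1 / k) *\<^sub>R \<beta>' (t / k))"
      by (intro continuous_intros continuous_on_compose2[OF piece(4)]) (use k img in auto)
    show "\<forall>t\<in>{k * a..k * b}. \<beta> (t / k) \<in> co c ` (dm c \<inter> S)"
      using piece(5) img by blast
  qed
  moreover have "integral {k * a..k * b} (\<lambda>t. q c (\<beta> (t / k)) ((1 / k) *\<^sub>R \<beta>' (t / k)) ((1 / k) *\<^sub>R \<beta>' (t / k)))
     = integral {a..b} (\<lambda>t. q c (\<beta> t) (\<beta>' t) (\<beta>' t)) / k"
  proof -
    let ?f = "\<lambda>t. q c (\<beta> t) (\<beta>' t) (\<beta>' t)"
    have "(?f has_integral integral {a..b} ?f) (cbox a b)"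
      using integrable_integral[OF integrable_continuous_real[OF piece_continuous(3)[OF piece(1,3,4,5)]]] by simp
    from has_integral_affinity[OF this, of "1 / k" 0]
    have "((\<lambda>t. ?f (t / k)) has_integral k * integral {a..b} ?f) ((\<lambda>x. k * x) ` {a..b})"
      using k by (simp add: divide_inverse mult.commute)
    moreover have "(\<lambda>x. k * x) ` {a..b} = {k * a..k * b}" using k piece(2) by (simp add: image_mult_atLeastAtMost)
    ultimately have "((\<lambda>t. (1 / k\<^sup>2) * ?f (t / k)) has_integral (1 / k\<^sup>2) * (k * integral {a..b} ?f)) {k * a..k * b}"
      by (intro has_integral_mult_right) simp
    moreover have "(1 / k\<^sup>2) * ?f (t / k) = q c (\<beta> (t / k)) ((1 / k) *\<^sub>R \<beta>' (t / k)) ((1 / k) *\<^sub>R \<beta>' (t / k))" for t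
      by (simp add: blinfun.bilinear_simps power2_eq_square)
    moreover have "(1 / k\<^sup>2) * (k * integral {a..b} ?f) = integral {a..b} ?f / k"
      using k by (simp add: power2_eq_square)
    ultimately show ?thesis by (simp add: integral_unique)
  qed
  ultimately show ?case using k by (simp add: right_diff_distrib)
next
  case (trans x y \<tau>1 e1 z \<tau>2 e2)
  then show ?case using path.trans by (simp add: distrib_left add_divide_distrib)
qed

lemma subpiece:
  assumes "c \<in> A" "\<forall>t\<in>{a..b}. (\<beta> has_vector_derivative \<beta>' t) (at t within {a..b})"
    "continuous_on {a..b} \<beta>'" "\<forall>t\<in>{a'..b'}. \<beta> t \<in> co c ` (dm c \<inter> S)" "{a'..b'} \<subseteq> {a..b}" "a' \<le> b'"
  shows "path S (ci c (\<beta> a')) (ci c (\<beta> b')) (b' - a') (integral {a'..b'} (\<lambda>t. q c (\<beta> t) (\<beta>' t) (\<beta>' t)))"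
proof (rule path.piece[OF assms(1,6) _ _ assms(4)])
  show "\<forall>t\<in>{a'..b'}. (\<beta> has_vector_derivative \<beta>' t) (at t within {a'..b'})"
    using assms(2,5) by (meson has_vector_derivative_within_subset subsetD)
  show "continuous_on {a'..b'} \<beta>'" using assms(3,5) continuous_on_subset by blast
qed

text \<open>The intermediate value theorem on the piece that crosses the level; duration and energy
  split additively there, so nothing is lost in the cost.\<close>

lemma path_crossing:
  assumes "path S y z \<tau> e" and \<phi>: "continuous_on UNIV (\<phi> :: 'a \<Rightarrow> real)"
  shows "\<phi> y \<le> \<delta> \<Longrightarrow> \<delta> \<le> \<phi> z \<Longrightarrow> \<exists>u \<tau>1 e1 \<tau>2 e2. \<phi> u = \<delta> \<and> path S y u \<tau>1 e1 \<and> path S u z \<tau>2 e2 \<and> \<tau> = \<tau>1 + \<tau>2 \<and> e = e1 + e2"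
  using assms(1)
proof (induction rule: path.induct)
  case (piece c a b \<beta> \<beta>')
  note p = piece_continuous[OF piece(1,3-5)]
  have "continuous_on {a..b} (\<lambda>t. \<phi> (ci c (\<beta> t)))"
    by (rule continuous_on_compose2[OF \<phi> p(2)]) auto
  then obtain t where t: "a \<le> t" "t \<le> b" "\<phi> (ci c (\<beta> t)) = \<delta>"
    using IVT'[of "\<lambda>t. \<phi> (ci c (\<beta> t))" a \<delta> b] piece by auto
  have "path S (ci c (\<beta> a)) (ci c (\<beta> t)) (t - a) (integral {a..t} (\<lambda>t. q c (\<beta> t) (\<beta>' t) (\<beta>' t)))"
    by (rule subpiece[OF piece(1,3,4)]) (use t piece in auto)
  moreover have "path S (ci c (\<beta> t)) (ci c (\<beta> b)) (b - t) (integral {t..b} (\<lambda>t. q c (\<beta> t) (\<beta>' t) (\<beta>' t)))"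
    by (rule subpiece[OF piece(1,3,4)]) (use t piece in auto)
  moreover have "integral {a..t} (\<lambda>t. q c (\<beta> t) (\<beta>' t) (\<beta>' t)) + integral {t..b} (\<lambda>t. q c (\<beta> t) (\<beta>' t) (\<beta>' t)) = integral {a..b} (\<lambda>t. q c (\<beta> t) (\<beta>' t) (\<beta>' t))"
    by (rule Henstock_Kurzweil_Integration.integral_combine[OF t(1,2) integrable_continuous_real[OF p(3)]])
  ultimately show ?case using t(3)
    by (intro exI[of _ "ci c (\<beta> t)"] exI[of _ "t - a"] exI[of _ "integral {a..t} (\<lambda>t. q c (\<beta> t) (\<beta>' t) (\<beta>' t))"]
        exI[of _ "b - t"] exI[of _ "integral {t..b} (\<lambda>t. q c (\<beta> t) (\<beta>' t) (\<beta>' t))"]) auto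
next
  case (trans x y \<tau>1 e1 z \<tau>2 e2)
  show ?case
  proof (cases "\<delta> \<le> \<phi> y")
    case True
    then obtain u t1 f1 t2 f2 where u: "\<phi> u = \<delta>" "path S x u t1 f1" "path S u y t2 f2" "\<tau>1 = t1 + t2" "e1 = f1 + f2"
      using trans.IH(1) trans.prems by blast
    show ?thesis
      using u path.trans[OF u(3) trans.hyps(2)]
      by (intro exI[of _ u] exI[of _ t1] exI[of _ f1] exI[of _ "t2 + \<tau>2"] exI[of _ "f2 + e2"]) auto
  next
    case False
    then obtain u t1 f1 t2 f2 where u: "\<phi> u = \<delta>" "path S y u t1 f1" "path S u z t2 f2" "\<tau>2 = t1 + t2" "e2 = f1 + f2"
      using trans.IH(2) trans.prems by fastforce
    show ?thesis
      using u path.trans[OF trans.hyps(1) u(2)]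
      by (intro exI[of _ u] exI[of _ "\<tau>1 + t1"] exI[of _ "e1 + f1"] exI[of _ t2] exI[of _ f2]) auto
  qed
qed

lemma segment_path:
  assumes c: "c \<in> A" and \<tau>: "\<tau> > 0" and seg: "closed_segment x y \<subseteq> co c ` (dm c \<inter> S)"
    and B: "\<And>u. u \<in> closed_segment x y \<Longrightarrow> q c u ((1 / \<tau>) *\<^sub>R (y - x)) ((1 / \<tau>) *\<^sub>R (y - x)) \<le> B"
  shows "\<exists>e. path S (ci c x) (ci c y) \<tau> e \<and> e \<le> \<tau> * B"
proof -
  let ?v = "(1 / \<tau>) *\<^sub>R (y - x)"
  let ?\<beta> = "\<lambda>t. x + t *\<^sub>R ?v"
  have inseg: "?\<beta> t \<in> closed_segment x y" if "t \<in> {0..\<tau>}" for t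
    unfolding in_segment using that \<tau>
    by (intro exI[of _ "t / \<tau>"]) (auto simp: algebra_simps)
  have d: "\<forall>t\<in>{0..\<tau>}. (?\<beta> has_vector_derivative ?v) (at t within {0..\<tau>})"
    using \<tau> by (auto intro!: derivative_eq_intros)
  have im: "\<forall>t\<in>{0..\<tau>}. ?\<beta> t \<in> co c ` (dm c \<inter> S)" using inseg seg by blast
  have c0: "continuous_on {0..\<tau>} (\<lambda>t::real. ?v)" by simp
  have "path S (ci c (?\<beta> 0)) (ci c (?\<beta> \<tau>)) (\<tau> - 0) (integral {0..\<tau>} (\<lambda>t. q c (?\<beta> t) ?v ?v))"
    by (rule path.piece[OF c _ d c0 im]) (use \<tau> in simp)
  moreover have "integral {0..\<tau>} (\<lambda>t. q c (?\<beta> t) ?v ?v) \<le> integral {0..\<tau>} (\<lambda>t. B)"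
    by (rule integral_le[OF integrable_continuous_real[OF piece_continuous(3)[OF c d c0 im]]])
      (use B inseg in auto)
  ultimately show ?thesis using \<tau>
    by (intro exI[of _ "integral {0..\<tau>} (\<lambda>t. q c (?\<beta> t) ?v ?v)"]) auto
qed

lemma local_bounds:
  assumes c: "c \<in> A" and p: "p \<in> dm c" and S: "open S" "p \<in> S"
  shows "\<exists>r l L. 0 < r \<and> 0 < l \<and> 0 < L \<and> cball (co c p) r \<subseteq> co c ` (dm c \<inter> S) \<and>
    (\<forall>x\<in>cball (co c p) r. \<forall>v. l * (norm v)\<^sup>2 \<le> q c x v v \<and> q c x v v \<le> L * (norm v)\<^sup>2)"
proof -
  interpret c: chart_metric "im c" "G c" by (rule chart_metric_chart[OF c])
  have "open (co c ` (dm c \<inter> S))" by (rule open_co_image[OF c S(1)])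
  then obtain r where r: "r > 0" "cball (co c p) r \<subseteq> co c ` (dm c \<inter> S)"
    using p S open_contains_cball by blast
  have "cball (co c p) r \<subseteq> im c" using r(2) by blast
  then obtain l L where "0 < l" "0 < L" "\<forall>x\<in>cball (co c p) r. \<forall>v. l * (norm v)\<^sup>2 \<le> q c x v v \<and> q c x v v \<le> L * (norm v)\<^sup>2"
    using c.g_bounds[OF compact_cball] by meson
  then show ?thesis using r by blast
qed

text \<open>The coordinate segment in time sqrt L times |y - x|: its squared speed is at most 1, so
  its energy is at most its duration.\<close>

lemma ball_path:
  assumes c: "c \<in> A" and r: "cball x0 r \<subseteq> co c ` (dm c \<inter> S)" and L: "0 < L"
    "\<And>x v. x \<in> cball x0 r \<Longrightarrow> q c x v v \<le> L * (norm v)\<^sup>2"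
    and xy: "x \<in> cball x0 r" "y \<in> cball x0 r"
  shows "\<exists>\<tau> e. path S (ci c x) (ci c y) \<tau> e \<and> (\<tau> + e) / 2 \<le> sqrt L * norm (y - x)"
proof (cases "x = y")
  case True
  have "x \<in> co c ` (dm c \<inter> S)" using xy r by blast
  then have "ci c x \<in> S" using c by auto
  then show ?thesis using path_refl[of "ci c x" S] True by (intro exI[of _ 0]) auto
next
  case False
  define \<tau> where "\<tau> = sqrt L * norm (y - x)"
  have \<tau>: "\<tau> > 0" using L False by (simp add: \<tau>_def)
  have seg: "closed_segment x y \<subseteq> cball x0 r" using xy by (simp add: closed_segment_subset)
  have "\<exists>e. path S (ci c x) (ci c y) \<tau> e \<and> e \<le> \<tau> * 1"
  proof (rule segment_path[OF c \<tau>])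
    show "closed_segment x y \<subseteq> co c ` (dm c \<inter> S)" using seg r by blast
    fix u assume "u \<in> closed_segment x y"
    then have "q c u ((1 / \<tau>) *\<^sub>R (y - x)) ((1 / \<tau>) *\<^sub>R (y - x)) \<le> L * (norm ((1 / \<tau>) *\<^sub>R (y - x)))\<^sup>2"
      using seg by (intro L) auto
    also have "\<dots> = 1" using L False by (simp add: \<tau>_def power_mult_distrib power_divide)
    finally show "q c u ((1 / \<tau>) *\<^sub>R (y - x)) ((1 / \<tau>) *\<^sub>R (y - x)) \<le> 1" .
  qed
  then obtain e where "path S (ci c x) (ci c y) \<tau> e" "e \<le> \<tau>" by auto
  then show ?thesis unfolding \<tau>_def[symmetric] by (intro exI[of _ \<tau>] exI[of _ e]) auto
qed

text \<open>Points of a small coordinate ball are joined by segments, so the set of points reachable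
  from y and its complement are both open.\<close>

lemma path_connected_manifold: "\<exists>\<tau> e. path UNIV y z \<tau> e"
proof -
  let ?R = "\<lambda>y z. \<exists>\<tau> e. path UNIV y z \<tau> e"
  have loc: "\<exists>N. open N \<and> p \<in> N \<and> (\<forall>u\<in>N. \<forall>v\<in>N. ?R u v)" for p
  proof -
    obtain c where c: "c \<in> A" "p \<in> dm c" using ex_chart by blast
    obtain r l L where r: "0 < r" "0 < L" "cball (co c p) r \<subseteq> co c ` (dm c \<inter> UNIV)"
      "\<And>x v. x \<in> cball (co c p) r \<Longrightarrow> q c x v v \<le> L * (norm v)\<^sup>2"
      using local_bounds[OF c open_UNIV UNIV_I] by blast
    have "open (ci c ` ball (co c p) r)"
      using r(3) ball_subset_cball by (intro open_ci_image[OF c(1)]) auto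
    moreover have "p \<in> ci c ` ball (co c p) r"
      using r(1) c by (intro image_eqI[of _ _ "co c p"]) auto
    moreover have "?R u v" if uv: "u \<in> ci c ` ball (co c p) r" "v \<in> ci c ` ball (co c p) r" for u v
    proof -
      obtain x y where xy: "u = ci c x" "v = ci c y" "x \<in> ball (co c p) r" "y \<in> ball (co c p) r"
        using uv by blast
      show ?thesis
        using ball_path[OF c(1) r(3,2,4), of x y] xy by auto
    qed
    ultimately show ?thesis by blast
  qed
  have o1: "open {z. ?R y z}"
  proof (rule Topological_Spaces.openI)
    fix z assume z: "z \<in> {z. ?R y z}"
    obtain N where "open N" "z \<in> N" "\<forall>u\<in>N. \<forall>v\<in>N. ?R u v" using loc by blast
    then show "\<exists>T. open T \<and> z \<in> T \<and> T \<subseteq> {z. ?R y z}"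
      using z path.trans by (intro exI[of _ N]) blast
  qed
  have o2: "open {z. \<not> ?R y z}"
  proof (rule Topological_Spaces.openI)
    fix z assume z: "z \<in> {z. \<not> ?R y z}"
    obtain N where "open N" "z \<in> N" "\<forall>u\<in>N. \<forall>v\<in>N. ?R u v" using loc by blast
    then show "\<exists>T. open T \<and> z \<in> T \<and> T \<subseteq> {z. \<not> ?R y z}"
      using z path.trans by (intro exI[of _ N]) blast
  qed
  have "{z. ?R y z} = UNIV"
  proof (rule ccontr)
    assume "{z. ?R y z} \<noteq> UNIV"
    moreover have "y \<in> {z. ?R y z}" using path_refl by blast
    ultimately show False
      using connectedD[OF connected o1 o2] by blast
  qed
  then show ?thesis by blast
qed

text \<open>Both summands are additive under concatenation; by rescaling time, the infimum is that of \<open>sqrt (\<tau> * e)\<close>,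
  which is the Riemannian distance.\<close>

definition mdist :: "'a \<Rightarrow> 'a \<Rightarrow> real"
  where "mdist y z = Inf {(\<tau> + e) / 2 | \<tau> e. path UNIV y z \<tau> e}"

lemma mdist_le:
  assumes "path UNIV y z \<tau> e"
  shows "mdist y z \<le> (\<tau> + e) / 2"
  unfolding mdist_def
proof (rule cInf_lower)
  show "(\<tau> + e) / 2 \<in> {(\<tau> + e) / 2 | \<tau> e. path UNIV y z \<tau> e}" using assms by blast
  show "bdd_below {(\<tau> + e) / 2 | \<tau> e. path UNIV y z \<tau> e}"
    by (rule bdd_belowI[of _ 0]) (auto dest!: path_nonneg)
qed

lemma mdist_greatest:
  assumes "\<And>\<tau> e. path UNIV y z \<tau> e \<Longrightarrow> m \<le> (\<tau> + e) / 2"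
  shows "m \<le> mdist y z"
  unfolding mdist_def
proof (rule cInf_greatest)
  show "{(\<tau> + e) / 2 | \<tau> e. path UNIV y z \<tau> e} \<noteq> {}"
    using path_connected_manifold[of y z] by blast
qed (use assms in blast)

lemma mdist_nonneg: "0 \<le> mdist y z"
  by (rule mdist_greatest) (use path_nonneg in fastforce)

lemma mdist_refl [simp]: "mdist y y = 0"
  using mdist_le[OF path_refl[of y UNIV]] mdist_nonneg[of y y] by simp

lemma mdist_triangle: "mdist x z \<le> mdist x y + mdist y z"
proof -
  have "mdist x z - mdist x y \<le> mdist y z"
  proof (rule mdist_greatest)
    fix \<tau> e assume p: "path UNIV y z \<tau> e"
    have "mdist x z - (\<tau> + e) / 2 \<le> mdist x y"
    proof (rule mdist_greatest)
      fix \<tau>' e' assume "path UNIV x y \<tau>' e'"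
      from mdist_le[OF path.trans[OF this p]] show "mdist x z - (\<tau> + e) / 2 \<le> (\<tau>' + e') / 2"
        by (simp add: field_simps)
    qed
    then show "mdist x z - mdist x y \<le> (\<tau> + e) / 2" by linarith
  qed
  then show ?thesis by simp
qed

text \<open>Rescale so that duration and energy agree, the case of equality between arithmetic and
  geometric mean. If the energy is 0, the duration can be made arbitrarily short.\<close>

lemma mdist_le_sqrt:
  assumes p: "path UNIV y z \<tau> e" and "0 < \<tau>"
  shows "mdist y z \<le> sqrt (\<tau> * e)"
proof (cases "e = 0")
  case True
  have "mdist y z \<le> \<epsilon>" if "\<epsilon> > 0" for \<epsilon>
    using mdist_le[OF path_rescale[OF p, of "\<epsilon> / \<tau>"]] that assms True by simp
  then have "mdist y z \<le> 0" by (meson field_le_epsilon add_0 linorder_not_le dense_ge)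
  then show ?thesis using True by simp
next
  case False
  then have e: "e > 0" using path_nonneg[OF p] by simp
  define k where "k = sqrt (e / \<tau>)"
  have k: "k > 0" using e assms by (simp add: k_def)
  have "\<tau> * e = (e / \<tau>) * \<tau>\<^sup>2" using assms by (simp add: power2_eq_square)
  then have "sqrt (\<tau> * e) = sqrt (e / \<tau>) * sqrt (\<tau>\<^sup>2)" by (metis real_sqrt_mult)
  then have 1: "k * \<tau> = sqrt (\<tau> * e)" using assms by (simp add: k_def)
  have "k * k = e / \<tau>" using e assms by (simp add: k_def)
  then have "e / k = k * \<tau>" using k assms by (simp add: field_simps)
  with 1 have "k * \<tau> = sqrt (\<tau> * e)" "e / k = sqrt (\<tau> * e)" by auto
  then show ?thesis using mdist_le[OF path_rescale[OF p k]] by simp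
qed

lemma mdist_local_upper:
  "\<exists>c N L. c \<in> A \<and> p \<in> dm c \<and> open N \<and> p \<in> N \<and> N \<subseteq> dm c \<and>
    (\<forall>u\<in>N. \<forall>v\<in>N. mdist u v \<le> L * norm (co c v - co c u))"
proof -
  obtain c where c: "c \<in> A" "p \<in> dm c" using ex_chart by blast
  obtain r l L where r: "0 < r" "0 < L" "cball (co c p) r \<subseteq> co c ` (dm c \<inter> UNIV)"
    "\<And>x v. x \<in> cball (co c p) r \<Longrightarrow> q c x v v \<le> L * (norm v)\<^sup>2"
    using local_bounds[OF c open_UNIV UNIV_I] by blast
  have im: "cball (co c p) r \<subseteq> im c" using r(3) by auto
  let ?N = "ci c ` ball (co c p) r"
  have "open ?N"
    using im ball_subset_cball by (intro open_ci_image[OF c(1)]) auto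
  moreover have "p \<in> ?N"
    using r(1) c by (intro image_eqI[of _ _ "co c p"]) auto
  moreover have "?N \<subseteq> dm c" using im by (auto simp: subset_iff)
  moreover have "mdist u v \<le> sqrt L * norm (co c v - co c u)" if uv: "u \<in> ?N" "v \<in> ?N" for u v
  proof -
    obtain x y where xy: "u = ci c x" "v = ci c y" "x \<in> cball (co c p) r" "y \<in> cball (co c p) r"
      using uv by auto
    obtain \<tau> e where "path UNIV (ci c x) (ci c y) \<tau> e" "(\<tau> + e) / 2 \<le> sqrt L * norm (y - x)"
      using ball_path[OF c(1) r(3,2,4) xy(3,4)] by blast
    then show ?thesis using mdist_le[of u v \<tau> e] xy im by (auto simp: subset_iff)
  qed
  ultimately show ?thesis using c by blast
qed

text \<open>The auxiliary bound mentions both orders of the arguments, so that no symmetry of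
  \<open>mdist\<close> is invoked; \<open>mdist_local_upper\<close> bounds both.\<close>

lemma mdist_continuous: "continuous_on UNIV (\<lambda>u. mdist z u)" "continuous_on UNIV (\<lambda>u. mdist u z)"
proof -
  have *: "continuous_on UNIV f" if f: "\<And>u v. \<bar>f u - f v\<bar> \<le> max (mdist u v) (mdist v u)" for f :: "'a \<Rightarrow> real"
  proof (rule continuous_at_imp_continuous_on, rule ballI)
    fix p
    obtain c N L where N: "c \<in> A" "p \<in> dm c" "open N" "p \<in> N" "N \<subseteq> dm c"
      "\<And>u v. u \<in> N \<Longrightarrow> v \<in> N \<Longrightarrow> mdist u v \<le> L * norm (co c v - co c u)"
      using mdist_local_upper[of p] by blast
    have "continuous_on N (co c)" using cont_co[OF N(1)] N(5) continuous_on_subset by blast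
    then have "(co c \<longlongrightarrow> co c p) (at p)"
      using N(3,4) by (simp add: continuous_on_eq_continuous_at isCont_def)
    then have lim: "((\<lambda>u. L * norm (co c u - co c p)) \<longlongrightarrow> 0) (at p)"
      by (auto intro!: tendsto_eq_intros)
    have "eventually (\<lambda>u. norm (f u - f p) \<le> L * norm (co c u - co c p)) (at p)"
      unfolding eventually_at_topological
    proof (intro exI[of _ N] conjI N ballI impI)
      fix u assume "u \<in> N"
      then show "norm (f u - f p) \<le> L * norm (co c u - co c p)"
        using f[of u p] N(6)[of u p] N(6)[of p u] N(4) by (simp add: norm_minus_commute)
    qed
    from Lim_null_comparison[OF this lim] show "isCont f p"
      unfolding isCont_def by (rule LIM_zero_cancel)
  qed
  show "continuous_on UNIV (\<lambda>u. mdist z u)"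
    by (rule *) (use mdist_triangle[of z] in \<open>smt (verit)\<close>)
  show "continuous_on UNIV (\<lambda>u. mdist u z)"
    by (rule *) (use mdist_triangle[of _ z] in \<open>smt (verit)\<close>)
qed

text \<open>Cut at the first exit from Q: before it the piece lies in Q, and the exit point lies in
  the closed set S. The disjunction, with an initial portion of no larger duration and energy, is
  what the induction over concatenations can carry.\<close>

lemma path_localize:
  assumes Q: "open Q" and S: "closed S" "Q \<subseteq> S"
  shows "path UNIV y z \<tau> e \<Longrightarrow> y \<in> Q \<Longrightarrow>
    path S y z \<tau> e \<or> (\<exists>u \<tau>1 e1. u \<in> S \<and> u \<notin> Q \<and> path S y u \<tau>1 e1 \<and> \<tau>1 \<le> \<tau> \<and> e1 \<le> e)"
proof (induction rule: path.induct)
  case (piece c a b \<beta> \<beta>')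
  let ?\<sigma> = "\<lambda>t. ci c (\<beta> t)"
  let ?q = "\<lambda>t. q c (\<beta> t) (\<beta>' t) (\<beta>' t)"
  note p = piece_continuous[OF piece(1,3-5)]
  have \<beta>im: "\<beta> t \<in> co c ` (dm c \<inter> S)" if "t \<in> {a..b}" "?\<sigma> t \<in> S" for t
    using that piece(5) by (auto intro!: image_eqI[of _ _ "?\<sigma> t"])
  show ?case
  proof (cases "\<forall>t\<in>{a..b}. ?\<sigma> t \<in> Q")
    case True
    then have "path S (?\<sigma> a) (?\<sigma> b) (b - a) (integral {a..b} ?q)"
      using S piece(2) by (intro path.piece[OF piece(1-4)]) (auto intro!: \<beta>im)
    then show ?thesis by blast
  next
    case False
    \<comment> \<open>The times outside Q form a closed set, so a first one exists.\<close>
    let ?B = "{a..b} \<inter> ?\<sigma> -` (- Q)"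
    have "closed ?B"
      by (rule continuous_closed_preimage[OF p(2) closed_atLeastAtMost closed_Compl[OF Q]])
    moreover have "?B \<noteq> {}" using False by auto
    moreover have "bdd_below ?B" by (rule bdd_belowI[of _ a]) auto
    ultimately have inf: "Inf ?B \<in> ?B" by (rule closed_contains_Inf[rotated 2])
    define t1 where "t1 = Inf ?B"
    have t1: "a \<le> t1" "t1 \<le> b" "?\<sigma> t1 \<notin> Q" using inf by (auto simp: t1_def)
    have before: "?\<sigma> t \<in> Q" if "a \<le> t" "t < t1" for t
    proof (rule ccontr)
      assume "?\<sigma> t \<notin> Q"
      then have "t \<in> ?B" using that t1 by auto
      then have "t1 \<le> t" unfolding t1_def by (rule cInf_lower) (rule bdd_belowI[of _ a], auto)
      then show False using that by simp
    qed
    have "a < t1" using t1 piece(6) by (metis order_le_less)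
    have "?\<sigma> ` closure {a..<t1} \<subseteq> S"
    proof (rule image_closure_subset[OF _ S(1)])
      show "continuous_on (closure {a..<t1}) ?\<sigma>"
        by (rule continuous_on_subset[OF p(2)]) (use \<open>a < t1\<close> t1 in auto)
      show "?\<sigma> ` {a..<t1} \<subseteq> S" using before S(2) by auto
    qed
    then have inS: "?\<sigma> t \<in> S" if "t \<in> {a..t1}" for t using that \<open>a < t1\<close> by auto
    have "path S (?\<sigma> a) (?\<sigma> t1) (t1 - a) (integral {a..t1} ?q)"
      by (rule subpiece[OF piece(1,3,4)]) (use t1 inS in \<open>auto intro!: \<beta>im\<close>)
    moreover have "integral {a..t1} ?q \<le> integral {a..b} ?q"
      by (rule integral_subset_le)
        (use t1 p(4) in \<open>auto intro!: integrable_continuous_real continuous_on_subset[OF p(3)]\<close>)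
    ultimately show ?thesis using t1 inS[of t1] \<open>a < t1\<close>
      by (intro disjI2 exI[of _ "?\<sigma> t1"] exI[of _ "t1 - a"] exI[of _ "integral {a..t1} ?q"]) auto
  qed
next
  case (trans x y \<tau>1 e1 z \<tau>2 e2)
  note n = path_nonneg[OF trans.hyps(1)] path_nonneg[OF trans.hyps(2)]
  consider "path S x y \<tau>1 e1" "y \<in> Q" | "path S x y \<tau>1 e1" "y \<notin> Q"
    | "\<exists>u \<tau>' e'. u \<in> S \<and> u \<notin> Q \<and> path S x u \<tau>' e' \<and> \<tau>' \<le> \<tau>1 \<and> e' \<le> e1"
    using trans.IH(1) trans.prems by blast
  then show ?case
  proof cases
    case 1
    from trans.IH(2)[OF 1(2)] show ?thesis
    proof
      assume "path S y z \<tau>2 e2"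
      then show ?thesis using path.trans[OF 1(1)] by blast
    next
      assume "\<exists>u \<tau>1 e1. u \<in> S \<and> u \<notin> Q \<and> path S y u \<tau>1 e1 \<and> \<tau>1 \<le> \<tau>2 \<and> e1 \<le> e2"
      then obtain u \<tau>' e' where "u \<in> S" "u \<notin> Q" "path S y u \<tau>' e'" "\<tau>' \<le> \<tau>2" "e' \<le> e2" by blast
      then show ?thesis using path.trans[OF 1(1)]
        by (intro disjI2 exI[of _ u] exI[of _ "\<tau>1 + \<tau>'"] exI[of _ "e1 + e'"]) auto
    qed
  next
    case 2
    then show ?thesis using n path_endpoints[OF 2(1)]
      by (intro disjI2 exI[of _ y] exI[of _ \<tau>1] exI[of _ e1]) auto
  next
    case 3
    then show ?thesis using n by (smt (verit))
  qed
qed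

text \<open>A calibration: if \<Psi>, as a function of time and position, grows along every curve at
  most at the rate of its energy density, then its total increase bounds the energy from below.
  Pieces given in other charts are transferred to c, where their energy density is the same;
  \<theta> is the offset between the time of a piece and the total time.\<close>

lemma path_calibrate:
  assumes c: "c \<in> A" and S: "S \<subseteq> dm c"
    and cal: "\<And>\<beta> v s I \<theta>. (\<beta> has_vector_derivative v) (at s within I) \<Longrightarrow> \<beta> s \<in> co c ` S \<Longrightarrow> 0 \<le> \<theta> + s \<Longrightarrow> \<theta> + s \<le> T \<Longrightarrow>
       \<exists>D. ((\<lambda>r. \<Psi> (\<theta> + r) (\<beta> r)) has_real_derivative D) (at s within I) \<and> D \<le> q c (\<beta> s) v v"
  shows "path S y z \<tau> e \<Longrightarrow> 0 \<le> t0 \<Longrightarrow> t0 + \<tau> \<le> T \<Longrightarrow> \<Psi> (t0 + \<tau>) (co c z) - \<Psi> t0 (co c y) \<le> e"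
proof (induction arbitrary: t0 rule: path.induct)
  case (piece d a b \<beta> \<beta>')
  note p = piece_continuous[OF piece(1,3-5)]
  let ?\<sigma> = "\<lambda>t. ci d (\<beta> t)" and ?q = "\<lambda>t. q d (\<beta> t) (\<beta>' t) (\<beta>' t)"
  let ?\<alpha> = "\<lambda>t. tr d c (\<beta> t)"
  have \<sigma>: "?\<sigma> t \<in> dm d" "?\<sigma> t \<in> S" "co d (?\<sigma> t) = \<beta> t" if "t \<in> {a..b}" for t
  proof -
    obtain x where "\<beta> t = co d x" "x \<in> dm d" "x \<in> S" using piece(5) \<open>t \<in> {a..b}\<close> by blast
    then show "?\<sigma> t \<in> dm d" "?\<sigma> t \<in> S" "co d (?\<sigma> t) = \<beta> t" using piece(1) by auto
  qed
  have "\<exists>D. ((\<lambda>r. \<Psi> (t0 - a + r) (?\<alpha> r)) has_real_derivative D) (at t within {a..b}) \<and> D \<le> ?q t" if t: "t \<in> {a..b}" for t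
  proof -
    have sc: "?\<sigma> t \<in> dm c" using \<sigma>(2)[OF t] S by blast
    have "(tr d c has_derivative jac d c (?\<sigma> t)) (at (\<beta> t) within \<beta> ` {a..b})"
      using tr_works[OF piece(1) c \<sigma>(1)[OF t] sc] \<sigma>(3)[OF t] by (simp add: has_derivative_at_withinI)
    with piece(3) t have "((tr d c \<circ> \<beta>) has_vector_derivative jac d c (?\<sigma> t) (\<beta>' t)) (at t within {a..b})"
      by (intro vector_derivative_diff_chain_within) auto
    then have \<alpha>': "(?\<alpha> has_vector_derivative jac d c (?\<sigma> t) (\<beta>' t)) (at t within {a..b})"
      by (simp add: o_def)
    have "?\<alpha> t = co c (?\<sigma> t)" using in_chart_co[OF piece(1) \<sigma>(1)[OF t], of "co c"] \<sigma>(3)[OF t] by simp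
    moreover have "q c (co c (?\<sigma> t)) (jac d c (?\<sigma> t) (\<beta>' t)) (jac d c (?\<sigma> t) (\<beta>' t)) = ?q t"
      using q_jac[OF piece(1) c \<sigma>(1)[OF t] sc] \<sigma>(3)[OF t] by simp
    ultimately show ?thesis
      using cal[OF \<alpha>', of "t0 - a"] \<sigma>(2)[OF t] t piece(6,7) by auto
  qed
  then have "\<forall>t\<in>{a..b}. \<exists>D. ((\<lambda>r. \<Psi> (t0 - a + r) (?\<alpha> r)) has_real_derivative D) (at t within {a..b}) \<and> D \<le> ?q t"
    by blast
  from bchoice[OF this] obtain D where D: "\<And>t. t \<in> {a..b} \<Longrightarrow> ((\<lambda>r. \<Psi> (t0 - a + r) (?\<alpha> r)) has_real_derivative D t) (at t within {a..b})"
    "\<And>t. t \<in> {a..b} \<Longrightarrow> D t \<le> ?q t" by blast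
  have "(D has_integral \<Psi> (t0 - a + b) (?\<alpha> b) - \<Psi> (t0 - a + a) (?\<alpha> a)) {a..b}"
    by (rule fundamental_theorem_of_calculus[OF piece(2)])
      (use D(1) in \<open>auto simp: has_real_derivative_iff_has_vector_derivative\<close>)
  then have "\<Psi> (t0 - a + b) (?\<alpha> b) - \<Psi> (t0 - a + a) (?\<alpha> a) \<le> integral {a..b} ?q"
    by (rule has_integral_le[OF _ integrable_integral[OF integrable_continuous_real[OF p(3)]]]) (rule D(2))
  moreover have "?\<alpha> t = co c (?\<sigma> t)" if "t \<in> {a..b}" for t
    using in_chart_co[OF piece(1) \<sigma>(1)[OF that], of "co c"] \<sigma>(3)[OF that] by simp
  ultimately show ?case using piece(2) by (simp add: algebra_simps)
next
  case (trans x y \<tau>1 e1 z \<tau>2 e2)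
  have "\<Psi> (t0 + \<tau>1) (co c y) - \<Psi> t0 (co c x) \<le> e1"
    using trans.prems path_nonneg[OF trans.hyps(2)] by (intro trans.IH(1)) auto
  moreover have "\<Psi> (t0 + \<tau>1 + \<tau>2) (co c z) - \<Psi> (t0 + \<tau>1) (co c y) \<le> e2"
    using trans.prems path_nonneg[OF trans.hyps(1)] by (intro trans.IH(2)) auto
  ultimately show ?case by (simp add: add.assoc)
qed

text \<open>Calibrated by a linear function minus time: in the direction u from y to z it grows at
  rate at most 2 sqrt(l) |v| - 1, which is at most l |v|^2.\<close>

lemma path_lower_bound:
  assumes c: "c \<in> A" and S: "S \<subseteq> dm c" and l: "0 < l" "\<And>x v. x \<in> co c ` S \<Longrightarrow> l * (norm v)\<^sup>2 \<le> q c x v v"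
    and p: "path S y z \<tau> e"
  shows "sqrt l * norm (co c z - co c y) \<le> (\<tau> + e) / 2"
proof -
  define u where "u = sgn (co c z - co c y)"
  have nu: "norm u \<le> 1" by (simp add: u_def norm_sgn)
  have "(2 * sqrt l * (co c z \<bullet> u) - (0 + \<tau>)) - (2 * sqrt l * (co c y \<bullet> u) - 0) \<le> e"
  proof (rule path_calibrate[OF c S _ p, where \<Psi> = "\<lambda>t x. 2 * sqrt l * (x \<bullet> u) - t" and T = \<tau>])
    fix \<beta> v s I \<theta>
    assume \<beta>: "(\<beta> has_vector_derivative v) (at s within I)" "\<beta> s \<in> co c ` S"
    have "((\<lambda>r. \<beta> r \<bullet> u) has_real_derivative v \<bullet> u) (at s within I)"
      using bounded_linear.has_vector_derivative[OF bounded_linear_inner_left \<beta>(1)]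
      by (simp add: has_real_derivative_iff_has_vector_derivative)
    then have 1: "((\<lambda>r. 2 * sqrt l * (\<beta> r \<bullet> u) - (\<theta> + r)) has_real_derivative 2 * sqrt l * (v \<bullet> u) - 1) (at s within I)"
      by (auto intro!: derivative_eq_intros)
    have "v \<bullet> u \<le> norm v * 1"
      using norm_cauchy_schwarz[of v u] mult_left_mono[OF nu, of "norm v"] by simp
    then have "2 * sqrt l * (v \<bullet> u) \<le> 2 * sqrt l * norm v" using l(1) by simp
    also have "\<dots> \<le> l * (norm v)\<^sup>2 + 1"
      using sum_squares_bound[of "sqrt l * norm v" 1] l(1) by (simp add: power_mult_distrib)
    finally have "2 * sqrt l * (v \<bullet> u) - 1 \<le> q c (\<beta> s) v v" using l(2)[OF \<beta>(2), of v] by simp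
    with 1 show "\<exists>D. ((\<lambda>r. 2 * sqrt l * (\<beta> r \<bullet> u) - (\<theta> + r)) has_real_derivative D) (at s within I) \<and> D \<le> q c (\<beta> s) v v"
      by blast
  qed auto
  moreover have "(co c z - co c y) \<bullet> u = norm (co c z - co c y)"
    by (cases "co c z = co c y") (simp_all add: u_def sgn_div_norm dot_square_norm power2_eq_square)
  then have "2 * sqrt l * (co c z \<bullet> u) - 2 * sqrt l * (co c y \<bullet> u) = 2 * (sqrt l * norm (co c z - co c y))"
    by (metis inner_diff_left mult.assoc right_diff_distrib)
  ultimately show ?thesis by simp
qed

lemma closed_ci_cball:
  assumes c: "c \<in> A" and r: "cball x0 r \<subseteq> im c"
  shows "compact (ci c ` cball x0 r)" "closed (ci c ` cball x0 r)" "ci c ` cball x0 r \<subseteq> dm c"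
    "open (ci c ` ball x0 r)" "co c ` (ci c ` cball x0 r) = cball x0 r"
proof -
  show "compact (ci c ` cball x0 r)"
    by (intro compact_continuous_image compact_cball continuous_on_subset[OF cont_ci[OF c]] r)
  then show "closed (ci c ` cball x0 r)" by (rule compact_imp_closed)
  show "ci c ` cball x0 r \<subseteq> dm c" using r by (auto simp: subset_iff)
  show "open (ci c ` ball x0 r)" using r ball_subset_cball by (intro open_ci_image[OF c]) auto
  have "co c (ci c x) = x" if "x \<in> cball x0 r" for x using r that by auto
  then show "co c ` (ci c ` cball x0 r) = cball x0 r" by (simp add: image_image)
qed

text \<open>An initial portion that reaches the boundary of the coordinate ball already costs
  \<open>sqrt l * r\<close>.\<close>

lemma path_stays:
  assumes c: "c \<in> A" and r: "0 < r" "cball (co c p) r \<subseteq> im c" and p: "p \<in> dm c"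
    and l: "0 < l" "\<And>x v. x \<in> cball (co c p) r \<Longrightarrow> l * (norm v)\<^sup>2 \<le> q c x v v"
    and path: "path UNIV p y \<tau> e" and cost: "(\<tau> + e) / 2 < sqrt l * r"
  shows "path (ci c ` cball (co c p) r) p y \<tau> e"
proof -
  let ?S = "ci c ` cball (co c p) r" and ?Q = "ci c ` ball (co c p) r"
  note S = closed_ci_cball[OF c r(2)]
  have pO: "p \<in> ?Q" using r(1) p c by (intro image_eqI[of _ _ "co c p"]) auto
  have l': "\<And>x v. x \<in> co c ` ?S \<Longrightarrow> l * (norm v)\<^sup>2 \<le> q c x v v" using l(2) unfolding S(5) .
  have "?Q \<subseteq> ?S" by (intro image_mono ball_subset_cball)
  from path_localize[OF S(4,2) this path pO] show ?thesis
  proof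
    assume "\<exists>u \<tau>1 e1. u \<in> ?S \<and> u \<notin> ?Q \<and> path ?S p u \<tau>1 e1 \<and> \<tau>1 \<le> \<tau> \<and> e1 \<le> e"
    then obtain u \<tau>1 e1 where u: "u \<in> ?S" "u \<notin> ?Q" "path ?S p u \<tau>1 e1" "\<tau>1 \<le> \<tau>" "e1 \<le> e" by blast
    obtain x where x: "u = ci c x" "x \<in> cball (co c p) r" using u(1) by blast
    have "x \<notin> ball (co c p) r" using u(2) x(1) by blast
    then have "r \<le> norm (co c u - co c p)"
      using x r(2) by (auto simp: dist_norm norm_minus_commute subset_iff)
    then have "sqrt l * r \<le> sqrt l * norm (co c u - co c p)" using l(1) by simp
    also have "\<dots> \<le> (\<tau>1 + e1) / 2" by (rule path_lower_bound[OF c S(3) l(1) l' u(3)])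
    also have "\<dots> \<le> (\<tau> + e) / 2" using u(4,5) by simp
    also note cost
    finally show ?thesis by simp
  qed
qed

text \<open>A path cheaper than \<open>sqrt l * r\<close> stays in the ball and obeys the coordinate
  bound; any other path exceeds the largest value that the bound can take in the ball.\<close>

lemma mdist_lower:
  assumes c: "c \<in> A" and r: "0 < r" "cball (co c p) r \<subseteq> im c" and p: "p \<in> dm c"
    and l: "0 < l" "\<And>x v. x \<in> cball (co c p) r \<Longrightarrow> l * (norm v)\<^sup>2 \<le> q c x v v"
    and y: "mdist p y < sqrt l * r"
  shows "y \<in> ci c ` cball (co c p) r" "sqrt l * norm (co c y - co c p) \<le> mdist p y"
proof -
  let ?S = "ci c ` cball (co c p) r"
  note S = closed_ci_cball[OF c r(2)]
  have l': "\<And>x v. x \<in> co c ` ?S \<Longrightarrow> l * (norm v)\<^sup>2 \<le> q c x v v" using l(2) unfolding S(5) .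
  have ex: "\<exists>\<tau> e. path UNIV p y \<tau> e \<and> (\<tau> + e) / 2 < sqrt l * r"
    using mdist_greatest[of p y "sqrt l * r"] y by force
  then obtain \<tau> e where "path ?S p y \<tau> e" using path_stays[OF c r p l] by blast
  then show "y \<in> ?S" using path_endpoints by blast
  show "sqrt l * norm (co c y - co c p) \<le> mdist p y"
  proof (rule mdist_greatest)
    fix \<tau> e assume pa: "path UNIV p y \<tau> e"
    show "sqrt l * norm (co c y - co c p) \<le> (\<tau> + e) / 2"
    proof (cases "(\<tau> + e) / 2 < sqrt l * r")
      case True
      show ?thesis by (rule path_lower_bound[OF c S(3) l(1) l' path_stays[OF c r p l pa True]])
    next
      case False
      have "norm (co c y - co c p) \<le> r"
        using \<open>y \<in> ?S\<close> r(2) by (auto simp: dist_norm norm_minus_commute subset_iff)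
      then have "sqrt l * norm (co c y - co c p) \<le> sqrt l * r" using l(1) by simp
      then show ?thesis using False by simp
    qed
  qed
qed

lemma mdist_eq_0: "mdist p y = 0 \<Longrightarrow> y = p"
proof -
  assume d: "mdist p y = 0"
  obtain c where c: "c \<in> A" "p \<in> dm c" using ex_chart by blast
  obtain r l L where r: "0 < r" "0 < l" "cball (co c p) r \<subseteq> co c ` (dm c \<inter> UNIV)"
    "\<And>x v. x \<in> cball (co c p) r \<Longrightarrow> l * (norm v)\<^sup>2 \<le> q c x v v"
    using local_bounds[OF c open_UNIV UNIV_I] by blast
  have im: "cball (co c p) r \<subseteq> im c" using r(3) by auto
  have "mdist p y < sqrt l * r" using d r by simp
  note m = mdist_lower[OF c(1) r(1) im c(2) r(2,4) this]
  have "co c y = co c p" using m(2) d r(2) by (simp add: mult_le_0_iff)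
  moreover have "y \<in> dm c" using m(1) closed_ci_cball(3)[OF c(1) im] by blast
  ultimately show "y = p" using ci_co[OF c(1)] c(2) by metis
qed

text \<open>A small sphere around z is a closed subset of a compact coordinate ball, so the distance
  to x attains its minimum on it. Every path from z to x crosses the sphere and pays for both
  parts.\<close>

lemma sphere_step:
  "\<exists>d>0. \<forall>\<delta>. 0 < \<delta> \<longrightarrow> \<delta> \<le> d \<longrightarrow> \<delta> \<le> mdist z x \<longrightarrow> (\<exists>y. mdist z y = \<delta> \<and> \<delta> + mdist y x \<le> mdist z x)"
proof -
  obtain c where c: "c \<in> A" "z \<in> dm c" using ex_chart by blast
  obtain r l L where r: "0 < r" "0 < l" "cball (co c z) r \<subseteq> co c ` (dm c \<inter> UNIV)"
    "\<And>x v. x \<in> cball (co c z) r \<Longrightarrow> l * (norm v)\<^sup>2 \<le> q c x v v"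
    using local_bounds[OF c open_UNIV UNIV_I] by blast
  have im: "cball (co c z) r \<subseteq> im c" using r(3) by auto
  note S = closed_ci_cball[OF c(1) im]
  have "\<exists>y. mdist z y = \<delta> \<and> \<delta> + mdist y x \<le> mdist z x"
    if \<delta>: "0 < \<delta>" "\<delta> \<le> sqrt l * r / 2" "\<delta> \<le> mdist z x" for \<delta>
  proof -
    let ?K = "{y. mdist z y = \<delta>}"
    have "\<delta> < sqrt l * r" using \<delta> r by (smt (verit) field_sum_of_halves)
    then have "?K \<subseteq> ci c ` cball (co c z) r"
      using mdist_lower(1)[OF c(1) r(1) im c(2) r(2,4)] by auto
    moreover have "closed ?K"
      by (rule closed_Collect_eq[OF mdist_continuous(1) continuous_on_const])
    ultimately have K: "compact ?K"
      by (metis S(1) compact_Int_closed inf.absorb_iff2)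
    have cross: "\<exists>y. mdist z y = \<delta> \<and> mdist z y + mdist y x \<le> (\<tau> + e) / 2" if pa: "path UNIV z x \<tau> e" for \<tau> e
    proof -
      obtain u \<tau>1 e1 \<tau>2 e2 where u: "mdist z u = \<delta>" "path UNIV z u \<tau>1 e1" "path UNIV u x \<tau>2 e2" "\<tau> = \<tau>1 + \<tau>2" "e = e1 + e2"
        using path_crossing[OF pa mdist_continuous(1)[of z], of \<delta>] \<delta> by auto
      then show ?thesis using mdist_le[OF u(2)] mdist_le[OF u(3)]
        by (intro exI[of _ u] conjI) (auto simp: add_divide_distrib)
    qed
    have "?K \<noteq> {}" using cross path_connected_manifold[of z x] by blast
    then obtain y where y: "y \<in> ?K" "\<And>u. u \<in> ?K \<Longrightarrow> mdist y x \<le> mdist u x"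
      using continuous_attains_inf[OF K _ continuous_on_subset[OF mdist_continuous(2)[of x] subset_UNIV]] by blast
    have "\<delta> + mdist y x \<le> mdist z x"
    proof (rule mdist_greatest)
      fix \<tau> e assume "path UNIV z x \<tau> e"
      then obtain u where "mdist z u = \<delta>" "mdist z u + mdist u x \<le> (\<tau> + e) / 2" using cross by blast
      then show "\<delta> + mdist y x \<le> (\<tau> + e) / 2" using y(2)[of u] by simp
    qed
    then show ?thesis using y(1) by blast
  qed
  then show ?thesis using r by (intro exI[of _ "sqrt l * r / 2"]) auto
qed

end

section \<open>Geodesics and completeness\<close>

lemma smooth_on_cball_bounds:
  fixes F :: "'e::euclidean_space \<Rightarrow> 'b::real_normed_vector"
  assumes U: "open U" and F: "smooth_on U F" and K: "cball x0 r \<subseteq> U"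
  shows "\<exists>C>0. \<forall>x\<in>cball x0 r. norm (F x) \<le> C \<and> (\<forall>y\<in>cball x0 r. norm (F y - F x) \<le> C * norm (y - x) \<and>
     norm (F y - F x - bderiv F x (y - x)) \<le> C * (norm (y - x))\<^sup>2)"
proof -
  have bd: "\<exists>B. \<forall>x\<in>cball x0 r. norm (H x) \<le> B" if "smooth_on U H" for H :: "'e \<Rightarrow> 'c::real_normed_vector"
  proof -
    have "compact (H ` cball x0 r)"
      using smooth_on_continuous[OF that] K continuous_on_subset compact_continuous_image compact_cball by blast
    then show ?thesis using compact_imp_bounded bounded_iff by (metis imageI)
  qed
  have sm1: "smooth_on U (bderiv F)" by (rule smooth_on_bderiv[OF U F])
  obtain B0 where B0: "\<forall>x\<in>cball x0 r. norm (F x) \<le> B0" using bd[OF F] by blast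
  obtain B1 where B1: "\<forall>x\<in>cball x0 r. norm (bderiv F x) \<le> B1" using bd[OF sm1] by blast
  obtain B2 where B2: "\<forall>x\<in>cball x0 r. norm (bderiv (bderiv F) x) \<le> B2" using bd[OF smooth_on_bderiv[OF U sm1]] by blast
  have lip: "norm (H y - H x) \<le> B * norm (y - x)"
    if H: "smooth_on U H" and B: "\<forall>x\<in>cball x0 r. norm (bderiv H x) \<le> B" and xy: "x \<in> cball x0 r" "y \<in> cball x0 r"
    for H :: "'e \<Rightarrow> 'c::real_normed_vector" and B x y
  proof (rule differentiable_bound[of "cball x0 r" H "\<lambda>x. bderiv H x"])
    show "(H has_derivative bderiv H x) (at x within cball x0 r)" if "x \<in> cball x0 r" for x
      using bderiv_works[OF H] that K by (blast intro: has_derivative_at_withinI)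
    show "onorm (bderiv H x) \<le> B" if "x \<in> cball x0 r" for x
      using B that by (simp add: norm_blinfun.rep_eq)
  qed (use xy in auto)
  define C where "C = max (max B0 1) (max B1 B2)"
  have C: "C > 0" "B0 \<le> C" "B1 \<le> C" "B2 \<le> C" by (auto simp: C_def)
  have "norm (F y - F x) \<le> C * norm (y - x)" if "x \<in> cball x0 r" "y \<in> cball x0 r" for x y
    using lip[OF F B1 that] mult_right_mono[OF C(3), of "norm (y - x)"] by simp
  moreover have "norm (F y - F x - bderiv F x (y - x)) \<le> C * (norm (y - x))\<^sup>2" if xy: "x \<in> cball x0 r" "y \<in> cball x0 r" for x y
  proof -
    have seg: "closed_segment x y \<subseteq> cball x0 r" using xy by (simp add: closed_segment_subset)
    have "norm (F y - F x - bderiv F x (y - x)) \<le> norm (y - x) * (C * norm (y - x))"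
    proof (rule differentiable_bound_linearization[of x y "closed_segment x y"])
      show "x + t *\<^sub>R (y - x) \<in> closed_segment x y" if "t \<in> {0..1}" for t
        using that unfolding in_segment by (intro exI[of _ t]) (auto simp: algebra_simps)
      show "(F has_derivative bderiv F u) (at u within closed_segment x y)" if "u \<in> closed_segment x y" for u
        using bderiv_works[OF F] that K seg by (blast intro: has_derivative_at_withinI)
      show "onorm (blinfun_apply (bderiv F u) - blinfun_apply (bderiv F x)) \<le> C * norm (y - x)" if u: "u \<in> closed_segment x y" for u
      proof -
        have "blinfun_apply (bderiv F u) - blinfun_apply (bderiv F x) = blinfun_apply (bderiv F u - bderiv F x)"
          by (simp add: fun_eq_iff blinfun.diff_left)
        then have "onorm (blinfun_apply (bderiv F u) - blinfun_apply (bderiv F x)) = norm (bderiv F u - bderiv F x)"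
          by (simp only: norm_blinfun.rep_eq)
        also have "\<dots> \<le> B2 * norm (u - x)" by (rule lip[OF sm1 B2]) (use u seg xy in auto)
        also have "\<dots> \<le> C * norm (u - x)" using C(4) by (rule mult_right_mono) simp
        also have "\<dots> \<le> C * norm (y - x)"
          using segment_bound(1)[OF u] C(1) by (simp add: norm_minus_commute)
        finally show ?thesis .
      qed
    qed auto
    then show ?thesis by (simp add: power2_eq_square mult_ac)
  qed
  ultimately show ?thesis using B0 C by (intro exI[of _ C]) force
qed

text \<open>D times the decaying exponential is nonincreasing.\<close>

lemma gronwall:
  fixes D :: "real \<Rightarrow> real"
  assumes ab: "a \<le> b" and D: "\<And>t. a \<le> t \<Longrightarrow> t \<le> b \<Longrightarrow> (D has_real_derivative D' t) (at t)"
    and le: "\<And>t. a \<le> t \<Longrightarrow> t \<le> b \<Longrightarrow> D' t \<le> K * D t"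
  shows "D b \<le> D a * exp (K * (b - a))"
proof -
  let ?f = "\<lambda>t. D t * exp (- K * (t - a))"
  have "?f a \<ge> ?f b"
  proof (rule DERIV_nonpos_imp_nonincreasing[OF ab])
    fix t assume t: "a \<le> t" "t \<le> b"
    have "(?f has_real_derivative (D' t - K * D t) * exp (- K * (t - a))) (at t)"
      using D[OF t] by (auto intro!: derivative_eq_intros simp: algebra_simps)
    moreover have "(D' t - K * D t) * exp (- K * (t - a)) \<le> 0"
      using le[OF t] by (simp add: mult_nonpos_nonneg)
    ultimately show "\<exists>y. (?f has_real_derivative y) (at t) \<and> y \<le> 0" by blast
  qed
  then have "(D b * exp (- K * (b - a))) * exp (K * (b - a)) \<le> D a * exp (K * (b - a))"
    by (intro mult_right_mono) simp_all
  moreover have "(D b * exp (- K * (b - a))) * exp (K * (b - a)) = D b"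
    by (simp add: mult.assoc flip: exp_add)
  ultimately show ?thesis by (simp only:)
qed

section \<open>Speed, length and continuous dependence of geodesics\<close>

context riemannian_manifold begin

definition vel :: "('a, 'n) chart \<Rightarrow> (real \<Rightarrow> 'a) \<Rightarrow> real \<Rightarrow> real^'n"
  where "vel c \<gamma> t = vector_derivative (co c \<circ> \<gamma>) (at t)"

lemma geodesic_cont: "geodesic A g \<gamma> \<Longrightarrow> continuous_on UNIV \<gamma>"
  by (simp add: geodesic_def)

lemma geodesic_open_vimage: "geodesic A g \<gamma> \<Longrightarrow> open S \<Longrightarrow> open (\<gamma> -` S)"
  using geodesic_cont by (simp add: continuous_on_open_vimage)

lemma geodesic_iff:
  "geodesic A g \<gamma> \<longleftrightarrow> continuous_on UNIV \<gamma> \<and> (\<forall>c\<in>A. \<forall>t. \<gamma> t \<in> dm c \<longrightarrow> (co c \<circ> \<gamma>) differentiable (at t) \<and>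
    (vel c \<gamma> has_vector_derivative - \<Gamma> c (co c (\<gamma> t)) (vel c \<gamma> t) (vel c \<gamma> t)) (at t))"
proof -
  have "(\<chi> k. - (\<Sum>i\<in>UNIV. \<Sum>j\<in>UNIV. christoffel (G c) k i j x * v $ i * v $ j)) = - \<Gamma> c x v v" for c x v
    by (simp add: vec_eq_iff chrB_nth)
  then show ?thesis by (simp only: geodesic_def Let_def vel_def[abs_def])
qed

lemma geodesicD:
  assumes "geodesic A g \<gamma>" "c \<in> A" "\<gamma> t \<in> dm c"
  shows "((\<lambda>s. co c (\<gamma> s)) has_vector_derivative vel c \<gamma> t) (at t)"
    "(vel c \<gamma> has_vector_derivative - \<Gamma> c (co c (\<gamma> t)) (vel c \<gamma> t) (vel c \<gamma> t)) (at t)"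
  using assms unfolding geodesic_iff by (auto simp: vel_def vector_derivative_works o_def)

lemma velI: "((\<lambda>s. co c (\<gamma> s)) has_vector_derivative v) (at t) \<Longrightarrow> vel c \<gamma> t = v"
  unfolding vel_def o_def by (rule vector_derivative_at)

lemma geodesicI:
  assumes "continuous_on UNIV \<gamma>"
    and "\<And>c t. c \<in> A \<Longrightarrow> \<gamma> t \<in> dm c \<Longrightarrow> \<exists>v. ((\<lambda>s. co c (\<gamma> s)) has_vector_derivative v) (at t)"
    and "\<And>c t. c \<in> A \<Longrightarrow> \<gamma> t \<in> dm c \<Longrightarrow>
      (vel c \<gamma> has_vector_derivative - \<Gamma> c (co c (\<gamma> t)) (vel c \<gamma> t) (vel c \<gamma> t)) (at t)"
  shows "geodesic A g \<gamma>"
  using assms unfolding geodesic_iff o_def by (blast intro: differentiableI_vector)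

lemma vel_transform:
  assumes \<gamma>: "continuous_on UNIV \<gamma>" and c: "c \<in> A" "\<gamma> t \<in> dm c" and d: "d \<in> A" "\<gamma> t \<in> dm d"
    and v: "((\<lambda>s. co c (\<gamma> s)) has_vector_derivative v) (at t)"
  shows "((\<lambda>s. co d (\<gamma> s)) has_vector_derivative jac c d (\<gamma> t) v) (at t)"
proof -
  have "((\<lambda>s. tr c d (co c (\<gamma> s))) has_vector_derivative jac c d (\<gamma> t) v) (at t)"
    using vector_derivative_diff_chain_within[OF v has_derivative_at_withinI[OF tr_works[OF c(1) d(1) c(2) d(2)]]]
    by (simp add: o_def)
  moreover have "open (\<gamma> -` (dm c \<inter> dm d))"
    using \<gamma> open_domain c d by (simp add: continuous_on_open_vimage open_Int)
  ultimately show ?thesis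
    by (rule has_vector_derivative_transform_within_open) (use c d in auto)
qed

lemma geodesic_vel_jac:
  assumes "geodesic A g \<gamma>" "c \<in> A" "\<gamma> t \<in> dm c" "d \<in> A" "\<gamma> t \<in> dm d"
  shows "vel d \<gamma> t = jac c d (\<gamma> t) (vel c \<gamma> t)"
  by (rule velI) (rule vel_transform[OF geodesic_cont[OF assms(1)] assms(2-5) geodesicD(1)[OF assms(1-3)]])

lemma geodesic_affine:
  assumes \<gamma>: "geodesic A g \<gamma>"
  shows "geodesic A g (\<lambda>s. \<gamma> (k * s + a))"
    and "c \<in> A \<Longrightarrow> \<gamma> (k * t + a) \<in> dm c \<Longrightarrow> vel c (\<lambda>s. \<gamma> (k * s + a)) t = k *\<^sub>R vel c \<gamma> (k * t + a)"
proof -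
  let ?\<sigma> = "\<lambda>s. \<gamma> (k * s + a)"
  have aff: "((\<lambda>s. k * s + a) has_vector_derivative k) (at t)" for t
    by (auto intro!: derivative_eq_intros simp: has_real_derivative_iff_has_vector_derivative[symmetric])
  have d1: "((\<lambda>s. co c (?\<sigma> s)) has_vector_derivative k *\<^sub>R vel c \<gamma> (k * t + a)) (at t)"
    if c: "c \<in> A" "?\<sigma> t \<in> dm c" for c t
    using vector_diff_chain_at[OF aff geodesicD(1)[OF \<gamma> c]] by (simp add: o_def)
  show vel: "vel c ?\<sigma> t = k *\<^sub>R vel c \<gamma> (k * t + a)" if "c \<in> A" "?\<sigma> t \<in> dm c" for c t
    by (rule velI[OF d1[OF that]])
  have cont: "continuous_on UNIV ?\<sigma>"
    by (rule continuous_on_compose2[OF geodesic_cont[OF \<gamma>]]) (auto intro!: continuous_intros)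
  show "geodesic A g ?\<sigma>"
  proof (rule geodesicI[OF cont])
    fix c t assume c: "c \<in> A" "?\<sigma> t \<in> dm c"
    show "\<exists>v. ((\<lambda>s. co c (?\<sigma> s)) has_vector_derivative v) (at t)" using d1[OF c] by blast
    have "((\<lambda>s. k *\<^sub>R vel c \<gamma> (k * s + a)) has_vector_derivative k *\<^sub>R (k *\<^sub>R - \<Gamma> c (co c (?\<sigma> t)) (vel c \<gamma> (k * t + a)) (vel c \<gamma> (k * t + a)))) (at t)"
      using bounded_linear.has_vector_derivative[OF bounded_linear_scaleR_right vector_diff_chain_at[OF aff geodesicD(2)[OF \<gamma> c]]]
      by (simp add: o_def)
    moreover have "open (?\<sigma> -` dm c)" using cont open_domain[OF c(1)] by (simp add: continuous_on_open_vimage)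
    ultimately have "(vel c ?\<sigma> has_vector_derivative k *\<^sub>R (k *\<^sub>R - \<Gamma> c (co c (?\<sigma> t)) (vel c \<gamma> (k * t + a)) (vel c \<gamma> (k * t + a)))) (at t)"
      by (rule has_vector_derivative_transform_within_open) (use c vel in auto)
    then show "(vel c ?\<sigma> has_vector_derivative - \<Gamma> c (co c (?\<sigma> t)) (vel c ?\<sigma> t) (vel c ?\<sigma> t)) (at t)"
      by (simp add: vel[OF c] blinfun.bilinear_simps)
  qed
qed

text \<open>The chart is arbitrary; by \<open>speed2_eq\<close> the choice does not matter along
  geodesics.\<close>

definition speed2 :: "(real \<Rightarrow> 'a) \<Rightarrow> real \<Rightarrow> real"
  where "speed2 \<gamma> t = (let c = SOME c. c \<in> A \<and> \<gamma> t \<in> dm c in q c (co c (\<gamma> t)) (vel c \<gamma> t) (vel c \<gamma> t))"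

lemma speed2_eq:
  assumes \<gamma>: "geodesic A g \<gamma>" and c: "c \<in> A" "\<gamma> t \<in> dm c"
  shows "speed2 \<gamma> t = q c (co c (\<gamma> t)) (vel c \<gamma> t) (vel c \<gamma> t)"
proof -
  define d where "d = (SOME c. c \<in> A \<and> \<gamma> t \<in> dm c)"
  have d: "d \<in> A \<and> \<gamma> t \<in> dm d"
    unfolding d_def by (rule someI_ex) (use c in blast)
  then show ?thesis
    using q_jac[OF c(1) _ c(2), of d] geodesic_vel_jac[OF \<gamma> c, of d]
    by (simp add: speed2_def d_def[symmetric])
qed

lemma speed2_const:
  assumes \<gamma>: "geodesic A g \<gamma>"
  shows "speed2 \<gamma> t = speed2 \<gamma> 0"
proof -
  have "(speed2 \<gamma> has_real_derivative 0) (at t)" for t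
  proof -
    obtain c where c: "c \<in> A" "\<gamma> t \<in> dm c" using ex_chart by blast
    interpret c: chart_metric "im c" "G c" by (rule chart_metric_chart[OF c(1)])
    have x: "co c (\<gamma> t) \<in> im c" using c by simp
    have "((\<lambda>s. q c (co c (\<gamma> s)) (vel c \<gamma> s) (vel c \<gamma> s)) has_vector_derivative
      (bderiv (q c) (co c (\<gamma> t)) (vel c \<gamma> t) (vel c \<gamma> t) (vel c \<gamma> t)
       + q c (co c (\<gamma> t)) (- \<Gamma> c (co c (\<gamma> t)) (vel c \<gamma> t) (vel c \<gamma> t)) (vel c \<gamma> t)
       + q c (co c (\<gamma> t)) (vel c \<gamma> t) (- \<Gamma> c (co c (\<gamma> t)) (vel c \<gamma> t) (vel c \<gamma> t)))) (at t)"
      by (intro has_vector_derivative_blinfun2[where \<gamma> = "\<lambda>s. co c (\<gamma> s)"] c.dg_works[OF x] geodesicD[OF \<gamma> c])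
    then have "((\<lambda>s. q c (co c (\<gamma> s)) (vel c \<gamma> s) (vel c \<gamma> s)) has_vector_derivative 0) (at t)"
      by (simp add: c.compat[OF x] blinfun.bilinear_simps)
    moreover have "open (\<gamma> -` dm c)" by (rule geodesic_open_vimage[OF \<gamma> open_domain[OF c(1)]])
    ultimately have "(speed2 \<gamma> has_vector_derivative 0) (at t)"
      by (rule has_vector_derivative_transform_within_open) (use c speed2_eq[OF \<gamma> c(1)] in auto)
    then show ?thesis by (simp add: has_real_derivative_iff_has_vector_derivative)
  qed
  then show ?thesis by (intro DERIV_isconst_all) blast
qed

lemma speed2_chart:
  assumes "geodesic A g \<gamma>" "c \<in> A" "\<gamma> t \<in> dm c"
  shows "q c (co c (\<gamma> t)) (vel c \<gamma> t) (vel c \<gamma> t) = speed2 \<gamma> 0"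
  using speed2_eq[OF assms] speed2_const[OF assms(1), of t] by simp

lemma speed2_nonneg: "geodesic A g \<gamma> \<Longrightarrow> 0 \<le> speed2 \<gamma> 0"
proof -
  assume \<gamma>: "geodesic A g \<gamma>"
  obtain c where c: "c \<in> A" "\<gamma> 0 \<in> dm c" using ex_chart by blast
  then show ?thesis
    using chart_metric.g_nonneg[OF chart_metric_chart[OF c(1)]] speed2_chart[OF \<gamma> c] by (metis imageI)
qed

lemma speed2_affine: "geodesic A g \<gamma> \<Longrightarrow> speed2 (\<lambda>s. \<gamma> (k * s + a)) 0 = k\<^sup>2 * speed2 \<gamma> 0"
proof -
  assume \<gamma>: "geodesic A g \<gamma>"
  obtain c where c: "c \<in> A" "\<gamma> (k * 0 + a) \<in> dm c" using ex_chart by blast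
  show ?thesis
    using speed2_eq[OF geodesic_affine(1)[OF \<gamma>] c] geodesic_affine(2)[OF \<gamma> c] speed2_chart[OF \<gamma> c]
    by (simp add: blinfun.bilinear_simps power2_eq_square)
qed

text \<open>\<open>Bolzano\<close> stands in for a subdivision of the interval: the relation between
  a and b chains, and it holds on short intervals around each time, where one chart suffices. Later
  arguments along a geodesic follow the same scheme.\<close>

lemma geodesic_path:
  assumes \<gamma>: "geodesic A g \<gamma>" and ab: "a \<le> b"
  shows "path UNIV (\<gamma> a) (\<gamma> b) (b - a) ((b - a) * speed2 \<gamma> 0)"
  using ab
proof (induction rule: Bolzano)
  case (trans a b c)
  then show ?case using path.trans[of UNIV "\<gamma> a" "\<gamma> b" "b - a" _ "\<gamma> c" "c - b"]
    by (fastforce simp: algebra_simps)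
next
  case (local x)
  obtain c where c: "c \<in> A" "\<gamma> x \<in> dm c" using ex_chart by blast
  have "open (\<gamma> -` dm c)" by (rule geodesic_open_vimage[OF \<gamma> open_domain[OF c(1)]])
  then obtain d where d: "d > 0" "ball x d \<subseteq> \<gamma> -` dm c" using c(2) open_contains_ball by blast
  have "path UNIV (\<gamma> a) (\<gamma> b) (b - a) ((b - a) * speed2 \<gamma> 0)" if ab: "a \<le> x" "x \<le> b" "b - a < d" for a b
  proof -
    have dm: "\<gamma> t \<in> dm c" if "t \<in> {a..b}" for t
      using d(2) that ab by (auto simp: dist_real_def subset_iff)
    have cv: "continuous_on {a..b} (vel c \<gamma>)"
      by (intro continuous_at_imp_continuous_on ballI has_vector_derivative_continuous[OF geodesicD(2)[OF \<gamma> c(1) dm]])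
    have "path UNIV (ci c (co c (\<gamma> a))) (ci c (co c (\<gamma> b))) (b - a) (integral {a..b} (\<lambda>t. q c (co c (\<gamma> t)) (vel c \<gamma> t) (vel c \<gamma> t)))"
      by (rule path.piece[OF c(1), where \<beta> = "\<lambda>t. co c (\<gamma> t)"])
        (use ab dm cv geodesicD(1)[OF \<gamma> c(1)] in \<open>auto intro: has_vector_derivative_at_within\<close>)
    moreover have "integral {a..b} (\<lambda>t. q c (co c (\<gamma> t)) (vel c \<gamma> t) (vel c \<gamma> t)) = integral {a..b} (\<lambda>t. speed2 \<gamma> 0)"
      by (rule integral_cong) (use speed2_chart[OF \<gamma> c(1) dm] in simp)
    ultimately show ?thesis using c dm[of a] dm[of b] ab by simp
  qed
  then show ?case using d(1) by blast
qed

lemma geodesic_mdist: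
  assumes \<gamma>: "geodesic A g \<gamma>" and ab: "a \<le> b"
  shows "mdist (\<gamma> a) (\<gamma> b) \<le> (b - a) * sqrt (speed2 \<gamma> 0)"
proof (cases "a = b")
  case False
  then have "mdist (\<gamma> a) (\<gamma> b) \<le> sqrt ((b - a) * ((b - a) * speed2 \<gamma> 0))"
    using ab by (intro mdist_le_sqrt geodesic_path \<gamma>) auto
  also have "(b - a) * ((b - a) * speed2 \<gamma> 0) = (b - a)\<^sup>2 * speed2 \<gamma> 0" by (simp add: power2_eq_square)
  finally show ?thesis using ab by (simp add: real_sqrt_mult)
qed simp

text \<open>The distance from the starting point is at most elapsed time times speed, too little to
  leave the ball of radius r / 2 around it. The constant speed then bounds the coordinate
  velocity.\<close>

lemma geodesic_stays:
  assumes \<gamma>: "geodesic A g \<gamma>" and c: "c \<in> A" and r: "0 < r" "cball x0 r \<subseteq> im c"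
    and l: "0 < l" "\<And>x v. x \<in> cball x0 r \<Longrightarrow> l * (norm v)\<^sup>2 \<le> q c x v v"
    and start: "\<gamma> a \<in> ci c ` cball x0 (r / 2)" and t: "a \<le> t" "(t - a) * sqrt (speed2 \<gamma> 0) < sqrt l * (r / 2)"
  shows "\<gamma> t \<in> dm c" "co c (\<gamma> t) \<in> cball x0 r" "norm (vel c \<gamma> t) \<le> sqrt (speed2 \<gamma> 0 / l)"
proof -
  obtain x where x: "\<gamma> a = ci c x" "x \<in> cball x0 (r / 2)" using start by blast
  have xr: "x \<in> cball x0 r" using x(2) r(1) by auto
  have xim: "x \<in> im c" using xr r(2) by blast
  have coa: "co c (\<gamma> a) = x" "\<gamma> a \<in> dm c" using x(1) xim by auto
  have sub: "cball (co c (\<gamma> a)) (r / 2) \<subseteq> cball x0 r"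
    unfolding coa(1)
  proof
    fix y assume "y \<in> cball x (r / 2)"
    then show "y \<in> cball x0 r" using x(2) dist_triangle[of x0 y x] by auto
  qed
  have "mdist (\<gamma> a) (\<gamma> t) < sqrt l * (r / 2)"
    using geodesic_mdist[OF \<gamma> t(1)] t(2) by linarith
  then have "\<gamma> t \<in> ci c ` cball (co c (\<gamma> a)) (r / 2)"
    by (rule mdist_lower(1)[OF c _ order_trans[OF sub r(2)] coa(2) l(1), rotated 2])
      (use l(2) sub r(1) in auto)
  then obtain y where y: "\<gamma> t = ci c y" "y \<in> cball x0 r" using sub by blast
  then have "y \<in> im c" using r(2) by blast
  then show dmt: "\<gamma> t \<in> dm c" and cot: "co c (\<gamma> t) \<in> cball x0 r" using y by auto
  have "l * (norm (vel c \<gamma> t))\<^sup>2 \<le> speed2 \<gamma> 0"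
    using l(2)[OF cot, of "vel c \<gamma> t"] speed2_chart[OF \<gamma> c dmt] by simp
  then have "(norm (vel c \<gamma> t))\<^sup>2 \<le> speed2 \<gamma> 0 / l" using l(1) by (simp add: field_simps)
  then show "norm (vel c \<gamma> t) \<le> sqrt (speed2 \<gamma> 0 / l)" by (rule real_le_rsqrt)
qed

text \<open>Gronwall for the squared difference of positions plus that of velocities. K depends only
  on the coordinate ball and the velocity bound M, so it serves all pairs of geodesics and all
  intervals.\<close>

lemma geodesic_gronwall:
  assumes c: "c \<in> A" and r: "cball x0 r \<subseteq> im c" and M: "M \<ge> 0"
  shows "\<exists>K. \<forall>\<gamma> \<sigma> a b. geodesic A g \<gamma> \<longrightarrow> geodesic A g \<sigma> \<longrightarrow> a \<le> b \<longrightarrow>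
    (\<forall>t\<in>{a..b}. \<gamma> t \<in> dm c \<and> \<sigma> t \<in> dm c \<and> co c (\<gamma> t) \<in> cball x0 r \<and> co c (\<sigma> t) \<in> cball x0 r \<and>
      norm (vel c \<gamma> t) \<le> M \<and> norm (vel c \<sigma> t) \<le> M) \<longrightarrow>
    (norm (co c (\<gamma> b) - co c (\<sigma> b)))\<^sup>2 + (norm (vel c \<gamma> b - vel c \<sigma> b))\<^sup>2
      \<le> ((norm (co c (\<gamma> a) - co c (\<sigma> a)))\<^sup>2 + (norm (vel c \<gamma> a - vel c \<sigma> a))\<^sup>2) * exp (K * (b - a))"
proof -
  interpret c: chart_metric "im c" "G c" by (rule chart_metric_chart[OF c])
  obtain C where C: "C > 0" "\<And>x. x \<in> cball x0 r \<Longrightarrow> norm (\<Gamma> c x) \<le> C"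
    "\<And>x y. x \<in> cball x0 r \<Longrightarrow> y \<in> cball x0 r \<Longrightarrow> norm (\<Gamma> c y - \<Gamma> c x) \<le> C * norm (y - x)"
    using smooth_on_cball_bounds[OF c.open_U c.smooth_\<Gamma> r] by blast
  \<comment> \<open>1 comes from 2 x.v \<le> |x|^2 + |v|^2. The difference of the accelerations
    contributes the other terms: \<open>C * M\<^sup>2\<close> by the Lipschitz bound of \<Gamma>,
    \<open>4 * (C * M)\<close> by its norm.\<close>
  define K where "K = 1 + C * M\<^sup>2 + 4 * (C * M)"
  show ?thesis
  proof (intro exI[of _ K] allI impI)
    fix \<gamma> \<sigma> a b
    assume \<gamma>: "geodesic A g \<gamma>" and \<sigma>: "geodesic A g \<sigma>" and ab: "(a::real) \<le> b"
      and H: "\<forall>t\<in>{a..b}. \<gamma> t \<in> dm c \<and> \<sigma> t \<in> dm c \<and> co c (\<gamma> t) \<in> cball x0 r \<and> co c (\<sigma> t) \<in> cball x0 r \<and>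
        norm (vel c \<gamma> t) \<le> M \<and> norm (vel c \<sigma> t) \<le> M"
    let ?x = "\<lambda>t. co c (\<gamma> t) - co c (\<sigma> t)" and ?v = "\<lambda>t. vel c \<gamma> t - vel c \<sigma> t"
    let ?w = "\<lambda>t. - \<Gamma> c (co c (\<gamma> t)) (vel c \<gamma> t) (vel c \<gamma> t) - (- \<Gamma> c (co c (\<sigma> t)) (vel c \<sigma> t) (vel c \<sigma> t))"
    have "(?x b \<bullet> ?x b + ?v b \<bullet> ?v b) \<le> (?x a \<bullet> ?x a + ?v a \<bullet> ?v a) * exp (K * (b - a))"
    proof (rule gronwall[OF ab])
      fix t assume t: "a \<le> t" "t \<le> b"
      then have h: "\<gamma> t \<in> dm c" "\<sigma> t \<in> dm c" "co c (\<gamma> t) \<in> cball x0 r" "co c (\<sigma> t) \<in> cball x0 r"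
        "norm (vel c \<gamma> t) \<le> M" "norm (vel c \<sigma> t) \<le> M" using H by auto
      have dx: "(?x has_vector_derivative ?v t) (at t)"
        by (intro has_vector_derivative_diff geodesicD c \<gamma> \<sigma> h)
      have dv: "(?v has_vector_derivative ?w t) (at t)"
        by (intro has_vector_derivative_diff geodesicD c \<gamma> \<sigma> h)
      show "((\<lambda>t. ?x t \<bullet> ?x t + ?v t \<bullet> ?v t) has_real_derivative 2 * (?x t \<bullet> ?v t) + 2 * (?v t \<bullet> ?w t)) (at t)"
        unfolding has_real_derivative_iff_has_vector_derivative
        using has_vector_derivative_add[OF bounded_bilinear.has_vector_derivative[OF bounded_bilinear_inner dx dx]
            bounded_bilinear.has_vector_derivative[OF bounded_bilinear_inner dv dv]]
        by (simp add: inner_commute)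
      have w_eq: "- ?w t = (\<Gamma> c (co c (\<gamma> t)) - \<Gamma> c (co c (\<sigma> t))) (vel c \<gamma> t) (vel c \<gamma> t)
          + \<Gamma> c (co c (\<sigma> t)) (?v t) (vel c \<gamma> t) + \<Gamma> c (co c (\<sigma> t)) (vel c \<sigma> t) (?v t)"
        by (simp add: blinfun.bilinear_simps)
      have n2: "norm (B u v) \<le> p * s * s'" if "norm B \<le> p" "norm u \<le> s" "norm v \<le> s'" for B :: "(real^'n) \<Rightarrow>\<^sub>L (real^'n) \<Rightarrow>\<^sub>L (real^'n)" and u v p s s'
      proof -
        have "norm (B u v) \<le> norm (B u) * norm v" by (rule norm_blinfun)
        also have "\<dots> \<le> (norm B * norm u) * norm v" by (intro mult_right_mono norm_blinfun) simp
        also have "\<dots> \<le> p * s * s'"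
          using that by (intro mult_mono) (auto intro: order_trans[OF norm_ge_zero] mult_nonneg_nonneg)
        finally show ?thesis .
      qed
      have "norm (?w t) = norm (- ?w t)" by (metis norm_minus_cancel)
      also have "\<dots> \<le> (C * norm (?x t)) * M * M + C * norm (?v t) * M + C * M * norm (?v t)"
        unfolding w_eq by (intro order_trans[OF norm_triangle_ineq] add_mono n2 C h order_refl)
      finally have w: "norm (?w t) \<le> C * M\<^sup>2 * norm (?x t) + 2 * (C * M) * norm (?v t)"
        by (simp add: power2_eq_square algebra_simps)
      have s1: "2 * (?x t \<bullet> ?v t) \<le> ?x t \<bullet> ?x t + ?v t \<bullet> ?v t"
      proof -
        have "0 \<le> (?x t - ?v t) \<bullet> (?x t - ?v t)" by simp
        then show ?thesis by (simp add: inner_diff_left inner_diff_right inner_commute algebra_simps)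
      qed
      have "?v t \<bullet> ?w t \<le> norm (?v t) * norm (?w t)" by (rule norm_cauchy_schwarz)
      also have "\<dots> \<le> norm (?v t) * (C * M\<^sup>2 * norm (?x t) + 2 * (C * M) * norm (?v t))"
        by (rule mult_left_mono[OF w]) simp
      finally have s2: "2 * (?v t \<bullet> ?w t) \<le> C * M\<^sup>2 * (2 * norm (?x t) * norm (?v t)) + 4 * (C * M) * (norm (?v t))\<^sup>2"
        by (simp add: power2_eq_square algebra_simps)
      also have "\<dots> \<le> C * M\<^sup>2 * ((norm (?x t))\<^sup>2 + (norm (?v t))\<^sup>2) + 4 * (C * M) * ((norm (?x t))\<^sup>2 + (norm (?v t))\<^sup>2)"
        using C(1) M sum_squares_bound[of "norm (?x t)" "norm (?v t)"]
        by (intro add_mono mult_left_mono) auto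
      finally show "2 * (?x t \<bullet> ?v t) + 2 * (?v t \<bullet> ?w t) \<le> K * (?x t \<bullet> ?x t + ?v t \<bullet> ?v t)"
        using s1 unfolding K_def by (simp add: power2_norm_eq_inner algebra_simps)
    qed
    then show "(norm (?x b))\<^sup>2 + (norm (?v b))\<^sup>2 \<le> ((norm (?x a))\<^sup>2 + (norm (?v a))\<^sup>2) * exp (K * (b - a))"
      by (simp add: power2_norm_eq_inner)
  qed
qed

end

section \<open>Short geodesics exist and minimise\<close>

context chart_metric begin

text \<open>The Euler-Lagrange equation of the energy: along the geodesic, for fixed V, the rate of
  2 g(T, V) is the derivative of g(T, T) in direction V.\<close>

lemma geodesic_first_variation:
  assumes x: "x \<in> U"
  shows "2 * (dg x T T V + g x (- \<Gamma> x T T) V) = dg x V T T"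
  by (simp add: compat[OF x] blinfun.minus_left blinfun.minus_right g_sym[OF x, of T "\<Gamma> x V T"] \<Gamma>_sym[OF x, of T V])

text \<open>A competitor at y = x + V moves with velocity T + V'. Expanding its energy density
  around x, the first-order terms match and the errors are at most C m^2 |V|^2 and 2 C m |V| |V'|.
  Once their mixed term is absorbed, the terms with l leave at least l / 2 times |V|^2 + |V'|^2,
  which dominates the errors for small m.\<close>

lemma calibration_ineq:
  assumes C: "C > 0" "norm (g y - g x) \<le> C * norm (y - x)" "norm (g y - g x - dg x (y - x)) \<le> C * (norm (y - x))\<^sup>2"
    and l: "l > 0" "l * (norm V')\<^sup>2 \<le> g y V' V'" and m: "norm T \<le> m" "C * m\<^sup>2 + C * m \<le> l / 2"
    and t: "0 \<le> t" "t \<le> 1" and x: "x \<in> U" "y \<in> U"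
  shows "dg x (y - x) T T + 2 * g x T V' + l * (- ((y - x) \<bullet> (y - x)) + (1 - 2 * t) * ((y - x) \<bullet> V')) + g x T T
    \<le> g y (T + V') (T + V')"
proof -
  let ?V = "y - x"
  define a where "a = norm V'"
  define b where "b = norm ?V"
  have ab: "0 \<le> a" "0 \<le> b" by (auto simp: a_def b_def)
  have m0: "0 \<le> m" using m(1) norm_ge_zero order_trans by blast
  have n2: "\<bar>B u v\<bar> \<le> norm B * norm u * norm v" for B :: "(real^'n) \<Rightarrow>\<^sub>L (real^'n) \<Rightarrow>\<^sub>L real" and u v
  proof -
    have "norm (B u v) \<le> norm (B u) * norm v" by (rule norm_blinfun)
    also have "\<dots> \<le> (norm B * norm u) * norm v" by (intro mult_right_mono norm_blinfun) simp
    finally show ?thesis by simp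
  qed
  have "\<bar>(g y - g x - dg x ?V) T T\<bar> \<le> norm (g y - g x - dg x ?V) * norm T * norm T" by (rule n2)
  also have "\<dots> \<le> (C * b\<^sup>2) * m * m"
    using C m(1) m0 unfolding b_def by (intro mult_mono) auto
  finally have 1: "- (C * m\<^sup>2 * b\<^sup>2) \<le> (g y - g x - dg x ?V) T T" by (simp add: power2_eq_square algebra_simps abs_le_iff)
  have "\<bar>(g y - g x) T V'\<bar> \<le> norm (g y - g x) * norm T * norm V'" by (rule n2)
  also have "\<dots> \<le> (C * b) * m * a"
    using C m(1) m0 unfolding a_def b_def by (intro mult_mono) auto
  finally have 2: "- (C * m * (a * b)) \<le> (g y - g x) T V'" by (simp add: algebra_simps abs_le_iff)
  have "\<bar>(1 - 2 * t) * (?V \<bullet> V')\<bar> \<le> 1 * (b * a)"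
    unfolding abs_mult a_def b_def using t Cauchy_Schwarz_ineq2[of ?V V'] by (intro mult_mono) auto
  then have 3: "(1 - 2 * t) * (?V \<bullet> V') \<le> a * b" by (simp add: mult.commute abs_le_iff)
  have s: "2 * (a * b) \<le> a\<^sup>2 + b\<^sup>2" using sum_squares_bound[of a b] by simp
  have "l * (- b\<^sup>2 + (1 - 2 * t) * (?V \<bullet> V')) \<le> l * (- b\<^sup>2 + a * b)"
    using 3 l(1) by simp
  moreover have "l * a\<^sup>2 + l * b\<^sup>2 - l * (a * b) - C * m\<^sup>2 * b\<^sup>2 - 2 * (C * m * (a * b)) \<ge> 0"
  proof -
    have "l * (a * b) \<le> l * ((a\<^sup>2 + b\<^sup>2) / 2)" using s l(1) by (intro mult_left_mono) auto
    moreover have "C * m * (2 * (a * b)) \<le> C * m * (a\<^sup>2 + b\<^sup>2)" using s C(1) m0 by (intro mult_left_mono) auto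
    moreover have "C * m\<^sup>2 * b\<^sup>2 \<le> C * m\<^sup>2 * (a\<^sup>2 + b\<^sup>2)" using C(1) by (intro mult_left_mono) auto
    moreover have "(C * m\<^sup>2 + C * m) * (a\<^sup>2 + b\<^sup>2) \<le> l / 2 * (a\<^sup>2 + b\<^sup>2)" using m(2) by (rule mult_right_mono) simp
    ultimately show ?thesis by (simp add: algebra_simps)
  qed
  moreover have "l * a\<^sup>2 \<le> g y V' V'" using l(2) by (simp add: a_def)
  ultimately show ?thesis
    using 1 2 g_sym[OF x(2), of V' T]
    by (simp add: b_def power2_norm_eq_inner blinfun.bilinear_simps algebra_simps)
qed

end

context riemannian_manifold begin

text \<open>Rescaling to unit duration needs a positive duration; waiting supplies one without
  energy.\<close>

lemma path_wait: "p \<in> S \<Longrightarrow> 0 \<le> \<epsilon> \<Longrightarrow> path S p p \<epsilon> 0"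
proof -
  assume p: "p \<in> S" "0 \<le> \<epsilon>"
  obtain c where c: "c \<in> A" "p \<in> dm c" using ex_chart by blast
  show ?thesis
    using path.piece[of c 0 \<epsilon> "\<lambda>_. co c p" "\<lambda>_. 0" S] c p by simp
qed

text \<open>A calibration takes the place of normal coordinates and the Gauss lemma. Low speed is
  assumed because \<open>calibration_ineq\<close> requires a small coordinate velocity.\<close>

lemma local_minimizer:
  assumes c: "c \<in> A" and z: "z \<in> dm c" and r: "0 < r" "cball (co c z) r \<subseteq> im c"
    and l: "0 < l" "\<And>x v. x \<in> cball (co c z) r \<Longrightarrow> l * (norm v)\<^sup>2 \<le> q c x v v"
  shows "\<exists>\<eta>>0. \<forall>\<gamma>. geodesic A g \<gamma> \<longrightarrow> \<gamma> 0 = z \<longrightarrow> sqrt (speed2 \<gamma> 0) \<le> \<eta> \<longrightarrow> sqrt (speed2 \<gamma> 0) \<le> mdist z (\<gamma> 1)"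
proof -
  interpret c: chart_metric "im c" "G c" by (rule chart_metric_chart[OF c])
  let ?o = "co c z"
  let ?S = "ci c ` cball ?o r"
  note S = closed_ci_cball[OF c r(2)]
  obtain C where C: "C > 0"
    "\<And>x y. x \<in> cball ?o r \<Longrightarrow> y \<in> cball ?o r \<Longrightarrow> norm (q c y - q c x) \<le> C * norm (y - x)"
    "\<And>x y. x \<in> cball ?o r \<Longrightarrow> y \<in> cball ?o r \<Longrightarrow> norm (q c y - q c x - bderiv (q c) x (y - x)) \<le> C * (norm (y - x))\<^sup>2"
    using smooth_on_cball_bounds[OF c.open_U c.smooth_g r(2)] by blast
  \<comment> \<open>Chosen so that m^2 \<le> m and C m \<le> l / 4.\<close>
  define m where "m = min 1 (l / (4 * C))"
  have m: "m > 0" "m \<le> 1" using l(1) C(1) by (auto simp: m_def)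
  have Cm: "C * m\<^sup>2 + C * m \<le> l / 2"
  proof -
    have "m\<^sup>2 \<le> m" using m by (simp add: power2_eq_square mult_left_le)
    then have 1: "C * m\<^sup>2 \<le> C * m" using C(1) by simp
    have "C * m \<le> C * (l / (4 * C))" using C(1) by (intro mult_left_mono) (auto simp: m_def)
    also have "\<dots> = l / 4" using C(1) by simp
    finally have 2: "C * m \<le> l / 4" .
    show ?thesis using 1 2 by linarith
  qed
  \<comment> \<open>The first bound keeps the coordinate velocity below m, the second keeps the
    geodesic in the ball up to time 1.\<close>
  define \<eta> where "\<eta> = min (sqrt l * m) (sqrt l * (r / 4))"
  show ?thesis
  proof (intro exI[of _ \<eta>] conjI allI impI)
    show "\<eta> > 0" using m l(1) r(1) by (simp add: \<eta>_def)
    fix \<gamma> assume \<gamma>: "geodesic A g \<gamma>" and \<gamma>0: "\<gamma> 0 = z" and \<eta>: "sqrt (speed2 \<gamma> 0) \<le> \<eta>"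
    let ?s2 = "speed2 \<gamma> 0"
    have s2: "0 \<le> ?s2" by (rule speed2_nonneg[OF \<gamma>])
    have start: "\<gamma> 0 \<in> ci c ` cball ?o (r / 2)" using c z r(1) \<gamma>0 by (intro image_eqI[of _ _ ?o]) auto
    have le: "sqrt ?s2 < sqrt l * (r / 2)"
    proof -
      have "sqrt ?s2 \<le> sqrt l * (r / 4)" using \<eta> by (simp add: \<eta>_def)
      also have "\<dots> < sqrt l * (r / 2)" using l(1) r(1) by simp
      finally show ?thesis .
    qed
    have st: "\<gamma> t \<in> dm c" "co c (\<gamma> t) \<in> cball ?o r" "norm (vel c \<gamma> t) \<le> m" if t: "0 \<le> t" "t \<le> 1" for t
    proof -
      have "(t - 0) * sqrt ?s2 \<le> 1 * sqrt ?s2" using t s2 by (intro mult_right_mono) auto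
      then have le': "(t - 0) * sqrt ?s2 < sqrt l * (r / 2)" using le by simp
      show "\<gamma> t \<in> dm c" by (rule geodesic_stays(1)[OF \<gamma> c r l start t(1) le'])
      show "co c (\<gamma> t) \<in> cball ?o r" by (rule geodesic_stays(2)[OF \<gamma> c r l start t(1) le'])
      have "norm (vel c \<gamma> t) \<le> sqrt (?s2 / l)" by (rule geodesic_stays(3)[OF \<gamma> c r l start t(1) le'])
      also have "\<dots> = sqrt ?s2 / sqrt l" by (rule real_sqrt_divide)
      also have "\<dots> \<le> m" using \<eta> l(1) by (simp add: \<eta>_def field_simps)
      finally show "norm (vel c \<gamma> t) \<le> m" .
    qed
    \<comment> \<open>\<open>\<Psi>\<close> agrees to first order with the energy along \<open>\<gamma>\<close>; the quadratic term with the decreasing factor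
      \<open>1/2 - t\<close> absorbs the second order errors, so \<open>\<Psi>\<close> calibrates \<open>\<gamma>\<close>.\<close>
    define \<Psi> where "\<Psi> t y = 2 * q c (co c (\<gamma> t)) (vel c \<gamma> t) (y - co c (\<gamma> t))
      + l * (1/2 - t) * ((y - co c (\<gamma> t)) \<bullet> (y - co c (\<gamma> t))) + t * ?s2" for t y
    have cal: "\<exists>D. ((\<lambda>r. \<Psi> (\<theta> + r) (\<beta> r)) has_real_derivative D) (at s within I) \<and> D \<le> q c (\<beta> s) v v"
      if \<beta>: "(\<beta> has_vector_derivative v) (at s within I)" "\<beta> s \<in> co c ` ?S" and \<theta>: "0 \<le> \<theta> + s" "\<theta> + s \<le> 1" for \<beta> v s I \<theta>
    proof -
      define t where "t = \<theta> + s"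
      have t: "0 \<le> t" "t \<le> 1" using \<theta> by (auto simp: t_def)
      let ?x = "co c (\<gamma> t)" and ?T = "vel c \<gamma> t"
      have xU: "?x \<in> im c" using st(1)[OF t] by simp
      have y: "\<beta> s \<in> cball ?o r" using \<beta>(2) unfolding S(5) .
      then have yU: "\<beta> s \<in> im c" using r(2) by blast
      have aff: "((\<lambda>r. \<theta> + r) has_vector_derivative 1) (at s within I)"
        by (auto intro!: derivative_eq_intros simp: has_real_derivative_iff_has_vector_derivative[symmetric])
      have dx: "((\<lambda>r. co c (\<gamma> (\<theta> + r))) has_vector_derivative ?T) (at s within I)"
        using vector_diff_chain_within[OF aff has_vector_derivative_at_within[OF geodesicD(1)[OF \<gamma> c st(1)[OF t], unfolded t_def]]]
        by (simp add: o_def t_def)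
      have dv: "((\<lambda>r. vel c \<gamma> (\<theta> + r)) has_vector_derivative - \<Gamma> c ?x ?T ?T) (at s within I)"
        using vector_diff_chain_within[OF aff has_vector_derivative_at_within[OF geodesicD(2)[OF \<gamma> c st(1)[OF t], unfolded t_def]]]
        by (simp add: o_def t_def)
      have dV: "((\<lambda>r. \<beta> r - co c (\<gamma> (\<theta> + r))) has_vector_derivative v - ?T) (at s within I)"
        by (rule has_vector_derivative_diff[OF \<beta>(1) dx])
      let ?V = "\<beta> s - ?x"
      have d1: "((\<lambda>r. q c (co c (\<gamma> (\<theta> + r))) (vel c \<gamma> (\<theta> + r)) (\<beta> r - co c (\<gamma> (\<theta> + r)))) has_vector_derivative
          (bderiv (q c) ?x ?T ?T ?V + q c ?x (- \<Gamma> c ?x ?T ?T) ?V + q c ?x ?T (v - ?T))) (at s within I)"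
        using has_vector_derivative_blinfun2[where \<gamma> = "\<lambda>r. co c (\<gamma> (\<theta> + r))", OF c.dg_works[OF xU, unfolded t_def] dx dv dV]
        by (simp add: t_def)
      have d2: "((\<lambda>r. (\<beta> r - co c (\<gamma> (\<theta> + r))) \<bullet> (\<beta> r - co c (\<gamma> (\<theta> + r)))) has_vector_derivative 2 * (?V \<bullet> (v - ?T))) (at s within I)"
        using bounded_bilinear.has_vector_derivative[OF bounded_bilinear_inner dV dV]
        by (simp add: t_def inner_commute)
      have d3: "((\<lambda>r. l * (1/2 - (\<theta> + r))) has_real_derivative - l) (at s within I)"
        by (auto intro!: derivative_eq_intros)
      have d4: "((\<lambda>r. (\<theta> + r) * ?s2) has_real_derivative ?s2) (at s within I)"
        by (auto intro!: derivative_eq_intros)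
      have "((\<lambda>r. \<Psi> (\<theta> + r) (\<beta> r)) has_real_derivative
         2 * (bderiv (q c) ?x ?T ?T ?V + q c ?x (- \<Gamma> c ?x ?T ?T) ?V + q c ?x ?T (v - ?T))
          + (- l * (?V \<bullet> ?V) + 2 * (?V \<bullet> (v - ?T)) * (l * (1/2 - t))) + ?s2) (at s within I)"
        unfolding \<Psi>_def
        by (rule DERIV_cong[OF DERIV_add[OF DERIV_add[OF DERIV_cmult[OF d1[folded has_real_derivative_iff_has_vector_derivative], of 2]
            DERIV_mult[OF d3 d2[folded has_real_derivative_iff_has_vector_derivative]]] d4]]) (simp add: t_def)
      moreover have "2 * (bderiv (q c) ?x ?T ?T ?V + q c ?x (- \<Gamma> c ?x ?T ?T) ?V + q c ?x ?T (v - ?T))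
          + (- l * (?V \<bullet> ?V) + 2 * (?V \<bullet> (v - ?T)) * (l * (1/2 - t))) + ?s2
        = bderiv (q c) ?x ?V ?T ?T + 2 * q c ?x ?T (v - ?T) + l * (- (?V \<bullet> ?V) + (1 - 2 * t) * (?V \<bullet> (v - ?T))) + q c ?x ?T ?T"
        unfolding c.geodesic_first_variation[OF xU, symmetric] speed2_chart[OF \<gamma> c st(1)[OF t]]
        by (simp add: algebra_simps)
      moreover have "\<dots> \<le> q c (\<beta> s) (?T + (v - ?T)) (?T + (v - ?T))"
        by (rule c.calibration_ineq[OF C(1) C(2)[OF st(2)[OF t] y] C(3)[OF st(2)[OF t] y] l(1) l(2)[OF y] st(3)[OF t] Cm t xU yU])
      ultimately show ?thesis by auto
    qed
    show "sqrt ?s2 \<le> mdist z (\<gamma> 1)"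
    proof (rule mdist_greatest)
      fix \<tau> e assume pa: "path UNIV z (\<gamma> 1) \<tau> e"
      note n = path_nonneg[OF pa]
      show "sqrt ?s2 \<le> (\<tau> + e) / 2"
      proof (cases "(\<tau> + e) / 2 < sqrt l * r")
        case True
        have paS: "path ?S z (\<gamma> 1) \<tau> e" by (rule path_stays[OF c r z l pa True])
        have zS: "z \<in> ?S" using path_endpoints[OF paS] by blast
        \<comment> \<open>The path may have duration 0, so a waiting time \<epsilon> precedes it
          before it is rescaled to duration 1. Between the two ends \<Psi> increases by exactly the
          squared speed; \<epsilon> is sent to 0 afterwards.\<close>
        have "?s2 \<le> (\<epsilon> + \<tau>) * e" if "\<epsilon> > 0" for \<epsilon>
        proof -
          have "path ?S z (\<gamma> 1) (\<epsilon> + \<tau>) (0 + e)"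
            by (rule path.trans[OF path_wait[OF zS] paS]) (use that in simp)
          from path_rescale[OF this, of "1 / (\<epsilon> + \<tau>)"] have "path ?S z (\<gamma> 1) 1 ((\<epsilon> + \<tau>) * e)"
            using that n by (simp add: mult.commute)
          from path_calibrate[where \<Psi> = \<Psi> and T = 1 and ?t0.0 = 0, OF c S(3) cal this]
          have "\<Psi> 1 (co c (\<gamma> 1)) - \<Psi> 0 (co c z) \<le> (\<epsilon> + \<tau>) * e" by simp
          then show ?thesis by (simp add: \<Psi>_def \<gamma>0 blinfun.bilinear_simps)
        qed
        then have "?s2 - \<tau> * e \<le> \<epsilon> * e" if "\<epsilon> > 0" for \<epsilon> using that by (simp add: algebra_simps)
        then have lim: "?s2 - \<tau> * e \<le> \<epsilon> * e" if "\<epsilon> > 0" for \<epsilon> using that by blast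
        have "?s2 \<le> \<tau> * e"
        proof (rule field_le_epsilon)
          fix d :: real assume "d > 0"
          then have "d / (e + 1) > 0" using n by simp
          from lim[OF this] have "?s2 - \<tau> * e \<le> d * (e / (e + 1))" by simp
          also have "\<dots> \<le> d * 1" using \<open>d > 0\<close> n by (intro mult_left_mono) auto
          finally show "?s2 \<le> \<tau> * e + d" by simp
        qed
        also have "\<dots> \<le> ((\<tau> + e) / 2)\<^sup>2"
          using sum_squares_bound[of \<tau> e] by (simp add: power2_eq_square algebra_simps)
        finally show ?thesis using n by (intro real_le_lsqrt) auto
      next
        case False
        have "sqrt ?s2 \<le> sqrt l * (r / 2)" using le by simp
        also have "\<dots> \<le> sqrt l * r" using r(1) l(1) by simp
        also have "\<dots> \<le> (\<tau> + e) / 2" using False by simp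
        finally show ?thesis .
      qed
    qed
  qed
qed

lemma complete_metricD:
  assumes "complete_metric A g" "c \<in> A" "p \<in> dm c"
  shows "\<exists>\<gamma>. geodesic A g \<gamma> \<and> \<gamma> 0 = p \<and> vel c \<gamma> 0 = v"
  using assms unfolding complete_metric_def vel_def by (metis vector_derivative_at)

text \<open>Surjectivity of the exponential map near z from its continuity alone. In coordinates it
  differs from v \<mapsto> \<open>co c z + v\<close> by a term quadratic in v, so v + (y - exp v)
  maps a small ball into itself, and Brouwer's theorem provides a solution of exp v = y.\<close>

lemma local_exp:
  assumes complete: "complete_metric A g"
    and c: "c \<in> A" and z: "z \<in> dm c" and r: "0 < r" "cball (co c z) r \<subseteq> im c"
    and l: "0 < l" "\<And>x v. x \<in> cball (co c z) r \<Longrightarrow> l * (norm v)\<^sup>2 \<le> q c x v v"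
    and L: "0 < L" "\<And>x v. x \<in> cball (co c z) r \<Longrightarrow> q c x v v \<le> L * (norm v)\<^sup>2"
  shows "\<exists>\<rho>>0. \<forall>y\<in>cball (co c z) \<rho>. \<exists>\<gamma>. geodesic A g \<gamma> \<and> \<gamma> 0 = z \<and> \<gamma> 1 = ci c y \<and> norm (vel c \<gamma> 0) \<le> 2 * norm (y - co c z)"
proof -
  interpret c: chart_metric "im c" "G c" by (rule chart_metric_chart[OF c])
  let ?o = "co c z"
  obtain \<Phi> where \<Phi>: "\<And>v. geodesic A g (\<Phi> v)" "\<And>v. \<Phi> v 0 = z" "\<And>v. vel c (\<Phi> v) 0 = v"
    using complete_metricD[OF complete c z] by metis
  define \<kappa> where "\<kappa> = sqrt (L / l)"
  have \<kappa>: "\<kappa> > 0" using l L by (simp add: \<kappa>_def)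
  have x0: "?o \<in> cball ?o r" using r(1) by simp
  have s2: "speed2 (\<Phi> v) 0 \<le> L * (norm v)\<^sup>2" for v
    using speed2_chart[OF \<Phi>(1)[of v] c, of 0] \<Phi> z L(2)[OF x0, of v] by simp
  \<comment> \<open>Initial velocities up to this length keep the geodesic in the ball until time 1;
    r / 4 leaves room for the strict inequality with r / 2.\<close>
  define \<rho>1 where "\<rho>1 = sqrt l * (r / 4) / sqrt L"
  have \<rho>1: "\<rho>1 > 0" using l L r by (simp add: \<rho>1_def)
  have st: "\<Phi> v t \<in> dm c" "co c (\<Phi> v t) \<in> cball ?o r" "norm (vel c (\<Phi> v) t) \<le> \<kappa> * norm v"
    if v: "norm v \<le> \<rho>1" and t: "0 \<le> t" "t \<le> 1" for v t
  proof -
    have start: "\<Phi> v 0 \<in> ci c ` cball ?o (r / 2)" using c z r(1) \<Phi>(2) by (intro image_eqI[of _ _ ?o]) auto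
    have "sqrt (speed2 (\<Phi> v) 0) \<le> sqrt (L * (norm v)\<^sup>2)" using s2 by simp
    also have "\<dots> = sqrt L * norm v" by (simp add: real_sqrt_mult)
    finally have sv: "sqrt (speed2 (\<Phi> v) 0) \<le> sqrt L * norm v" .
    also have "\<dots> \<le> sqrt L * \<rho>1" using v L by simp
    also have "\<dots> = sqrt l * (r / 4)" using L by (simp add: \<rho>1_def)
    also have "\<dots> < sqrt l * (r / 2)" using l r by simp
    finally have s: "sqrt (speed2 (\<Phi> v) 0) < sqrt l * (r / 2)" .
    have "(t - 0) * sqrt (speed2 (\<Phi> v) 0) \<le> 1 * sqrt (speed2 (\<Phi> v) 0)"
      using t speed2_nonneg[OF \<Phi>(1)] by (intro mult_right_mono) auto
    then have le: "(t - 0) * sqrt (speed2 (\<Phi> v) 0) < sqrt l * (r / 2)" using s by simp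
    show "\<Phi> v t \<in> dm c" by (rule geodesic_stays(1)[OF \<Phi>(1) c r l start t(1) le])
    show "co c (\<Phi> v t) \<in> cball ?o r" by (rule geodesic_stays(2)[OF \<Phi>(1) c r l start t(1) le])
    have "norm (vel c (\<Phi> v) t) \<le> sqrt (speed2 (\<Phi> v) 0 / l)" by (rule geodesic_stays(3)[OF \<Phi>(1) c r l start t(1) le])
    also have "\<dots> = sqrt (speed2 (\<Phi> v) 0) / sqrt l" by (rule real_sqrt_divide)
    also have "\<dots> \<le> (sqrt L * norm v) / sqrt l" using sv l by (intro divide_right_mono) auto
    also have "\<dots> = \<kappa> * norm v" by (simp add: \<kappa>_def real_sqrt_divide)
    finally show "norm (vel c (\<Phi> v) t) \<le> \<kappa> * norm v" .
  qed
  define e where "e v = co c (\<Phi> v 1)" for v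
  obtain K where K: "\<And>\<gamma> \<sigma> a b. geodesic A g \<gamma> \<Longrightarrow> geodesic A g \<sigma> \<Longrightarrow> a \<le> b \<Longrightarrow>
    (\<forall>t\<in>{a..b}. \<gamma> t \<in> dm c \<and> \<sigma> t \<in> dm c \<and> co c (\<gamma> t) \<in> cball ?o r \<and> co c (\<sigma> t) \<in> cball ?o r \<and>
      norm (vel c \<gamma> t) \<le> \<kappa> * \<rho>1 \<and> norm (vel c \<sigma> t) \<le> \<kappa> * \<rho>1) \<Longrightarrow>
    (norm (co c (\<gamma> b) - co c (\<sigma> b)))\<^sup>2 + (norm (vel c \<gamma> b - vel c \<sigma> b))\<^sup>2
      \<le> ((norm (co c (\<gamma> a) - co c (\<sigma> a)))\<^sup>2 + (norm (vel c \<gamma> a - vel c \<sigma> a))\<^sup>2) * exp (K * (b - a))"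
    using geodesic_gronwall[OF c r(2), of "\<kappa> * \<rho>1"] mult_nonneg_nonneg[OF less_imp_le[OF \<kappa>] less_imp_le[OF \<rho>1]] by metis
  have lip: "norm (e v - e w) \<le> sqrt (exp K) * norm (v - w)" if v: "norm v \<le> \<rho>1" "norm w \<le> \<rho>1" for v w
  proof -
    have M: "norm (vel c (\<Phi> u) t) \<le> \<kappa> * \<rho>1" if "norm u \<le> \<rho>1" "0 \<le> t" "t \<le> 1" for u t
      using st(3)[OF that] mult_left_mono[OF that(1), of \<kappa>] \<kappa> by linarith
    have "(norm (e v - e w))\<^sup>2 + (norm (vel c (\<Phi> v) 1 - vel c (\<Phi> w) 1))\<^sup>2
      \<le> ((norm (co c (\<Phi> v 0) - co c (\<Phi> w 0)))\<^sup>2 + (norm (vel c (\<Phi> v) 0 - vel c (\<Phi> w) 0))\<^sup>2) * exp (K * (1 - 0))"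
      unfolding e_def by (rule K[OF \<Phi>(1) \<Phi>(1)]) (use st v M in auto)
    then have "(norm (e v - e w))\<^sup>2 + (norm (vel c (\<Phi> v) 1 - vel c (\<Phi> w) 1))\<^sup>2 \<le> (norm (v - w))\<^sup>2 * exp K"
      by (simp add: \<Phi>)
    then have "(norm (e v - e w))\<^sup>2 \<le> (norm (v - w))\<^sup>2 * exp K"
      by (rule order_trans[rotated]) simp
    then have "norm (e v - e w) \<le> sqrt ((norm (v - w))\<^sup>2 * exp K)" by (rule real_le_rsqrt)
    then show ?thesis by (simp add: real_sqrt_mult mult.commute)
  qed
  obtain C where C: "C > 0" "\<And>x. x \<in> cball ?o r \<Longrightarrow> norm (\<Gamma> c x) \<le> C"
    using smooth_on_cball_bounds[OF c.open_U c.smooth_\<Gamma> r(2)] by blast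
  define N where "N = C * \<kappa>\<^sup>2"
  have N: "N > 0" using C \<kappa> by (simp add: N_def)
  have close: "norm (e v - ?o - v) \<le> N * (norm v)\<^sup>2" if v: "norm v \<le> \<rho>1" for v
  proof -
    have g1: "norm (vel c (\<Phi> v) t - vel c (\<Phi> v) 0) \<le> N * (norm v)\<^sup>2" if t: "0 \<le> t" "t \<le> 1" for t
    proof (rule norm_diff_le_bound_unit_interval[OF _ _ t])
      fix s :: real assume s: "0 \<le> s" "s \<le> 1"
      show "(vel c (\<Phi> v) has_vector_derivative - \<Gamma> c (co c (\<Phi> v s)) (vel c (\<Phi> v) s) (vel c (\<Phi> v) s)) (at s)"
        by (rule geodesicD(2)[OF \<Phi>(1) c st(1)[OF v s]])
      let ?u = "vel c (\<Phi> v) s" and ?B = "\<Gamma> c (co c (\<Phi> v s))"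
      have "norm (?B ?u ?u) \<le> norm (?B ?u) * norm ?u" by (rule norm_blinfun)
      also have "\<dots> \<le> (norm ?B * norm ?u) * norm ?u" by (intro mult_right_mono norm_blinfun) simp
      also have "\<dots> \<le> (C * (\<kappa> * norm v)) * (\<kappa> * norm v)"
        using C st[OF v s] \<kappa> by (intro mult_mono) auto
      also have "\<dots> = N * (norm v)\<^sup>2" by (simp add: N_def power2_eq_square)
      finally show "norm (- ?B ?u ?u) \<le> N * (norm v)\<^sup>2" by simp
    qed
    have "norm ((co c (\<Phi> v 1) - 1 *\<^sub>R v) - (co c (\<Phi> v 0) - 0 *\<^sub>R v)) \<le> N * (norm v)\<^sup>2"
    proof (rule norm_diff_le_bound_unit_interval[of "\<lambda>t. co c (\<Phi> v t) - t *\<^sub>R v" "\<lambda>t. vel c (\<Phi> v) t - vel c (\<Phi> v) 0"])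
      fix s :: real assume s: "0 \<le> s" "s \<le> 1"
      have "((\<lambda>t. co c (\<Phi> v t) - t *\<^sub>R v) has_vector_derivative vel c (\<Phi> v) s - v) (at s)"
        by (intro has_vector_derivative_diff geodesicD(1)[OF \<Phi>(1) c st(1)[OF v s]])
          (auto intro!: derivative_eq_intros)
      then show "((\<lambda>t. co c (\<Phi> v t) - t *\<^sub>R v) has_vector_derivative vel c (\<Phi> v) s - vel c (\<Phi> v) 0) (at s)"
        by (simp add: \<Phi>)
    qed (use g1 in auto)
    then show ?thesis by (simp add: e_def \<Phi> algebra_simps)
  qed
  \<comment> \<open>With N \<rho> \<le> 1/2 the deviation is at most half of |v|; hence points
    within \<rho> / 2 are reached, and |v| is at most twice their distance from the centre.\<close>
  define \<rho> where "\<rho> = min \<rho>1 (1 / (2 * N))"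
  have \<rho>: "\<rho> > 0" "\<rho> \<le> \<rho>1" "N * \<rho> \<le> 1 / 2"
    using \<rho>1 N mult_left_mono[of \<rho> "1 / (2 * N)" N] by (auto simp: \<rho>_def)
  have half: "N * (norm v)\<^sup>2 \<le> norm v / 2" if "norm v \<le> \<rho>" for v :: "real^'n"
  proof -
    have "N * (norm v)\<^sup>2 = (N * norm v) * norm v" by (simp add: power2_eq_square)
    also have "\<dots> \<le> (N * \<rho>) * norm v" using that N by (intro mult_right_mono mult_left_mono) auto
    also have "\<dots> \<le> 1 / 2 * norm v" using \<rho>(3) by (rule mult_right_mono) simp
    finally show ?thesis by simp
  qed
  have "\<exists>\<gamma>. geodesic A g \<gamma> \<and> \<gamma> 0 = z \<and> \<gamma> 1 = ci c y \<and> norm (vel c \<gamma> 0) \<le> 2 * norm (y - ?o)"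
    if y: "y \<in> cball ?o (\<rho> / 2)" for y
  proof -
    let ?f = "\<lambda>v. v + (y - e v)"
    have "\<exists>v\<in>cball 0 \<rho>. ?f v = v"
    proof (rule brouwer)
      have "continuous_on (cball 0 \<rho>) e"
      proof (rule lipschitz_on_continuous_on)
        show "(sqrt (exp K))-lipschitz_on (cball 0 \<rho>) e"
          using lip \<rho>(2) by (intro lipschitz_onI) (auto simp: dist_norm)
      qed
      then show "continuous_on (cball 0 \<rho>) ?f" by (intro continuous_intros)
      show "?f \<in> cball 0 \<rho> \<rightarrow> cball 0 \<rho>"
      proof
        fix v :: "real^'n" assume "v \<in> cball 0 \<rho>"
        then have v: "norm v \<le> \<rho>" by simp
        have "?f v = (y - ?o) - (e v - ?o - v)" by simp
        then have "norm (?f v) \<le> norm (y - ?o) + norm (e v - ?o - v)" by (metis norm_triangle_ineq4)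
        also have "\<dots> \<le> \<rho> / 2 + norm v / 2"
          using y close[of v] half[OF v] v \<rho>(2) by (intro add_mono) (auto simp: dist_norm norm_minus_commute)
        finally show "?f v \<in> cball 0 \<rho>" using v by simp
      qed
    qed (use \<rho> in auto)
    then obtain v where v: "norm v \<le> \<rho>" "e v = y" by auto
    have v1: "norm v \<le> \<rho>1" using v(1) \<rho>(2) by simp
    have "norm v = norm ((y - ?o) - (e v - ?o - v))" using v(2) by simp
    also have "\<dots> \<le> norm (y - ?o) + norm (e v - ?o - v)" by (rule norm_triangle_ineq4)
    also have "\<dots> \<le> norm (y - ?o) + norm v / 2" using close[OF v1] half[OF v(1)] by simp
    finally have "norm v \<le> 2 * norm (y - ?o)" by simp
    moreover have "\<Phi> v 1 = ci c y" using v(2) st(1)[OF v1, of 1] c by (auto simp: e_def)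
    ultimately show ?thesis using \<Phi> by (intro exI[of _ "\<Phi> v"]) simp
  qed
  then show ?thesis using \<rho>(1) by (intro exI[of _ "\<rho> / 2"]) auto
qed

text \<open>For y close to z the geodesic of \<open>local_exp\<close> is slow enough for
  \<open>local_minimizer\<close>, so its speed is the distance.\<close>

lemma local_geodesic:
  assumes complete: "complete_metric A g"
  shows "\<exists>d>0. \<forall>y. mdist z y < d \<longrightarrow> (\<exists>\<gamma>. geodesic A g \<gamma> \<and> \<gamma> 0 = z \<and> \<gamma> 1 = y \<and> sqrt (speed2 \<gamma> 0) = mdist z y)"
proof -
  obtain c where c: "c \<in> A" "z \<in> dm c" using ex_chart by blast
  obtain r l L where r: "0 < r" "0 < l" "0 < L" "cball (co c z) r \<subseteq> co c ` (dm c \<inter> UNIV)"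
    "\<And>x v. x \<in> cball (co c z) r \<Longrightarrow> l * (norm v)\<^sup>2 \<le> q c x v v"
    "\<And>x v. x \<in> cball (co c z) r \<Longrightarrow> q c x v v \<le> L * (norm v)\<^sup>2"
    using local_bounds[OF c open_UNIV UNIV_I] by blast
  have im: "cball (co c z) r \<subseteq> im c" using r(4) by auto
  obtain \<eta> where \<eta>: "\<eta> > 0" "\<And>\<gamma>. geodesic A g \<gamma> \<Longrightarrow> \<gamma> 0 = z \<Longrightarrow> sqrt (speed2 \<gamma> 0) \<le> \<eta> \<Longrightarrow> sqrt (speed2 \<gamma> 0) \<le> mdist z (\<gamma> 1)"
    using local_minimizer[OF c r(1) im r(2,5)] by blast
  obtain \<rho> where \<rho>: "\<rho> > 0" "\<And>y. y \<in> cball (co c z) \<rho> \<Longrightarrow> \<exists>\<gamma>. geodesic A g \<gamma> \<and> \<gamma> 0 = z \<and> \<gamma> 1 = ci c y \<and> norm (vel c \<gamma> 0) \<le> 2 * norm (y - co c z)"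
    using local_exp[OF complete c r(1) im r(2,5,3,6)] by blast
  \<comment> \<open>The last bound turns an initial coordinate velocity of at most 2 \<rho>' into a
    speed of at most \<eta>.\<close>
  define \<rho>' where "\<rho>' = min (min \<rho> r) (\<eta> / (2 * sqrt L))"
  have \<rho>': "\<rho>' > 0" "\<rho>' \<le> \<rho>" "\<rho>' \<le> r" "\<rho>' \<le> \<eta> / (2 * sqrt L)" using \<rho>(1) r \<eta>(1) by (auto simp: \<rho>'_def)
  show ?thesis
  proof (intro exI[of _ "sqrt l * \<rho>'"] conjI allI impI)
    show "0 < sqrt l * \<rho>'" using r \<rho>' by simp
    fix y assume y: "mdist z y < sqrt l * \<rho>'"
    also have "\<dots> \<le> sqrt l * r" using r(2) \<rho>'(3) by simp
    finally have "mdist z y < sqrt l * r" .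
    note m = mdist_lower[OF c(1) r(1) im c(2) r(2,5) this]
    have "sqrt l * norm (co c y - co c z) < sqrt l * \<rho>'" using m(2) y by linarith
    then have n: "norm (co c y - co c z) < \<rho>'" using r(2) by simp
    then have "co c y \<in> cball (co c z) \<rho>" using \<rho>'(2) by (simp add: dist_norm norm_minus_commute)
    then obtain \<gamma> where \<gamma>: "geodesic A g \<gamma>" "\<gamma> 0 = z" "\<gamma> 1 = ci c (co c y)" "norm (vel c \<gamma> 0) \<le> 2 * norm (co c y - co c z)"
      using \<rho>(2) by blast
    have ydm: "y \<in> dm c" using m(1) closed_ci_cball(3)[OF c(1) im] by blast
    then have \<gamma>1: "\<gamma> 1 = y" using \<gamma>(3) c by simp
    have "speed2 \<gamma> 0 \<le> L * (norm (vel c \<gamma> 0))\<^sup>2"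
      using speed2_chart[OF \<gamma>(1) c(1), of 0] \<gamma>(2) c r(1) r(6)[of "co c z" "vel c \<gamma> 0"] by simp
    then have "sqrt (speed2 \<gamma> 0) \<le> sqrt (L * (norm (vel c \<gamma> 0))\<^sup>2)" by simp
    also have "\<dots> = sqrt L * norm (vel c \<gamma> 0)" by (simp add: real_sqrt_mult)
    also have "\<dots> \<le> sqrt L * (2 * \<rho>')" using \<gamma>(4) n r(3) by (intro mult_left_mono) auto
    also have "\<dots> \<le> \<eta>" using \<rho>'(4) r(3) by (simp add: field_simps)
    finally have "sqrt (speed2 \<gamma> 0) \<le> mdist z y" using \<eta>(2)[OF \<gamma>(1,2)] \<gamma>1 by simp
    moreover have "mdist z y \<le> sqrt (speed2 \<gamma> 0)"
      using geodesic_mdist[OF \<gamma>(1), of 0 1] \<gamma>(2) \<gamma>1 by simp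
    ultimately show "\<exists>\<gamma>. geodesic A g \<gamma> \<and> \<gamma> 0 = z \<and> \<gamma> 1 = y \<and> sqrt (speed2 \<gamma> 0) = mdist z y"
      using \<gamma>(1,2) \<gamma>1 by auto
  qed
qed

end

lemma has_vector_derivative_at_0_tendsto:
  assumes "(h has_vector_derivative D) (at 0)" "h 0 = 0"
  shows "((\<lambda>e. (1 / e) *\<^sub>R h e) \<longlongrightarrow> D) (at 0)"
proof -
  have "((\<lambda>e. norm (h e - e *\<^sub>R D) / norm e) \<longlongrightarrow> 0) (at 0)"
    using assms unfolding has_vector_derivative_def has_derivative_iff_norm by simp
  moreover have "eventually (\<lambda>e. norm (h e - e *\<^sub>R D) / norm e = norm ((1 / e) *\<^sub>R h e - D)) (at (0::real))"
  proof (rule eventually_at_topological[THEN iffD2], intro exI[of _ UNIV] conjI ballI impI)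
    fix e :: real assume "e \<noteq> 0"
    then have "(1 / e) *\<^sub>R h e - D = (1 / e) *\<^sub>R (h e - e *\<^sub>R D)" by (simp add: scaleR_right_diff_distrib)
    then show "norm (h e - e *\<^sub>R D) / norm e = norm ((1 / e) *\<^sub>R h e - D)" by simp
  qed auto
  ultimately have "((\<lambda>e. norm ((1 / e) *\<^sub>R h e - D)) \<longlongrightarrow> 0) (at 0)"
    using Lim_transform_eventually by fastforce
  then show ?thesis by (simp add: tendsto_norm_zero_iff LIM_zero_iff)
qed

section \<open>Minimising curves have no corners; local uniqueness and the Hopf-Rinow
  theorem\<close>

context riemannian_manifold begin

text \<open>The mean of two distinct unit vectors is strictly shorter than 1. For small \<epsilon>
  the shortcut in time 2 \<epsilon> therefore has energy at most 2 \<epsilon> B with B < 1, and its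
  cost is below 2 \<epsilon>.\<close>

lemma no_corner:
  assumes \<gamma>: "geodesic A g \<gamma>" and \<sigma>: "geodesic A g \<sigma>" and z: "\<gamma> 0 = \<sigma> 0"
    and unit: "speed2 \<gamma> 0 = 1" "speed2 \<sigma> 0 = 1" and c: "c \<in> A" "\<gamma> 0 \<in> dm c"
    and \<delta>: "\<delta> > 0" "\<And>\<epsilon>. 0 < \<epsilon> \<Longrightarrow> \<epsilon> \<le> \<delta> \<Longrightarrow> 2 * \<epsilon> \<le> mdist (\<gamma> (- \<epsilon>)) (\<sigma> \<epsilon>)"
  shows "vel c \<gamma> 0 = vel c \<sigma> 0"
proof (rule ccontr)
  assume ne: "vel c \<gamma> 0 \<noteq> vel c \<sigma> 0"
  interpret c: chart_metric "im c" "G c" by (rule chart_metric_chart[OF c(1)])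
  define x0 where "x0 = co c (\<gamma> 0)"
  define T where "T = vel c \<gamma> 0"
  define S where "S = vel c \<sigma> 0"
  \<comment> \<open>The coordinate segment cutting the corner has velocity close to \<open>u\<close>, which is shorter than a unit vector.\<close>
  define u where "u = (1/2) *\<^sub>R (S + T)"
  have x0: "x0 \<in> im c" using c by (simp add: x0_def)
  have TT: "q c x0 T T = 1" using speed2_chart[OF \<gamma> c] unit by (simp add: x0_def T_def)
  have SS: "q c x0 S S = 1" using speed2_chart[OF \<sigma> c(1), of 0] c z unit by (simp add: x0_def S_def)
  have "q c x0 (T - S) (T - S) > 0" using ne by (intro c.g_pos x0) (simp add: T_def S_def)
  then have TS: "q c x0 T S < 1" using TT SS c.g_sym[OF x0, of S T] by (simp add: blinfun.bilinear_simps)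
  have uu: "q c x0 u u < 1" unfolding u_def using TS TT SS c.g_sym[OF x0, of S T] by (simp add: blinfun.bilinear_simps field_simps)
  define B where "B = (1 + q c x0 u u) / 2"
  have B: "B < 1" "q c x0 u u < B" using uu by (auto simp: B_def)
  let ?f = "\<lambda>z::(real^'n) \<times> (real^'n). q c (fst z) (snd z) (snd z)"
  have cf: "continuous_on (im c \<times> UNIV) ?f"
    by (intro continuous_intros continuous_on_compose2[OF smooth_on_continuous[OF c.smooth_g]]) auto
  \<comment> \<open>Positions and velocities with squared norm below B form an open set; a product
    neighbourhood inside it lets the points of the segment and its velocity be controlled
    separately.\<close>
  let ?W = "(im c \<times> UNIV) \<inter> ?f -` {..<B}"
  have oW: "open ?W"
    by (rule continuous_open_preimage[OF cf]) (auto intro!: open_Times open_image c)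
  have "(x0, u) \<in> ?W" using x0 B by auto
  then obtain N1 N2 where N': "open N1" "open N2" "(x0, u) \<in> N1 \<times> N2" "N1 \<times> N2 \<subseteq> ?W"
    by (rule open_prod_elim[OF oW])
  then have N: "open N1" "open N2" "x0 \<in> N1" "u \<in> N2" "N1 \<times> N2 \<subseteq> ?W" by auto
  obtain \<rho> where \<rho>: "\<rho> > 0" "ball x0 \<rho> \<subseteq> N1" using N(1,3) open_contains_ball by blast
  have dS: "((\<lambda>e. co c (\<sigma> e)) has_vector_derivative S) (at 0)"
    using geodesicD(1)[OF \<sigma> c(1), of 0] c z by (simp add: S_def)
  have neg: "((\<lambda>e::real. - e) has_vector_derivative - 1) (at 0)"
    by (auto intro!: derivative_eq_intros simp: has_real_derivative_iff_has_vector_derivative[symmetric])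
  have dT: "((\<lambda>e. co c (\<gamma> (- e))) has_vector_derivative - T) (at 0)"
  proof -
    have "((\<lambda>s. co c (\<gamma> s)) has_vector_derivative T) (at (- 0))"
      using geodesicD(1)[OF \<gamma> c] by (simp add: T_def)
    from vector_diff_chain_at[OF neg this] show ?thesis by (simp add: o_def)
  qed
  let ?h = "\<lambda>e. co c (\<sigma> e) - co c (\<gamma> (- e))"
  have "(?h has_vector_derivative S - (- T)) (at 0)" by (rule has_vector_derivative_diff[OF dS dT])
  then have "((\<lambda>e. (1 / e) *\<^sub>R ?h e) \<longlongrightarrow> S + T) (at 0)"
    by (intro has_vector_derivative_at_0_tendsto) (auto simp: z)
  then have "((\<lambda>e. (1 / 2) *\<^sub>R ((1 / e) *\<^sub>R ?h e)) \<longlongrightarrow> u) (at 0)"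
    unfolding u_def by (intro tendsto_intros)
  then have "eventually (\<lambda>e. (1 / 2) *\<^sub>R ((1 / e) *\<^sub>R ?h e) \<in> N2) (at 0)"
    using N(2,4) by (rule topological_tendstoD)
  then have ev1: "eventually (\<lambda>e. (1 / 2) *\<^sub>R ((1 / e) *\<^sub>R ?h e) \<in> N2) (at_right 0)"
    by (simp add: eventually_at_split)
  have tS: "((\<lambda>e. co c (\<sigma> e)) \<longlongrightarrow> x0) (at_right 0)"
    using has_vector_derivative_continuous[OF dS] z by (simp add: continuous_within x0_def filterlim_at_split)
  have tT: "((\<lambda>e. co c (\<gamma> (- e))) \<longlongrightarrow> x0) (at_right 0)"
    using has_vector_derivative_continuous[OF dT] by (simp add: continuous_within x0_def filterlim_at_split)
  have ev2: "eventually (\<lambda>e. co c (\<sigma> e) \<in> ball x0 \<rho>) (at_right 0)"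
    by (rule topological_tendstoD[OF tS]) (use \<rho> in auto)
  have ev3: "eventually (\<lambda>e. co c (\<gamma> (- e)) \<in> ball x0 \<rho>) (at_right 0)"
    by (rule topological_tendstoD[OF tT]) (use \<rho> in auto)
  have t\<sigma>: "(\<sigma> \<longlongrightarrow> \<sigma> 0) (at_right 0)"
    using geodesic_cont[OF \<sigma>] by (simp add: continuous_on_eq_continuous_at isCont_def filterlim_at_split)
  have "continuous_on UNIV (\<lambda>e. \<gamma> (- e))"
    by (rule continuous_on_compose2[OF geodesic_cont[OF \<gamma>]]) (auto intro!: continuous_intros)
  then have "isCont (\<lambda>e. \<gamma> (- e)) 0" by (simp add: continuous_on_eq_continuous_at)
  then have t\<gamma>: "((\<lambda>e. \<gamma> (- e)) \<longlongrightarrow> \<gamma> 0) (at_right 0)"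
    by (simp add: isCont_def filterlim_at_split)
  have ev4: "eventually (\<lambda>e. \<sigma> e \<in> dm c) (at_right 0)"
    by (rule topological_tendstoD[OF t\<sigma>]) (use c z open_domain in auto)
  have ev5: "eventually (\<lambda>e. \<gamma> (- e) \<in> dm c) (at_right 0)"
    by (rule topological_tendstoD[OF t\<gamma>]) (use c z open_domain in auto)
  have ev6: "eventually (\<lambda>e. 0 < e \<and> e \<le> \<delta>) (at_right 0)"
    using \<delta>(1) by (auto simp: eventually_at_right_field intro!: exI[of _ \<delta>])
  obtain e where e: "(1 / 2) *\<^sub>R ((1 / e) *\<^sub>R ?h e) \<in> N2" "co c (\<sigma> e) \<in> ball x0 \<rho>" "co c (\<gamma> (- e)) \<in> ball x0 \<rho>"
    "\<sigma> e \<in> dm c" "\<gamma> (- e) \<in> dm c" "0 < e" "e \<le> \<delta>"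
    using eventually_happens'[OF trivial_limit_at_right_real eventually_conj[OF ev1 eventually_conj[OF ev2 eventually_conj[OF ev3 eventually_conj[OF ev4 eventually_conj[OF ev5 ev6]]]]]]
    by auto
  let ?x = "co c (\<gamma> (- e))" and ?y = "co c (\<sigma> e)"
  have seg: "closed_segment ?x ?y \<subseteq> N1"
    using closed_segment_subset[OF e(3,2) convex_ball] \<rho>(2) by blast
  have "\<exists>en. path UNIV (ci c ?x) (ci c ?y) (2 * e) en \<and> en \<le> (2 * e) * B"
  proof (rule segment_path[OF c(1)])
    show "closed_segment ?x ?y \<subseteq> co c ` (dm c \<inter> UNIV)" using seg N(4,5) by auto
    fix v assume "v \<in> closed_segment ?x ?y"
    then have "(v, (1 / 2) *\<^sub>R ((1 / e) *\<^sub>R ?h e)) \<in> ?W" using seg e(1) N(5) by blast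
    then show "q c v ((1 / (2 * e)) *\<^sub>R (?y - ?x)) ((1 / (2 * e)) *\<^sub>R (?y - ?x)) \<le> B" by simp
  qed (use e in auto)
  then obtain en where en: "path UNIV (\<gamma> (- e)) (\<sigma> e) (2 * e) en" "en \<le> (2 * e) * B" using c e by auto
  have "2 * e \<le> mdist (\<gamma> (- e)) (\<sigma> e)" by (rule \<delta>(2)[OF e(6,7)])
  also have "\<dots> \<le> (2 * e + en) / 2" by (rule mdist_le[OF en(1)])
  also have "\<dots> \<le> e + e * B" using en(2) by simp
  also have "\<dots> < 2 * e" using B(1) e(6) by simp
  finally show False by simp
qed

text \<open>Continuous dependence near time x in a single chart, in the form that
  \<open>Bolzano\<close> consumes: d, r and K do not depend on a and b. Competitors have squared
  speed at most one above that of \<gamma>, so one velocity bound serves all of them.\<close>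

lemma local_flow:
  assumes \<gamma>: "geodesic A g \<gamma>"
  shows "\<exists>c d r K. c \<in> A \<and> 0 < d \<and> 0 < r \<and> \<gamma> x \<in> dm c \<and>
    (\<forall>a b. a \<le> x \<longrightarrow> x \<le> b \<longrightarrow> b - a < d \<longrightarrow> \<gamma> a \<in> dm c \<and> \<gamma> b \<in> dm c \<and>
     (\<forall>\<sigma>. geodesic A g \<sigma> \<longrightarrow> \<sigma> a \<in> dm c \<longrightarrow> norm (co c (\<sigma> a) - co c (\<gamma> a)) \<le> r \<longrightarrow> speed2 \<sigma> 0 \<le> speed2 \<gamma> 0 + 1 \<longrightarrow>
      \<sigma> b \<in> dm c \<and> (norm (co c (\<sigma> b) - co c (\<gamma> b)))\<^sup>2 + (norm (vel c \<sigma> b - vel c \<gamma> b))\<^sup>2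
      \<le> ((norm (co c (\<sigma> a) - co c (\<gamma> a)))\<^sup>2 + (norm (vel c \<sigma> a - vel c \<gamma> a))\<^sup>2) * exp (K * (b - a))))"
proof -
  obtain c where c: "c \<in> A" "\<gamma> x \<in> dm c" using ex_chart by blast
  let ?o = "co c (\<gamma> x)"
  obtain r l L where r: "0 < r" "0 < l" "cball ?o r \<subseteq> co c ` (dm c \<inter> UNIV)"
    "\<And>x v. x \<in> cball ?o r \<Longrightarrow> l * (norm v)\<^sup>2 \<le> q c x v v"
    using local_bounds[OF c open_UNIV UNIV_I] by blast
  have im: "cball ?o r \<subseteq> im c" using r(3) by auto
  let ?N = "ci c ` ball ?o (r / 4)"
  have sub: "ball ?o (r / 4) \<subseteq> im c" using im r(1) by (auto simp: subset_iff)
  have oN: "open ?N" by (rule open_ci_image[OF c(1) sub open_ball])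
  have "\<gamma> x \<in> ?N" using r(1) c by (intro image_eqI[of _ _ ?o]) auto
  then obtain d1 where d1: "d1 > 0" "ball x d1 \<subseteq> \<gamma> -` ?N"
    using geodesic_open_vimage[OF \<gamma> oN] open_contains_ball by blast
  define s where "s = speed2 \<gamma> 0 + 1"
  have s: "s > 0" using speed2_nonneg[OF \<gamma>] by (simp add: s_def)
  define M where "M = sqrt (s / l)"
  have M: "M \<ge> 0" using s r by (simp add: M_def)
  obtain K where K: "\<And>\<gamma> \<sigma> a b. geodesic A g \<gamma> \<Longrightarrow> geodesic A g \<sigma> \<Longrightarrow> a \<le> b \<Longrightarrow>
    (\<forall>t\<in>{a..b}. \<gamma> t \<in> dm c \<and> \<sigma> t \<in> dm c \<and> co c (\<gamma> t) \<in> cball ?o r \<and> co c (\<sigma> t) \<in> cball ?o r \<and>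
      norm (vel c \<gamma> t) \<le> M \<and> norm (vel c \<sigma> t) \<le> M) \<Longrightarrow>
    (norm (co c (\<gamma> b) - co c (\<sigma> b)))\<^sup>2 + (norm (vel c \<gamma> b - vel c \<sigma> b))\<^sup>2
      \<le> ((norm (co c (\<gamma> a) - co c (\<sigma> a)))\<^sup>2 + (norm (vel c \<gamma> a - vel c \<sigma> a))\<^sup>2) * exp (K * (b - a))"
    using geodesic_gronwall[OF c(1) im M] by metis
  define d2 where "d2 = sqrt l * (r / 2) / sqrt s"
  have d2: "d2 > 0" using r s by (simp add: d2_def)
  have stay: "\<sigma> t \<in> dm c \<and> co c (\<sigma> t) \<in> cball ?o r \<and> norm (vel c \<sigma> t) \<le> M"
    if \<sigma>: "geodesic A g \<sigma>" "speed2 \<sigma> 0 \<le> s" "\<sigma> a \<in> ci c ` cball ?o (r / 2)" and t: "a \<le> t" "t - a < d2" for \<sigma> a t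
  proof -
    have "(t - a) * sqrt (speed2 \<sigma> 0) \<le> (t - a) * sqrt s" using t \<sigma>(2) by (intro mult_left_mono) auto
    also have "\<dots> < d2 * sqrt s" using t s by simp
    also have "\<dots> = sqrt l * (r / 2)" using s by (simp add: d2_def)
    finally have le: "(t - a) * sqrt (speed2 \<sigma> 0) < sqrt l * (r / 2)" .
    have "norm (vel c \<sigma> t) \<le> sqrt (speed2 \<sigma> 0 / l)"
      by (rule geodesic_stays(3)[OF \<sigma>(1) c(1) r(1) im r(2,4) \<sigma>(3) t(1) le])
    also have "\<dots> \<le> M" unfolding M_def using \<sigma>(2) r(2) by (simp add: divide_right_mono)
    finally show ?thesis
      using geodesic_stays(1)[OF \<sigma>(1) c(1) r(1) im r(2,4) \<sigma>(3) t(1) le]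
        geodesic_stays(2)[OF \<sigma>(1) c(1) r(1) im r(2,4) \<sigma>(3) t(1) le] by blast
  qed
  have \<gamma>N: "\<gamma> t \<in> dm c \<and> co c (\<gamma> t) \<in> ball ?o (r / 4)" if t: "\<bar>t - x\<bar> < d1" for t
  proof -
    have "\<gamma> t \<in> ?N" using d1(2) t by (auto simp: dist_real_def subset_iff)
    then obtain y where "\<gamma> t = ci c y" "y \<in> ball ?o (r / 4)" by blast
    then show ?thesis using sub by (auto simp: subset_iff)
  qed
  have main: "\<gamma> a \<in> dm c \<and> \<gamma> b \<in> dm c \<and>
     (\<forall>\<sigma>. geodesic A g \<sigma> \<longrightarrow> \<sigma> a \<in> dm c \<longrightarrow> norm (co c (\<sigma> a) - co c (\<gamma> a)) \<le> r / 4 \<longrightarrow> speed2 \<sigma> 0 \<le> speed2 \<gamma> 0 + 1 \<longrightarrow>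
      \<sigma> b \<in> dm c \<and> (norm (co c (\<sigma> b) - co c (\<gamma> b)))\<^sup>2 + (norm (vel c \<sigma> b - vel c \<gamma> b))\<^sup>2
      \<le> ((norm (co c (\<sigma> a) - co c (\<gamma> a)))\<^sup>2 + (norm (vel c \<sigma> a - vel c \<gamma> a))\<^sup>2) * exp (K * (b - a)))"
    if ab: "a \<le> x" "x \<le> b" "b - a < min d1 d2" for a b
  proof (intro conjI allI impI)
    have ga: "\<gamma> a \<in> dm c" "co c (\<gamma> a) \<in> ball ?o (r / 4)" and gb: "\<gamma> b \<in> dm c"
      using \<gamma>N[of a] \<gamma>N[of b] ab by auto
    show "\<gamma> a \<in> dm c" "\<gamma> b \<in> dm c" by (rule ga gb)+
    fix \<sigma> assume \<sigma>: "geodesic A g \<sigma>" "\<sigma> a \<in> dm c" "norm (co c (\<sigma> a) - co c (\<gamma> a)) \<le> r / 4" "speed2 \<sigma> 0 \<le> speed2 \<gamma> 0 + 1"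
    have \<sigma>a: "\<sigma> a \<in> ci c ` cball ?o (r / 2)"
    proof (rule image_eqI)
      show "\<sigma> a = ci c (co c (\<sigma> a))" using \<sigma>(2) c by simp
      show "co c (\<sigma> a) \<in> cball ?o (r / 2)"
        using dist_triangle[of ?o "co c (\<sigma> a)" "co c (\<gamma> a)"] ga(2) \<sigma>(3) by (simp add: dist_norm norm_minus_commute)
    qed
    have \<gamma>a: "\<gamma> a \<in> ci c ` cball ?o (r / 2)"
      using ga c r(1) by (intro image_eqI[of _ _ "co c (\<gamma> a)"]) auto
    have st: "\<forall>t\<in>{a..b}. \<sigma> t \<in> dm c \<and> \<gamma> t \<in> dm c \<and> co c (\<sigma> t) \<in> cball ?o r \<and> co c (\<gamma> t) \<in> cball ?o r \<and>
      norm (vel c \<sigma> t) \<le> M \<and> norm (vel c \<gamma> t) \<le> M"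
    proof
      fix t assume t: "t \<in> {a..b}"
      show "\<sigma> t \<in> dm c \<and> \<gamma> t \<in> dm c \<and> co c (\<sigma> t) \<in> cball ?o r \<and> co c (\<gamma> t) \<in> cball ?o r \<and>
        norm (vel c \<sigma> t) \<le> M \<and> norm (vel c \<gamma> t) \<le> M"
        using stay[OF \<sigma>(1) _ \<sigma>a, of t] stay[OF \<gamma> _ \<gamma>a, of t] \<sigma>(4) t ab by (auto simp: s_def)
    qed
    show "\<sigma> b \<in> dm c" using st ab by auto
    show "(norm (co c (\<sigma> b) - co c (\<gamma> b)))\<^sup>2 + (norm (vel c \<sigma> b - vel c \<gamma> b))\<^sup>2
      \<le> ((norm (co c (\<sigma> a) - co c (\<gamma> a)))\<^sup>2 + (norm (vel c \<sigma> a - vel c \<gamma> a))\<^sup>2) * exp (K * (b - a))"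
      by (rule K[OF \<sigma>(1) \<gamma> _ st]) (use ab in simp)
  qed
  show ?thesis
    by (rule exI[of _ c], rule exI[of _ "min d1 d2"], rule exI[of _ "r / 4"], rule exI[of _ K],
        rule conjI[OF c(1)], rule conjI, simp add: d1(1) d2, rule conjI, simp add: r(1), rule conjI[OF c(2)],
        rule allI, rule allI, rule impI, rule impI, rule impI, rule main)
qed

text \<open>Equal initial data make the right side of the Gronwall bound vanish.\<close>

lemma geodesic_unique_local:
  assumes \<gamma>: "geodesic A g \<gamma>" and \<sigma>: "geodesic A g \<sigma>" and 0: "\<gamma> 0 = \<sigma> 0"
    and v: "\<And>c. c \<in> A \<Longrightarrow> \<gamma> 0 \<in> dm c \<Longrightarrow> vel c \<gamma> 0 = vel c \<sigma> 0"
  shows "\<exists>d>0. \<forall>t. 0 \<le> t \<longrightarrow> t < d \<longrightarrow> \<sigma> t = \<gamma> t"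
proof -
  obtain c d r K where f: "c \<in> A" "0 < d" "0 < r" "\<gamma> 0 \<in> dm c"
    "\<And>a b. a \<le> 0 \<Longrightarrow> 0 \<le> b \<Longrightarrow> b - a < d \<Longrightarrow> \<gamma> a \<in> dm c \<and> \<gamma> b \<in> dm c \<and>
     (\<forall>\<sigma>. geodesic A g \<sigma> \<longrightarrow> \<sigma> a \<in> dm c \<longrightarrow> norm (co c (\<sigma> a) - co c (\<gamma> a)) \<le> r \<longrightarrow> speed2 \<sigma> 0 \<le> speed2 \<gamma> 0 + 1 \<longrightarrow>
      \<sigma> b \<in> dm c \<and> (norm (co c (\<sigma> b) - co c (\<gamma> b)))\<^sup>2 + (norm (vel c \<sigma> b - vel c \<gamma> b))\<^sup>2
      \<le> ((norm (co c (\<sigma> a) - co c (\<gamma> a)))\<^sup>2 + (norm (vel c \<sigma> a - vel c \<gamma> a))\<^sup>2) * exp (K * (b - a)))"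
    using local_flow[OF \<gamma>, of 0] by blast
  have s2: "speed2 \<sigma> 0 = speed2 \<gamma> 0"
    using speed2_chart[OF \<gamma> f(1,4)] speed2_chart[OF \<sigma> f(1), of 0] f(4) 0 v[OF f(1,4)] by simp
  have "\<sigma> t = \<gamma> t" if t: "0 \<le> t" "t < d" for t
  proof -
    have dm: "\<gamma> t \<in> dm c" "\<sigma> t \<in> dm c"
      and le: "(norm (co c (\<sigma> t) - co c (\<gamma> t)))\<^sup>2 + (norm (vel c \<sigma> t - vel c \<gamma> t))\<^sup>2 \<le> 0"
      using f(5)[of 0 t] t \<sigma> f(3,4) 0 s2 v[OF f(1,4)] by auto
    have "(norm (co c (\<sigma> t) - co c (\<gamma> t)))\<^sup>2 \<le> 0" using le by (rule order_trans[rotated]) simp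
    then have "co c (\<sigma> t) = co c (\<gamma> t)" by simp
    then show ?thesis using dm f(1) by (metis ci_co)
  qed
  then show ?thesis using f(2) by blast
qed

text \<open>\<open>sphere_step\<close> selects a point near p through which the distance to x is
  additive; follow the unit-speed geodesic through it for as long as the distance to x decreases at
  unit rate. If that stopped at a time t0 < r, one could aim anew from \<gamma> t0; the broken curve
  still minimises, so it has no corner, and uniqueness prolongs \<gamma>.\<close>

theorem hopf_rinow:
  assumes complete: "complete_metric A g"
  shows "\<exists>\<gamma>. geodesic A g \<gamma> \<and> \<gamma> 0 = p \<and> \<gamma> 1 = x \<and> sqrt (speed2 \<gamma> 0) = mdist p x"
proof (cases "mdist p x = 0")
  case True
  obtain c where c: "c \<in> A" "p \<in> dm c" using ex_chart by blast
  obtain \<gamma> where \<gamma>: "geodesic A g \<gamma>" "\<gamma> 0 = p" "vel c \<gamma> 0 = 0" using complete_metricD[OF complete c] by blast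
  have s: "speed2 \<gamma> 0 = 0" using speed2_eq[OF \<gamma>(1) c(1), of 0] \<gamma> c by (simp add: blinfun.bilinear_simps)
  have "mdist p (\<gamma> 1) = 0" using geodesic_mdist[OF \<gamma>(1), of 0 1] \<gamma>(2) s mdist_nonneg[of p "\<gamma> 1"] by simp
  then have "\<gamma> 1 = x" using mdist_eq_0 True by metis
  then show ?thesis using \<gamma> s True by auto
next
  case False
  define r where "r = mdist p x"
  have r: "r > 0" using False mdist_nonneg[of p x] by (simp add: r_def)
  have step: "\<exists>d>0. \<forall>\<delta>. 0 < \<delta> \<longrightarrow> \<delta> \<le> d \<longrightarrow> \<delta> \<le> mdist z x \<longrightarrow>
      (\<exists>\<sigma>. geodesic A g \<sigma> \<and> \<sigma> 0 = z \<and> speed2 \<sigma> 0 = 1 \<and> \<delta> + mdist (\<sigma> \<delta>) x \<le> mdist z x)" for z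
  proof -
    obtain d1 where d1: "d1 > 0" "\<And>\<delta>. 0 < \<delta> \<Longrightarrow> \<delta> \<le> d1 \<Longrightarrow> \<delta> \<le> mdist z x \<Longrightarrow> \<exists>y. mdist z y = \<delta> \<and> \<delta> + mdist y x \<le> mdist z x"
      using sphere_step[of z x] by blast
    obtain d2 where d2: "d2 > 0" "\<And>y. mdist z y < d2 \<Longrightarrow> \<exists>\<gamma>. geodesic A g \<gamma> \<and> \<gamma> 0 = z \<and> \<gamma> 1 = y \<and> sqrt (speed2 \<gamma> 0) = mdist z y"
      using local_geodesic[OF complete, of z] by blast
    have "\<exists>\<sigma>. geodesic A g \<sigma> \<and> \<sigma> 0 = z \<and> speed2 \<sigma> 0 = 1 \<and> \<delta> + mdist (\<sigma> \<delta>) x \<le> mdist z x"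
      if \<delta>: "0 < \<delta>" "\<delta> \<le> min d1 (d2 / 2)" "\<delta> \<le> mdist z x" for \<delta>
    proof -
      obtain y where y: "mdist z y = \<delta>" "\<delta> + mdist y x \<le> mdist z x" using d1(2)[of \<delta>] \<delta> by auto
      obtain \<gamma> where \<gamma>: "geodesic A g \<gamma>" "\<gamma> 0 = z" "\<gamma> 1 = y" "sqrt (speed2 \<gamma> 0) = \<delta>"
        using d2(2)[of y] y(1) \<delta> d2(1) by auto
      have s: "speed2 \<gamma> 0 = \<delta>\<^sup>2" using \<gamma>(4) speed2_nonneg[OF \<gamma>(1)] by (metis real_sqrt_pow2)
      let ?\<sigma> = "\<lambda>s. \<gamma> ((1 / \<delta>) * s + 0)"
      have "geodesic A g ?\<sigma>" by (rule geodesic_affine(1)[OF \<gamma>(1)])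
      moreover have "speed2 ?\<sigma> 0 = 1" unfolding speed2_affine[OF \<gamma>(1)] s using \<delta>(1) by (simp add: power_divide)
      ultimately show ?thesis using \<gamma> y \<delta>(1) by (intro exI[of _ ?\<sigma>]) simp
    qed
    then show ?thesis using d1(1) d2(1) by (intro exI[of _ "min d1 (d2 / 2)"]) auto
  qed
  obtain dp where dp: "dp > 0" "\<And>\<delta>. 0 < \<delta> \<Longrightarrow> \<delta> \<le> dp \<Longrightarrow> \<delta> \<le> mdist p x \<Longrightarrow>
      (\<exists>\<sigma>. geodesic A g \<sigma> \<and> \<sigma> 0 = p \<and> speed2 \<sigma> 0 = 1 \<and> \<delta> + mdist (\<sigma> \<delta>) x \<le> mdist p x)"
    using step[of p] by blast
  define \<delta>1 where "\<delta>1 = min dp r"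
  have \<delta>1: "0 < \<delta>1" "\<delta>1 \<le> r" using dp(1) r by (auto simp: \<delta>1_def)
  obtain \<gamma> where \<gamma>: "geodesic A g \<gamma>" "\<gamma> 0 = p" "speed2 \<gamma> 0 = 1" "\<delta>1 + mdist (\<gamma> \<delta>1) x \<le> r"
    using dp(2)[of \<delta>1] dp(1) r unfolding \<delta>1_def r_def by auto
  have unit: "mdist (\<gamma> a) (\<gamma> b) \<le> b - a" if "a \<le> b" for a b
    using geodesic_mdist[OF \<gamma>(1) that] \<gamma>(3) by simp
  \<comment> \<open>The times up to which nothing is lost: the distance to x is always at least r -
    t. The condition is closed, hence holds at the supremum.\<close>
  define B where "B = {0..r} \<inter> {t. mdist (\<gamma> t) x + t \<le> r}"
  have "continuous_on UNIV (\<lambda>t. mdist (\<gamma> t) x + t)"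
    by (intro continuous_intros continuous_on_compose2[OF mdist_continuous(2) geodesic_cont[OF \<gamma>(1)]]) auto
  then have "closed {t. mdist (\<gamma> t) x + t \<le> r}"
    by (intro closed_Collect_le continuous_on_const)
  then have clB: "closed B" by (simp add: B_def closed_Int)
  have bB: "bdd_above B" by (rule bdd_aboveI[of _ r]) (auto simp: B_def)
  have \<delta>1B: "\<delta>1 \<in> B" using \<delta>1 \<gamma>(4) by (simp add: B_def)
  define t0 where "t0 = Sup B"
  have t0B: "t0 \<in> B" unfolding t0_def using closed_contains_Sup[OF _ bB clB] \<delta>1B by blast
  have t0: "\<delta>1 \<le> t0" "t0 \<le> r" "mdist (\<gamma> t0) x + t0 \<le> r"
    using t0B cSup_upper[OF \<delta>1B bB] by (auto simp: B_def t0_def)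
  have "t0 = r"
  proof (rule ccontr)
    assume "t0 \<noteq> r"
    then have t0r: "t0 < r" using t0 by simp
    have lower: "r - t \<le> mdist (\<gamma> t) x" if "0 \<le> t" for t
      using mdist_triangle[of p x "\<gamma> t"] unit[OF that] \<gamma>(2) by (simp add: r_def)
    have zx: "mdist (\<gamma> t0) x = r - t0" using lower[of t0] t0 \<delta>1 by simp
    obtain d where d: "d > 0" "\<And>\<delta>. 0 < \<delta> \<Longrightarrow> \<delta> \<le> d \<Longrightarrow> \<delta> \<le> mdist (\<gamma> t0) x \<Longrightarrow>
      (\<exists>\<sigma>. geodesic A g \<sigma> \<and> \<sigma> 0 = \<gamma> t0 \<and> speed2 \<sigma> 0 = 1 \<and> \<delta> + mdist (\<sigma> \<delta>) x \<le> mdist (\<gamma> t0) x)"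
      using step[of "\<gamma> t0"] by blast
    define \<delta> where "\<delta> = min d (r - t0)"
    have \<delta>: "0 < \<delta>" "\<delta> \<le> d" "\<delta> \<le> r - t0" using d(1) t0r by (auto simp: \<delta>_def)
    obtain \<sigma> where \<sigma>: "geodesic A g \<sigma>" "\<sigma> 0 = \<gamma> t0" "speed2 \<sigma> 0 = 1" "\<delta> + mdist (\<sigma> \<delta>) x \<le> r - t0"
      using d(2)[of \<delta>] \<delta> zx by auto
    have \<sigma>x: "mdist (\<sigma> s) x \<le> r - t0 - s" if "s \<le> \<delta>" for s
      using mdist_triangle[of "\<sigma> s" x "\<sigma> \<delta>"] geodesic_mdist[OF \<sigma>(1) that] \<sigma>(3,4) by simp
    let ?\<gamma> = "\<lambda>s. \<gamma> (1 * s + t0)"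
    have g': "geodesic A g ?\<gamma>" by (rule geodesic_affine(1)[OF \<gamma>(1)])
    have s': "speed2 ?\<gamma> 0 = 1" unfolding speed2_affine[OF \<gamma>(1)] by (simp add: \<gamma>(3))
    \<comment> \<open>Triangle inequality towards x: the first point has distance at least r - t0 +
      \<epsilon> from x, the second at most r - t0 - \<epsilon>.\<close>
    have far: "2 * \<epsilon> \<le> mdist (?\<gamma> (- \<epsilon>)) (\<sigma> \<epsilon>)" if \<epsilon>: "0 < \<epsilon>" "\<epsilon> \<le> min \<delta> t0" for \<epsilon>
      using mdist_triangle[of "\<gamma> (t0 - \<epsilon>)" x "\<sigma> \<epsilon>"] lower[of "t0 - \<epsilon>"] \<sigma>x[of \<epsilon>] \<epsilon> by simp
    have "\<exists>d>0. \<forall>t. 0 \<le> t \<longrightarrow> t < d \<longrightarrow> \<sigma> t = ?\<gamma> t"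
    proof (rule geodesic_unique_local[OF g' \<sigma>(1)])
      show "?\<gamma> 0 = \<sigma> 0" using \<sigma>(2) by simp
      fix c assume c: "c \<in> A" "?\<gamma> 0 \<in> dm c"
      show "vel c ?\<gamma> 0 = vel c \<sigma> 0"
        by (rule no_corner[where \<delta> = "min \<delta> t0", OF g' \<sigma>(1) _ s' \<sigma>(3) c _ far]) (use \<sigma>(2) \<delta> t0 \<delta>1 in auto)
    qed
    then obtain d' where d': "d' > 0" "\<And>t. 0 \<le> t \<Longrightarrow> t < d' \<Longrightarrow> \<sigma> t = \<gamma> (t + t0)" by auto
    define s where "s = min \<delta> (d' / 2)"
    have s: "0 < s" "s \<le> \<delta>" "s < d'" using \<delta> d'(1) by (auto simp: s_def)
    have "t0 + s \<in> B"
      using \<sigma>x[OF s(2)] d'(2)[of s] s \<delta> t0 \<delta>1 by (simp add: B_def add.commute)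
    then have "t0 + s \<le> t0" using cSup_upper[OF _ bB] unfolding t0_def[symmetric] by blast
    then show False using s by simp
  qed
  then have "mdist (\<gamma> r) x = 0" using t0 mdist_nonneg[of "\<gamma> r" x] by simp
  then have "x = \<gamma> r" by (rule mdist_eq_0)
  moreover have "speed2 (\<lambda>s. \<gamma> (r * s + 0)) 0 = r\<^sup>2" unfolding speed2_affine[OF \<gamma>(1)] by (simp add: \<gamma>(3))
  then have "sqrt (speed2 (\<lambda>s. \<gamma> (r * s + 0)) 0) = mdist p x" using r by (simp add: r_def[symmetric])
  ultimately show ?thesis
    using geodesic_affine(1)[OF \<gamma>(1), of r 0] \<gamma>(2) by (intro exI[of _ "\<lambda>s. \<gamma> (r * s + 0)"]) simp
qed

end

context chart_function begin

lemma w_nonneg: "x \<in> U \<Longrightarrow> 0 \<le> w x"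
  by (simp add: w_eq g_nonneg)

text \<open>The component of X orthogonal to v has nonnegative square.\<close>

lemma cauchy_schwarz_g:
  assumes x: "x \<in> U"
  shows "(bderiv F x v)\<^sup>2 \<le> w x * g x v v"
proof (cases "v = 0")
  case False
  have pos: "g x v v > 0" by (rule g_pos[OF x False])
  define t where "t = g x (X x) v / g x v v"
  have "0 \<le> g x (X x - t *\<^sub>R v) (X x - t *\<^sub>R v)" by (rule g_nonneg[OF x])
  also have "\<dots> = g x (X x) (X x) - 2 * t * g x (X x) v + t * t * g x v v"
    by (simp add: blinfun.bilinear_simps g_sym[OF x, of v "X x"] algebra_simps)
  also have "\<dots> = w x - (g x (X x) v)\<^sup>2 / g x v v"
    using pos by (simp add: w_eq[OF x] t_def power2_eq_square field_simps)
  finally show ?thesis using pos by (simp add: g_X[OF x] field_simps)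
qed (simp add: blinfun.bilinear_simps)

end

section \<open>The exponential map at a point\<close>

context riemannian_manifold begin

lemma tendsto_co:
  assumes c: "c \<in> A" "p \<in> dm c" and u: "(u \<longlongrightarrow> p) F"
  shows "((\<lambda>k. co c (u k)) \<longlongrightarrow> co c p) F"
proof -
  have "isCont (co c) p" using cont_co[OF c(1)] open_domain[OF c(1)] c(2) by (simp add: continuous_on_eq_continuous_at)
  then show ?thesis using u by (rule isCont_tendsto_compose)
qed

text \<open>Convergence of position and velocity at time t, that is, convergence in the tangent
  bundle, expressed through charts.\<close>

definition flow_conv :: "(nat \<Rightarrow> real \<Rightarrow> 'a) \<Rightarrow> (real \<Rightarrow> 'a) \<Rightarrow> real \<Rightarrow> bool"
  where "flow_conv \<sigma> \<gamma> t \<longleftrightarrow> (\<lambda>k. \<sigma> k t) \<longlonglongrightarrow> \<gamma> t \<and>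
    (\<forall>c\<in>A. \<gamma> t \<in> dm c \<longrightarrow> (\<lambda>k. vel c (\<sigma> k) t) \<longlonglongrightarrow> vel c \<gamma> t)"

text \<open>One chart suffices: velocities in another chart are images under \<open>jac\<close>,
  which depends continuously on the point.\<close>

lemma flow_convI:
  assumes \<sigma>: "\<And>k. geodesic A g (\<sigma> k)" and \<gamma>: "geodesic A g \<gamma>" and c: "c \<in> A" "\<gamma> t \<in> dm c"
    and x: "(\<lambda>k. \<sigma> k t) \<longlonglongrightarrow> \<gamma> t" and v: "(\<lambda>k. vel c (\<sigma> k) t) \<longlonglongrightarrow> vel c \<gamma> t"
  shows "flow_conv \<sigma> \<gamma> t"
  unfolding flow_conv_def
proof (intro conjI x ballI impI)
  fix d assume d: "d \<in> A" "\<gamma> t \<in> dm d"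
  have ev: "eventually (\<lambda>k. \<sigma> k t \<in> dm c \<inter> dm d) sequentially"
    by (rule topological_tendstoD[OF x open_Int[OF open_domain[OF c(1)] open_domain[OF d(1)]]]) (use c d in simp)
  have "smooth_on (co c ` (dm c \<inter> dm d)) (bderiv (tr c d))"
    by (intro smooth_on_bderiv open_overlap smooth_transition c d)
  then have "isCont (bderiv (tr c d)) (co c (\<gamma> t))"
    using smooth_on_continuous open_overlap[OF c(1) d(1)] c d by (fastforce simp: continuous_on_eq_continuous_at)
  then have "(\<lambda>k. jac c d (\<sigma> k t)) \<longlonglongrightarrow> jac c d (\<gamma> t)"
    unfolding jac_def by (rule isCont_tendsto_compose[OF _ tendsto_co[OF c x]])
  then have "(\<lambda>k. jac c d (\<sigma> k t) (vel c (\<sigma> k) t)) \<longlonglongrightarrow> jac c d (\<gamma> t) (vel c \<gamma> t)"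
    by (intro tendsto_intros v)
  moreover have "eventually (\<lambda>k. jac c d (\<sigma> k t) (vel c (\<sigma> k) t) = vel d (\<sigma> k) t) sequentially"
    using ev by eventually_elim (use geodesic_vel_jac[OF \<sigma> c(1) _ d(1)] in auto)
  ultimately show "(\<lambda>k. vel d (\<sigma> k) t) \<longlonglongrightarrow> vel d \<gamma> t"
    unfolding geodesic_vel_jac[OF \<gamma> c d] by (rule Lim_transform_eventually)
qed

text \<open>\<open>local_flow\<close> carries convergence over short intervals, and the implication
  from a to b chains. Since the speeds converge too, all but finitely many competitors satisfy its
  speed bound.\<close>

lemma flow_convergence:
  assumes \<sigma>: "\<And>k. geodesic A g (\<sigma> k)" and \<gamma>: "geodesic A g \<gamma>" and ab: "a \<le> b"
    and conv: "flow_conv \<sigma> \<gamma> a"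
  shows "flow_conv \<sigma> \<gamma> b"
proof -
  have "flow_conv \<sigma> \<gamma> a \<longrightarrow> flow_conv \<sigma> \<gamma> b"
    using ab
  proof (induction rule: Bolzano)
    case (local x)
    obtain c d r K where f: "c \<in> A" "0 < d" "0 < r" "\<gamma> x \<in> dm c"
      "\<And>a b. a \<le> x \<Longrightarrow> x \<le> b \<Longrightarrow> b - a < d \<Longrightarrow> \<gamma> a \<in> dm c \<and> \<gamma> b \<in> dm c \<and>
       (\<forall>\<sigma>. geodesic A g \<sigma> \<longrightarrow> \<sigma> a \<in> dm c \<longrightarrow> norm (co c (\<sigma> a) - co c (\<gamma> a)) \<le> r \<longrightarrow> speed2 \<sigma> 0 \<le> speed2 \<gamma> 0 + 1 \<longrightarrow>
        \<sigma> b \<in> dm c \<and> (norm (co c (\<sigma> b) - co c (\<gamma> b)))\<^sup>2 + (norm (vel c \<sigma> b - vel c \<gamma> b))\<^sup>2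
        \<le> ((norm (co c (\<sigma> a) - co c (\<gamma> a)))\<^sup>2 + (norm (vel c \<sigma> a - vel c \<gamma> a))\<^sup>2) * exp (K * (b - a)))"
      using local_flow[OF \<gamma>, of x] by blast
    interpret c: chart_metric "im c" "G c" by (rule chart_metric_chart[OF f(1)])
    have "flow_conv \<sigma> \<gamma> b" if ab: "a \<le> x" "x \<le> b" "b - a < d" and conv: "flow_conv \<sigma> \<gamma> a" for a b
    proof -
      have dm: "\<gamma> a \<in> dm c" "\<gamma> b \<in> dm c" using f(5)[OF ab] by auto
      have xa: "(\<lambda>k. \<sigma> k a) \<longlonglongrightarrow> \<gamma> a" and va: "(\<lambda>k. vel c (\<sigma> k) a) \<longlonglongrightarrow> vel c \<gamma> a"
        using conv f(1) dm unfolding flow_conv_def by auto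
      have ca: "(\<lambda>k. co c (\<sigma> k a)) \<longlonglongrightarrow> co c (\<gamma> a)" by (rule tendsto_co[OF f(1) dm(1) xa])
      have ev1: "eventually (\<lambda>k. \<sigma> k a \<in> dm c) sequentially"
        by (rule topological_tendstoD[OF xa open_domain[OF f(1)] dm(1)])
      have "((\<lambda>k. norm (co c (\<sigma> k a) - co c (\<gamma> a))) \<longlongrightarrow> 0) sequentially"
        using ca by (simp add: LIM_zero_iff tendsto_norm_zero_iff)
      then have ev2: "eventually (\<lambda>k. norm (co c (\<sigma> k a) - co c (\<gamma> a)) < r) sequentially"
        by (rule order_tendstoD(2)[OF _ f(3)])
      have "isCont (q c) (co c (\<gamma> a))"
        using smooth_on_continuous[OF c.smooth_g] c.open_U dm(1) by (simp add: continuous_on_eq_continuous_at)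
      then have "(\<lambda>k. q c (co c (\<sigma> k a))) \<longlonglongrightarrow> q c (co c (\<gamma> a))" using ca by (rule isCont_tendsto_compose)
      then have "(\<lambda>k. q c (co c (\<sigma> k a)) (vel c (\<sigma> k) a) (vel c (\<sigma> k) a)) \<longlonglongrightarrow> speed2 \<gamma> 0"
        unfolding speed2_chart[OF \<gamma> f(1) dm(1), symmetric] by (intro tendsto_intros va)
      then have "eventually (\<lambda>k. q c (co c (\<sigma> k a)) (vel c (\<sigma> k) a) (vel c (\<sigma> k) a) < speed2 \<gamma> 0 + 1) sequentially"
        by (rule order_tendstoD(2)) simp
      with ev1 have ev3: "eventually (\<lambda>k. speed2 (\<sigma> k) 0 < speed2 \<gamma> 0 + 1) sequentially"
        by eventually_elim (use speed2_chart[OF \<sigma> f(1)] in auto)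
      let ?R = "\<lambda>k. ((norm (co c (\<sigma> k a) - co c (\<gamma> a)))\<^sup>2 + (norm (vel c (\<sigma> k) a - vel c \<gamma> a))\<^sup>2) * exp (K * (b - a))"
      have R: "?R \<longlonglongrightarrow> 0"
        by (rule tendsto_eq_intros tendsto_norm ca va refl | simp)+
      have ev: "eventually (\<lambda>k. \<sigma> k b \<in> dm c \<and> (norm (co c (\<sigma> k b) - co c (\<gamma> b)))\<^sup>2 + (norm (vel c (\<sigma> k) b - vel c \<gamma> b))\<^sup>2 \<le> ?R k) sequentially"
        using ev1 ev2 ev3 by eventually_elim (use f(5)[OF ab] \<sigma> in auto)
      have "(\<lambda>k. (norm (co c (\<sigma> k b) - co c (\<gamma> b)))\<^sup>2) \<longlonglongrightarrow> 0"
      proof (rule tendsto_sandwich[OF _ _ tendsto_const R])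
        show "eventually (\<lambda>k. (norm (co c (\<sigma> k b) - co c (\<gamma> b)))\<^sup>2 \<le> ?R k) sequentially"
          using ev by eventually_elim (meson order_trans le_add_same_cancel1 zero_le_power2)
      qed simp
      then have cb: "(\<lambda>k. co c (\<sigma> k b)) \<longlonglongrightarrow> co c (\<gamma> b)"
        by (simp add: power_tendsto_0_iff tendsto_norm_zero_iff LIM_zero_iff)
      have "(\<lambda>k. (norm (vel c (\<sigma> k) b - vel c \<gamma> b))\<^sup>2) \<longlonglongrightarrow> 0"
      proof (rule tendsto_sandwich[OF _ _ tendsto_const R])
        show "eventually (\<lambda>k. (norm (vel c (\<sigma> k) b - vel c \<gamma> b))\<^sup>2 \<le> ?R k) sequentially"
          using ev by eventually_elim (meson order_trans le_add_same_cancel2 zero_le_power2)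
      qed simp
      then have vb: "(\<lambda>k. vel c (\<sigma> k) b) \<longlonglongrightarrow> vel c \<gamma> b"
        by (simp add: power_tendsto_0_iff tendsto_norm_zero_iff LIM_zero_iff)
      have "isCont (ci c) (co c (\<gamma> b))"
        using cont_ci[OF f(1)] c.open_U dm(2) by (simp add: continuous_on_eq_continuous_at)
      then have "(\<lambda>k. ci c (co c (\<sigma> k b))) \<longlonglongrightarrow> ci c (co c (\<gamma> b))" using cb by (rule isCont_tendsto_compose)
      moreover have "eventually (\<lambda>k. ci c (co c (\<sigma> k b)) = \<sigma> k b) sequentially"
        using ev by eventually_elim (use f(1) in auto)
      ultimately have "(\<lambda>k. \<sigma> k b) \<longlonglongrightarrow> ci c (co c (\<gamma> b))" by (rule Lim_transform_eventually)
      then have xb: "(\<lambda>k. \<sigma> k b) \<longlonglongrightarrow> \<gamma> b" using f(1) dm(2) by simp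
      show ?thesis by (rule flow_convI[OF \<sigma> \<gamma> f(1) dm(2) xb vb])
    qed
    then show ?case using f(2) by blast
  qed blast
  then show ?thesis using conv by blast
qed

text \<open>The time-one map of geodesics. Continuity is obtained through sequences from
  \<open>flow_convergence\<close>; applied to a constant sequence, the same lemma shows that the
  initial velocity determines the endpoint.\<close>

lemma ex_exp:
  assumes complete: "complete_metric A g" and c: "c \<in> A" "p \<in> dm c"
  shows "\<exists>e. continuous_on UNIV e \<and> (\<forall>\<gamma>. geodesic A g \<gamma> \<longrightarrow> \<gamma> 0 = p \<longrightarrow> \<gamma> 1 = e (vel c \<gamma> 0))
    \<and> (\<forall>v. \<exists>\<gamma>. geodesic A g \<gamma> \<and> \<gamma> 0 = p \<and> vel c \<gamma> 0 = v \<and> \<gamma> 1 = e v)"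
proof -
  obtain \<Phi> where \<Phi>: "\<And>v. geodesic A g (\<Phi> v)" "\<And>v. \<Phi> v 0 = p" "\<And>v. vel c (\<Phi> v) 0 = v"
    using complete_metricD[OF complete c] by metis
  have conv0: "flow_conv (\<lambda>k. \<Phi> (u k)) \<gamma> 0" if "geodesic A g \<gamma>" "\<gamma> 0 = p" "u \<longlonglongrightarrow> vel c \<gamma> 0" for u \<gamma>
    by (rule flow_convI[OF \<Phi>(1) that(1) c(1)]) (use \<Phi> that c in auto)
  have cont: "continuous_on UNIV (\<lambda>v. \<Phi> v 1)"
  proof (rule continuous_on_sequentiallyI)
    fix u a assume "(u :: nat \<Rightarrow> real^'n) \<longlonglongrightarrow> a"
    then have "flow_conv (\<lambda>k. \<Phi> (u k)) (\<Phi> a) 0" using \<Phi> by (intro conv0) auto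
    from flow_convergence[OF \<Phi>(1) \<Phi>(1) _ this, of 1] show "(\<lambda>n. \<Phi> (u n) 1) \<longlonglongrightarrow> \<Phi> a 1"
      by (simp add: flow_conv_def)
  qed
  have uniq: "\<gamma> 1 = \<Phi> (vel c \<gamma> 0) 1" if \<gamma>: "geodesic A g \<gamma>" "\<gamma> 0 = p" for \<gamma>
  proof -
    have "flow_conv (\<lambda>k. \<Phi> (vel c \<gamma> 0)) \<gamma> 0" by (rule conv0[OF \<gamma>]) simp
    from flow_convergence[OF \<Phi>(1) \<gamma>(1) _ this, of 1] have "(\<lambda>k::nat. \<Phi> (vel c \<gamma> 0) 1) \<longlonglongrightarrow> \<gamma> 1"
      by (simp add: flow_conv_def)
    then show ?thesis by (simp add: LIMSEQ_const_iff)
  qed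
  show ?thesis using cont uniq \<Phi> by (intro exI[of _ "\<lambda>v. \<Phi> v 1"]) blast
qed

end

section \<open>The gradient estimate\<close>

locale riemannian_function = riemannian_manifold A g
  for A :: "('a::{t2_space, second_countable_topology}, 'n::finite) chart set" and g +
  fixes f :: "'a \<Rightarrow> real"
  assumes smooth_f: "smooth_function A f"
begin

abbreviation (input) "F c \<equiv> in_chart c f"
abbreviation (input) "wc c \<equiv> chart_function.w (in_chart c (g c)) (in_chart c f)"

lemma chart_function_chart: "c \<in> A \<Longrightarrow> chart_function (im c) (G c) (F c)"
  using chart_metric_chart smooth_f
  by (intro chart_function.intro) (auto simp: smooth_function_def chart_function_axioms_def)

lemma dF_jac:
  assumes cd: "c \<in> A" "d \<in> A" and p: "p \<in> dm c" "p \<in> dm d"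
  shows "bderiv (F c) (co c p) v = bderiv (F d) (co d p) (jac c d p v)"
proof -
  interpret c: chart_function "im c" "G c" "F c" by (rule chart_function_chart[OF cd(1)])
  interpret d: chart_function "im d" "G d" "F d" by (rule chart_function_chart[OF cd(2)])
  have "(F d has_derivative bderiv (F d) (co d p)) (at (tr c d (co c p)))"
    using bderiv_works[OF d.smooth_F, of "co d p"] cd p by simp
  from diff_chain_at[OF tr_works[OF cd p] this]
  have "((\<lambda>x. F d (tr c d x)) has_derivative (\<lambda>v. bderiv (F d) (co d p) (jac c d p v))) (at (co c p))"
    by (simp only: o_def)
  then have "(F c has_derivative (\<lambda>v. bderiv (F d) (co d p) (jac c d p v))) (at (co c p))"
  proof (subst has_derivative_cong_open[OF open_overlap[OF cd]])
    show "co c p \<in> co c ` (dm c \<inter> dm d)" using p by auto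
    show "F c x = F d (tr c d x)" if "x \<in> co c ` (dm c \<inter> dm d)" for x
      using that cd by auto
  qed
  from bderiv_eqI[OF c.smooth_F _ this] show ?thesis using p by simp
qed

lemma wc_jac:
  assumes cd: "c \<in> A" "d \<in> A" and p: "p \<in> dm c" "p \<in> dm d"
  shows "wc c (co c p) = wc d (co d p)"
proof -
  interpret c: chart_function "im c" "G c" "F c" by (rule chart_function_chart[OF cd(1)])
  interpret d: chart_function "im d" "G d" "F d" by (rule chart_function_chart[OF cd(2)])
  have x: "co c p \<in> im c" "co d p \<in> im d" using p by auto
  let ?Xc = "gradient (G c) (F c) (co c p)" and ?Xd = "gradient (G d) (F d) (co d p)"
  have "jac c d p ?Xc = ?Xd"
  proof (rule d.g_nondegenerate[OF x(2)])
    fix v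
    have "q d (co d p) (jac c d p ?Xc) v = q d (co d p) (jac c d p ?Xc) (jac c d p (jac d c p v))"
      by (simp add: jac_inverse[OF cd(2,1) p(2,1)])
    also have "\<dots> = bderiv (F c) (co c p) (jac d c p v)"
      by (simp add: q_jac[OF cd p, symmetric] c.g_X[OF x(1)])
    also have "\<dots> = q d (co d p) ?Xd v"
      by (simp add: dF_jac[OF cd p] jac_inverse[OF cd(2,1) p(2,1)] d.g_X[OF x(2)])
    finally show "q d (co d p) (jac c d p ?Xc) v = q d (co d p) ?Xd v" .
  qed
  then show ?thesis by (simp add: c.w_def d.w_def dF_jac[OF cd p])
qed

text \<open>The coordinate functions \<open>wc c\<close> glued to one global function, through an
  arbitrary chart at each point.\<close>

definition gradsq :: "'a \<Rightarrow> real"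
  where "gradsq p = (let c = SOME c. c \<in> A \<and> p \<in> dm c in wc c (co c p))"

lemma gradsq_eq: "c \<in> A \<Longrightarrow> p \<in> dm c \<Longrightarrow> gradsq p = wc c (co c p)"
proof -
  assume c: "c \<in> A" "p \<in> dm c"
  define d where "d = (SOME c. c \<in> A \<and> p \<in> dm c)"
  have d: "d \<in> A \<and> p \<in> dm d"
    unfolding d_def by (rule someI_ex) (use c in blast)
  then show ?thesis
    using wc_jac[OF c(1) _ c(2), of d] by (simp add: gradsq_def d_def[symmetric])
qed

lemma gradsq_nonneg: "0 \<le> gradsq p"
proof -
  obtain c where c: "c \<in> A" "p \<in> dm c" using ex_chart by blast
  interpret c: chart_function "im c" "G c" "F c" by (rule chart_function_chart[OF c(1)])
  show ?thesis using gradsq_eq[OF c] c.w_nonneg c by simp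
qed

lemma gradsq_continuous: "continuous_on UNIV gradsq"
proof (rule continuous_at_imp_continuous_on, rule ballI)
  fix p
  obtain c where c: "c \<in> A" "p \<in> dm c" using ex_chart by blast
  interpret c: chart_function "im c" "G c" "F c" by (rule chart_function_chart[OF c(1)])
  have "continuous_on (dm c) (\<lambda>u. wc c (co c u))"
    by (rule continuous_on_compose2[OF smooth_on_continuous[OF c.smooth_w] cont_co[OF c(1)]]) auto
  then have "continuous_on (dm c) gradsq"
    by (rule continuous_on_cong[THEN iffD1, rotated 2]) (auto simp: gradsq_eq[OF c(1)])
  then show "isCont gradsq p" using open_domain[OF c(1)] c(2) by (simp add: continuous_on_eq_continuous_at)
qed

text \<open>Compactness is taken from the tangent space: w(exp v) (R^2 - |v|^2)^2 has a maximum over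
  |v| \<le> R. Replacing |v| by the distance of exp v does not decrease the value there, and each
  point of the metric ball is exp of a vector as long as its distance, so the maximiser serves for
  the distance as well. Positivity at p keeps it off the boundary.\<close>

lemma max_point:
  assumes complete: "complete_metric A g" and R: "R > 0" and p: "gradsq p > 0"
  shows "\<exists>x. mdist p x < R \<and> gradsq x > 0 \<and> gradsq p * R ^ 4 \<le> gradsq x * (R\<^sup>2 - (mdist p x)\<^sup>2)\<^sup>2 \<and>
    (\<forall>y. mdist p y \<le> R \<longrightarrow> gradsq y * (R\<^sup>2 - (mdist p y)\<^sup>2)\<^sup>2 \<le> gradsq x * (R\<^sup>2 - (mdist p x)\<^sup>2)\<^sup>2)"
proof -
  obtain c where c: "c \<in> A" "p \<in> dm c" using ex_chart by blast
  interpret c: chart_function "im c" "G c" "F c" by (rule chart_function_chart[OF c(1)])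
  obtain e where e: "continuous_on UNIV e" "\<And>\<gamma>. geodesic A g \<gamma> \<Longrightarrow> \<gamma> 0 = p \<Longrightarrow> \<gamma> 1 = e (vel c \<gamma> 0)"
    "\<And>v. \<exists>\<gamma>. geodesic A g \<gamma> \<and> \<gamma> 0 = p \<and> vel c \<gamma> 0 = v \<and> \<gamma> 1 = e v"
    using ex_exp[OF complete c] by blast
  let ?x = "co c p"
  have x: "?x \<in> im c" using c by simp
  define B where "B = {v. q c ?x v v \<le> R\<^sup>2}"
  obtain l L where l: "0 < l" "\<And>v. l * (norm v)\<^sup>2 \<le> q c ?x v v"
    using c.g_bounds[of "{?x}"] x by auto
  have "closed B" unfolding B_def by (intro closed_Collect_le continuous_intros)
  moreover have "bounded B"
  proof (rule boundedI)
    fix v assume "v \<in> B"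
    then have "l * (norm v)\<^sup>2 \<le> R\<^sup>2" using l(2)[of v] by (simp add: B_def)
    then have "(norm v)\<^sup>2 \<le> R\<^sup>2 / l" using l(1) by (simp add: field_simps)
    then show "norm v \<le> sqrt (R\<^sup>2 / l)" by (rule real_le_rsqrt)
  qed
  ultimately have cB: "compact B" by (simp add: compact_eq_bounded_closed)
  have B0: "0 \<in> B" by (simp add: B_def blinfun.bilinear_simps)
  let ?H = "\<lambda>v. gradsq (e v) * (R\<^sup>2 - q c ?x v v)\<^sup>2"
  have "continuous_on UNIV (\<lambda>v. gradsq (e v))"
    by (rule continuous_on_compose2[OF gradsq_continuous e(1)]) auto
  then have "continuous_on UNIV ?H" by (intro continuous_intros)
  then obtain v where v: "v \<in> B" "\<And>u. u \<in> B \<Longrightarrow> ?H u \<le> ?H v"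
    using continuous_attains_sup[OF cB, of ?H] B0 continuous_on_subset by blast
  have md: "(mdist p (e u))\<^sup>2 \<le> q c ?x u u" for u
  proof -
    obtain \<gamma> where \<gamma>: "geodesic A g \<gamma>" "\<gamma> 0 = p" "vel c \<gamma> 0 = u" "\<gamma> 1 = e u" using e(3) by blast
    have s: "speed2 \<gamma> 0 = q c ?x u u" using speed2_chart[OF \<gamma>(1) c(1), of 0] \<gamma> c by simp
    have "mdist p (e u) \<le> sqrt (q c ?x u u)" using geodesic_mdist[OF \<gamma>(1), of 0 1] \<gamma> s by simp
    then have "(mdist p (e u))\<^sup>2 \<le> (sqrt (q c ?x u u))\<^sup>2" by (intro power_mono mdist_nonneg)
    then show ?thesis using c.g_nonneg[OF x, of u] by simp
  qed
  have reach: "\<exists>u. e u = y \<and> q c ?x u u = (mdist p y)\<^sup>2" for y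
  proof -
    obtain \<gamma> where \<gamma>: "geodesic A g \<gamma>" "\<gamma> 0 = p" "\<gamma> 1 = y" "sqrt (speed2 \<gamma> 0) = mdist p y"
      using hopf_rinow[OF complete] by blast
    have "speed2 \<gamma> 0 = q c ?x (vel c \<gamma> 0) (vel c \<gamma> 0)" using speed2_chart[OF \<gamma>(1) c(1), of 0] \<gamma> c by simp
    moreover have "speed2 \<gamma> 0 = (mdist p y)\<^sup>2" using \<gamma>(4) speed2_nonneg[OF \<gamma>(1)] by (metis real_sqrt_pow2)
    ultimately show ?thesis using e(2)[OF \<gamma>(1,2)] \<gamma>(3) by (intro exI[of _ "vel c \<gamma> 0"]) simp
  qed
  let ?y = "e v"
  have sq: "?H v \<le> gradsq ?y * (R\<^sup>2 - (mdist p ?y)\<^sup>2)\<^sup>2"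
    using v(1) md[of v] gradsq_nonneg unfolding B_def by (intro mult_left_mono power_mono) auto
  have all: "gradsq y * (R\<^sup>2 - (mdist p y)\<^sup>2)\<^sup>2 \<le> gradsq ?y * (R\<^sup>2 - (mdist p ?y)\<^sup>2)\<^sup>2" if y: "mdist p y \<le> R" for y
  proof -
    obtain u where u: "e u = y" "q c ?x u u = (mdist p y)\<^sup>2" using reach by blast
    have "u \<in> B" using u(2) y mdist_nonneg[of p y] by (simp add: B_def power_mono)
    then have "?H u \<le> ?H v" by (rule v(2))
    then show ?thesis using u sq by simp
  qed
  have p0: "gradsq p * R ^ 4 \<le> gradsq ?y * (R\<^sup>2 - (mdist p ?y)\<^sup>2)\<^sup>2"
    using all[of p] R by (simp flip: power_mult)
  then have pos: "0 < gradsq ?y * (R\<^sup>2 - (mdist p ?y)\<^sup>2)\<^sup>2"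
    using p R by (smt (verit) mult_pos_pos zero_less_power)
  then have "gradsq ?y > 0" "(mdist p ?y)\<^sup>2 \<noteq> R\<^sup>2" using gradsq_nonneg[of ?y] by (auto simp: zero_less_mult_iff)
  moreover have "(mdist p ?y)\<^sup>2 \<le> R\<^sup>2" using md[of v] v(1) by (simp add: B_def)
  ultimately have "gradsq ?y > 0" "mdist p ?y < R"
    using R mdist_nonneg[of p ?y] by (auto simp: power2_le_iff_abs_le less_le)
  then show ?thesis using p0 all by blast
qed

text \<open>By Hopf-Rinow the closed unit ball around p lies in the image of a compact ball of
  tangent vectors.\<close>

lemma gradsq_bounded:
  assumes complete: "complete_metric A g"
  shows "\<exists>D\<ge>0. \<forall>y. mdist p y \<le> 1 \<longrightarrow> gradsq y \<le> D"
proof -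
  obtain c where c: "c \<in> A" "p \<in> dm c" using ex_chart by blast
  interpret c: chart_function "im c" "G c" "F c" by (rule chart_function_chart[OF c(1)])
  obtain e where e: "continuous_on UNIV e" "\<And>\<gamma>. geodesic A g \<gamma> \<Longrightarrow> \<gamma> 0 = p \<Longrightarrow> \<gamma> 1 = e (vel c \<gamma> 0)"
    using ex_exp[OF complete c] by blast
  let ?x = "co c p"
  have x: "?x \<in> im c" using c by simp
  obtain l L where l: "0 < l" "\<And>v. l * (norm v)\<^sup>2 \<le> q c ?x v v"
    using c.g_bounds[of "{?x}"] x by auto
  have "continuous_on (cball 0 (sqrt (1 / l))) (\<lambda>v. gradsq (e v))"
    by (rule continuous_on_compose2[OF gradsq_continuous continuous_on_subset[OF e(1)]]) auto
  then have "bounded ((\<lambda>v. gradsq (e v)) ` cball 0 (sqrt (1 / l)))"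
    by (intro compact_imp_bounded compact_continuous_image compact_cball)
  then obtain D where D: "\<And>v. v \<in> cball 0 (sqrt (1 / l)) \<Longrightarrow> norm (gradsq (e v)) \<le> D"
    unfolding bounded_iff by blast
  have "gradsq y \<le> D" if y: "mdist p y \<le> 1" for y
  proof -
    obtain \<gamma> where \<gamma>: "geodesic A g \<gamma>" "\<gamma> 0 = p" "\<gamma> 1 = y" "sqrt (speed2 \<gamma> 0) = mdist p y"
      using hopf_rinow[OF complete] by blast
    have "speed2 \<gamma> 0 = q c ?x (vel c \<gamma> 0) (vel c \<gamma> 0)" using speed2_chart[OF \<gamma>(1) c(1), of 0] \<gamma> c by simp
    moreover have "speed2 \<gamma> 0 \<le> 1"
      by (subst real_sqrt_le_1_iff[symmetric]) (simp only: \<gamma>(4) y)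
    ultimately have "l * (norm (vel c \<gamma> 0))\<^sup>2 \<le> 1" using l(2)[of "vel c \<gamma> 0"] by simp
    then have "(norm (vel c \<gamma> 0))\<^sup>2 \<le> 1 / l" using l(1) by (simp add: field_simps)
    then have "norm (vel c \<gamma> 0) \<le> sqrt (1 / l)" by (rule real_le_rsqrt)
    then have "norm (gradsq (e (vel c \<gamma> 0))) \<le> D" by (intro D) simp
    then show ?thesis using e(2)[OF \<gamma>(1,2)] \<gamma>(3) by simp
  qed
  then show ?thesis using gradsq_nonneg[of p] by (intro exI[of _ "max D 0"]) fastforce
qed

end

section \<open>Jets at a maximum, and f along geodesics\<close>

lemma jet_in_open:
  assumes j: "jet UNIV (\<lambda>_::unit. \<phi>) (\<lambda>_. a) (\<lambda>_. b) (\<lambda>_. c)" and O: "open S" "a \<in> S"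
  shows "\<exists>\<delta>>0. \<forall>s. \<bar>s\<bar> \<le> \<delta> \<longrightarrow> \<phi> s \<in> S"
proof -
  obtain C e where 1: "0 < e" "1 \<le> C" "\<And>s. \<bar>s\<bar> \<le> e \<Longrightarrow> norm (\<phi> s - a) \<le> 3 * C * \<bar>s\<bar>"
    by (rule jetE[OF j]) blast
  obtain r where r: "r > 0" "cball a r \<subseteq> S" using O open_contains_cball by blast
  have "\<phi> s \<in> S" if "\<bar>s\<bar> \<le> min e (r / (3 * C))" for s
  proof -
    have "norm (\<phi> s - a) \<le> 3 * C * \<bar>s\<bar>" using 1(3) that by simp
    also have "\<dots> \<le> r" using that 1(2) by (simp add: field_simps)
    finally have "\<phi> s \<in> cball a r" by (simp add: dist_norm norm_minus_commute)
    then show ?thesis using r(2) by blast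
  qed
  then show ?thesis using 1(1,2) r(1) by (intro exI[of _ "min e (r / (3 * C))"]) auto
qed

text \<open>Necessary conditions read off the 2-jet: divide by s for either sign, then by s^2, and
  let s tend to 0.\<close>

lemma jet_local_max:
  fixes \<phi> :: "real \<Rightarrow> real"
  assumes j: "jet UNIV (\<lambda>_::unit. \<phi>) (\<lambda>_. a) (\<lambda>_. b) (\<lambda>_. c)"
    and max: "\<delta> > 0" "\<And>s. \<bar>s\<bar> \<le> \<delta> \<Longrightarrow> \<phi> s \<le> a"
  shows "b = 0" "c \<le> 0"
proof -
  obtain C e where 1: "0 < e" "\<And>s. \<bar>s\<bar> \<le> e \<Longrightarrow> norm (\<phi> s - (a + s *\<^sub>R b + (s\<^sup>2 / 2) *\<^sub>R c)) \<le> C * \<bar>s\<bar> ^ 3"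
    by (rule jetE[OF j]) blast
  have key: "s * b + s\<^sup>2 / 2 * c - C * \<bar>s\<bar> ^ 3 \<le> 0" if "\<bar>s\<bar> \<le> min e \<delta>" for s
    using 1(2)[of s] max(2)[of s] that by (simp add: abs_le_iff)
  have ev: "eventually (\<lambda>s. 0 < s \<and> s \<le> min e \<delta>) (at_right (0::real))"
    unfolding eventually_at_right_field using 1(1) max(1) by (intro exI[of _ "min e \<delta>"]) auto
  have lin: "\<sigma> * b \<le> 0" if \<sigma>: "\<sigma> = 1 \<or> \<sigma> = - 1" for \<sigma>
  proof (rule tendsto_upperbound)
    show "((\<lambda>s. \<sigma> * b + s / 2 * c - C * s ^ 2) \<longlongrightarrow> \<sigma> * b) (at_right 0)"
      by (rule tendsto_eq_intros refl | simp)+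
    show "eventually (\<lambda>s. \<sigma> * b + s / 2 * c - C * s ^ 2 \<le> 0) (at_right 0)"
      using ev
    proof eventually_elim
      case (elim s)
      then have "s * (\<sigma> * b + s / 2 * c - C * s ^ 2) \<le> 0"
        using key[of "\<sigma> * s"] \<sigma> by (auto simp: algebra_simps power2_eq_square power3_eq_cube)
      then show ?case using elim by (simp add: mult_le_0_iff)
    qed
  qed simp
  show b: "b = 0" using lin[of 1] lin[of "- 1"] by simp
  have "c / 2 \<le> 0"
  proof (rule tendsto_upperbound)
    show "((\<lambda>s. c / 2 - C * s) \<longlongrightarrow> c / 2) (at_right 0)"
      by (rule tendsto_eq_intros refl | simp)+
    show "eventually (\<lambda>s. c / 2 - C * s \<le> 0) (at_right 0)"
      using ev
    proof eventually_elim
      case (elim s)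
      then have "s\<^sup>2 * (c / 2 - C * s) \<le> 0"
        using key[of s] b by (simp add: algebra_simps power2_eq_square power3_eq_cube)
      then show ?case using elim by (simp add: mult_le_0_iff)
    qed
  qed simp
  then show "c \<le> 0" by simp
qed

context riemannian_function begin

definition dfg :: "(real \<Rightarrow> 'a) \<Rightarrow> real \<Rightarrow> real"
  where "dfg \<gamma> = deriv (\<lambda>s. f (\<gamma> s))"

lemma dfg_eq:
  assumes \<gamma>: "geodesic A g \<gamma>" and c: "c \<in> A" "\<gamma> t \<in> dm c"
  shows "dfg \<gamma> t = bderiv (F c) (co c (\<gamma> t)) (vel c \<gamma> t)"
proof -
  interpret c: chart_function "im c" "G c" "F c" by (rule chart_function_chart[OF c(1)])
  have "co c (\<gamma> t) \<in> im c" using c by simp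
  then have "((\<lambda>s. F c (co c (\<gamma> s))) has_vector_derivative bderiv (F c) (co c (\<gamma> t)) (vel c \<gamma> t)) (at t)"
    using vector_derivative_diff_chain_within[OF geodesicD(1)[OF \<gamma> c] has_derivative_at_withinI[OF bderiv_works[OF c.smooth_F]]]
    by (simp add: o_def)
  moreover have "open (\<gamma> -` dm c)" by (rule geodesic_open_vimage[OF \<gamma> open_domain[OF c(1)]])
  ultimately have "((\<lambda>s. f (\<gamma> s)) has_vector_derivative bderiv (F c) (co c (\<gamma> t)) (vel c \<gamma> t)) (at t)"
    by (rule has_vector_derivative_transform_within_open) (use c in auto)
  then show ?thesis
    unfolding dfg_def by (simp add: DERIV_imp_deriv has_real_derivative_iff_has_vector_derivative)
qed

text \<open>The acceleration -\<Gamma>(T, T) turns the second derivative of f along the geodesic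
  into the covariant Hessian.\<close>

lemma dfg_deriv:
  assumes \<gamma>: "geodesic A g \<gamma>" and c: "c \<in> A" "\<gamma> t \<in> dm c"
  shows "(dfg \<gamma> has_real_derivative chart_metric.hs (G c) (F c) (co c (\<gamma> t)) (vel c \<gamma> t) (vel c \<gamma> t)) (at t)"
proof -
  interpret c: chart_function "im c" "G c" "F c" by (rule chart_function_chart[OF c(1)])
  let ?x = "co c (\<gamma> t)" and ?T = "vel c \<gamma> t"
  have x: "?x \<in> im c" using c by simp
  have "((\<lambda>s. bderiv (F c) (co c (\<gamma> s))) has_vector_derivative bderiv (bderiv (F c)) ?x ?T) (at t)"
    using vector_derivative_diff_chain_within[OF geodesicD(1)[OF \<gamma> c]
        has_derivative_at_withinI[OF bderiv_works[OF smooth_on_bderiv[OF c.open_U c.smooth_F] x]]]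
    by (simp add: o_def)
  from bounded_bilinear.has_vector_derivative[OF bounded_bilinear_blinfun_apply this geodesicD(2)[OF \<gamma> c]]
  have "((\<lambda>s. bderiv (F c) (co c (\<gamma> s)) (vel c \<gamma> s)) has_vector_derivative c.hs (F c) ?x ?T ?T) (at t)"
    by (simp add: c.hs_def blinfun.bilinear_simps)
  moreover have "open (\<gamma> -` dm c)" by (rule geodesic_open_vimage[OF \<gamma> open_domain[OF c(1)]])
  ultimately have "(dfg \<gamma> has_vector_derivative c.hs (F c) ?x ?T ?T) (at t)"
    by (rule has_vector_derivative_transform_within_open) (use c dfg_eq[OF \<gamma> c(1)] in auto)
  then show ?thesis by (simp add: has_real_derivative_iff_has_vector_derivative)
qed

end

section \<open>Variations carried along a geodesic\<close>

context riemannian_manifold begin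

text \<open>The state propagated along a minimal geodesic. The variation curves enter only through their jets, so that
  the chart can be changed at any time; \<open>K\<close> bounds the sum of the second derivatives of the energies.\<close>

definition variation :: "('a, 'n) chart \<Rightarrow> 'a \<Rightarrow> (real \<Rightarrow> 'a) \<Rightarrow> real \<Rightarrow> real \<Rightarrow> real \<Rightarrow> bool"
  where "variation c p \<gamma> t h K \<longleftrightarrow> (\<exists>E b e \<epsilon>. chart_metric.on_frame (G c) (co c (\<gamma> t)) E \<and>
    (\<forall>i. jet UNIV (\<lambda>_::unit. b i) (\<lambda>_. co c (\<gamma> t)) (\<lambda>_. h *\<^sub>R E i) (\<lambda>_. - \<Gamma> c (co c (\<gamma> t)) (h *\<^sub>R E i) (h *\<^sub>R E i)) \<and>
      jet UNIV (\<lambda>_::unit. e i) (\<lambda>_. t * speed2 \<gamma> 0) (\<lambda>_. 2 * (h * q c (co c (\<gamma> t)) (E i) (vel c \<gamma> t))) (\<lambda>_. \<epsilon> i) \<and>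
      (\<exists>\<delta>>0. \<forall>s. \<bar>s\<bar> \<le> \<delta> \<longrightarrow> b i s \<in> im c \<and> path UNIV p (ci c (b i s)) t (e i s))) \<and>
    (\<Sum>i\<in>UNIV. \<epsilon> i) \<le> K)"

lemma variationI:
  assumes "chart_metric.on_frame (G c) (co c (\<gamma> t)) E"
    and "\<And>i. jet UNIV (\<lambda>_::unit. b i) (\<lambda>_. co c (\<gamma> t)) (\<lambda>_. h *\<^sub>R E i) (\<lambda>_. - \<Gamma> c (co c (\<gamma> t)) (h *\<^sub>R E i) (h *\<^sub>R E i))"
    and "\<And>i. jet UNIV (\<lambda>_::unit. e i) (\<lambda>_. t * speed2 \<gamma> 0) (\<lambda>_. 2 * (h * q c (co c (\<gamma> t)) (E i) (vel c \<gamma> t))) (\<lambda>_. \<epsilon> i)"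
    and "\<And>i. \<exists>\<delta>>0. \<forall>s. \<bar>s\<bar> \<le> \<delta> \<longrightarrow> b i s \<in> im c \<and> path UNIV p (ci c (b i s)) t (e i s)"
    and "(\<Sum>i\<in>UNIV. \<epsilon> i) \<le> K"
  shows "variation c p \<gamma> t h K"
  unfolding variation_def
  by (intro exI[of _ E] exI[of _ b] exI[of _ e] exI[of _ \<epsilon>] conjI allI assms)

text \<open>Since h = 0, constant curves at p with zero energy will do.\<close>

lemma variation_0:
  assumes c: "c \<in> A" "p \<in> dm c" "\<gamma> 0 = p"
  shows "variation c p \<gamma> 0 0 0"
proof -
  interpret c: chart_metric "im c" "G c" by (rule chart_metric_chart[OF c(1)])
  have x: "co c p \<in> im c" using c by simp
  obtain E where E: "c.on_frame (co c p) E" using c.frame_exists[OF x] by blast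
  have j: "jet UNIV (\<lambda>_::unit. \<lambda>_. a) (\<lambda>_. a) (\<lambda>_. 0) (\<lambda>_. 0)" for a :: "'z::real_normed_vector"
    by (rule jetI[of 1 _ _ "norm a" _ 0 _ 0 _ 0]) auto
  have "jet UNIV (\<lambda>_::unit. \<lambda>_. co c p) (\<lambda>_. co c (\<gamma> 0)) (\<lambda>_. 0 *\<^sub>R E i) (\<lambda>_. - \<Gamma> c (co c (\<gamma> 0)) (0 *\<^sub>R E i) (0 *\<^sub>R E i))" for i
    using j[of "co c p"] c(3) by (simp add: blinfun.bilinear_simps)
  moreover have "jet UNIV (\<lambda>_::unit. \<lambda>_. 0::real) (\<lambda>_. 0 * speed2 \<gamma> 0) (\<lambda>_. 2 * (0 * q c (co c (\<gamma> 0)) (E i) (vel c \<gamma> 0))) (\<lambda>_. 0)" for i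
    using j[of "0::real"] by simp
  moreover have "path UNIV p (ci c (co c p)) 0 0" using path_refl[of p UNIV] c by simp
  ultimately show ?thesis
    unfolding variation_def using E x c(3)
    by (intro exI[of _ E] exI[of _ "\<lambda>_ _. co c p"] exI[of _ "\<lambda>_ _. 0"] exI[of _ "\<lambda>_. 0"])
       (auto intro: exI[of _ 1])
qed

text \<open>The second derivative that the chain rule adds to the jets is exactly the inhomogeneous
  term of \<open>christoffel_transform\<close>.\<close>

lemma variation_chart:
  assumes \<gamma>: "geodesic A g \<gamma>" and c: "c \<in> A" "\<gamma> t \<in> dm c" and d: "d \<in> A" "\<gamma> t \<in> dm d"
    and v: "variation c p \<gamma> t h K"
  shows "variation d p \<gamma> t h K"
proof -
  interpret c: chart_metric "im c" "G c" by (rule chart_metric_chart[OF c(1)])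
  interpret d: chart_metric "im d" "G d" by (rule chart_metric_chart[OF d(1)])
  obtain E b e \<epsilon> where E: "c.on_frame (co c (\<gamma> t)) E"
    and b: "\<And>i. jet UNIV (\<lambda>_::unit. b i) (\<lambda>_. co c (\<gamma> t)) (\<lambda>_. h *\<^sub>R E i) (\<lambda>_. - \<Gamma> c (co c (\<gamma> t)) (h *\<^sub>R E i) (h *\<^sub>R E i))"
    and e: "\<And>i. jet UNIV (\<lambda>_::unit. e i) (\<lambda>_. t * speed2 \<gamma> 0) (\<lambda>_. 2 * (h * q c (co c (\<gamma> t)) (E i) (vel c \<gamma> t))) (\<lambda>_. \<epsilon> i)"
    and p: "\<And>i. \<exists>\<delta>>0. \<forall>s. \<bar>s\<bar> \<le> \<delta> \<longrightarrow> b i s \<in> im c \<and> path UNIV p (ci c (b i s)) t (e i s)"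
    and K: "(\<Sum>i\<in>UNIV. \<epsilon> i) \<le> K"
    using v unfolding variation_def by blast
  let ?J = "jac c d (\<gamma> t)" and ?O = "co c ` (dm c \<inter> dm d)"
  have oO: "open ?O" by (rule open_overlap[OF c(1) d(1)])
  have xO: "co c (\<gamma> t) \<in> ?O" using c d by auto
  have "d.on_frame (co d (\<gamma> t)) (\<lambda>i. ?J (E i))"
    using E unfolding c.on_frame_def d.on_frame_def by (simp add: q_jac[OF c(1) d(1) c(2) d(2)])
  moreover have "jet UNIV (\<lambda>_::unit. \<lambda>s. tr c d (b i s)) (\<lambda>_. co d (\<gamma> t)) (\<lambda>_. h *\<^sub>R ?J (E i))
      (\<lambda>_. - \<Gamma> d (co d (\<gamma> t)) (h *\<^sub>R ?J (E i)) (h *\<^sub>R ?J (E i)))" for i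
  proof (rule jet_cong[OF jet_compose[OF oO smooth_transition[OF c(1) d(1)] _ _ b[of i], of "{co c (\<gamma> t)}"]])
    show "- \<Gamma> d (co d (\<gamma> t)) (h *\<^sub>R ?J (E i)) (h *\<^sub>R ?J (E i)) =
       bderiv (bderiv (tr c d)) (co c (\<gamma> t)) (h *\<^sub>R E i) (h *\<^sub>R E i) + bderiv (tr c d) (co c (\<gamma> t)) (- \<Gamma> c (co c (\<gamma> t)) (h *\<^sub>R E i) (h *\<^sub>R E i))"
      unfolding jac_def[symmetric] blinfun.minus_right christoffel_transform[OF c(1) d(1) c(2) d(2)]
      by (simp add: blinfun.bilinear_simps)
    show "h *\<^sub>R ?J (E i) = bderiv (tr c d) (co c (\<gamma> t)) (h *\<^sub>R E i)"
      by (simp add: jac_def blinfun.bilinear_simps)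
  qed (use xO c in auto)
  moreover have "jet UNIV (\<lambda>_::unit. e i) (\<lambda>_. t * speed2 \<gamma> 0) (\<lambda>_. 2 * (h * q d (co d (\<gamma> t)) (?J (E i)) (vel d \<gamma> t))) (\<lambda>_. \<epsilon> i)" for i
    using e[of i] by (simp add: geodesic_vel_jac[OF \<gamma> c d] q_jac[OF c(1) d(1) c(2) d(2)])
  moreover have "\<exists>\<delta>>0. \<forall>s. \<bar>s\<bar> \<le> \<delta> \<longrightarrow> tr c d (b i s) \<in> im d \<and> path UNIV p (ci d (tr c d (b i s))) t (e i s)" for i
  proof -
    obtain \<delta>1 where 1: "\<delta>1 > 0" "\<And>s. \<bar>s\<bar> \<le> \<delta>1 \<Longrightarrow> b i s \<in> im c \<and> path UNIV p (ci c (b i s)) t (e i s)"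
      using p[of i] by blast
    obtain \<delta>2 where 2: "\<delta>2 > 0" "\<And>s. \<bar>s\<bar> \<le> \<delta>2 \<Longrightarrow> b i s \<in> ?O"
      using jet_in_open[OF b[of i] oO xO] by blast
    have "tr c d (b i s) \<in> im d \<and> path UNIV p (ci d (tr c d (b i s))) t (e i s)" if s: "\<bar>s\<bar> \<le> min \<delta>1 \<delta>2" for s
    proof -
      have "b i s \<in> ?O" using 2(2) s by simp
      then obtain y where y: "b i s = co c y" "y \<in> dm c" "y \<in> dm d" by blast
      have "path UNIV p (ci c (b i s)) t (e i s)" using 1(2) s by simp
      then show ?thesis using y c(1) d(1) by simp
    qed
    then show ?thesis using 1(1) 2(1) by (intro exI[of _ "min \<delta>1 \<delta>2"]) auto
  qed
  ultimately show ?thesis using K by (rule variationI)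
qed

text \<open>The frame is transported in parallel over the piece, and the energies of the new pieces
  are added. Summed over the frame, the curvature terms become -Ric(T, T), so the hypothesis
  \<open>le\<close> says that \<open>Kf\<close> grows at least as fast as the sum of the second
  derivatives of the energies.\<close>

lemma variation_step:
  assumes \<gamma>: "geodesic A g \<gamma>" and c: "c \<in> A" and ab: "a \<le> b" and dm: "\<And>t. t \<in> {a..b} \<Longrightarrow> \<gamma> t \<in> dm c"
    and M: "\<And>t. t \<in> {a..b} \<Longrightarrow> norm (\<Gamma> c (co c (\<gamma> t)) (vel c \<gamma> t)) \<le> M" "M * (b - a) < 1"
    and h: "\<And>t. t \<in> {a..b} \<Longrightarrow> (h has_vector_derivative h' t) (at t within {a..b})" "continuous_on {a..b} h'"
    and Kf: "\<And>t. t \<in> {a..b} \<Longrightarrow> (Kf has_vector_derivative Kf' t) (at t within {a..b})"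
    and le: "\<And>t. t \<in> {a..b} \<Longrightarrow> 2 * real CARD('n) * (h' t)\<^sup>2
      - 2 * (h t)\<^sup>2 * (vel c \<gamma> t \<bullet> (ricci (G c) (co c (\<gamma> t)) *v vel c \<gamma> t)) \<le> Kf' t"
    and v: "variation c p \<gamma> a (h a) (Kf a)"
  shows "variation c p \<gamma> b (h b) (Kf b)"
proof -
  let ?x = "\<lambda>t. co c (\<gamma> t)" and ?T = "vel c \<gamma>"
  interpret c: chart_metric "im c" "G c" by (rule chart_metric_chart[OF c])
  interpret gp: geodesic_piece "im c" "G c" a b ?x ?T
    by unfold_locales (use ab dm geodesicD[OF \<gamma> c] in \<open>auto intro: has_vector_derivative_at_within\<close>)
  have aI: "a \<in> {a..b}" and bI: "b \<in> {a..b}" using ab by auto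
  obtain E0 \<beta> e \<epsilon> where E0: "c.on_frame (?x a) E0"
    and \<beta>: "\<And>i. jet UNIV (\<lambda>_::unit. \<beta> i) (\<lambda>_. ?x a) (\<lambda>_. h a *\<^sub>R E0 i) (\<lambda>_. - \<Gamma> c (?x a) (h a *\<^sub>R E0 i) (h a *\<^sub>R E0 i))"
    and e: "\<And>i. jet UNIV (\<lambda>_::unit. e i) (\<lambda>_. a * speed2 \<gamma> 0) (\<lambda>_. 2 * (h a * q c (?x a) (E0 i) (?T a))) (\<lambda>_. \<epsilon> i)"
    and p: "\<And>i. \<exists>\<delta>>0. \<forall>s. \<bar>s\<bar> \<le> \<delta> \<longrightarrow> \<beta> i s \<in> im c \<and> path UNIV p (ci c (\<beta> i s)) a (e i s)"
    and K: "(\<Sum>i\<in>UNIV. \<epsilon> i) \<le> Kf a"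
    using v unfolding variation_def by blast
  have "\<forall>i. \<exists>E. E a = E0 i \<and> gp.parallel E"
    using gp.parallel_exists[OF M] by blast
  then obtain E where E: "\<And>i. E i a = E0 i" "\<And>i. gp.parallel (E i)" by metis
  \<comment> \<open>What the inherited end curve has beyond its 2-jet; adding it at all times makes
    the new variation start exactly on \<beta>.\<close>
  define r where "r i s = \<beta> i s - (?x a + s *\<^sub>R (h a *\<^sub>R E0 i) + (s\<^sup>2 / 2) *\<^sub>R (- \<Gamma> c (?x a) (h a *\<^sub>R E0 i) (h a *\<^sub>R E0 i)))" for i s
  have "\<forall>i. \<exists>C \<epsilon>r. 0 < \<epsilon>r \<and> (\<forall>s. \<bar>s\<bar> \<le> \<epsilon>r \<longrightarrow> norm (r i s) \<le> C * \<bar>s\<bar> ^ 3)"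
    unfolding r_def using jetE[OF \<beta>] by (metis UNIV_I)
  then obtain Cr \<epsilon>r where r: "\<And>i. 0 < \<epsilon>r i" "\<And>i s. \<bar>s\<bar> \<le> \<epsilon>r i \<Longrightarrow> norm (r i s) \<le> Cr i * \<bar>s\<bar> ^ 3" by metis
  have gv: "geodesic_variation (im c) (G c) a b ?x ?T (E i) h h' (r i) (Cr i) (\<epsilon>r i)" for i
    using E E0 h r by unfold_locales (auto simp: c.on_frame_def)
  define \<alpha> where "\<alpha> i = geodesic_variation.\<alpha> (G c) ?x (E i) h (r i)" for i
  define \<alpha>' where "\<alpha>' i = geodesic_variation.\<alpha>' (G c) ?x ?T (E i) h h'" for i
  let ?en = "\<lambda>i s. integral {a..b} (\<lambda>t. q c (\<alpha> i t s) (\<alpha>' i t s) (\<alpha>' i t s))"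
  let ?R = "\<lambda>i t. q c (?x t) (c.riem (?x t) (E i t) (?T t) (E i t)) (?T t)"
  let ?k = "\<lambda>i t. 2 * (h' t)\<^sup>2 + 2 * ((h t)\<^sup>2 * ?R i t)"
  have gET: "q c (?x t) (E i t) (E j t) = (if i = j then 1 else 0)" if "t \<in> {a..b}" for i j t
    using gp.g_parallel_const[OF E(2) E(2) that] E0 by (simp add: E c.on_frame_def)
  have fr: "c.on_frame (?x t) (\<lambda>i. E i t)" if "t \<in> {a..b}" for t
    using gET[OF that] by (simp add: c.on_frame_def)
  have "jet UNIV (\<lambda>_::unit. \<alpha> i b) (\<lambda>_. ?x b) (\<lambda>_. h b *\<^sub>R E i b) (\<lambda>_. - \<Gamma> c (?x b) (h b *\<^sub>R E i b) (h b *\<^sub>R E i b))" for i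
    using geodesic_variation.jet_end[OF gv[of i]]
    unfolding \<alpha>_def geodesic_variation.W_def[OF gv] geodesic_variation.V_def[OF gv] .
  moreover have "jet UNIV (\<lambda>_::unit. \<lambda>s. e i s + ?en i s) (\<lambda>_. b * speed2 \<gamma> 0) (\<lambda>_. 2 * (h b * q c (?x b) (E i b) (?T b)))
      (\<lambda>_. \<epsilon> i + integral {a..b} (?k i))" for i
  proof (rule jet_cong[OF jet_add[OF e[of i] geodesic_variation.jet_energy[OF gv[of i]]]])
    show "e i s + ?en i s = e i s + integral {a..b} (\<lambda>t. q c (geodesic_variation.\<alpha> (G c) ?x (E i) h (r i) t s)
        (geodesic_variation.\<alpha>' (G c) ?x ?T (E i) h h' t s) (geodesic_variation.\<alpha>' (G c) ?x ?T (E i) h h' t s))" for s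
      by (simp add: \<alpha>_def \<alpha>'_def)
    show "b * speed2 \<gamma> 0 = a * speed2 \<gamma> 0 + (b - a) * q c (?x a) (?T a) (?T a)"
      using speed2_chart[OF \<gamma> c dm[OF aI]] by (simp add: algebra_simps)
  qed (simp_all add: E)
  moreover have "\<exists>\<delta>>0. \<forall>s. \<bar>s\<bar> \<le> \<delta> \<longrightarrow> \<alpha> i b s \<in> im c \<and> path UNIV p (ci c (\<alpha> i b s)) b (e i s + ?en i s)" for i
  proof -
    obtain \<delta>1 where 1: "\<delta>1 > 0" "\<And>s. \<bar>s\<bar> \<le> \<delta>1 \<Longrightarrow> \<beta> i s \<in> im c \<and> path UNIV p (ci c (\<beta> i s)) a (e i s)"
      using p[of i] by blast
    obtain \<delta>2 where 2: "\<delta>2 > 0" "\<And>s. \<bar>s\<bar> \<le> \<delta>2 \<Longrightarrow> (\<forall>t\<in>{a..b}. \<alpha> i t s \<in> im c) \<and> continuous_on {a..b} (\<lambda>t. \<alpha>' i t s)"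
      using geodesic_variation.energy_continuous[OF gv[of i]] unfolding \<alpha>_def \<alpha>'_def by blast
    have "\<alpha> i b s \<in> im c \<and> path UNIV p (ci c (\<alpha> i b s)) b (e i s + ?en i s)" if s: "\<bar>s\<bar> \<le> min \<delta>1 \<delta>2" for s
    proof -
      have \<alpha>U: "\<forall>t\<in>{a..b}. \<alpha> i t s \<in> im c" and c\<alpha>': "continuous_on {a..b} (\<lambda>t. \<alpha>' i t s)" using 2(2) s by auto
      have "path UNIV (ci c (\<alpha> i a s)) (ci c (\<alpha> i b s)) (b - a) (?en i s)"
      proof (rule path.piece[OF c ab _ c\<alpha>'])
        show "\<forall>t\<in>{a..b}. ((\<lambda>t. \<alpha> i t s) has_vector_derivative \<alpha>' i t s) (at t within {a..b})"
          unfolding \<alpha>_def \<alpha>'_def using geodesic_variation.\<alpha>_deriv[OF gv[of i]] by blast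
      qed (use \<alpha>U in simp)
      then have pc: "path UNIV (ci c (\<alpha> i a s)) (ci c (\<alpha> i b s)) (b - a) (?en i s)" .
      have \<alpha>a: "\<alpha> i a s = \<beta> i s"
        unfolding \<alpha>_def geodesic_variation.\<alpha>_def[OF gv] geodesic_variation.W_def[OF gv] geodesic_variation.V_def[OF gv]
        by (simp add: E r_def)
      have "path UNIV p (ci c (\<beta> i s)) a (e i s)" using 1(2) s by simp
      from path.trans[OF this pc[unfolded \<alpha>a]]
      have "path UNIV p (ci c (\<alpha> i b s)) (a + (b - a)) (e i s + ?en i s)" .
      then show ?thesis using \<alpha>U bI by simp
    qed
    then show ?thesis using 1(1) 2(1) by (intro exI[of _ "min \<delta>1 \<delta>2"]) auto
  qed
  moreover have "(\<Sum>i\<in>UNIV. \<epsilon> i + integral {a..b} (?k i)) \<le> Kf b"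
  proof -
    have cont_k: "continuous_on {a..b} (?k i)" for i
      by (intro continuous_intros h(2) geodesic_variation.cont_h[OF gv[of i]] geodesic_variation.cont_riem[OF gv[of i]])
    have "(\<Sum>i\<in>UNIV. integral {a..b} (?k i)) = integral {a..b} (\<lambda>t. \<Sum>i\<in>UNIV. ?k i t)"
      by (rule integral_sum[symmetric]) (auto intro: integrable_continuous_real cont_k)
    also have "\<dots> \<le> integral {a..b} Kf'"
    proof (rule integral_le)
      show "(\<lambda>t. \<Sum>i\<in>UNIV. ?k i t) integrable_on {a..b}"
        by (intro integrable_continuous_real continuous_on_sum cont_k)
      show "Kf' integrable_on {a..b}"
        using fundamental_theorem_of_calculus[OF ab Kf] by (rule has_integral_integrable)
      fix t assume t: "t \<in> {a..b}"
      have x: "?x t \<in> im c" using dm[OF t] by simp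
      have "?R i t = - q c (?x t) (c.riem (?x t) (E i t) (?T t) (?T t)) (E i t)" for i
        by (rule c.riem_antisym[OF x])
      then have "(\<Sum>i\<in>UNIV. ?R i t) = - trc (\<lambda>u. c.riem (?x t) u (?T t) (?T t))"
        by (simp add: c.frame_trc[OF x fr[OF t] c.linear_riem(1)] sum_negf)
      also have "\<dots> = - (?T t \<bullet> (ricci (G c) (?x t) *v ?T t))"
        by (simp add: c.ricci_eq_trc[OF x])
      finally have R: "(\<Sum>i\<in>UNIV. ?R i t) = - (?T t \<bullet> (ricci (G c) (?x t) *v ?T t))" .
      have "(\<Sum>i\<in>UNIV. ?k i t) = 2 * real CARD('n) * (h' t)\<^sup>2 + 2 * (h t)\<^sup>2 * (\<Sum>i\<in>UNIV. ?R i t)"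
        by (simp add: sum.distrib sum_distrib_left mult.assoc)
      then show "(\<Sum>i\<in>UNIV. ?k i t) \<le> Kf' t" using le[OF t] unfolding R by simp
    qed
    also have "\<dots> = Kf b - Kf a"
      using fundamental_theorem_of_calculus[OF ab Kf] by (rule integral_unique)
    finally show ?thesis using K by (simp add: sum.distrib)
  qed
  ultimately show ?thesis by (rule variationI[where \<gamma> = \<gamma> and t = b, OF fr[OF bI]])
qed

end

text \<open>The cutoff is built from a squared positive part: the second variation only asks for a
  continuous derivative.\<close>

lemma pos_part_power2_deriv: "((\<lambda>u::real. (max 0 u)\<^sup>2) has_real_derivative 2 * max 0 u) (at u)"
proof -
  consider "u < 0" | "u > 0" | "u = 0" by linarith
  then show ?thesis
  proof cases
    case 1
    have "((\<lambda>u::real. 0) has_real_derivative 2 * max 0 u) (at u)" using 1 by simp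
    then show ?thesis by (rule has_field_derivative_transform_within_open[of _ _ _ "{..<0}"]) (use 1 in auto)
  next
    case 2
    have "((\<lambda>u::real. u\<^sup>2) has_real_derivative 2 * max 0 u) (at u)"
      using 2 by (auto intro!: derivative_eq_intros)
    then show ?thesis by (rule has_field_derivative_transform_within_open[of _ _ _ "{0<..}"]) (use 2 in auto)
  next
    case 3
    have "((\<lambda>h::real. (max 0 h)\<^sup>2 / h) \<longlongrightarrow> 0) (at 0)"
    proof (rule Lim_null_comparison)
      show "eventually (\<lambda>h::real. norm ((max 0 h)\<^sup>2 / h) \<le> \<bar>h\<bar>) (at 0)"
        by (intro always_eventually allI) (auto simp: max_def power2_eq_square)
      show "((\<lambda>h::real. \<bar>h\<bar>) \<longlongrightarrow> 0) (at 0)" by (rule tendsto_eq_intros refl | simp)+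
    qed
    then show ?thesis using 3 by (simp add: DERIV_def)
  qed
qed

lemma pos_part_power3_deriv: "((\<lambda>u::real. (max 0 u) ^ 3) has_real_derivative 3 * (max 0 u)\<^sup>2) (at u)"
proof -
  have "((\<lambda>u::real. u * (max 0 u)\<^sup>2) has_real_derivative 3 * (max 0 u)\<^sup>2) (at u)"
    by (rule DERIV_mult'[OF DERIV_ident pos_part_power2_deriv, THEN DERIV_cong]) (auto simp: max_def power2_eq_square)
  moreover have "(\<lambda>u::real. u * (max 0 u)\<^sup>2) = (\<lambda>u. (max 0 u) ^ 3)"
    by (auto simp: fun_eq_iff max_def power2_eq_square power3_eq_cube)
  ultimately show ?thesis by simp
qed

lemma jet_const_diff:
  fixes \<phi> :: "'t \<Rightarrow> real \<Rightarrow> 'b::real_normed_vector"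
  assumes "jet S \<phi> a b c"
  shows "jet S (\<lambda>t s. r - \<phi> t s) (\<lambda>t. r - a t) (\<lambda>t. - b t) (\<lambda>t. - c t)"
proof -
  obtain C e where 1: "0 < e" "\<And>t. t \<in> S \<Longrightarrow> norm (a t) \<le> C" "\<And>t. t \<in> S \<Longrightarrow> norm (b t) \<le> C" "\<And>t. t \<in> S \<Longrightarrow> norm (c t) \<le> C"
    "\<And>t s. t \<in> S \<Longrightarrow> \<bar>s\<bar> \<le> e \<Longrightarrow> norm (\<phi> t s - (a t + s *\<^sub>R b t + (s\<^sup>2 / 2) *\<^sub>R c t)) \<le> C * \<bar>s\<bar> ^ 3"
    by (rule jetE[OF assms]) blast
  show ?thesis
  proof (rule jetI[OF 1(1), of _ _ "norm r + C" _ C _ C _ C])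
    fix t s assume t: "t \<in> S" "\<bar>s\<bar> \<le> e"
    have "r - \<phi> t s - (r - a t + s *\<^sub>R - b t + (s\<^sup>2 / 2) *\<^sub>R - c t) = - (\<phi> t s - (a t + s *\<^sub>R b t + (s\<^sup>2 / 2) *\<^sub>R c t))"
      by simp
    then show "norm (r - \<phi> t s - (r - a t + s *\<^sub>R - b t + (s\<^sup>2 / 2) *\<^sub>R - c t)) \<le> C * \<bar>s\<bar> ^ 3"
      using 1(5)[OF t] by (simp only: norm_minus_cancel)
  qed (use 1 in \<open>auto intro: order_trans[OF norm_triangle_ineq4]\<close>)
qed

section \<open>The maximum principle at the point x\<close>

context chart_function begin

text \<open>Along each curve \<open>b i\<close> the function w (R2 - e)^2 is maximal at 0. The
  first-order condition is P0 dw(E i) = 4 a i w; inserted into the second-order condition it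
  produces 24 = 32 - 8 times the square of a i. Summed over the frame these squares give s2, and the
  first-order conditions give P0 dw(X) = 4 w dF(T), the drift. A factor w is cancelled at the
  end.\<close>

lemma max_estimate:
  fixes b :: "'a \<Rightarrow> real \<Rightarrow> real^'a" and e :: "'a \<Rightarrow> real \<Rightarrow> real"
  assumes x: "x \<in> U" and E: "on_frame x E" and T: "g x T T = s2" and P: "s2 < R2" and w: "w x > 0"
    and b: "\<And>i. jet UNIV (\<lambda>_::unit. b i) (\<lambda>_. x) (\<lambda>_. E i) (\<lambda>_. - \<Gamma> x (E i) (E i))"
    and e: "\<And>i. jet UNIV (\<lambda>_::unit. e i) (\<lambda>_. s2) (\<lambda>_. 2 * g x (E i) T) (\<lambda>_. \<epsilon> i)"
    and max: "\<And>i. \<exists>\<delta>>0. \<forall>s. \<bar>s\<bar> \<le> \<delta> \<longrightarrow> w (b i s) * (R2 - e i s)\<^sup>2 \<le> w x * (R2 - s2)\<^sup>2"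
    and boch: "laplacian G w x \<ge> 2 / real CARD('a) * (w x)\<^sup>2 + bderiv w x (X x)"
  shows "2 / real CARD('a) * w x * (R2 - s2)\<^sup>2 \<le> 24 * s2 + 2 * (R2 - s2) * (\<Sum>i\<in>UNIV. \<epsilon> i) - 4 * (R2 - s2) * bderiv F x T"
proof -
  define P0 where "P0 = R2 - s2"
  have P0: "P0 > 0" using P by (simp add: P0_def)
  define a where "a i = g x (E i) T" for i
  have gT: "g x T (E i) = a i" for i unfolding a_def by (rule g_sym[OF x])
  have "bderiv w x (E i) * P0 = 4 * a i * w x \<and> hs w x (E i) (E i) * P0\<^sup>2 \<le> w x * (24 * (a i)\<^sup>2 + 2 * P0 * \<epsilon> i)" for i
  proof -
    note jw = jet_compose[OF open_U smooth_w _ _ b[of i], of "{x}"]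
    have jw: "jet UNIV (\<lambda>_::unit. \<lambda>s. w (b i s)) (\<lambda>_. w x) (\<lambda>_. bderiv w x (E i)) (\<lambda>_. hs w x (E i) (E i))"
      by (rule jet_cong[OF jw]) (use x in \<open>auto simp: hs_def blinfun.bilinear_simps\<close>)
    note jP = jet_const_diff[OF e[of i], of R2]
    note j = jet_bilinear[OF bounded_bilinear_mult jw jet_bilinear[OF bounded_bilinear_mult jP jP]]
    \<comment> \<open>The jet of R2 - e is (P0, -2 a, -\<epsilon>), that of its square is (P0^2, -4
      a P0, 8 a^2 - 2 P0 \<epsilon>).\<close>
    have j: "jet UNIV (\<lambda>_::unit. \<lambda>s. w (b i s) * (R2 - e i s)\<^sup>2) (\<lambda>_. w x * (R2 - s2)\<^sup>2)
       (\<lambda>_. P0 * (bderiv w x (E i) * P0 - 4 * a i * w x))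
       (\<lambda>_. hs w x (E i) (E i) * P0\<^sup>2 - 8 * a i * (bderiv w x (E i) * P0) + w x * (8 * (a i)\<^sup>2 - 2 * P0 * \<epsilon> i))"
      by (rule jet_cong[OF j]) (auto simp: P0_def a_def power2_eq_square algebra_simps)
    obtain \<delta> where \<delta>: "\<delta> > 0" "\<And>s. \<bar>s\<bar> \<le> \<delta> \<Longrightarrow> w (b i s) * (R2 - e i s)\<^sup>2 \<le> w x * (R2 - s2)\<^sup>2"
      using max[of i] by blast
    have 1: "bderiv w x (E i) * P0 = 4 * a i * w x" using jet_local_max(1)[OF j \<delta>] P0 by simp
    then show ?thesis using jet_local_max(2)[OF j \<delta>] by (simp add: algebra_simps power2_eq_square)
  qed
  then have 1: "\<And>i. bderiv w x (E i) * P0 = 4 * a i * w x" and 2: "\<And>i. hs w x (E i) (E i) * P0\<^sup>2 \<le> w x * (24 * (a i)\<^sup>2 + 2 * P0 * \<epsilon> i)"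
    by auto
  have "(\<Sum>i\<in>UNIV. (a i)\<^sup>2) = s2"
    using frame_norm2[OF x E, of T T] by (simp add: T gT power2_eq_square)
  then have s2: "(\<Sum>i\<in>UNIV. w x * (24 * (a i)\<^sup>2 + 2 * P0 * \<epsilon> i)) = w x * (24 * s2 + 2 * P0 * (\<Sum>i\<in>UNIV. \<epsilon> i))"
    by (simp add: sum_distrib_left[symmetric] sum.distrib)
  have lap: "laplacian G w x * P0\<^sup>2 \<le> w x * (24 * s2 + 2 * P0 * (\<Sum>i\<in>UNIV. \<epsilon> i))"
    unfolding laplacian_frame[OF smooth_w x E] sum_distrib_right s2[symmetric] by (rule sum_mono) (rule 2)
  have "bderiv w x (X x) * P0 = (\<Sum>i\<in>UNIV. g x (X x) (E i) * (bderiv w x (E i) * P0))"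
    by (subst frame_expand(1)[OF x E, of "X x"]) (simp add: blinfun.sum_right blinfun.scaleR_right sum_distrib_right mult.assoc)
  also have "\<dots> = 4 * w x * (\<Sum>i\<in>UNIV. g x (X x) (E i) * g x T (E i))"
    unfolding 1 gT by (simp add: sum_distrib_left mult_ac)
  also have "\<dots> = 4 * w x * bderiv F x T"
    by (simp only: frame_norm2[OF x E, of "X x" T, symmetric] g_X[OF x, of T])
  finally have dw: "bderiv w x (X x) * P0 = 4 * w x * bderiv F x T" .
  have "(2 / real CARD('a) * (w x)\<^sup>2 + bderiv w x (X x)) * P0\<^sup>2 \<le> w x * (24 * s2 + 2 * P0 * (\<Sum>i\<in>UNIV. \<epsilon> i))"
    using mult_right_mono[OF boch, of "P0\<^sup>2"] lap by simp
  moreover have "(2 / real CARD('a) * (w x)\<^sup>2 + bderiv w x (X x)) * P0\<^sup>2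
      = w x * (2 / real CARD('a) * w x * P0\<^sup>2) + (bderiv w x (X x) * P0) * P0"
    by (simp add: algebra_simps power2_eq_square)
  ultimately have "w x * (2 / real CARD('a) * w x * P0\<^sup>2) \<le> w x * (24 * s2 + 2 * P0 * (\<Sum>i\<in>UNIV. \<epsilon> i) - 4 * P0 * bderiv F x T)"
    unfolding dw by (simp add: algebra_simps)
  then show ?thesis unfolding P0_def[symmetric] using w by (simp only: mult_le_cancel_left_pos)
qed

end

section \<open>The estimate on a ball of radius R and its limit\<close>

context riemannian_function begin

text \<open>The square of h' integrates to 4 \<kappa> / 3 over [0, 1], and the second variations
  count it twice for each of the n frame vectors: this is the term 8 n \<kappa> / 3. The other two
  terms are values at the end, where h = 1.\<close>

lemma variation_exists:
  assumes ric: "\<And>c p v. c \<in> A \<Longrightarrow> p \<in> dm c \<Longrightarrow>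
      v \<bullet> (ricci (G c) (co c p) *v v) + chart_metric.hs (G c) (F c) (co c p) v v \<ge> 0"
    and \<gamma>: "geodesic A g \<gamma>" "\<gamma> 0 = p" and \<kappa>: "\<kappa> > 0"
    and D: "\<And>t. 0 \<le> t \<Longrightarrow> \<kappa> * t < 1 \<Longrightarrow> \<bar>dfg \<gamma> t\<bar> \<le> D"
    and K: "\<kappa> \<ge> 1"
  shows "\<exists>c\<in>A. \<gamma> 1 \<in> dm c \<and> variation c p \<gamma> 1 1 (8 * real CARD('n) * \<kappa> / 3 + 2 * dfg \<gamma> 1 + 2 * D)"
proof -
  let ?u = "\<lambda>t. max 0 (1 - \<kappa> * t)"
  \<comment> \<open>Rises from 0 at p to 1 at time 1 / \<kappa>, which is at most 1, and stays
    there, with continuous derivative throughout.\<close>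
  define h where "h t = 1 - (?u t)\<^sup>2" for t
  define h' where "h' t = 2 * \<kappa> * ?u t" for t
  \<comment> \<open>\<open>Ric(T, T) \<ge> - (f \<circ> \<gamma>)''\<close>, and integrating \<open>h\<^sup>2 (f \<circ> \<gamma>)''\<close> by parts leaves an integral over the support
    of \<open>h'\<close>, where \<open>(f \<circ> \<gamma>)'\<close> is bounded by \<open>D\<close>.\<close>
  define Kf where "Kf t = 2 * real CARD('n) * (4 * \<kappa> / 3 * (1 - ?u t ^ 3)) + 2 * (h t)\<^sup>2 * dfg \<gamma> t + 2 * D * (h t)\<^sup>2" for t
  let ?S = "\<lambda>t. \<exists>c\<in>A. \<gamma> t \<in> dm c \<and> variation c p \<gamma> t (h t) (Kf t)"
  have lin: "((\<lambda>t. 1 - \<kappa> * t) has_real_derivative - \<kappa>) (at t)" for t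
    by (auto intro!: derivative_eq_intros)
  have hd: "(h has_real_derivative h' t) (at t)" for t
    unfolding h_def[abs_def] h'_def
    by (rule DERIV_cong[OF DERIV_diff[OF DERIV_const DERIV_chain2[OF pos_part_power2_deriv lin]]]) simp
  have u3: "((\<lambda>t. 1 - ?u t ^ 3) has_real_derivative 3 * \<kappa> * (?u t)\<^sup>2) (at t)" for t
    by (rule DERIV_cong[OF DERIV_diff[OF DERIV_const DERIV_chain2[OF pos_part_power3_deriv lin]]]) simp
  have h0: "0 \<le> h t" if "0 \<le> t" for t
  proof -
    have "\<bar>?u t\<bar> \<le> 1" using that \<kappa> by auto
    then have "(?u t)\<^sup>2 \<le> 1" by (simp only: abs_square_le_1)
    then show ?thesis by (simp add: h_def)
  qed
  define Pr where "Pr a b \<longleftrightarrow> (0 \<le> a \<longrightarrow> ?S a \<longrightarrow> ?S b)" for a b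
  have step: "Pr 0 1"
  proof (rule Bolzano[where P = Pr])
    show "Pr a c" if "Pr a b" "Pr b c" "a \<le> b" "b \<le> c" for a b c
      using that order_trans unfolding Pr_def by blast
    fix x
    obtain c where c: "c \<in> A" "\<gamma> x \<in> dm c" using ex_chart by blast
    interpret c: chart_function "im c" "G c" "F c" by (rule chart_function_chart[OF c(1)])
    let ?x = "\<lambda>t. co c (\<gamma> t)" and ?T = "vel c \<gamma>"
    have "open (\<gamma> -` dm c)" by (rule geodesic_open_vimage[OF \<gamma>(1) open_domain[OF c(1)]])
    then obtain d0 where d0: "d0 > 0" "ball x d0 \<subseteq> \<gamma> -` dm c" using c(2) open_contains_ball by blast
    have "isCont ?x x" by (rule has_vector_derivative_continuous[OF geodesicD(1)[OF \<gamma>(1) c]])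
    moreover have "isCont (\<Gamma> c) (?x x)"
      using smooth_on_continuous[OF c.smooth_\<Gamma>] c.open_U c(2) by (simp add: continuous_on_eq_continuous_at)
    ultimately have "isCont (\<lambda>t. \<Gamma> c (?x t)) x" by (rule isCont_o2)
    moreover have "isCont ?T x" by (rule has_vector_derivative_continuous[OF geodesicD(2)[OF \<gamma>(1) c]])
    ultimately have "isCont (\<lambda>t. \<Gamma> c (?x t) (?T t)) x" by (intro continuous_intros)
    then obtain d1 where d1: "d1 > 0" "\<And>t. dist t x < d1 \<Longrightarrow> dist (\<Gamma> c (?x t) (?T t)) (\<Gamma> c (?x x) (?T x)) < 1"
      unfolding continuous_at_eps_delta using zero_less_one by blast
    define M where "M = norm (\<Gamma> c (?x x) (?T x)) + 1"
    have M0: "M > 0" unfolding M_def by (simp add: add_nonneg_pos)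
    have M: "norm (\<Gamma> c (?x t) (?T t)) \<le> M" if "dist t x < d1" for t
      using d1(2)[OF that] norm_triangle_ineq2[of "\<Gamma> c (?x t) (?T t)" "\<Gamma> c (?x x) (?T x)"] by (simp add: M_def dist_norm)
    \<comment> \<open>Intervals around x shorter than d stay in the chart and satisfy M (b - a) < 1,
      as required for parallel transport.\<close>
    define d where "d = min (min d0 d1) (1 / M)"
    have d: "d > 0" "d \<le> d0" "d \<le> d1" "d \<le> 1 / M" using d0 d1 M0 by (auto simp: d_def)
    have Md: "M * d \<le> 1" using d(4) M0 by (simp add: field_simps)
    have "?S b" if ab: "a \<le> x" "x \<le> b" "b - a < d" and a0: "0 \<le> a" and Sa: "?S a" for a b
    proof -
      have dist: "dist t x < d" if "t \<in> {a..b}" for t using that ab by (auto simp: dist_real_def)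
      have dm: "\<gamma> t \<in> dm c" if "t \<in> {a..b}" for t
        using dist[OF that] d(2) d0(2) by (auto simp: dist_commute subset_iff)
      have aI: "a \<in> {a..b}" and bI: "b \<in> {a..b}" using ab by auto
      obtain c' where c': "c' \<in> A" "\<gamma> a \<in> dm c'" "variation c' p \<gamma> a (h a) (Kf a)" using Sa by blast
      have va: "variation c p \<gamma> a (h a) (Kf a)"
        by (rule variation_chart[OF \<gamma>(1) c'(1,2) c(1) dm[OF aI] c'(3)])
      let ?H = "\<lambda>t. c.hs (F c) (?x t) (?T t) (?T t)"
      let ?K' = "\<lambda>t. 2 * real CARD('n) * (h' t)\<^sup>2 + 2 * (h t)\<^sup>2 * ?H t + 4 * h t * h' t * (dfg \<gamma> t + D)"
      have "variation c p \<gamma> b (h b) (Kf b)"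
      proof (rule variation_step[where \<gamma> = \<gamma> and a = a and b = b and h = h and h' = h' and Kf = Kf and Kf' = ?K' and M = M,
            OF \<gamma>(1) c(1) _ dm _ _ _ _ _ _ va])
        show "a \<le> b" using ab by simp
        show "norm (\<Gamma> c (?x t) (?T t)) \<le> M" if "t \<in> {a..b}" for t
          using M dist[OF that] d(3) by simp
        show "M * (b - a) < 1" using ab(3) Md M0 by (smt (verit) mult_less_cancel_left_pos)
        show "(h has_vector_derivative h' t) (at t within {a..b})" for t
          using hd[of t] by (simp add: has_real_derivative_iff_has_vector_derivative has_vector_derivative_at_within)
        show "continuous_on {a..b} h'" unfolding h'_def by (intro continuous_intros)
        fix t assume t: "t \<in> {a..b}"
        have "((\<lambda>t. (h t)\<^sup>2) has_real_derivative 2 * h t * h' t) (at t)"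
          by (rule DERIV_cong[OF DERIV_power[OF hd[of t], of 2]]) simp
        note h2 = this
        have "(Kf has_real_derivative ?K' t) (at t)"
          unfolding Kf_def[abs_def]
          by (rule derivative_eq_intros u3 h2 dfg_deriv[OF \<gamma>(1) c(1) dm[OF t]] refl)+
             (simp add: h'_def power2_eq_square algebra_simps)
        then show "(Kf has_vector_derivative ?K' t) (at t within {a..b})"
          by (simp add: has_real_derivative_iff_has_vector_derivative has_vector_derivative_at_within)
        have t0: "0 \<le> t" using t a0 by simp
        \<comment> \<open>The bound by D is available exactly where it is needed, since h' vanishes
          from time 1 / \<kappa> on.\<close>
        have "0 \<le> h t * h' t * (dfg \<gamma> t + D)"
        proof (cases "\<kappa> * t < 1")
          case True
          then have "0 \<le> dfg \<gamma> t + D" using D[OF t0] by linarith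
          then show ?thesis using h0[OF t0] \<kappa> by (simp add: h'_def)
        qed (simp add: h'_def)
        moreover have "0 \<le> (h t)\<^sup>2 * (?T t \<bullet> (ricci (G c) (?x t) *v ?T t) + ?H t)"
          by (intro mult_nonneg_nonneg zero_le_power2 ric c(1) dm[OF t])
        ultimately show "2 * real CARD('n) * (h' t)\<^sup>2 - 2 * (h t)\<^sup>2 * (?T t \<bullet> (ricci (G c) (?x t) *v ?T t)) \<le> ?K' t"
          by (simp add: algebra_simps)
      qed
      then show ?thesis using c(1) dm[OF bI] by blast
    qed
    then show "\<exists>d>0. \<forall>a b. a \<le> x \<and> x \<le> b \<and> b - a < d \<longrightarrow> Pr a b"
      using d(1) unfolding Pr_def by blast
  qed simp
  have "h 0 = 0" "Kf 0 = 0" by (auto simp: h_def Kf_def)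
  moreover have "h 1 = 1" "Kf 1 = 8 * real CARD('n) * \<kappa> / 3 + 2 * dfg \<gamma> 1 + 2 * D"
    using K by (auto simp: h_def Kf_def)
  moreover obtain c where "c \<in> A" "p \<in> dm c" using ex_chart by blast
  ultimately show ?thesis using step[unfolded Pr_def] variation_0[of c p \<gamma>] \<gamma>(2) by auto
qed

text \<open>The derivative of f at the end of the geodesic occurs in the sum of second variations
  and, with opposite sign, in the drift at the maximum. After the cancellation the right side is of
  order R^3 only.\<close>

lemma gradsq_estimate:
  assumes complete: "complete_metric A g"
    and ric: "\<And>c p v. c \<in> A \<Longrightarrow> p \<in> dm c \<Longrightarrow>
      v \<bullet> (ricci (G c) (co c p) *v v) + chart_metric.hs (G c) (F c) (co c p) v v \<ge> 0"
    and boch: "\<And>c x. c \<in> A \<Longrightarrow> x \<in> im c \<Longrightarrow> laplacian (G c) (wc c) x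
      \<ge> 2 / real CARD('n) * (wc c x)\<^sup>2 + bderiv (wc c) x (gradient (G c) (F c) x)"
    and R: "R \<ge> 1" and D1: "0 \<le> D1" "\<And>y. mdist p y \<le> 1 \<Longrightarrow> gradsq y \<le> D1" and p: "gradsq p > 0"
  shows "2 / real CARD('n) * (gradsq p * R ^ 4) \<le> 24 * R\<^sup>2 + 4 * R\<^sup>2 * (4 * real CARD('n) * R / 3 + sqrt D1 * R)"
proof -
  obtain x where x: "mdist p x < R" "gradsq x > 0" "gradsq p * R ^ 4 \<le> gradsq x * (R\<^sup>2 - (mdist p x)\<^sup>2)\<^sup>2"
    and max: "\<And>y. mdist p y \<le> R \<Longrightarrow> gradsq y * (R\<^sup>2 - (mdist p y)\<^sup>2)\<^sup>2 \<le> gradsq x * (R\<^sup>2 - (mdist p x)\<^sup>2)\<^sup>2"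
    using max_point[OF complete _ p, of R] R by auto
  obtain \<gamma> where \<gamma>: "geodesic A g \<gamma>" "\<gamma> 0 = p" "\<gamma> 1 = x" "sqrt (speed2 \<gamma> 0) = mdist p x"
    using hopf_rinow[OF complete] by blast
  define l s2 where "l = mdist p x" and "s2 = speed2 \<gamma> 0"
  have l0: "0 \<le> l" and lR: "l < R" using x(1) mdist_nonneg by (auto simp: l_def)
  have s2: "s2 = l\<^sup>2" using \<gamma>(4) speed2_nonneg[OF \<gamma>(1)] unfolding l_def s2_def by (metis real_sqrt_pow2)
  \<comment> \<open>Times with \<kappa> t < 1 then belong to points at distance less than 1 from p,
    where the gradient is bounded by D1, and the condition \<kappa> \<ge> 1 of the cutoff
    holds.\<close>
  define \<kappa> where "\<kappa> = max 1 l"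
  have \<kappa>: "\<kappa> \<ge> 1" "l \<le> \<kappa>" "\<kappa> \<le> R" using R lR by (auto simp: \<kappa>_def)
  define D where "D = sqrt D1 * l"
  have Db: "\<bar>dfg \<gamma> t\<bar> \<le> D" if t: "0 \<le> t" "\<kappa> * t < 1" for t
  proof -
    obtain c where c: "c \<in> A" "\<gamma> t \<in> dm c" using ex_chart by blast
    interpret c: chart_function "im c" "G c" "F c" by (rule chart_function_chart[OF c(1)])
    have "mdist p (\<gamma> t) \<le> t * l" using geodesic_mdist[OF \<gamma>(1) t(1)] \<gamma>(2,4) by (simp add: l_def)
    also have "\<dots> \<le> t * \<kappa>" using \<kappa>(2) t(1) by (rule mult_left_mono)
    finally have g1: "gradsq (\<gamma> t) \<le> D1" using t(2) by (intro D1(2)) (simp add: mult.commute)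
    have "(dfg \<gamma> t)\<^sup>2 \<le> gradsq (\<gamma> t) * s2"
      using c.cauchy_schwarz_g[of "co c (\<gamma> t)" "vel c \<gamma> t"] c
      by (simp add: dfg_eq[OF \<gamma>(1) c] gradsq_eq[OF c] speed2_chart[OF \<gamma>(1) c] s2_def)
    also have "\<dots> \<le> D1 * s2" using g1 by (rule mult_right_mono) (simp add: s2)
    also have "\<dots> = D\<^sup>2" using D1(1) by (simp add: D_def s2 power_mult_distrib)
    finally have "\<bar>dfg \<gamma> t\<bar> \<le> \<bar>D\<bar>" by (simp only: abs_le_square_iff)
    then show ?thesis using D1(1) l0 by (simp add: D_def)
  qed
  define K where "K = 8 * real CARD('n) * \<kappa> / 3 + 2 * dfg \<gamma> 1 + 2 * D"
  obtain c where c: "c \<in> A" "\<gamma> 1 \<in> dm c" and v: "variation c p \<gamma> 1 1 K"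
    using variation_exists[OF ric \<gamma>(1,2) _ Db \<kappa>(1)] \<kappa>(1) unfolding K_def by auto
  interpret c: chart_function "im c" "G c" "F c" by (rule chart_function_chart[OF c(1)])
  let ?x = "co c x" and ?T = "vel c \<gamma> 1"
  have xc: "x \<in> dm c" "?x \<in> im c" using c \<gamma>(3) by auto
  obtain E b e \<epsilon> where E: "c.on_frame ?x E"
    and b: "\<And>i. jet UNIV (\<lambda>_::unit. b i) (\<lambda>_. ?x) (\<lambda>_. E i) (\<lambda>_. - \<Gamma> c ?x (E i) (E i))"
    and e: "\<And>i. jet UNIV (\<lambda>_::unit. e i) (\<lambda>_. s2) (\<lambda>_. 2 * q c ?x (E i) ?T) (\<lambda>_. \<epsilon> i)"
    and pt: "\<And>i. \<exists>\<delta>>0. \<forall>s. \<bar>s\<bar> \<le> \<delta> \<longrightarrow> b i s \<in> im c \<and> path UNIV p (ci c (b i s)) 1 (e i s)"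
    and \<epsilon>: "(\<Sum>i\<in>UNIV. \<epsilon> i) \<le> K"
    using v unfolding variation_def \<gamma>(3) s2_def[symmetric] mult_1_left scaleR_one by blast
  have P: "s2 < R\<^sup>2" unfolding s2 using lR l0 by (simp add: power_strict_mono)
  have wx: "c.w ?x = gradsq x" using gradsq_eq[OF c(1) xc(1)] by simp
  have maxw: "\<exists>\<delta>>0. \<forall>s. \<bar>s\<bar> \<le> \<delta> \<longrightarrow> c.w (b i s) * (R\<^sup>2 - e i s)\<^sup>2 \<le> c.w ?x * (R\<^sup>2 - s2)\<^sup>2" for i
  proof -
    obtain \<delta>1 where 1: "\<delta>1 > 0" "\<And>s. \<bar>s\<bar> \<le> \<delta>1 \<Longrightarrow> b i s \<in> im c \<and> path UNIV p (ci c (b i s)) 1 (e i s)"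
      using pt[of i] by blast
    obtain \<delta>2 where 2: "\<delta>2 > 0" "\<And>s. \<bar>s\<bar> \<le> \<delta>2 \<Longrightarrow> e i s \<in> {..<R\<^sup>2}"
      using jet_in_open[OF e[of i], of "{..<R\<^sup>2}"] P by auto
    have "c.w (b i s) * (R\<^sup>2 - e i s)\<^sup>2 \<le> c.w ?x * (R\<^sup>2 - s2)\<^sup>2" if s: "\<bar>s\<bar> \<le> min \<delta>1 \<delta>2" for s
    proof -
      let ?y = "ci c (b i s)"
      have im: "b i s \<in> im c" and pa: "path UNIV p ?y 1 (e i s)" using 1(2) s by auto
      have eR: "e i s < R\<^sup>2" using 2(2) s by simp
      have e0: "0 \<le> e i s" using path_nonneg[OF pa] by simp
      \<comment> \<open>At unit duration the energy dominates the squared distance. While it stays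
        below R^2, putting it in place of the squared distance only lowers the value, so the
        maximality of x carries over to the barrier.\<close>
      have "mdist p ?y \<le> sqrt (e i s)" using mdist_le_sqrt[OF pa] by simp
      then have "(mdist p ?y)\<^sup>2 \<le> (sqrt (e i s))\<^sup>2" by (intro power_mono mdist_nonneg)
      then have d2: "(mdist p ?y)\<^sup>2 \<le> e i s" using e0 by simp
      then have "(mdist p ?y)\<^sup>2 \<le> R\<^sup>2" using eR by linarith
      then have "mdist p ?y \<le> R" using R by (simp add: power2_le_iff_abs_le)
      then have "gradsq ?y * (R\<^sup>2 - (mdist p ?y)\<^sup>2)\<^sup>2 \<le> gradsq x * (R\<^sup>2 - s2)\<^sup>2"
        using max unfolding s2 l_def by blast
      moreover have "gradsq ?y * (R\<^sup>2 - e i s)\<^sup>2 \<le> gradsq ?y * (R\<^sup>2 - (mdist p ?y)\<^sup>2)\<^sup>2"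
        using d2 eR by (intro mult_left_mono power_mono gradsq_nonneg) auto
      moreover have "c.w (b i s) = gradsq ?y" using gradsq_eq[OF c(1), of ?y] im by simp
      ultimately show ?thesis unfolding wx by simp
    qed
    then show ?thesis using 1(1) 2(1) by (intro exI[of _ "min \<delta>1 \<delta>2"]) auto
  qed
  have gT: "q c ?x ?T ?T = s2" using speed2_chart[OF \<gamma>(1) c] by (simp add: \<gamma>(3) s2_def)
  have w0: "c.w ?x > 0" using x(2) wx by simp
  have "2 / real CARD('n) * c.w ?x * (R\<^sup>2 - s2)\<^sup>2 \<le> 24 * s2 + 2 * (R\<^sup>2 - s2) * (\<Sum>i\<in>UNIV. \<epsilon> i) - 4 * (R\<^sup>2 - s2) * bderiv (F c) ?x ?T"
    by (rule c.max_estimate[OF xc(2) E gT P w0 b e maxw boch[OF c(1) xc(2)]])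
  also have "\<dots> \<le> 24 * s2 + 2 * (R\<^sup>2 - s2) * K - 4 * (R\<^sup>2 - s2) * bderiv (F c) ?x ?T"
    using mult_left_mono[OF \<epsilon>, of "2 * (R\<^sup>2 - s2)"] P by simp
  \<comment> \<open>The terms with dF(T) cancel here: K contains twice the derivative of f along the
    geodesic at time 1.\<close>
  also have "\<dots> = 24 * s2 + 4 * ((R\<^sup>2 - s2) * (4 * real CARD('n) * \<kappa> / 3 + D))"
    unfolding K_def using dfg_eq[OF \<gamma>(1) c] by (simp add: \<gamma>(3) algebra_simps)
  finally have est: "2 / real CARD('n) * c.w ?x * (R\<^sup>2 - s2)\<^sup>2 \<le> 24 * s2 + 4 * ((R\<^sup>2 - s2) * (4 * real CARD('n) * \<kappa> / 3 + D))" .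
  have "(R\<^sup>2 - s2) * (4 * real CARD('n) * \<kappa> / 3 + D) \<le> R\<^sup>2 * (4 * real CARD('n) * R / 3 + sqrt D1 * R)"
    unfolding D_def using P s2 \<kappa> lR l0 D1(1) by (intro mult_mono add_mono divide_right_mono mult_left_mono) auto
  then have rhs: "2 / real CARD('n) * c.w ?x * (R\<^sup>2 - s2)\<^sup>2 \<le> 24 * R\<^sup>2 + 4 * (R\<^sup>2 * (4 * real CARD('n) * R / 3 + sqrt D1 * R))"
    using est P by linarith
  have "2 / real CARD('n) * (gradsq p * R ^ 4) \<le> 2 / real CARD('n) * (c.w ?x * (R\<^sup>2 - s2)\<^sup>2)"
    using x(3) unfolding wx s2 l_def by (rule mult_left_mono) simp
  then show ?thesis using rhs by (simp add: mult.assoc)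
qed

text \<open>A positive value at p makes the left side of the estimate grow like R^4, the right side
  only like R^3; R beyond the quotient of the constants, and at least 1, gives the
  contradiction.\<close>

lemma gradsq_eq_0:
  assumes complete: "complete_metric A g"
    and ric: "\<And>c p v. c \<in> A \<Longrightarrow> p \<in> dm c \<Longrightarrow>
      v \<bullet> (ricci (G c) (co c p) *v v) + chart_metric.hs (G c) (F c) (co c p) v v \<ge> 0"
    and boch: "\<And>c x. c \<in> A \<Longrightarrow> x \<in> im c \<Longrightarrow> laplacian (G c) (wc c) x
      \<ge> 2 / real CARD('n) * (wc c x)\<^sup>2 + bderiv (wc c) x (gradient (G c) (F c) x)"
  shows "gradsq p = 0"
proof (rule ccontr)
  assume "gradsq p \<noteq> 0"
  then have p: "gradsq p > 0" using gradsq_nonneg[of p] by linarith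
  obtain D1 where D1: "0 \<le> D1" "\<And>y. mdist p y \<le> 1 \<Longrightarrow> gradsq y \<le> D1"
    using gradsq_bounded[OF complete] by blast
  define k where "k = 2 / real CARD('n) * gradsq p"
  have k: "k > 0" using p zero_less_card_finite[where 'a = 'n] unfolding k_def by (intro mult_pos_pos divide_pos_pos) simp_all
  define C where "C = 24 + 4 * (4 * real CARD('n) / 3 + sqrt D1)"
  have C: "C \<ge> 0" using D1(1) by (simp add: C_def)
  define R where "R = max 1 (C / k + 1)"
  have R: "R \<ge> 1" "R > C / k" by (auto simp: R_def)
  have "k * R ^ 4 \<le> 24 * R\<^sup>2 + 4 * R\<^sup>2 * (4 * real CARD('n) * R / 3 + sqrt D1 * R)"
    using gradsq_estimate[OF complete ric boch R(1) D1 p] by (simp add: k_def mult.assoc)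
  also have "\<dots> \<le> C * R ^ 3"
  proof -
    have "R\<^sup>2 \<le> R ^ 3" using R(1) by (simp add: power_increasing)
    then show ?thesis by (simp add: C_def algebra_simps power2_eq_square power3_eq_cube)
  qed
  finally have "(k * R) * R ^ 3 \<le> C * R ^ 3" by (simp add: power3_eq_cube power4_eq_xxxx mult_ac)
  then have "k * R \<le> C" using R(1) by simp
  then show False using R(2) k by (simp add: field_simps)
qed

text \<open>By Cauchy-Schwarz df vanishes, so f is constant on coordinate balls, and connectedness
  makes it globally constant.\<close>

lemma constant_if_gradsq_eq_0:
  assumes "\<And>p. gradsq p = 0"
  shows "f constant_on UNIV"
proof -
  have loc: "\<exists>S. open S \<and> p \<in> S \<and> (\<forall>y\<in>S. f y = f p)" for p
  proof -
    obtain c where c: "c \<in> A" "p \<in> dm c" using ex_chart by blast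
    interpret c: chart_function "im c" "G c" "F c" by (rule chart_function_chart[OF c(1)])
    have d0: "bderiv (F c) x v = 0" if "x \<in> im c" for x v
      using c.cauchy_schwarz_g[OF that, of v] gradsq_eq[OF c(1), of "ci c x"] assms[of "ci c x"] that by simp
    obtain r where r: "r > 0" "ball (co c p) r \<subseteq> im c"
      using c.open_U c(2) open_contains_ball by blast
    have const: "F c x = F c (co c p)" if "x \<in> ball (co c p) r" for x
    proof (rule has_derivative_zero_unique[where f = "F c", OF convex_ball])
      show "(F c has_derivative (\<lambda>h. 0)) (at y within ball (co c p) r)" if "y \<in> ball (co c p) r" for y
      proof -
        have y: "y \<in> im c" using that r(2) by blast
        have "blinfun_apply (bderiv (F c) y) = (\<lambda>h. 0)" using d0[OF y] by auto
        then show ?thesis using bderiv_works[OF c.smooth_F y] by (metis has_derivative_at_withinI)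
      qed
    qed (use that r in auto)
    have "open (ci c ` ball (co c p) r)" by (rule open_ci_image[OF c(1) r(2) open_ball])
    moreover have "p \<in> ci c ` ball (co c p) r"
      by (rule image_eqI[of _ _ "co c p"]) (use c r in auto)
    moreover have "f y = f p" if yB: "y \<in> ci c ` ball (co c p) r" for y
    proof -
      obtain x where x: "y = ci c x" "x \<in> ball (co c p) r" using yB by blast
      then have "F c x = F c (co c p)" by (intro const)
      then show ?thesis using x r(2) c by (auto simp: in_chart_def)
    qed
    ultimately show ?thesis by blast
  qed
  have "f a = f b" for a b
  proof (rule connected_local_const[OF connected, of a b f])
    show "\<forall>a\<in>UNIV. \<forall>\<^sub>F b in at a within UNIV. f a = f b"
      using loc by (metis (mono_tags, lifting) eventually_at_topological)
  qed auto
  then show ?thesis by (auto simp: constant_on_def)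
qed

end

theorem theorem1p2:
  fixes A :: "('a::{t2_space, second_countable_topology}, 'n::finite) chart set"
    and g :: "('a, 'n) chart \<Rightarrow> 'a \<Rightarrow> real ^ 'n ^ 'n"
    and f :: "'a \<Rightarrow> real"
    and m :: ereal
    and c\<^sub>1 c\<^sub>2 :: real
  assumes "riemannian_manifold A g"
    and "complete_metric A g"
    and "0 < m"
    and "smooth_function A f"
    and "bakry_emery_ricci_nonneg A g m f"
    and "c\<^sub>1 \<ge> 0" and "c\<^sub>2 \<ge> 0"
    and "\<forall>c\<in>A. \<forall>p\<in>fst c. f_laplacian_at g c f f p = c\<^sub>1 * exp (c\<^sub>2 * f p)"
  shows "f constant_on UNIV"
proof -
  interpret riemannian_function A g f
    using assms(1,4) by (simp add: riemannian_function_def riemannian_function_axioms_def)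
  \<comment> \<open>Includes m = \<infinity>, where 1 / m is 0.\<close>
  have m: "0 \<le> real_of_ereal (1 / m)" using assms(3) by (cases m) (auto simp: one_ereal_def)
  have ric: "v \<bullet> (ricci (G c) (co c p) *v v) + chart_metric.hs (G c) (F c) (co c p) v v \<ge> 0"
    if c: "c \<in> A" "p \<in> dm c" for c p v
  proof -
    interpret c: chart_function "im c" "G c" "F c" by (rule chart_function_chart[OF c(1)])
    let ?x = "co c p" and ?Q = "\<chi> i j. partial i (F c) (co c p) * partial j (F c) (co c p)"
    have x: "?x \<in> im c" using c by simp
    \<comment> \<open>The tensor df \<otimes> df evaluates to a square, so the Bakry-Emery bound
      passes to Ric + Hess f.\<close>
    have "v \<bullet> (?Q *v v) = (\<Sum>i\<in>UNIV. v $ i * partial i (F c) ?x)\<^sup>2"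
      by (simp add: inner_vec_def matrix_vector_mult_def power2_eq_square sum_product sum_distrib_left mult_ac)
    then have Q: "0 \<le> v \<bullet> (?Q *v v)" by simp
    have "0 \<le> v \<bullet> (bakry_emery_ricci m (G c) (F c) ?x *v v)"
      using assms(5) c unfolding bakry_emery_ricci_nonneg_def by blast
    also have "\<dots> = v \<bullet> (ricci (G c) ?x *v v) + v \<bullet> (hessian (G c) (F c) ?x *v v) - real_of_ereal (1 / m) * (v \<bullet> (?Q *v v))"
      unfolding bakry_emery_ricci_def
      by (simp add: matrix_vector_mult_diff_rdistrib matrix_vector_mult_add_rdistrib inner_diff_right inner_add_right
          scaleR_matrix_vector_assoc[symmetric])
    finally show ?thesis
      using mult_nonneg_nonneg[OF m Q] by (simp add: c.hessian_eq_hs[OF c.smooth_F x])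
  qed
  have boch: "laplacian (G c) (wc c) x \<ge> 2 / real CARD('n) * (wc c x)\<^sup>2 + bderiv (wc c) x (gradient (G c) (F c) x)"
    if c: "c \<in> A" and x: "x \<in> im c" for c x
  proof -
    interpret c: chart_function "im c" "G c" "F c" by (rule chart_function_chart[OF c])
    show ?thesis
    proof (rule c.bochner[OF x])
      show "f_laplacian (G c) (F c) (F c) y = c\<^sub>1 * exp (c\<^sub>2 * F c y)" if "y \<in> im c" for y
        using assms(8) c that unfolding f_laplacian_at_def by auto
      show "0 \<le> v \<bullet> (ricci (G c) x *v v) + c.hs (F c) x v v" for v
        using ric[OF c, of "ci c x" v] x by simp
    qed (use assms in auto)
  qed
  show ?thesis
    by (rule constant_if_gradsq_eq_0) (rule gradsq_eq_0[OF assms(2) ric boch])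
qed

end
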